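(* Let $(\theta,\beta)$ satisfy $0<\theta\le1$, $0<\beta<1$ and $\frac{3\theta}{4}+\frac{\beta}{2}\le1$, and set $\phi_2:=\frac{\theta}{2(2+\theta-\beta)}\in(0,1)$. Then the linear operator $\mathbb{B}$ is the generator of a strongly continuous semigroup of contractions $S(t)=e^{t\mathbb{B}}$ on the Hilbert space $\mathcal{H}$, the resolvent estimate $$\limsup_{|\lambda|\to\infty}\ |\lambda|^{\frac{\theta}{2(2+\theta-\beta)}}\,\|(i\lambda I-\mathbb{B})^{-1}\|_{\mathcal{L}(\mathcal{H})}<\infty\qquad(\lambda\in\mathbb{R})$$ holds, and $S(t)$ is of Gevrey class $s_2$ (for $t>0$) for every $s_2>\dfrac1{\phi_2}=\dfrac{2(2+\theta-\beta)}{\theta}$.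
   Context: Let $\Omega\subset\mathbb{R}^n$ be a bounded open set with smooth boundary. $L^2(\Omega)$ is the complex Hilbert space with inner product $\langle\cdot,\cdot\rangle$ and norm $\|\cdot\|$. Let $A=-\Delta$ with domain $D(A)=H^2(\Omega)\cap H^1_0(\Omega)$; it is positive self-adjoint with compact inverse. For $s\in\mathbb{R}$, $A^s$ is the fractional power and $D(A^s)$ carries the norm $\|A^s u\|$ (for $s<0$, $D(A^s)$ is the completion of $L^2(\Omega)$ in this norm, and powers of $A$ are extended to this scale of spaces accordingly); $D(A^0)=L^2(\Omega)$. Fix constants $\alpha,\kappa,\gamma,\delta>0$ and parameters $0\le\theta\le1$, $0<\beta\le1$. The operator $I+\kappa A^\beta$ is extended to an isomorphism $D(A^{\beta/2})\to D(A^{-\beta/2})$ by $\langle (I+\kappa A^\beta)z_1,z_2\rangle_{D(A^{-\beta/2})\times D(A^{\beta/2})}=\langle z_1,z_2\rangle+\kappa\langle A^{\beta/2}z_1,A^{\beta/2}z_2\rangle$. The phase space is $\mathcal{H}=D(A)\times D(A^{1/2})\times D(A^{\beta/2})\times D(A^0)$, whose elements are written $U=(u,v,w,z)$, with the Hilbert norm $\|U\|_{\mathcal{H}}^2=\alpha\|Au\|^2+\alpha\|A^{1/2}v\|^2+\|w\|^2+\kappa\|A^{\beta/2}w\|^2+\|z\|^2$ (and the corresponding inner product). The operator $\mathbb{B}:D(\mathbb{B})\subset\mathcal{H}\to\mathcal{H}$ is $\mathbb{B}U=\big(w,\ z,\ -(I+\kappa A^\beta)^{-1}(\alpha A^2u+\gamma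 Az),\ -\alpha Av+\gamma Aw-\delta A^\theta z\big)$ with domain $D(\mathbb{B})=\{U\in\mathcal{H}: (w,z)\in D(A)\times D(A^{1/2}),\ -\alpha A^2u-\gamma Az\in D(A^{-\beta/2}),\ -\alpha v-\delta A^{\theta-1}z\in D(A)\}$. It is associated, via $U=(u,v,u_t,v_t)$ and $\frac{d}{dt}U=\mathbb{B}U$, with the system $u_{tt}+\kappa A^\beta u_{tt}+\alpha A^2u+\gamma Av_t=0$, $v_{tt}+\alpha Av-\gamma Au_t+\delta A^\theta v_t=0$ in $\Omega\times(0,\infty)$, with boundary conditions $u=Au=0$, $v=0$ on $\partial\Omega$ and given initial data. Gevrey class: for $t_0\ge0$, a strongly continuous semigroup $S(t)$ on a Banach space $\mathcal{H}$ is of Gevrey class $s>1$ for $t>t_0$ if $S(t)$ is infinitely differentiable for $t>t_0$ and for every compact $K\subset(t_0,\infty)$ and every $\mu>0$ there is a constant $C=C(\mu,K)>0$ such that $\|S^{(n)}(t)\|_{\mathcal{L}(\mathcal{H})}\le C\mu^n(n!)^s$ for all $t\in K$, $n=0,1,2,\dots$. Here $t_0=0$. *)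

theory Defs
  imports "HOL-Analysis.Analysis"
begin

section \<open>The complex Hilbert space $L^2$\<close>

class scaleC = real_vector +
  fixes scaleC :: "complex \<Rightarrow> 'a \<Rightarrow> 'a" (infixr \<open>*\<^sub>C\<close> 75)
  assumes scaleC_add_right: "c *\<^sub>C (x + y) = c *\<^sub>C x + c *\<^sub>C y"
    and scaleC_add_left: "(c + d) *\<^sub>C x = c *\<^sub>C x + d *\<^sub>C x"
    and scaleC_scaleC: "c *\<^sub>C d *\<^sub>C x = (c * d) *\<^sub>C x"
    and scaleC_of_real: "complex_of_real r *\<^sub>C x = r *\<^sub>R x"

instantiation prod :: (scaleC, scaleC) scaleC
begin

definition scaleC_prod_def: "c *\<^sub>C p = (c *\<^sub>C fst p, c *\<^sub>C snd p)"

instance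
  by standard
    (auto simp: scaleC_prod_def scaleC_add_right scaleC_add_left scaleC_scaleC scaleC_of_real
      scaleR_prod_def plus_prod_def)

end

definition square_integrable :: "('a::euclidean_space \<Rightarrow> complex) \<Rightarrow> bool" where
  "square_integrable f \<longleftrightarrow>
     f \<in> borel_measurable lebesgue \<and> integrable lebesgue (\<lambda>x. (cmod (f x))\<^sup>2)"

lemma square_integrable_zero: "square_integrable (\<lambda>x. 0)"
  by (simp add: square_integrable_def)

lemma square_integrable_mult:
  assumes "square_integrable f" "square_integrable g"
  shows "integrable lebesgue (\<lambda>x. f x * cnj (g x))"
proof (rule Bochner_Integration.integrable_bound)
  show "integrable lebesgue (\<lambda>x. (cmod (f x))\<^sup>2 + (cmod (g x))\<^sup>2)"
    using assms by (simp add: square_integrable_def)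
  have [measurable]: "f \<in> borel_measurable lebesgue" "g \<in> borel_measurable lebesgue"
    using assms by (auto simp: square_integrable_def)
  have "cnj \<in> borel_measurable borel"
    by (intro borel_measurable_continuous_onI continuous_intros)
  then have [measurable]: "(\<lambda>x. cnj (g x)) \<in> borel_measurable lebesgue"
    using measurable_compose[of g lebesgue borel cnj borel] by auto
  show "(\<lambda>x. f x * cnj (g x)) \<in> borel_measurable lebesgue"
    by measurable
  have "norm (f x * cnj (g x)) \<le> norm ((cmod (f x))\<^sup>2 + (cmod (g x))\<^sup>2)" for x
  proof -
    have "2 * (cmod (f x) * cmod (g x)) \<le> (cmod (f x))\<^sup>2 + (cmod (g x))\<^sup>2"
      using sum_squares_bound[of "cmod (f x)" "cmod (g x)"] by simp
    moreover have "0 \<le> cmod (f x) * cmod (g x)" by simp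
    ultimately have "cmod (f x) * cmod (g x) \<le> (cmod (f x))\<^sup>2 + (cmod (g x))\<^sup>2" by linarith
    then show ?thesis by (simp add: norm_mult)
  qed
  then show "AE x in lebesgue. norm (f x * cnj (g x)) \<le> norm ((cmod (f x))\<^sup>2 + (cmod (g x))\<^sup>2)"
    by simp
qed

lemma square_integrable_add:
  assumes "square_integrable f" "square_integrable g"
  shows "square_integrable (\<lambda>x. f x + g x)"
  unfolding square_integrable_def
proof
  have [measurable]: "f \<in> borel_measurable lebesgue" "g \<in> borel_measurable lebesgue"
    using assms by (auto simp: square_integrable_def)
  show "(\<lambda>x. f x + g x) \<in> borel_measurable lebesgue" by measurable
  show "integrable lebesgue (\<lambda>x. (cmod (f x + g x))\<^sup>2)"
  proof (rule Bochner_Integration.integrable_bound)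
    show "integrable lebesgue (\<lambda>x. 2 * (cmod (f x))\<^sup>2 + 2 * (cmod (g x))\<^sup>2)"
      using assms by (simp add: square_integrable_def)
    show "(\<lambda>x. (cmod (f x + g x))\<^sup>2) \<in> borel_measurable lebesgue" by measurable
    have "(cmod (f x + g x))\<^sup>2 \<le> 2 * (cmod (f x))\<^sup>2 + 2 * (cmod (g x))\<^sup>2" for x
    proof -
      have "(cmod (f x + g x))\<^sup>2 \<le> (cmod (f x) + cmod (g x))\<^sup>2"
        by (intro power_mono norm_triangle_ineq) auto
      also have "\<dots> \<le> 2 * (cmod (f x))\<^sup>2 + 2 * (cmod (g x))\<^sup>2"
        using sum_squares_bound[of "cmod (f x)" "cmod (g x)"]
        by (simp add: power2_sum)
      finally show ?thesis .
    qed
    then show "AE x in lebesgue. norm ((cmod (f x + g x))\<^sup>2)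
        \<le> norm (2 * (cmod (f x))\<^sup>2 + 2 * (cmod (g x))\<^sup>2)"
      by simp
  qed
qed

lemma square_integrable_cmult:
  assumes "square_integrable f"
  shows "square_integrable (\<lambda>x. c * f x)"
proof -
  have [measurable]: "f \<in> borel_measurable lebesgue"
    using assms by (auto simp: square_integrable_def)
  have "(\<lambda>x. c * f x) \<in> borel_measurable lebesgue" by measurable
  then show ?thesis
    using assms by (simp add: square_integrable_def norm_mult power_mult_distrib)
qed

text \<open>Equality almost everywhere on square-integrable functions.  Functions on a subset
  $\Omega$ of the space are represented by their extension by zero, see \<open>L2_on\<close>.\<close>

definition l2rel :: "('a::euclidean_space \<Rightarrow> complex) \<Rightarrow> ('a \<Rightarrow> complex) \<Rightarrow> bool" where
  "l2rel f g \<longleftrightarrow> square_integrable f \<and> square_integrable g \<and> (AE x in lebesgue. f x = g x)"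

quotient_type (overloaded) 'a l2 = "'a::euclidean_space \<Rightarrow> complex" / partial: l2rel
proof (rule part_equivpI)
  show "\<exists>f::'a \<Rightarrow> complex. l2rel f f"
    by (rule exI[of _ "\<lambda>x. 0"]) (simp add: l2rel_def square_integrable_zero)
  show "symp (l2rel :: ('a \<Rightarrow> complex) \<Rightarrow> _)"
    by (auto simp: symp_def l2rel_def elim: AE_mp)
  show "transp (l2rel :: ('a \<Rightarrow> complex) \<Rightarrow> _)"
    unfolding transp_def l2rel_def by (auto elim: AE_mp)
qed

instantiation l2 :: (euclidean_space) "{real_vector, scaleC}"
begin

lift_definition zero_l2 :: "'a l2" is "\<lambda>x. 0"
  by (simp add: l2rel_def square_integrable_zero)

lift_definition plus_l2 :: "'a l2 \<Rightarrow> 'a l2 \<Rightarrow> 'a l2" is "\<lambda>f g x. f x + g x"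
  unfolding l2rel_def by (auto intro: square_integrable_add)

lift_definition scaleC_l2 :: "complex \<Rightarrow> 'a l2 \<Rightarrow> 'a l2" is "\<lambda>c f x. c * f x"
  unfolding l2rel_def by (auto intro: square_integrable_cmult)

definition uminus_l2 :: "'a l2 \<Rightarrow> 'a l2" where "uminus_l2 f = (- 1) *\<^sub>C f"

definition minus_l2 :: "'a l2 \<Rightarrow> 'a l2 \<Rightarrow> 'a l2" where "minus_l2 f g = f + (- g)"

definition scaleR_l2 :: "real \<Rightarrow> 'a l2 \<Rightarrow> 'a l2" where
  "scaleR_l2 r f = complex_of_real r *\<^sub>C f"

instance
proof
  fix f g h :: "'a l2" and a b :: real and c d :: complex
  show "f + g + h = f + (g + h)"
    by transfer (auto simp: l2rel_def add.assoc intro: square_integrable_add)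
  show "f + g = g + f"
    by transfer (auto simp: l2rel_def add.commute intro: square_integrable_add)
  show "0 + f = f"
    by transfer (auto simp: l2rel_def)
  show "- f + f = 0"
    unfolding uminus_l2_def by transfer (auto simp: l2rel_def square_integrable_zero)
  show "f - g = f + - g" by (simp add: minus_l2_def)
  show addr: "c *\<^sub>C (f + g) = c *\<^sub>C f + c *\<^sub>C g" for c and f g :: "'a l2"
    by transfer (auto simp: l2rel_def distrib_left
        intro: square_integrable_add square_integrable_cmult)
  show addl: "(c + d) *\<^sub>C f = c *\<^sub>C f + d *\<^sub>C f" for c d and f :: "'a l2"
    by transfer (auto simp: l2rel_def distrib_right
        intro: square_integrable_add square_integrable_cmult)
  show assoc: "c *\<^sub>C d *\<^sub>C f = (c * d) *\<^sub>C f" for c d and f :: "'a l2"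
    by transfer (auto simp: l2rel_def mult.assoc intro: square_integrable_cmult)
  show "complex_of_real a *\<^sub>C f = a *\<^sub>R f" by (simp add: scaleR_l2_def)
  show "a *\<^sub>R (f + g) = a *\<^sub>R f + a *\<^sub>R g" by (simp add: scaleR_l2_def addr)
  show "(a + b) *\<^sub>R f = a *\<^sub>R f + b *\<^sub>R f" by (simp add: scaleR_l2_def addl)
  show "a *\<^sub>R b *\<^sub>R f = (a * b) *\<^sub>R f" by (simp add: scaleR_l2_def assoc)
  show "1 *\<^sub>R f = f"
    unfolding scaleR_l2_def by transfer (auto simp: l2rel_def)
qed

end

lift_definition cinner :: "'a::euclidean_space l2 \<Rightarrow> 'a l2 \<Rightarrow> complex"
  is "\<lambda>f g. LINT x|lebesgue. f x * cnj (g x)"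
proof -
  fix f f' g g' :: "'a \<Rightarrow> complex"
  assume a: "l2rel f f'" "l2rel g g'"
  then have si: "square_integrable f" "square_integrable f'" "square_integrable g"
      "square_integrable g'"
    and ae: "AE x in lebesgue. f x = f' x" "AE x in lebesgue. g x = g' x"
    by (auto simp: l2rel_def)
  show "(LINT x|lebesgue. f x * cnj (g x)) = (LINT x|lebesgue. f' x * cnj (g' x))"
  proof (rule integral_cong_AE)
    show "(\<lambda>x. f x * cnj (g x)) \<in> borel_measurable lebesgue"
      "(\<lambda>x. f' x * cnj (g' x)) \<in> borel_measurable lebesgue"
      using si by (auto intro: borel_measurable_integrable square_integrable_mult)
    show "AE x in lebesgue. f x * cnj (g x) = f' x * cnj (g' x)"
      using ae by eventually_elim simp
  qed
qed

lemma cinner_commute: "cinner f g = cnj (cinner g f)"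
proof transfer
  fix f g :: "'a \<Rightarrow> complex"
  have "cnj (LINT x|lebesgue. g x * cnj (f x)) = (LINT x|lebesgue. cnj (g x * cnj (f x)))"
    by (rule Bochner_Integration.integral_cnj[symmetric])
  also have "\<dots> = (LINT x|lebesgue. f x * cnj (g x))"
    by (simp add: mult.commute)
  finally show "(LINT x|lebesgue. f x * cnj (g x)) = cnj (LINT x|lebesgue. g x * cnj (f x))"
    by simp
qed

lemma cinner_add_left: "cinner (f + g) h = cinner f h + cinner g h"
  by transfer (auto simp: l2rel_def distrib_right square_integrable_mult)

lemma cinner_scaleC_left: "cinner (c *\<^sub>C f) g = c * cinner f g"
  by transfer (simp add: mult.assoc)

lemma cinner_self:
  "cinner f f = complex_of_real (LINT x|lebesgue. (cmod (rep_l2 f x))\<^sup>2)"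
proof -
  have "cinner f f = (LINT x|lebesgue. rep_l2 f x * cnj (rep_l2 f x))"
    by (simp add: cinner.rep_eq)
  also have "\<dots> = (LINT x|lebesgue. complex_of_real ((cmod (rep_l2 f x))\<^sup>2))"
    by (simp only: complex_norm_square)
  finally show ?thesis by (simp only: integral_complex_of_real)
qed

lemma cinner_self_eq_0: "Re (cinner f f) = 0 \<longleftrightarrow> f = 0"
proof
  assume "f = 0"
  then show "Re (cinner f f) = 0"
    by (metis cinner_scaleC_left mult_zero_left scaleC_of_real of_real_0 scaleR_zero_left
        zero_complex.sel(1))
next
  assume "Re (cinner f f) = 0"
  then have z: "(LINT x|lebesgue. (cmod (rep_l2 f x))\<^sup>2) = 0" by (simp add: cinner_self)
  have r: "l2rel (rep_l2 f) (rep_l2 f)"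
    by (metis Quotient_l2 Quotient_rep_reflp)
  then have "integrable lebesgue (\<lambda>x. (cmod (rep_l2 f x))\<^sup>2)"
    by (simp add: l2rel_def square_integrable_def)
  then have "AE x in lebesgue. (cmod (rep_l2 f x))\<^sup>2 = 0"
    using z integral_nonneg_eq_0_iff_AE[of lebesgue "\<lambda>x. (cmod (rep_l2 f x))\<^sup>2"] by simp
  then have "l2rel (rep_l2 f) (\<lambda>x. 0)"
    using r by (auto simp: l2rel_def square_integrable_zero)
  then have "abs_l2 (rep_l2 f) = abs_l2 (\<lambda>x. 0)"
    by (rule Quotient_rel_abs[OF Quotient_l2])
  then show "f = 0"
    by (metis Quotient_abs_rep Quotient_l2 zero_l2.abs_eq)
qed

instantiation l2 :: (euclidean_space) real_inner
begin

definition inner_l2 :: "'a l2 \<Rightarrow> 'a l2 \<Rightarrow> real" where "inner_l2 f g = Re (cinner f g)"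

definition norm_l2 :: "'a l2 \<Rightarrow> real" where "norm_l2 f = sqrt (Re (cinner f f))"

definition sgn_l2 :: "'a l2 \<Rightarrow> 'a l2" where "sgn_l2 f = f /\<^sub>R norm f"

definition dist_l2 :: "'a l2 \<Rightarrow> 'a l2 \<Rightarrow> real" where "dist_l2 f g = norm (f - g)"

definition uniformity_l2 :: "('a l2 \<times> 'a l2) filter" where
  "uniformity_l2 = (INF e\<in>{0<..}. principal {(x, y). dist x y < e})"

definition open_l2 :: "'a l2 set \<Rightarrow> bool" where
  "open_l2 U \<longleftrightarrow> (\<forall>x\<in>U. \<forall>\<^sub>F (x', y) in uniformity. x' = x \<longrightarrow> y \<in> U)"

instance
proof
  fix f g h :: "'a l2" and r :: real and U :: "'a l2 set"
  show "inner f g = inner g f"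
    unfolding inner_l2_def by (subst cinner_commute) simp
  show "inner (f + g) h = inner f h + inner g h"
    by (simp add: inner_l2_def cinner_add_left)
  show "inner (r *\<^sub>R f) g = r * inner f g"
    by (simp add: inner_l2_def scaleR_l2_def cinner_scaleC_left)
  show "0 \<le> inner f f" by (simp add: inner_l2_def cinner_self)
  show "inner f f = 0 \<longleftrightarrow> f = 0" by (simp add: inner_l2_def cinner_self_eq_0)
  show "norm f = sqrt (inner f f)" by (simp add: norm_l2_def inner_l2_def)
qed (simp_all add: sgn_l2_def dist_l2_def uniformity_l2_def open_l2_def)

end

definition L2_on :: "'a::euclidean_space set \<Rightarrow> 'a l2 set" where
  "L2_on \<Omega> = {f. AE x in lebesgue. x \<notin> \<Omega> \<longrightarrow> rep_l2 f x = 0}"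


section \<open>Sobolev spaces and the Dirichlet Laplacian\<close>

definition partial ::
    "'a::euclidean_space \<Rightarrow> ('a \<Rightarrow> 'b::real_normed_vector) \<Rightarrow> 'a \<Rightarrow> 'b" where
  "partial i f x = frechet_derivative f (at x) i"

primrec Ck_on :: "nat \<Rightarrow> 'a::euclidean_space set \<Rightarrow> ('a \<Rightarrow> 'b::real_normed_vector) \<Rightarrow> bool" where
  "Ck_on 0 U f \<longleftrightarrow> continuous_on U f"
| "Ck_on (Suc k) U f \<longleftrightarrow>
     (\<forall>x\<in>U. f differentiable (at x)) \<and> (\<forall>i\<in>Basis. Ck_on k U (partial i f))"

text \<open>Only used for open sets.\<close>

definition smooth_on :: "'a::euclidean_space set \<Rightarrow> ('a \<Rightarrow> 'b::real_normed_vector) \<Rightarrow> bool" where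
  "smooth_on U f \<longleftrightarrow> (\<forall>k. Ck_on k U f)"

text \<open>Near each boundary point, $\Omega$ is the sublevel set of a smooth function with
  non-vanishing gradient; so $\Omega$ lies locally on one side of its boundary.\<close>

definition smooth_boundary :: "'a::euclidean_space set \<Rightarrow> bool" where
  "smooth_boundary \<Omega> \<longleftrightarrow>
     (\<forall>p\<in>frontier \<Omega>. \<exists>U \<rho> :: 'a \<Rightarrow> real. open U \<and> p \<in> U \<and> smooth_on U \<rho> \<and>
        (\<forall>x\<in>U. \<exists>i\<in>Basis. partial i \<rho> x \<noteq> 0) \<and> \<Omega> \<inter> U = {x\<in>U. \<rho> x < 0})"

definition test_functions :: "'a::euclidean_space set \<Rightarrow> ('a \<Rightarrow> complex) set" where
  "test_functions \<Omega> =
     {\<phi>. smooth_on UNIV \<phi> \<and> (\<exists>K. compact K \<and> K \<subseteq> \<Omega> \<and> (\<forall>x. x \<notin> K \<longrightarrow> \<phi> x = 0))}"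

text \<open>The function \<open>g\<close> is the weak derivative of \<open>f\<close> in \<open>\<Omega>\<close> in direction \<open>i\<close>.\<close>

definition has_weak_partial ::
    "'a::euclidean_space set \<Rightarrow> 'a \<Rightarrow> 'a l2 \<Rightarrow> 'a l2 \<Rightarrow> bool" where
  "has_weak_partial \<Omega> i f g \<longleftrightarrow> f \<in> L2_on \<Omega> \<and> g \<in> L2_on \<Omega> \<and>
     (\<forall>\<phi>\<in>test_functions \<Omega>.
        (LINT x:\<Omega>|lebesgue. rep_l2 f x * partial i \<phi> x) =
        - (LINT x:\<Omega>|lebesgue. rep_l2 g x * \<phi> x))"

definition H2 :: "'a::euclidean_space set \<Rightarrow> 'a l2 set" where
  "H2 \<Omega> = {f\<in>L2_on \<Omega>. \<forall>i\<in>Basis. \<exists>g. has_weak_partial \<Omega> i f g \<and>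
     (\<forall>j\<in>Basis. \<exists>h. has_weak_partial \<Omega> j g h)}"

text \<open>The closure of the test functions in the norm of $H^1(\Omega)$.\<close>

definition H1_0 :: "'a::euclidean_space set \<Rightarrow> 'a l2 set" where
  "H1_0 \<Omega> = {f\<in>L2_on \<Omega>. \<exists>\<phi>::nat \<Rightarrow> 'a \<Rightarrow> complex.
     (\<forall>k. \<phi> k \<in> test_functions \<Omega>) \<and> (\<lambda>k. abs_l2 (\<phi> k)) \<longlonglongrightarrow> f \<and>
     (\<forall>i\<in>Basis. \<exists>g. has_weak_partial \<Omega> i f g \<and> (\<lambda>k. abs_l2 (partial i (\<phi> k))) \<longlonglongrightarrow> g)}"

text \<open>The operator $A = -\Delta$ with domain $H^2(\Omega) \cap H^1_0(\Omega)$, as a graph.\<close>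

definition neg_laplacian :: "'a::euclidean_space set \<Rightarrow> ('a l2 \<times> 'a l2) set" where
  "neg_laplacian \<Omega> = {(f, - (\<Sum>i\<in>Basis. h i)) | f h. f \<in> H2 \<Omega> \<inter> H1_0 \<Omega> \<and>
     (\<forall>i\<in>Basis. \<exists>g. has_weak_partial \<Omega> i f g \<and> has_weak_partial \<Omega> i g (h i))}"


section \<open>Fractional powers\<close>

definition eigenspace :: "'a::euclidean_space set \<Rightarrow> real \<Rightarrow> 'a l2 set" where
  "eigenspace \<Omega> \<mu> = {f. (f, \<mu> *\<^sub>R f) \<in> neg_laplacian \<Omega>}"

text \<open>Since $A$ is positive and self-adjoint with compact inverse, $L^2(\Omega)$ is the
  orthogonal sum of the eigenspaces of $A$.  An element \<open>F\<close> of the scale $D(A^s)$, $s$ real, is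
  represented by the family of its components \<open>F \<mu>\<close> in the eigenspaces (zero unless \<open>\<mu>\<close> is an
  eigenvalue), and $A^s$ multiplies the component \<open>F \<mu>\<close> by $\mu^s$.  The finite families are
  dense in \<open>scale \<Omega> s\<close> for the norm $(\sum_\mu \mu^{2s} \|F_\mu\|^2)^{1/2}$, so for
  $s < 0$ this is the completion of $L^2(\Omega)$ in the norm $\|A^s u\|$.\<close>

definition scale :: "'a::euclidean_space set \<Rightarrow> real \<Rightarrow> (real \<Rightarrow> 'a l2) set" where
  "scale \<Omega> s = {F. (\<forall>\<mu>. F \<mu> \<in> eigenspace \<Omega> \<mu>) \<and>
     (\<lambda>\<mu>. (\<mu> powr s * norm (F \<mu>))\<^sup>2) summable_on UNIV}"

definition scale_pow :: "real \<Rightarrow> (real \<Rightarrow> 'a::euclidean_space l2) \<Rightarrow> real \<Rightarrow> 'a l2" where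
  "scale_pow s F = (\<lambda>\<mu>. \<mu> powr s *\<^sub>R F \<mu>)"

text \<open>Passage between functions and their families of components.\<close>

definition components :: "'a::euclidean_space set \<Rightarrow> 'a l2 \<Rightarrow> real \<Rightarrow> 'a l2" where
  "components \<Omega> f = (THE F. (\<forall>\<mu>. F \<mu> \<in> eigenspace \<Omega> \<mu>) \<and> (F has_sum f) UNIV)"

definition synthesis :: "(real \<Rightarrow> 'a::euclidean_space l2) \<Rightarrow> 'a l2" where
  "synthesis F = infsum F UNIV"

text \<open>For $s \ge 0$: the space $D(A^s)$ as a space of functions, and $A^s$ on it.  By completeness
  of the eigenfunctions, $D(A^0) = L^2(\Omega)$ and $D(A^1) = H^2(\Omega) \cap H^1_0(\Omega)$.\<close>

definition dom_pow :: "'a::euclidean_space set \<Rightarrow> real \<Rightarrow> 'a l2 set" where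
  "dom_pow \<Omega> s = {f\<in>L2_on \<Omega>. \<exists>F\<in>scale \<Omega> s. (F has_sum f) UNIV}"

definition frac_pow :: "'a::euclidean_space set \<Rightarrow> real \<Rightarrow> 'a l2 \<Rightarrow> 'a l2" where
  "frac_pow \<Omega> s f = synthesis (scale_pow s (components \<Omega> f))"


section \<open>Semigroups of operators\<close>

text \<open>A normed space is given by a complex subspace \<open>X\<close> of the ambient type together with a
  norm \<open>N\<close> on \<open>X\<close>, which need not be the norm of the type.\<close>

definition op_norm :: "'v set \<Rightarrow> ('v \<Rightarrow> real) \<Rightarrow> ('v \<Rightarrow> 'v) \<Rightarrow> ereal" where
  "op_norm X N T = (SUP x\<in>{x\<in>X. N x \<le> 1}. ereal (N (T x)))"

definition bounded_op :: "'v::scaleC set \<Rightarrow> ('v \<Rightarrow> real) \<Rightarrow> ('v \<Rightarrow> 'v) \<Rightarrow> bool" where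
  "bounded_op X N T \<longleftrightarrow> (\<forall>x\<in>X. T x \<in> X) \<and> (\<forall>x\<in>X. \<forall>y\<in>X. T (x + y) = T x + T y) \<and>
     (\<forall>c. \<forall>x\<in>X. T (c *\<^sub>C x) = c *\<^sub>C T x) \<and> op_norm X N T < \<infinity>"

definition C0_semigroup ::
    "'v::scaleC set \<Rightarrow> ('v \<Rightarrow> real) \<Rightarrow> (real \<Rightarrow> 'v \<Rightarrow> 'v) \<Rightarrow> bool" where
  "C0_semigroup X N S \<longleftrightarrow> (\<forall>t\<ge>0. bounded_op X N (S t)) \<and> (\<forall>x\<in>X. S 0 x = x) \<and>
     (\<forall>s\<ge>0. \<forall>t\<ge>0. \<forall>x\<in>X. S (s + t) x = S s (S t x)) \<and>
     (\<forall>x\<in>X. ((\<lambda>t. N (S t x - x)) \<longlongrightarrow> 0) (at_right 0))"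

definition contraction_semigroup ::
    "'v::scaleC set \<Rightarrow> ('v \<Rightarrow> real) \<Rightarrow> (real \<Rightarrow> 'v \<Rightarrow> 'v) \<Rightarrow> bool" where
  "contraction_semigroup X N S \<longleftrightarrow>
     C0_semigroup X N S \<and> (\<forall>t\<ge>0. \<forall>x\<in>X. N (S t x) \<le> N x)"

definition is_generator ::
    "'v::scaleC set \<Rightarrow> ('v \<Rightarrow> real) \<Rightarrow> (real \<Rightarrow> 'v \<Rightarrow> 'v) \<Rightarrow> 'v set \<Rightarrow> ('v \<Rightarrow> 'v) \<Rightarrow> bool" where
  "is_generator X N S D B \<longleftrightarrow>
     D = {x\<in>X. \<exists>y\<in>X. ((\<lambda>h. N ((S h x - x) /\<^sub>R h - y)) \<longlongrightarrow> 0) (at_right 0)} \<and>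
     (\<forall>x\<in>D. B x \<in> X \<and> ((\<lambda>h. N ((S h x - x) /\<^sub>R h - B x)) \<longlongrightarrow> 0) (at_right 0))"

text \<open>The operator $(\zeta I - B)^{-1}$ for \<open>B\<close> with domain \<open>D\<close>.\<close>

definition resolvent :: "'v::scaleC set \<Rightarrow> ('v \<Rightarrow> 'v) \<Rightarrow> complex \<Rightarrow> 'v \<Rightarrow> 'v" where
  "resolvent D B \<zeta> = the_inv_into D (\<lambda>x. \<zeta> *\<^sub>C x - B x)"

definition resolvent_set ::
    "'v::scaleC set \<Rightarrow> ('v \<Rightarrow> real) \<Rightarrow> 'v set \<Rightarrow> ('v \<Rightarrow> 'v) \<Rightarrow> complex set" where
  "resolvent_set X N D B =
     {\<zeta>. bij_betw (\<lambda>x. \<zeta> *\<^sub>C x - B x) D X \<and> bounded_op X N (resolvent D B \<zeta>)}"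

text \<open>In the following definition, \<open>D n t\<close> is the \<open>n\<close>-th derivative at \<open>t\<close> of \<open>S\<close>, as a
  function with values in the space of bounded operators with the operator norm.\<close>

definition gevrey_class ::
    "'v::scaleC set \<Rightarrow> ('v \<Rightarrow> real) \<Rightarrow> (real \<Rightarrow> 'v \<Rightarrow> 'v) \<Rightarrow> real \<Rightarrow> real \<Rightarrow> bool" where
  "gevrey_class X N S s t\<^sub>0 \<longleftrightarrow> s > 1 \<and> (\<exists>D::nat \<Rightarrow> real \<Rightarrow> 'v \<Rightarrow> 'v.
     (\<forall>n. \<forall>t>t\<^sub>0. bounded_op X N (D n t)) \<and>
     (\<forall>t>t\<^sub>0. \<forall>x\<in>X. D 0 t x = S t x) \<and>
     (\<forall>n. \<forall>t>t\<^sub>0.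
        ((\<lambda>h. op_norm X N (\<lambda>x. (D n (t + h) x - D n t x) /\<^sub>R h - D (Suc n) t x)) \<longlongrightarrow> 0) (at 0)) \<and>
     (\<forall>K \<mu>. compact K \<and> K \<subseteq> {t\<^sub>0<..} \<and> \<mu> > 0 \<longrightarrow>
        (\<exists>C>0. \<forall>t\<in>K. \<forall>n. op_norm X N (D n t) \<le> ereal (C * \<mu> ^ n * fact n powr s))))"


section \<open>The coupled system\<close>

type_synonym 'a state = "'a l2 \<times> 'a l2 \<times> 'a l2 \<times> 'a l2"

definition phase_space :: "'a::euclidean_space set \<Rightarrow> real \<Rightarrow> 'a state set" where
  "phase_space \<Omega> \<beta> = dom_pow \<Omega> 1 \<times> dom_pow \<Omega> (1/2) \<times> dom_pow \<Omega> (\<beta>/2) \<times> dom_pow \<Omega> 0"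

definition phase_norm ::
    "'a::euclidean_space set \<Rightarrow> real \<Rightarrow> real \<Rightarrow> real \<Rightarrow> 'a state \<Rightarrow> real" where
  "phase_norm \<Omega> \<alpha> \<kappa> \<beta> = (\<lambda>(u, v, w, z).
     sqrt (\<alpha> * (norm (frac_pow \<Omega> 1 u))\<^sup>2 + \<alpha> * (norm (frac_pow \<Omega> (1/2) v))\<^sup>2
       + (norm w)\<^sup>2 + \<kappa> * (norm (frac_pow \<Omega> (\<beta>/2) w))\<^sup>2 + (norm z)\<^sup>2))"

text \<open>The operator $I + \kappa A^\beta$ from $D(A^{\beta/2})$ onto $D(A^{-\beta/2})$,
  and its inverse.\<close>

definition inertia :: "real \<Rightarrow> real \<Rightarrow> (real \<Rightarrow> 'a::euclidean_space l2) \<Rightarrow> real \<Rightarrow> 'a l2" where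
  "inertia \<kappa> \<beta> F = (\<lambda>\<mu>. F \<mu> + \<kappa> *\<^sub>R scale_pow \<beta> F \<mu>)"

definition inertia_inv ::
    "'a::euclidean_space set \<Rightarrow> real \<Rightarrow> real \<Rightarrow> (real \<Rightarrow> 'a l2) \<Rightarrow> real \<Rightarrow> 'a l2" where
  "inertia_inv \<Omega> \<kappa> \<beta> = the_inv_into (scale \<Omega> (\<beta>/2)) (inertia \<kappa> \<beta>)"

definition op_B ::
    "'a::euclidean_space set \<Rightarrow> real \<Rightarrow> real \<Rightarrow> real \<Rightarrow> real \<Rightarrow> real \<Rightarrow> real \<Rightarrow> 'a state \<Rightarrow> 'a state" where
  "op_B \<Omega> \<alpha> \<kappa> \<gamma> \<delta> \<theta> \<beta> = (\<lambda>(u, v, w, z).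
     let u' = components \<Omega> u; v' = components \<Omega> v; w' = components \<Omega> w; z' = components \<Omega> z
     in (w, z,
         - synthesis (inertia_inv \<Omega> \<kappa> \<beta>
             (\<lambda>\<mu>. \<alpha> *\<^sub>R scale_pow 2 u' \<mu> + \<gamma> *\<^sub>R scale_pow 1 z' \<mu>)),
         synthesis (\<lambda>\<mu>. - \<alpha> *\<^sub>R scale_pow 1 v' \<mu> + \<gamma> *\<^sub>R scale_pow 1 w' \<mu>
             - \<delta> *\<^sub>R scale_pow \<theta> z' \<mu>)))"

definition dom_B ::
    "'a::euclidean_space set \<Rightarrow> real \<Rightarrow> real \<Rightarrow> real \<Rightarrow> real \<Rightarrow> real \<Rightarrow> 'a state set" where
  "dom_B \<Omega> \<alpha> \<gamma> \<delta> \<theta> \<beta> = {(u, v, w, z) \<in> phase_space \<Omega> \<beta>.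
     let u' = components \<Omega> u; v' = components \<Omega> v; z' = components \<Omega> z
     in w \<in> dom_pow \<Omega> 1 \<and> z \<in> dom_pow \<Omega> (1/2) \<and>
        (\<lambda>\<mu>. - \<alpha> *\<^sub>R scale_pow 2 u' \<mu> - \<gamma> *\<^sub>R scale_pow 1 z' \<mu>) \<in> scale \<Omega> (- \<beta>/2) \<and>
        (\<lambda>\<mu>. - \<alpha> *\<^sub>R v' \<mu> - \<delta> *\<^sub>R scale_pow (\<theta> - 1) z' \<mu>) \<in> scale \<Omega> 1}"

end

theory Submission
  imports Defs "HOL-Probability.Sinc_Integral" "HOL-Probability.Characteristic_Functions"
begin

text \<open>On the eigenspace of $A$ to the eigenvalue $\mu$ the operator acts as a 4x4 matrix
  $M_\mu$, which is dissipative in coordinates adapted to the energy norm.  From the Laplacian one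
  only needs that eigenspaces are orthogonal and that the eigenvalues are bounded below by a positive
  number (Poincar\'e); everything else is an estimate for $M_\mu$ that is uniform in $\mu$.

  Since only one component is damped, the resolvent equation is estimated by bounding all components
  in terms of the damped one; in the given range of $(\theta, \beta)$ this yields
  $|(i\lambda - M)^{-1}| \le C |\lambda|^{-3\phi_2}$ for $|\lambda| \ge 1$, which is stronger than the
  claimed decay.  Fourier inversion of $t^k e^{-t} M e^{tM}$ then gives
  $|M e^{tM}| \le K t^{-k}$ for $0 < t \le 1$ as soon as $\phi_2 (k + 1) \ge 1$.  As
  $M^n e^{tM} = (M e^{tM/n})^n$, it follows that $|M^n e^{tM}| \le (K' t^{-k})^n n!^k$, and the
  smallest admissible $k$ is less than $1 / \phi_2$.\<close>

section \<open>Bounded operators on a normed space\<close>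

text \<open>The obstacle is uniformity: the norm of M grows with the eigenvalue and must not enter
  any constant. Only contractivity and resolvent bounds are used, and M R(l) = (1 + il) R(l) - 1
  trades M for one power of |l|. Origin of the exponent: put \<sigma> = 1 - \<beta>/2. The undamped
  part of M has size \<mu>^\<sigma>, the damping is d = \<delta> \<mu>^\<theta>. For |l| beyond a
  multiple of \<mu>^\<sigma> the resolvent is of order 1/|l|. Below it, the energy identity for the
  damped component yields the extra terms 1/d and d/a^2 with a ~ \<mu>^\<sigma>, that is
  |l|^(-\<theta>/\<sigma>) and |l|^(\<theta>/\<sigma> - 2) at worst. Since 2(2 + \<theta> - \<beta>)
  = 4\<sigma> + 2\<theta>, the number 3 \<phi>_2 = 3\<theta>/(4\<sigma> + 2\<theta>) is at most 1,
  \<theta>/\<sigma> and 2 - \<theta>/\<sigma> as soon as 3\<theta> <= 4\<sigma>, which is the given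
  range. The factor 3 pays for one power of |l| lost to M and two spent on integrability: 3 \<phi>_2
  (k + 1) >= 3 is the condition on k. As k is strictly smaller than the Gevrey order, the difference
  absorbs all geometric constants, whatever the radius demanded.\<close>

typedef (overloaded) ('a::real_normed_vector) bop = "UNIV :: ('a \<Rightarrow>\<^sub>L 'a) set" ..

setup_lifting type_definition_bop

lift_definition bop_apply :: "'a::real_normed_vector bop \<Rightarrow> 'a \<Rightarrow> 'a" is blinfun_apply .

text \<open>On this copy of the bounded linear maps, composition is the multiplication of an
  algebra, so that \<open>exp\<close> and powers apply to operators. The class
  \<open>perfect_space\<close> excludes the zero space, in which the unit would equal 0.\<close>

instantiation bop :: ("{real_normed_vector,perfect_space}") real_algebra_1
begin

lift_definition zero_bop :: "'a bop" is 0 .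
lift_definition one_bop :: "'a bop" is id_blinfun .
lift_definition plus_bop :: "'a bop \<Rightarrow> 'a bop \<Rightarrow> 'a bop" is "(+)" .
lift_definition minus_bop :: "'a bop \<Rightarrow> 'a bop \<Rightarrow> 'a bop" is "(-)" .
lift_definition uminus_bop :: "'a bop \<Rightarrow> 'a bop" is uminus .
lift_definition times_bop :: "'a bop \<Rightarrow> 'a bop \<Rightarrow> 'a bop" is blinfun_compose .
lift_definition scaleR_bop :: "real \<Rightarrow> 'a bop \<Rightarrow> 'a bop" is scaleR .

instance
proof
  fix f g h :: "'a bop" and r s :: real
  show "f * g * h = f * (g * h)"
    by transfer (rule blinfun_eqI, simp)
  show "(f + g) * h = f * h + g * h" "f * (g + h) = f * g + f * h"
    by (transfer, rule blinfun_eqI, simp add: blinfun.bilinear_simps)+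
  show "r *\<^sub>R f * g = r *\<^sub>R (f * g)" "f * r *\<^sub>R g = r *\<^sub>R (f * g)"
    by (transfer, rule blinfun_eqI, simp add: blinfun.bilinear_simps)+
  show "1 * f = f" "f * 1 = f"
    by (transfer, rule blinfun_eqI, simp)+
  show "(0::'a bop) \<noteq> 1"
    by transfer (metis norm_blinfun_id norm_zero zero_neq_one)
qed (transfer, simp add: algebra_simps)+

end

instantiation bop :: ("{real_normed_vector,perfect_space}") real_normed_algebra_1
begin

lift_definition norm_bop :: "'a bop \<Rightarrow> real" is norm .

definition sgn_bop :: "'a bop \<Rightarrow> 'a bop" where "sgn_bop f = f /\<^sub>R norm f"
definition dist_bop :: "'a bop \<Rightarrow> 'a bop \<Rightarrow> real" where "dist_bop f g = norm (f - g)"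
definition uniformity_bop :: "('a bop \<times> 'a bop) filter" where
  "uniformity_bop = (INF e\<in>{0<..}. principal {(x, y). dist x y < e})"
definition open_bop :: "'a bop set \<Rightarrow> bool" where
  "open_bop U \<longleftrightarrow> (\<forall>x\<in>U. \<forall>\<^sub>F (x', y) in uniformity. x' = x \<longrightarrow> y \<in> U)"

instance
proof
  fix f g h :: "'a bop" and r :: real
  show "norm (f * g) \<le> norm f * norm g"
    by transfer (rule norm_blinfun_compose)
  show "norm (1::'a bop) = 1"
    by transfer simp
  show "norm (f + g) \<le> norm f + norm g"
    by transfer (rule norm_triangle_ineq)
  show "norm f = 0 \<longleftrightarrow> f = 0" "norm (r *\<^sub>R f) = \<bar>r\<bar> * norm f"
    by (transfer, simp)+
qed (simp_all add: sgn_bop_def dist_bop_def uniformity_bop_def open_bop_def)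

end

instance bop :: ("{banach,perfect_space}") banach
proof
  fix X :: "nat \<Rightarrow> 'a bop"
  assume "Cauchy X"
  then have "Cauchy (\<lambda>n. Rep_bop (X n))"
    unfolding Cauchy_def dist_bop_def dist_norm
    by (simp add: norm_bop.rep_eq minus_bop.rep_eq)
  then obtain L where "(\<lambda>n. Rep_bop (X n)) \<longlonglongrightarrow> L"
    using Cauchy_convergent convergent_def by blast
  then have "X \<longlonglongrightarrow> Abs_bop L"
    unfolding LIMSEQ_def dist_bop_def dist_norm
    by (simp add: norm_bop.rep_eq minus_bop.rep_eq Abs_bop_inverse)
  then show "convergent X"
    by (auto simp: convergent_def)
qed

lemma bop_eqI: "(\<And>x. bop_apply S x = bop_apply T x) \<Longrightarrow> S = T"
  by transfer (rule blinfun_eqI)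

lemma bop_apply_simps [simp]:
  fixes S T :: "'a::{real_normed_vector,perfect_space} bop"
  shows "bop_apply 0 x = 0" "bop_apply 1 x = x"
    "bop_apply (S + T) x = bop_apply S x + bop_apply T x"
    "bop_apply (S - T) x = bop_apply S x - bop_apply T x"
    "bop_apply (- S) x = - bop_apply S x"
    "bop_apply (S * T) x = bop_apply S (bop_apply T x)"
    "bop_apply (r *\<^sub>R T) x = r *\<^sub>R bop_apply T x"
  by (transfer, simp add: blinfun.bilinear_simps)+

lemma bounded_linear_bop_apply: "bounded_linear (bop_apply T)"
  by transfer (rule blinfun.bounded_linear_right)

lemmas bop_apply_linear [simp] =
  linear_0[OF bounded_linear.linear[OF bounded_linear_bop_apply]]
  linear_add[OF bounded_linear.linear[OF bounded_linear_bop_apply]]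
  linear_diff[OF bounded_linear.linear[OF bounded_linear_bop_apply]]
  linear_neg[OF bounded_linear.linear[OF bounded_linear_bop_apply]]
  linear_scale[OF bounded_linear.linear[OF bounded_linear_bop_apply]]

lemma norm_bop_apply:
  fixes T :: "'a::{real_normed_vector,perfect_space} bop"
  shows "norm (bop_apply T x) \<le> norm T * norm x"
  by transfer (rule norm_blinfun)

lemma norm_bop_le:
  fixes T :: "'a::{real_normed_vector,perfect_space} bop"
  assumes "0 \<le> C" "\<And>x. norm (bop_apply T x) \<le> C * norm x"
  shows "norm T \<le> C"
  using assms by transfer (rule norm_blinfun_bound)

lemma bounded_bilinear_bop_apply:
  "bounded_bilinear (bop_apply :: 'a::{real_normed_vector,perfect_space} bop \<Rightarrow> _)"
  by (rule bounded_bilinear.intro) (auto intro!: exI[of _ 1] simp: norm_bop_apply)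

lemmas has_vector_derivative_bop_apply =
  bounded_linear.has_vector_derivative[OF bounded_bilinear.bounded_linear_left
    [OF bounded_bilinear_bop_apply]]

definition bop_of :: "('a \<Rightarrow> 'a) \<Rightarrow> 'a::real_normed_vector bop" where
  "bop_of f = Abs_bop (Blinfun f)"

lemma bop_apply_bop_of: "bounded_linear f \<Longrightarrow> bop_apply (bop_of f) x = f x"
  by (simp add: bop_of_def bop_apply.rep_eq Abs_bop_inverse bounded_linear_Blinfun_apply)

text \<open>Through the product instance this gives \<open>scaleC\<close> on C^4, so that vectors of
  C^4 and states share one notation.\<close>

instantiation complex :: scaleC
begin
definition scaleC_complex :: "complex \<Rightarrow> complex \<Rightarrow> complex" where "scaleC_complex c x = c * x"
instance by standard (auto simp: scaleC_complex_def algebra_simps scaleR_conv_of_real)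
end

section \<open>Smoothing from resolvent decay\<close>

text \<open>Up to normalisation the Gaussian is its own Fourier transform: its characteristic
  function exp(-s^2/2) is read backwards as an integral representation of the density.\<close>

lemma std_normal_density_eq_fourier:
  "complex_of_real (std_normal_density s) =
     (LINT x|lborel. std_normal_density x *\<^sub>R iexp (s * x)) / sqrt (2 * pi)"
proof -
  have "(LINT x|lborel. std_normal_density x *\<^sub>R iexp (s * x)) = char std_normal_distribution s"
    unfolding char_def by (subst integral_density) (auto simp: normal_density_nonneg)
  also have "\<dots> = exp (- s\<^sup>2 / 2)"
    by (simp add: char_std_normal_distribution exp_of_real[symmetric])
  finally show ?thesis
    by (simp add: normal_density_def of_real_exp)
qed

text \<open>Approximate inversion: average \<open>h\<close> against a Gaussian of width \<open>\<epsilon>\<close>, write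
  the Gaussian as a Fourier integral and exchange the order of integration.\<close>

lemma norm_le_integral_fourier:
  fixes h :: "real \<Rightarrow> complex" and g :: "real \<Rightarrow> real"
  assumes cont: "continuous_on UNIV h" and int: "integrable lborel h"
    and bdd: "\<And>t. cmod (h t) \<le> B"
    and ft: "\<And>l. cmod (LINT s|lborel. h s * iexp (- (l * s))) \<le> g l"
    and g: "integrable lborel g"
  shows "cmod (h t) \<le> (LINT l|lborel. g l) / (2 * pi)"
proof -
  let ?\<nu> = "std_normal_density"
  have [measurable]: "h \<in> borel_measurable borel"
    using cont by (rule borel_measurable_continuous_onI)
  have B: "0 \<le> B" using bdd[of 0] norm_ge_zero order_trans by blast
  have nu_int: "integrable lborel ?\<nu>" by simp
  \<comment> \<open>The bound on the average does not depend on \<epsilon>, so it survives the limit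
    \<epsilon> -> 0. The Gaussian weight makes the double integral absolutely convergent, which the
    exchange of integrals requires.\<close>
  have smeared: "cmod (LINT s|lborel. ?\<nu> s *\<^sub>R h (t + \<epsilon> * s)) \<le> (LINT l|lborel. g l) / (2 * pi)"
    if \<epsilon>: "\<epsilon> > 0" for \<epsilon>
  proof -
    have h\<epsilon>: "integrable lborel (\<lambda>s. h (t + \<epsilon> * s))"
      using \<epsilon> int by (intro lborel_integrable_real_affine) auto
    define F where "F s x = ?\<nu> x *\<^sub>R (iexp (s * x) * h (t + \<epsilon> * s))" for s x :: real
    have F[measurable]: "case_prod F \<in> borel_measurable (lborel \<Otimes>\<^sub>M lborel)"
      unfolding F_def by measurable
    have nF: "norm (F s x) = ?\<nu> x * cmod (h (t + \<epsilon> * s))" for s x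
      by (simp add: F_def norm_mult normal_density_nonneg)
    have intF: "integrable (lborel \<Otimes>\<^sub>M lborel) (case_prod F)"
    proof (rule lborel_pair.Fubini_integrable[OF F])
      show "integrable lborel (\<lambda>x. LINT y|lborel. norm (case_prod F (x, y)))"
        using integrable_norm[OF h\<epsilon>] by (simp add: nF)
      have "integrable lborel (\<lambda>y. F x y)" for x
        unfolding F_def
        by (rule Bochner_Integration.integrable_bound[of _ "\<lambda>y. ?\<nu> y * cmod (h (t + \<epsilon> * x))"])
          (auto simp: norm_mult normal_density_nonneg)
      then show "AE x in lborel. integrable lborel (\<lambda>y. case_prod F (x, y))" by simp
    qed
    \<comment> \<open>Substituting y = t + \<epsilon> s turns the integral over s into the Fourier
      transform of \<open>h\<close> at the frequency - x / \<epsilon>, up to a phase and the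
      Jacobian.\<close>
    have inner: "(LINT s|lborel. F s x) =
        ?\<nu> x *\<^sub>R ((1 / \<epsilon>) *\<^sub>R (iexp (- (x * t / \<epsilon>)) * (LINT y|lborel. h y * iexp (- ((- x / \<epsilon>) * y)))))" for x
    proof -
      have "(LINT y|lborel. h y * iexp (x * (y - t) / \<epsilon>)) =
          \<bar>\<epsilon>\<bar> *\<^sub>R (LINT s|lborel. h (t + \<epsilon> * s) * iexp (x * ((t + \<epsilon> * s) - t) / \<epsilon>))"
        using \<epsilon> by (intro lborel_integral_real_affine) auto
      also have "\<dots> = \<epsilon> *\<^sub>R (LINT s|lborel. iexp (s * x) * h (t + \<epsilon> * s))"
        using \<epsilon> by (simp add: mult.commute)
      finally have 1: "(LINT s|lborel. iexp (s * x) * h (t + \<epsilon> * s)) =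
          (1 / \<epsilon>) *\<^sub>R (LINT y|lborel. h y * iexp (x * (y - t) / \<epsilon>))"
        using \<epsilon> by simp
      have 2: "iexp (x * (y - t) / \<epsilon>) = iexp (- (x * t / \<epsilon>)) * iexp (- ((- x / \<epsilon>) * y))" for y
        by (simp add: exp_add[symmetric] diff_divide_distrib algebra_simps)
      have "(LINT y|lborel. h y * iexp (x * (y - t) / \<epsilon>)) =
          (LINT y|lborel. iexp (- (x * t / \<epsilon>)) * (h y * iexp (- ((- x / \<epsilon>) * y))))"
        unfolding 2 by (simp only: mult.left_commute)
      also have "\<dots> = iexp (- (x * t / \<epsilon>)) * (LINT y|lborel. h y * iexp (- ((- x / \<epsilon>) * y)))"
        by (rule integral_mult_right_zero)
      finally show ?thesis
        using 1 by (simp add: F_def)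
    qed
    have g\<epsilon>: "integrable lborel (\<lambda>x. g (- x / \<epsilon>))"
      using lborel_integrable_real_affine[OF g, of "- 1 / \<epsilon>" 0] \<epsilon> by simp
    \<comment> \<open>The density is replaced by its maximum 1 / sqrt(2 pi); the representation of
      the density contributes the same factor, and together they give 1 / (2 pi). The factor 1 /
      \<epsilon> disappears in the substitution l = - x / \<epsilon>.\<close>
    have inner_le: "cmod (LINT s|lborel. F s x) \<le> (1 / sqrt (2 * pi)) * ((1 / \<epsilon>) * g (- x / \<epsilon>))" for x
    proof -
      have "cmod (LINT s|lborel. F s x) = ?\<nu> x * ((1 / \<epsilon>) *
          cmod (LINT y|lborel. h y * iexp (- ((- x / \<epsilon>) * y))))"
        unfolding inner using \<epsilon> by (simp add: norm_mult normal_density_nonneg)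
      also have "\<dots> \<le> (1 / sqrt (2 * pi)) * ((1 / \<epsilon>) * g (- x / \<epsilon>))"
      proof (intro mult_mono)
        show "?\<nu> x \<le> 1 / sqrt (2 * pi)"
          by (simp add: normal_density_def divide_right_mono)
        show "cmod (LINT y|lborel. h y * iexp (- ((- x / \<epsilon>) * y))) \<le> g (- x / \<epsilon>)"
          by (rule ft)
      qed (use \<epsilon> in \<open>auto simp: normal_density_nonneg\<close>)
      finally show ?thesis .
    qed
    have "(LINT s|lborel. ?\<nu> s *\<^sub>R h (t + \<epsilon> * s)) =
        (LINT s|lborel. (LINT x|lborel. F s x) / sqrt (2 * pi))"
    proof (intro Bochner_Integration.integral_cong refl)
      fix s
      have "?\<nu> s *\<^sub>R h (t + \<epsilon> * s) = complex_of_real (?\<nu> s) * h (t + \<epsilon> * s)"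
        by (simp add: scaleR_conv_of_real)
      also have "\<dots> = (LINT x|lborel. ?\<nu> x *\<^sub>R iexp (s * x)) * h (t + \<epsilon> * s) / sqrt (2 * pi)"
        by (subst std_normal_density_eq_fourier) simp
      also have "(LINT x|lborel. ?\<nu> x *\<^sub>R iexp (s * x)) * h (t + \<epsilon> * s) = (LINT x|lborel. F s x)"
        unfolding F_def by (subst integral_mult_left_zero[symmetric]) simp
      finally show "?\<nu> s *\<^sub>R h (t + \<epsilon> * s) = (LINT x|lborel. F s x) / sqrt (2 * pi)" .
    qed
    also have "\<dots> = (LINT s|lborel. LINT x|lborel. F s x) / sqrt (2 * pi)"
      by simp
    also have "(LINT s|lborel. LINT x|lborel. F s x) = (LINT x|lborel. LINT s|lborel. F s x)"
      by (rule lborel_pair.Fubini_integral[OF intF, symmetric])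
    finally have "cmod (LINT s|lborel. ?\<nu> s *\<^sub>R h (t + \<epsilon> * s)) =
        cmod (LINT x|lborel. LINT s|lborel. F s x) / sqrt (2 * pi)"
      by (simp add: norm_divide)
    also have "\<dots> \<le> (LINT x|lborel. (1 / sqrt (2 * pi)) * ((1 / \<epsilon>) * g (- x / \<epsilon>))) / sqrt (2 * pi)"
      using g\<epsilon> inner_le
      by (intro divide_right_mono Bochner_Integration.integral_norm_bound_integral)
        (auto intro!: lborel_pair.integrable_snd[OF intF])
    also have "\<dots> = ((1 / \<epsilon>) * (LINT x|lborel. g (0 + (- 1 / \<epsilon>) * x))) / (2 * pi)"
      by (simp add: divide_simps)
    also have "(1 / \<epsilon>) * (LINT x|lborel. g (0 + (- 1 / \<epsilon>) * x)) = (LINT l|lborel. g l)"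
      using lborel_integral_real_affine[of "- 1 / \<epsilon>" g 0] \<epsilon> by simp
    finally show ?thesis .
  qed
  \<comment> \<open>Now \<epsilon> = 1 / (n + 1) tends to 0. The Gaussian has total mass 1, so the
    averages tend to \<open>h t\<close>; boundedness of \<open>h\<close> supplies the
    majorant.\<close>
  have "(\<lambda>n. LINT s|lborel. ?\<nu> s *\<^sub>R h (t + (1 / real (Suc n)) * s)) \<longlonglongrightarrow> (LINT s|lborel. ?\<nu> s *\<^sub>R h t)"
  proof (rule integral_dominated_convergence[where w = "\<lambda>s. B * ?\<nu> s"])
    show "AE s in lborel. (\<lambda>n. ?\<nu> s *\<^sub>R h (t + (1 / real (Suc n)) * s)) \<longlonglongrightarrow> ?\<nu> s *\<^sub>R h t"
    proof (intro AE_I2 tendsto_scaleR tendsto_const)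
      fix s
      have "isCont h t" using cont by (simp add: continuous_on_eq_continuous_at)
      moreover have "(\<lambda>n. t + (1 / real (Suc n)) * s) \<longlonglongrightarrow> t + 0 * s"
        by (intro tendsto_add tendsto_mult tendsto_const LIMSEQ_Suc lim_1_over_n)
      ultimately show "(\<lambda>n. h (t + (1 / real (Suc n)) * s)) \<longlonglongrightarrow> h t"
        using isCont_tendsto_compose by fastforce
    qed
    show "AE s in lborel. norm (?\<nu> s *\<^sub>R h (t + (1 / real (Suc n)) * s)) \<le> B * ?\<nu> s" for n
      by (intro AE_I2) (simp add: mult.commute[of B] mult_left_mono bdd)
  qed (use nu_int in auto)
  then have "(\<lambda>n. cmod (LINT s|lborel. ?\<nu> s *\<^sub>R h (t + (1 / real (Suc n)) * s))) \<longlonglongrightarrow> cmod (h t)"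
    by (intro tendsto_norm) simp
  then show ?thesis
    by (rule LIMSEQ_le_const2) (intro exI allI impI smeared, simp)
qed

section \<open>Operators on C^4: complex scalars, complex linearity, exponentials\<close>

type_synonym cvec = "complex \<times> complex \<times> complex \<times> complex"

lemma norm_quad: "norm (a, b, c, d) = sqrt ((norm a)\<^sup>2 + (norm b)\<^sup>2 + (norm c)\<^sup>2 + (norm d)\<^sup>2)"
  by (simp add: norm_Pair add.assoc)

lemma scaleC_quad: "k *\<^sub>C (a, b, c, d) = (k *\<^sub>C a, k *\<^sub>C b, k *\<^sub>C c, k *\<^sub>C d)"
  by (simp add: scaleC_prod_def)

lemma norm_scaleC_cvec [simp]: "norm (k *\<^sub>C (x::cvec)) = cmod k * norm x"
proof -
  obtain a b c d where x: "x = (a, b, c, d)" by (cases x)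
  have "norm (k *\<^sub>C x) = sqrt ((cmod k)\<^sup>2 * ((cmod a)\<^sup>2 + (cmod b)\<^sup>2 + (cmod c)\<^sup>2 + (cmod d)\<^sup>2))"
    by (simp add: x scaleC_quad scaleC_complex_def norm_quad norm_mult power_mult_distrib algebra_simps)
  then show ?thesis by (simp add: x norm_quad real_sqrt_mult)
qed

lemma bounded_linear_scaleC_cvec: "bounded_linear (\<lambda>x::cvec. k *\<^sub>C x)"
proof (rule bounded_linear_intro[where K = "cmod k"])
  show "k *\<^sub>C (x + y) = k *\<^sub>C x + k *\<^sub>C y" for x y :: cvec by (rule scaleC_add_right)
  show "k *\<^sub>C (r *\<^sub>R x) = r *\<^sub>R (k *\<^sub>C x)" for r and x :: cvec
    by (metis scaleC_of_real scaleC_scaleC mult.commute)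
qed (simp add: mult.commute)

text \<open>The operators form an algebra over the reals only; complex scalars enter as elements of
  this algebra.\<close>

definition cop :: "complex \<Rightarrow> cvec bop" where "cop k = bop_of (\<lambda>x. k *\<^sub>C x)"

lemma cop_apply [simp]: "bop_apply (cop k) x = k *\<^sub>C x"
  by (simp add: cop_def bop_apply_bop_of bounded_linear_scaleC_cvec)

lemma cop_of_real: "cop (complex_of_real r) = r *\<^sub>R 1"
  by (rule bop_eqI) (simp add: scaleC_of_real)

lemma cop_mult: "cop (j * k) = cop j * cop k"
  by (rule bop_eqI) (simp add: scaleC_scaleC)

lemma cop_add: "cop (j + k) = cop j + cop k"
  by (rule bop_eqI) (simp add: scaleC_add_left)

lemma cop_1: "cop 1 = 1"
  using cop_of_real[of 1] by simp

lemma norm_cop: "norm (cop k) \<le> cmod k"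
  by (rule norm_bop_le) auto

lemma bounded_linear_cop: "bounded_linear cop"
proof (rule bounded_linear_intro[where K = 1])
  show "cop (r *\<^sub>R k) = r *\<^sub>R cop k" for r k
    by (simp add: scaleR_conv_of_real cop_mult cop_of_real)
qed (auto simp: cop_add norm_cop)

lemma exp_cop: "exp (cop k) = cop (exp k)"
proof -
  have pow: "cop (k ^ n) = cop k ^ n" for n
    by (induction n) (simp_all add: cop_1 cop_mult)
  have "(\<lambda>n. cop (k ^ n /\<^sub>R fact n)) sums cop (exp k)"
    by (rule bounded_linear.sums[OF bounded_linear_cop exp_converges])
  then have "(\<lambda>n. cop k ^ n /\<^sub>R fact n) sums cop (exp k)"
    by (simp add: bounded_linear.linear[OF bounded_linear_cop] linear_scale pow)
  then show ?thesis
    using exp_converges[of "cop k"] sums_unique2 by blast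
qed

text \<open>Complex linearity is stated as an algebraic identity because in this form it passes to
  products, differences, powers, inverses and exponentials.\<close>

definition clinear_op :: "cvec bop \<Rightarrow> bool" where
  "clinear_op T \<longleftrightarrow> (\<forall>k. cop k * T = T * cop k)"

text \<open>This sum is what repeated integration by parts of t^k/k! exp(-tA) leaves: multiplied by
  exp(-tA) it is, up to sign, a primitive of that integrand. Differentiation lowers the power of t,
  multiplication by \<open>A\<close> lowers the power of \<open>R\<close>, and the two results
  differ only in the term j = k.\<close>

lemma has_vector_derivative_exp_taylor_sum:
  fixes A R :: "'a::real_normed_algebra_1"
  assumes AR: "A * R = 1"
  shows "((\<lambda>t. \<Sum>j<Suc k. (t ^ j / fact j) *\<^sub>R R ^ (Suc k - j)) has_vector_derivative
     (A * (\<Sum>j<Suc k. (t ^ j / fact j) *\<^sub>R R ^ (Suc k - j)) - (t ^ k / fact k) *\<^sub>R 1)) (at t)"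
proof -
  have d: "((\<lambda>t. \<Sum>j<Suc k. (t ^ j / fact j) *\<^sub>R R ^ (Suc k - j)) has_vector_derivative
     (\<Sum>j<Suc k. (real j * t ^ (j - 1) / fact j) *\<^sub>R R ^ (Suc k - j))) (at t)"
    by (intro has_vector_derivative_sum)
      (auto intro!: derivative_eq_intros simp: has_real_derivative_iff_has_vector_derivative[symmetric]
        intro: has_vector_derivative_eq_rhs[OF has_vector_derivative_scaleR[OF _ has_vector_derivative_const]])
  have AS: "A * (\<Sum>j<Suc k. (t ^ j / fact j) *\<^sub>R R ^ (Suc k - j)) =
      (\<Sum>j<Suc k. (t ^ j / fact j) *\<^sub>R R ^ (k - j))"
    unfolding sum_distrib_left
  proof (rule sum.cong[OF refl])
    fix j assume "j \<in> {..<Suc k}"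
    then have "Suc k - j = Suc (k - j)" by auto
    then show "A * ((t ^ j / fact j) *\<^sub>R R ^ (Suc k - j)) = (t ^ j / fact j) *\<^sub>R R ^ (k - j)"
      by (simp add: mult.assoc[symmetric] AR)
  qed
  have "(\<Sum>j<Suc k. (real j * t ^ (j - 1) / fact j) *\<^sub>R R ^ (Suc k - j)) =
      (\<Sum>j<k. (t ^ j / fact j) *\<^sub>R R ^ (k - j))"
    unfolding sum.lessThan_Suc_shift by (simp add: divide_simps)
  also have "\<dots> = (\<Sum>j<Suc k. (t ^ j / fact j) *\<^sub>R R ^ (k - j)) - (t ^ k / fact k) *\<^sub>R 1"
    by simp
  finally show ?thesis using d AS by simp
qed

lemma integrable_erlang_density:
  assumes "0 < l" shows "integrable lborel (erlang_density k l)"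
proof (rule integrableI_nonneg)
  show "(\<integral>\<^sup>+ x. ennreal (erlang_density k l x) \<partial>lborel) < \<infinity>"
    using nn_integral_erlang_ith_moment[OF assms, of k 0] by simp
qed (use assms in auto)

text \<open>With rate 1 this is t^k/k! exp(-t) on the half line and 0 before it. For
  \<open>0 < k\<close> the two branches meet at 0; the Fourier inversion asks for a continuous
  function on the whole line.\<close>

lemma continuous_erlang_density:
  assumes "0 < k" shows "continuous_on UNIV (erlang_density k l)"
proof -
  have "continuous_on ({..0} \<union> {0..}) (\<lambda>x. if x \<le> 0 then 0 else (l ^ Suc k * x ^ k * exp (- l * x)) / fact k)"
    by (rule continuous_on_cases) (use assms in \<open>auto intro!: continuous_intros\<close>)
  moreover have "(\<lambda>x. if x \<le> 0 then 0 else (l ^ Suc k * x ^ k * exp (- l * x)) / fact k) = erlang_density k l"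
    using assms by (auto simp: erlang_density_def fun_eq_iff)
  moreover have "{..0} \<union> {0..} = (UNIV :: real set)" by auto
  ultimately show ?thesis by metis
qed

lemma clinear_op_apply: "clinear_op T \<Longrightarrow> bop_apply T (c *\<^sub>C x) = c *\<^sub>C bop_apply T x"
  unfolding clinear_op_def by (metis bop_apply_simps(6) cop_apply)

lemma clinear_op_mult: "clinear_op S \<Longrightarrow> clinear_op T \<Longrightarrow> clinear_op (S * T)"
  unfolding clinear_op_def by (metis mult.assoc)

lemma clinear_op_cop: "clinear_op (cop k)"
  unfolding clinear_op_def by (metis cop_mult mult.commute)

lemma clinear_op_1: "clinear_op 1"
  by (simp add: clinear_op_def)

lemma clinear_op_power: "clinear_op T \<Longrightarrow> clinear_op (T ^ n)"
  by (induction n) (simp_all add: clinear_op_mult clinear_op_1)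

lemma clinear_op_scaleR: "clinear_op T \<Longrightarrow> clinear_op (r *\<^sub>R T)"
  by (simp add: clinear_op_def)

lemma clinear_op_diff: "clinear_op S \<Longrightarrow> clinear_op T \<Longrightarrow> clinear_op (S - T)"
  by (simp add: clinear_op_def algebra_simps)

lemma exp_commute:
  fixes A B :: "'a::{real_normed_algebra_1,banach}"
  assumes "A * B = B * A" shows "exp A * B = B * exp A"
proof -
  have p: "A ^ n * B = B * A ^ n" for n
    using assms by (simp add: power_commuting_commutes)
  have "(\<lambda>n. (A ^ n /\<^sub>R fact n) * B) sums (exp A * B)"
    by (intro sums_mult2 exp_converges)
  moreover have "(\<lambda>n. B * (A ^ n /\<^sub>R fact n)) sums (B * exp A)"
    by (intro sums_mult exp_converges)
  ultimately show ?thesis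
    using sums_unique2 by (simp add: p)
qed

lemma clinear_op_exp: "clinear_op T \<Longrightarrow> clinear_op (exp T)"
  unfolding clinear_op_def by (metis exp_commute)

lemma continuous_on_exp_scaleR:
  fixes A :: "'a::{real_normed_algebra_1,banach}"
  shows "continuous_on S (\<lambda>t. exp (t *\<^sub>R A))"
  by (intro continuous_at_imp_continuous_on ballI
      has_vector_derivative_continuous[OF exp_scaleR_has_vector_derivative_right])

text \<open>The Fourier transform of \<open>t \<mapsto> t\<^sup>k/k! e\<^sup>-\<^sup>t M e\<^sup>t\<^sup>M\<close> on the half line is
  $M R(l)^{k+1}$ with $R(l) = (1 + il - M)^{-1}$, which is integrable in $l$ once $k$ is large.\<close>

lemma laplace_transform_exp:
  fixes M R :: "cvec bop" and \<zeta> :: complex and x :: cvec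
  assumes M: "clinear_op M" and contr: "\<And>t. 0 \<le> t \<Longrightarrow> norm (exp (t *\<^sub>R M)) \<le> 1"
    and R: "(cop \<zeta> - M) * R = 1" and \<zeta>: "Re \<zeta> = 1" and k: "0 < k"
  defines "f \<equiv> \<lambda>t. erlang_density k 1 t *\<^sub>R (cis (- (Im \<zeta> * t)) *\<^sub>C bop_apply (M * exp (t *\<^sub>R M)) x)"
  shows "integrable lborel f" and "(LINT t|lborel. f t) = bop_apply (M * R ^ Suc k) x"
proof -
  define A where "A = cop \<zeta> - M"
  have expA: "exp (t *\<^sub>R (- A)) = exp (t *\<^sub>R M) * cop (exp (- (t *\<^sub>R \<zeta>)))" for t
  proof -
    have "t *\<^sub>R (- A) = t *\<^sub>R M + cop (- (t *\<^sub>R \<zeta>))"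
      by (simp add: A_def algebra_simps linear_scale[OF bounded_linear.linear[OF bounded_linear_cop]]
          linear_neg[OF bounded_linear.linear[OF bounded_linear_cop]])
    then have "exp (t *\<^sub>R (- A)) = exp (t *\<^sub>R M) * exp (cop (- (t *\<^sub>R \<zeta>)))"
      using M unfolding clinear_op_def by (simp only:, subst exp_add_commuting) auto
    then show ?thesis by (simp only: exp_cop)
  qed
  have ez: "exp (- (t *\<^sub>R \<zeta>)) = exp (- t) *\<^sub>R cis (- (Im \<zeta> * t))" for t
    using \<zeta> by (simp add: exp_eq_polar scaleR_conv_of_real mult.commute)
  have nexpA: "norm (exp (t *\<^sub>R (- A))) \<le> exp (- t)" if "0 \<le> t" for t
  proof -
    have "norm (exp (t *\<^sub>R (- A))) \<le> norm (exp (t *\<^sub>R M)) * norm (cop (exp (- (t *\<^sub>R \<zeta>))))"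
      unfolding expA by (rule norm_mult_ineq)
    also have "\<dots> \<le> 1 * exp (- t)"
      using contr[OF that] norm_cop[of "exp (- (t *\<^sub>R \<zeta>))"] \<zeta> by (intro mult_mono) auto
    finally show ?thesis by simp
  qed
  \<comment> \<open>The complex factor exp(-t \<zeta>) is moved out of the operator, which uses that
    \<open>M * exp (t *\<^sub>R M)\<close> is complex linear.\<close>
  have f_eq: "f t = bop_apply ((t ^ k / fact k) *\<^sub>R (M * exp (t *\<^sub>R (- A)))) x" if "0 \<le> t" for t
  proof -
    let ?N = "M * exp (t *\<^sub>R M)"
    have N: "clinear_op ?N"
      by (intro clinear_op_mult clinear_op_exp clinear_op_scaleR M)
    have sc: "(r *\<^sub>R c) *\<^sub>C y = r *\<^sub>R (c *\<^sub>C y)" for r c and y :: cvec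
      by (simp add: scaleR_conv_of_real scaleC_scaleC[symmetric] scaleC_of_real)
    have "bop_apply ((t ^ k / fact k) *\<^sub>R (M * exp (t *\<^sub>R (- A)))) x =
        (t ^ k / fact k) *\<^sub>R bop_apply ?N (exp (- (t *\<^sub>R \<zeta>)) *\<^sub>C x)"
      unfolding expA by (simp only: bop_apply_simps cop_apply)
    also have "\<dots> = (t ^ k / fact k) *\<^sub>R exp (- t) *\<^sub>R (cis (- (Im \<zeta> * t)) *\<^sub>C bop_apply ?N x)"
      by (simp only: clinear_op_apply[OF N], simp only: ez sc)
    also have "\<dots> = f t"
      using that by (simp add: f_def erlang_density_def)
    finally show ?thesis ..
  qed
  have f_neg: "f t = 0" if "t \<le> 0" for t
    using that k by (simp add: f_def erlang_density_def)
  have cont: "continuous_on UNIV f"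
  proof -
    have ce: "continuous_on UNIV (\<lambda>t. erlang_density k 1 t)" by (rule continuous_erlang_density[OF k])
    have "continuous_on UNIV (\<lambda>t. bop_apply (erlang_density k 1 t *\<^sub>R (cop (cis (- (Im \<zeta> * t))) * (M * exp (t *\<^sub>R M)))) x)"
      by (intro bounded_linear.continuous_on[OF bounded_bilinear.bounded_linear_left[OF bounded_bilinear_bop_apply]]
         bounded_linear.continuous_on[OF bounded_linear_cop] continuous_on_exp_scaleR continuous_intros ce)
    then show ?thesis by (simp add: f_def)
  qed
  have [measurable]: "f \<in> borel_measurable borel"
    using cont by (rule borel_measurable_continuous_onI)
  show int: "integrable lborel f"
  proof (rule Bochner_Integration.integrable_bound)
    show "integrable lborel (\<lambda>t. (norm M * norm x) * erlang_density k 1 t)"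
      by (intro integrable_mult_right integrable_erlang_density) auto
    show "AE t in lborel. norm (f t) \<le> norm ((norm M * norm x) * erlang_density k 1 t)"
    proof (intro AE_I2)
      fix t :: real
      show "norm (f t) \<le> norm ((norm M * norm x) * erlang_density k 1 t)"
      proof (cases "0 \<le> t")
        case True
        have "norm (bop_apply (M * exp (t *\<^sub>R M)) x) \<le> norm (M * exp (t *\<^sub>R M)) * norm x"
          by (rule norm_bop_apply)
        also have "\<dots> \<le> (norm M * 1) * norm x"
          by (intro mult_right_mono order_trans[OF norm_mult_ineq] mult_left_mono contr[OF True]) auto
        finally show ?thesis
          by (simp add: f_def mult_left_mono mult.commute[of _ "erlang_density k 1 t"])
      qed (simp add: f_neg)
    qed
  qed simp
  define S where "S t = (\<Sum>j<Suc k. (t ^ j / fact j) *\<^sub>R R ^ (Suc k - j))" for t :: real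
  \<comment> \<open>By the formula for the derivative of \<open>S\<close>, the two terms containing
    \<open>A\<close> cancel in the derivative of \<open>G\<close>, so that \<open>- G\<close> is a
    primitive of \<open>f\<close>. At 0 only the term j = 0 survives, and at infinity the factor
    exp(-t) beats the polynomial \<open>S\<close>; the integral is therefore
    \<open>G 0\<close>.\<close>
  define G where "G t = bop_apply (M * (exp (t *\<^sub>R (- A)) * S t)) x" for t
  have dG: "((\<lambda>t. - G t) has_vector_derivative f t) (at t)" if "0 \<le> t" for t
  proof -
    have "(S has_vector_derivative (A * S t - (t ^ k / fact k) *\<^sub>R 1)) (at t)"
      unfolding S_def by (rule has_vector_derivative_exp_taylor_sum) (simp add: A_def R)
    then have "((\<lambda>t. exp (t *\<^sub>R (- A)) * S t) has_vector_derivative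
        exp (t *\<^sub>R (- A)) * (A * S t - (t ^ k / fact k) *\<^sub>R 1) + exp (t *\<^sub>R (- A)) * (- A) * S t) (at t)"
      by (intro has_vector_derivative_mult exp_scaleR_has_vector_derivative_right)
    then have "(G has_vector_derivative bop_apply (M * (exp (t *\<^sub>R (- A)) * (A * S t - (t ^ k / fact k) *\<^sub>R 1)
        + exp (t *\<^sub>R (- A)) * (- A) * S t)) x) (at t)"
      unfolding G_def
      by (intro has_vector_derivative_bop_apply
          bounded_linear.has_vector_derivative[OF bounded_linear_mult_right])
    moreover have "M * (exp (t *\<^sub>R (- A)) * (A * S t - (t ^ k / fact k) *\<^sub>R 1)
        + exp (t *\<^sub>R (- A)) * (- A) * S t) = - ((t ^ k / fact k) *\<^sub>R (M * exp (t *\<^sub>R (- A))))"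
      by (simp add: algebra_simps)
    ultimately have "(G has_vector_derivative - f t) (at t)"
      using f_eq[OF that] by (simp only: bop_apply_simps)
    then have "((\<lambda>t. - G t) has_vector_derivative - (- f t)) (at t)"
      by (rule has_vector_derivative_minus)
    then show ?thesis by simp
  qed
  have G0: "G 0 = bop_apply (M * R ^ Suc k) x"
  proof -
    have "S 0 = R ^ Suc k"
      unfolding S_def sum.lessThan_Suc_shift by (simp add: power_0_left)
    then show ?thesis by (simp add: G_def)
  qed
  have Ginf: "(G \<longlongrightarrow> 0) at_top"
  proof -
    have "((\<lambda>t. \<Sum>j<Suc k. (t ^ j / exp t / fact j) *\<^sub>R norm (R ^ (Suc k - j))) \<longlongrightarrow>
        (\<Sum>j<Suc k. (0 / fact j) *\<^sub>R norm (R ^ (Suc k - j)))) at_top"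
      by (intro tendsto_sum tendsto_scaleR tendsto_divide tendsto_const tendsto_power_div_exp_0) auto
    then have "((\<lambda>t. norm M * (\<Sum>j<Suc k. (t ^ j / exp t / fact j) *\<^sub>R norm (R ^ (Suc k - j))) * norm x)
        \<longlongrightarrow> norm M * 0 * norm x) at_top"
      by (intro tendsto_mult tendsto_const) simp
    then have lim: "((\<lambda>t. norm M * (\<Sum>j<Suc k. (t ^ j / exp t / fact j) *\<^sub>R norm (R ^ (Suc k - j))) * norm x)
        \<longlongrightarrow> 0) at_top" by simp
    have ev: "\<forall>\<^sub>F t in at_top. norm (G t) \<le>
        norm M * (\<Sum>j<Suc k. (t ^ j / exp t / fact j) *\<^sub>R norm (R ^ (Suc k - j))) * norm x"
    proof (rule eventually_mono[OF eventually_ge_at_top[of 0]])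
      fix t :: real assume t: "0 \<le> t"
      have "norm (G t) \<le> norm (M * (exp (t *\<^sub>R (- A)) * S t)) * norm x"
        unfolding G_def by (rule norm_bop_apply)
      also have "norm (M * (exp (t *\<^sub>R (- A)) * S t)) \<le> norm M * (norm (exp (t *\<^sub>R (- A))) * norm (S t))"
        by (intro order_trans[OF norm_mult_ineq] mult_left_mono norm_mult_ineq) auto
      also have "\<dots> \<le> norm M * (exp (- t) * (\<Sum>j<Suc k. norm ((t ^ j / fact j) *\<^sub>R R ^ (Suc k - j))))"
        unfolding S_def
        by (intro mult_left_mono mult_mono nexpA[OF t] norm_sum) (auto intro: sum_nonneg)
      also have "exp (- t) * (\<Sum>j<Suc k. norm ((t ^ j / fact j) *\<^sub>R R ^ (Suc k - j))) =
          (\<Sum>j<Suc k. (t ^ j / exp t / fact j) *\<^sub>R norm (R ^ (Suc k - j)))"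
        unfolding sum_distrib_left using t
        by (intro sum.cong refl) (simp add: exp_minus field_simps)
      finally show "norm (G t) \<le>
        norm M * (\<Sum>j<Suc k. (t ^ j / exp t / fact j) *\<^sub>R norm (R ^ (Suc k - j))) * norm x"
        by (simp add: mult_right_mono)
    qed
    show ?thesis
      by (rule Lim_null_comparison[OF ev lim])
  qed
  have "(LBINT t=ereal 0..\<infinity>. f t) = 0 - (- G 0)"
  proof (rule interval_integral_FTC_integrable)
    show "((\<lambda>t. - G t) has_vector_derivative f t) (at t)" if "ereal 0 < ereal t" for t
      using dG that by simp
    show "isCont f t" for t
      using cont by (simp add: continuous_on_eq_continuous_at)
    show "set_integrable lborel (einterval (ereal 0) \<infinity>) f"
      unfolding set_integrable_def by (intro integrable_mult_indicator int) auto
    have "isCont (\<lambda>t. - G t) 0"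
      using dG[of 0] has_vector_derivative_continuous by auto
    then show "(((\<lambda>t. - G t) \<circ> real_of_ereal) \<longlongrightarrow> - G 0) (at_right (ereal 0))"
      unfolding ereal_tendsto_simps isCont_def by (rule filterlim_at_split[THEN iffD1, THEN conjunct2])
    show "(((\<lambda>t. - G t) \<circ> real_of_ereal) \<longlongrightarrow> 0) (at_left \<infinity>)"
      unfolding ereal_tendsto_simps using tendsto_minus[OF Ginf] by simp
  qed auto
  moreover have "(LBINT t=ereal 0..\<infinity>. f t) = (LINT t|lborel. f t)"
    unfolding interval_lebesgue_integral_def set_lebesgue_integral_def
    by (simp, intro Bochner_Integration.integral_cong refl)
      (auto simp: indicator_def einterval_def f_neg)
  ultimately show "(LINT t|lborel. f t) = bop_apply (M * R ^ Suc k) x"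
    by (simp add: G0)
qed

lemma norm_cvec_le:
  "norm (x::cvec) \<le> cmod (fst x) + (cmod (fst (snd x)) + (cmod (fst (snd (snd x))) + cmod (snd (snd (snd x)))))"
proof -
  obtain a b c d where x: "x = (a, b, c, d)" by (cases x)
  have "norm x \<le> cmod a + norm (b, c, d)" "norm (b, c, d) \<le> cmod b + norm (c, d)"
    "norm (c, d) \<le> cmod c + cmod d"
    unfolding x norm_Pair by (rule sqrt_sum_squares_le_sum; simp)+
  then show ?thesis by (simp add: x)
qed

lemma norm_cvec_ge:
  fixes x :: cvec
  shows "cmod (fst x) \<le> norm x" "cmod (fst (snd x)) \<le> norm x"
    "cmod (fst (snd (snd x))) \<le> norm x" "cmod (snd (snd (snd x))) \<le> norm x"
proof -
  obtain a b c d where x: "x = (a, b, c, d)" by (cases x)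
  show "cmod (fst x) \<le> norm x" "cmod (fst (snd x)) \<le> norm x"
    "cmod (fst (snd (snd x))) \<le> norm x" "cmod (snd (snd (snd x))) \<le> norm x"
    by (auto simp: x norm_quad intro!: real_le_rsqrt)
qed

text \<open>Fourier inversion of t^k/k! exp(-t) M exp(tM), coordinate by coordinate. The transform
  is M R(l)^(k+1), and M R(l) = (1 + il) R(l) - 1 bounds it by |l|^(1 - \<psi>(k+1)), hence by a
  multiple of |l|^(-2). The result contains \<open>C\<close> but not \<open>norm M\<close>, which is
  what makes it uniform in the eigenvalue.\<close>

lemma norm_mult_exp_le:
  fixes M :: "cvec bop" and R :: "real \<Rightarrow> cvec bop"
  assumes M: "clinear_op M" and contr: "\<And>t. 0 \<le> t \<Longrightarrow> norm (exp (t *\<^sub>R M)) \<le> 1"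
    and R: "\<And>l. (cop (Complex 1 l) - M) * R l = 1"
    and R_le: "\<And>l. norm (R l) \<le> C * (1 + \<bar>l\<bar>) powr (- \<psi>)"
    and C: "0 < C" and psi: "\<psi> \<le> 1" and k: "0 < k" "3 \<le> \<psi> * real (Suc k)" and t: "0 < t"
  shows "norm (M * exp (t *\<^sub>R M)) \<le> 2 * fact k * (1 + C) * C ^ k * exp t / t ^ k"
proof -
  define g where "g l = (1 + C) * C ^ k * inverse (1 + l\<^sup>2)" for l :: real
  have g_int: "integrable lborel g" "(LINT l|lborel. g l) = (1 + C) * C ^ k * pi"
  proof -
    have 1: "integrable lborel (\<lambda>x::real. inverse (1 + x\<^sup>2))"
      using integrable_inverse_1_plus_square by (simp add: set_integrable_def)
    have 2: "(LINT x|lborel. inverse (1 + x\<^sup>2)) = pi"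
      using LBINT_inverse_1_plus_square
      by (simp add: interval_lebesgue_integral_def set_lebesgue_integral_def)
    show "integrable lborel g" "(LINT l|lborel. g l) = (1 + C) * C ^ k * pi"
      unfolding g_def using 1 2 by auto
  qed
  have MR: "norm (M * R l ^ Suc k) \<le> g l" for l
  proof -
    let ?L = "1 + \<bar>l\<bar>"
    have "M * R l = cop (Complex 1 l) * R l - 1"
      using R[of l] by (simp add: algebra_simps)
    then have "norm (M * R l) \<le> norm (cop (Complex 1 l) * R l) + 1"
      using norm_triangle_ineq4[of "cop (Complex 1 l) * R l" 1] by simp
    also have "\<dots> \<le> norm (cop (Complex 1 l)) * norm (R l) + 1"
      by (intro add_right_mono norm_mult_ineq)
    \<comment> \<open>The summand 1 is weakened to a nonnegative power of \<open>?L\<close>, so that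
      both terms have the same order; this is where \<psi> <= 1 enters.\<close>
    also have "\<dots> \<le> ?L * (C * ?L powr (- \<psi>)) + ?L powr (1 - \<psi>)"
    proof (intro add_mono mult_mono R_le)
      have "cmod (Complex 1 l) \<le> ?L"
        using cmod_le[of "Complex 1 l"] by simp
      then show "norm (cop (Complex 1 l)) \<le> ?L" using norm_cop order_trans by blast
      show "1 \<le> ?L powr (1 - \<psi>)" using psi by (intro ge_one_powr_ge_zero) auto
    qed auto
    also have "\<dots> = (1 + C) * ?L powr (1 - \<psi>)"
      by (simp add: powr_diff powr_minus field_simps)
    finally have 1: "norm (M * R l) \<le> (1 + C) * ?L powr (1 - \<psi>)" .
    have "norm (M * R l ^ Suc k) \<le> norm (M * R l) * norm (R l) ^ k"
      unfolding power_Suc mult.assoc[symmetric]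
      by (intro order_trans[OF norm_mult_ineq] mult_left_mono norm_power_ineq norm_ge_zero)
    also have "\<dots> \<le> ((1 + C) * ?L powr (1 - \<psi>)) * (C * ?L powr (- \<psi>)) ^ k"
      using C by (intro mult_mono power_mono 1 R_le) auto
    also have "\<dots> = (1 + C) * C ^ k * ?L powr (1 - \<psi> * real (Suc k))"
      by (simp add: power_mult_distrib powr_power powr_add[symmetric] algebra_simps)
    also have "?L powr (1 - \<psi> * real (Suc k)) \<le> ?L powr (- 2)"
      using k by (intro powr_mono) auto
    also have "?L powr (- 2) = inverse (?L\<^sup>2)"
      by (simp add: powr_minus powr_numeral)
    also have "\<dots> \<le> inverse (1 + l\<^sup>2)"
      by (intro le_imp_inverse_le) (auto simp: power2_sum add_pos_nonneg)
    finally show ?thesis using C by (simp add: g_def mult_left_mono)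
  qed
  \<comment> \<open>The inversion is available for scalar functions only, so a complex linear
    coordinate \<open>pr\<close> is applied. The total mass (1 + C) C^k pi of \<open>g\<close>,
    divided by 2 pi, gives the factor 1/2, and the four coordinates together give the 2 in the
    claim.\<close>
  have comp: "cmod (pr (bop_apply (M * exp (t *\<^sub>R M)) x)) * (exp (- t) * t ^ k / fact k) \<le>
      (1 + C) * C ^ k * norm x / 2"
    if pr: "bounded_linear pr" "\<And>c y. pr (c *\<^sub>C y) = c * pr y" "\<And>y. cmod (pr y) \<le> norm y"
    for pr :: "cvec \<Rightarrow> complex" and x
  proof -
    define v where "v t = erlang_density k 1 t *\<^sub>R bop_apply (M * exp (t *\<^sub>R M)) x" for t
    have "continuous_on UNIV (\<lambda>t. erlang_density k 1 t *\<^sub>R (M * exp (t *\<^sub>R M)))"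
      by (intro continuous_on_exp_scaleR continuous_intros continuous_erlang_density[OF k(1)])
    from bounded_linear.continuous_on[OF bounded_bilinear.bounded_linear_left
        [OF bounded_bilinear_bop_apply] this, of x]
    have cont: "continuous_on UNIV v"
      by (simp add: v_def[abs_def])
    have lap: "integrable lborel (\<lambda>s. iexp (- (l * s)) *\<^sub>C v s)"
      "(LINT s|lborel. iexp (- (l * s)) *\<^sub>C v s) = bop_apply (M * R l ^ Suc k) x" for l
    proof -
      have eq: "erlang_density k 1 s *\<^sub>R (cis (- (l * s)) *\<^sub>C bop_apply (M * exp (s *\<^sub>R M)) x) =
          iexp (- (l * s)) *\<^sub>C v s" for s
        by (simp only: v_def cis_conv_exp scaleC_of_real[symmetric] scaleC_scaleC mult.commute)
      show "integrable lborel (\<lambda>s. iexp (- (l * s)) *\<^sub>C v s)"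
        "(LINT s|lborel. iexp (- (l * s)) *\<^sub>C v s) = bop_apply (M * R l ^ Suc k) x"
        using laplace_transform_exp[OF M contr R[of l] complex.sel(1) k(1), where x = x]
        by (simp_all only: complex.sel eq)
    qed
    have v_int: "integrable lborel v"
    proof -
      have "1 *\<^sub>C y = y" for y :: cvec
        using scaleC_of_real[of 1 y] by simp
      then show ?thesis using lap(1)[of 0] by simp
    qed
    have "cmod (pr (v t)) \<le> (LINT l|lborel. g l * norm x) / (2 * pi)"
    proof (rule norm_le_integral_fourier)
      show "continuous_on UNIV (\<lambda>t. pr (v t))"
        by (rule bounded_linear.continuous_on[OF pr(1) cont])
      show "integrable lborel (\<lambda>t. pr (v t))"
        by (rule integrable_bounded_linear[OF pr(1) v_int])
      show "integrable lborel (\<lambda>l. g l * norm x)"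
        by (intro integrable_mult_left g_int)
      show "cmod (LINT s|lborel. pr (v s) * iexp (- (l * s))) \<le> g l * norm x" for l
      proof -
        have "(LINT s|lborel. pr (v s) * iexp (- (l * s))) = (LINT s|lborel. pr (iexp (- (l * s)) *\<^sub>C v s))"
          by (simp only: pr(2) mult.commute)
        also have "\<dots> = pr (bop_apply (M * R l ^ Suc k) x)"
          using integral_bounded_linear[OF pr(1) lap(1)] lap(2) by simp
        also have "cmod \<dots> \<le> norm (M * R l ^ Suc k) * norm x"
          using pr(3) norm_bop_apply order_trans by blast
        also have "\<dots> \<le> g l * norm x"
          by (intro mult_right_mono MR) auto
        finally show ?thesis .
      qed
      \<comment> \<open>This bound contains \<open>norm M\<close>, but it only justifies the
        inversion and does not enter the final constant.\<close>
      show "cmod (pr (v t)) \<le> norm M * norm x" for t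
      proof (cases "0 \<le> t")
        case True
        have e1: "erlang_density k 1 t \<le> 1"
        proof -
          have "t ^ k / fact k \<le> exp t"
          proof -
            have "(\<Sum>n\<in>{k}. t ^ n /\<^sub>R fact n) \<le> (\<Sum>n. t ^ n /\<^sub>R fact n)"
              using True by (intro sum_le_suminf summable_exp_generic) auto
            then show ?thesis by (simp add: exp_def divide_inverse mult.commute)
          qed
          then show ?thesis using True by (simp add: erlang_density_def exp_minus field_simps)
        qed
        have "cmod (pr (v t)) \<le> norm (v t)" by (rule pr(3))
        also have "\<dots> = erlang_density k 1 t * norm (bop_apply (M * exp (t *\<^sub>R M)) x)"
          by (simp add: v_def)
        also have "\<dots> \<le> 1 * (norm (M * exp (t *\<^sub>R M)) * norm x)"
          by (intro mult_mono e1 norm_bop_apply) auto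
        also have "\<dots> \<le> 1 * ((norm M * 1) * norm x)"
          by (intro mult_left_mono mult_right_mono order_trans[OF norm_mult_ineq] contr[OF True]) auto
        finally show ?thesis by simp
      next
        case False
        then show ?thesis
          using linear_0[OF bounded_linear.linear[OF pr(1)]] by (simp add: v_def erlang_density_def)
      qed
    qed
    also have "\<dots> = (1 + C) * C ^ k * norm x / 2"
      using g_int by simp
    finally show ?thesis
      using t linear_scale[OF bounded_linear.linear[OF pr(1)]]
      by (simp add: v_def erlang_density_def abs_mult mult_ac)
  qed
  show ?thesis
  proof (rule norm_bop_le)
    fix x
    define y where "y = bop_apply (M * exp (t *\<^sub>R M)) x"
    let ?e = "exp (- t) * t ^ k / fact k" and ?B = "(1 + C) * C ^ k * norm x / 2"
    have sc: "fst (c *\<^sub>C z) = c * fst z" "snd (c *\<^sub>C z') = c *\<^sub>C snd z'"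
      "fst (c *\<^sub>C z') = c *\<^sub>C fst z'"
      for c and z :: "complex \<times> 'z::scaleC" and z' :: "'w::scaleC \<times> 'u::scaleC"
      by (simp_all add: scaleC_prod_def scaleC_complex_def)
    have "cmod (fst y) * ?e \<le> ?B"
      unfolding y_def by (rule comp) (simp_all add: sc norm_cvec_ge bounded_linear_fst)
    moreover have "cmod (fst (snd y)) * ?e \<le> ?B"
      unfolding y_def
      by (rule comp[of "\<lambda>y. fst (snd y)"])
        (simp_all add: sc norm_cvec_ge bounded_linear_fst_comp bounded_linear_snd)
    moreover have "cmod (fst (snd (snd y))) * ?e \<le> ?B"
      unfolding y_def
      by (rule comp[of "\<lambda>y. fst (snd (snd y))"])
        (simp_all add: sc norm_cvec_ge bounded_linear_fst_comp bounded_linear_snd_comp bounded_linear_snd)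
    moreover have "cmod (snd (snd (snd y))) * ?e \<le> ?B"
      unfolding y_def
      by (rule comp[of "\<lambda>y. snd (snd (snd y))"])
        (simp_all add: sc scaleC_complex_def norm_cvec_ge bounded_linear_snd_comp bounded_linear_snd)
    ultimately have c: "(cmod (fst y) + (cmod (fst (snd y)) + (cmod (fst (snd (snd y))) + cmod (snd (snd (snd y)))))) * ?e
        \<le> ?B + (?B + (?B + ?B))"
      unfolding distrib_right by linarith
    have "norm y * ?e \<le> (cmod (fst y) + (cmod (fst (snd y)) + (cmod (fst (snd (snd y))) + cmod (snd (snd (snd y)))))) * ?e"
      using t by (intro mult_right_mono norm_cvec_le) auto
    also have "\<dots> \<le> ?B + (?B + (?B + ?B))"
      by (rule c)
    also have "\<dots> = 2 * (1 + C) * C ^ k * norm x" by simp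
    finally have "norm y * ?e \<le> 2 * (1 + C) * C ^ k * norm x" .
    then have "norm y \<le> 2 * (1 + C) * C ^ k * norm x / ?e"
      using t by (subst pos_le_divide_eq) auto
    also have "\<dots> = 2 * fact k * (1 + C) * C ^ k * exp t / t ^ k * norm x"
      by (simp add: exp_minus divide_inverse mult_ac)
    finally show "norm y \<le> 2 * fact k * (1 + C) * C ^ k * exp t / t ^ k * norm x" .
  qed (use C t in auto)
qed

text \<open>n^n / n! is one term of the series for e^n. Splitting the time t into n equal pieces
  produces n^n, which is thereby exchanged for n! at the cost of a geometric factor.\<close>

lemma power_le_exp_fact: "real n ^ n \<le> exp (real n) * fact n"
proof -
  have "(\<Sum>j\<in>{n}. real n ^ j /\<^sub>R fact j) \<le> (\<Sum>j. real n ^ j /\<^sub>R fact j)"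
    by (intro sum_le_suminf summable_exp_generic) auto
  then have "real n ^ n / fact n \<le> exp (real n)"
    by (simp add: exp_def divide_inverse mult.commute)
  then show ?thesis by (simp add: pos_divide_le_eq)
qed

lemma power_mult_commuting:
  fixes a b :: "'a::monoid_mult"
  assumes "a * b = b * a" shows "(a * b) ^ n = a ^ n * b ^ n"
proof (induction n)
  case (Suc n)
  have "(a * b) ^ Suc n = (a * b) * (a ^ n * b ^ n)" by (simp add: Suc)
  also have "\<dots> = a * (b * a ^ n) * b ^ n" by (simp add: mult.assoc)
  also have "b * a ^ n = a ^ n * b"
    using power_commuting_commutes[of a b n] assms by metis
  finally show ?case by (simp add: mult.assoc)
qed simp

lemma exp_scaleR_of_nat:
  fixes M :: "'a::{real_normed_algebra_1,banach}"
  shows "exp ((real n * s) *\<^sub>R M) = exp (s *\<^sub>R M) ^ n"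
proof (induction n)
  case (Suc n)
  have "exp ((real (Suc n) * s) *\<^sub>R M) = exp (s *\<^sub>R M + (real n * s) *\<^sub>R M)"
    by (simp add: distrib_right scaleR_add_left)
  also have "\<dots> = exp (s *\<^sub>R M) * exp ((real n * s) *\<^sub>R M)"
    by (rule exp_add_commuting) (simp add: mult.commute)
  finally show ?case by (simp add: Suc)
qed simp

lemma norm_power_mult_exp_le:
  fixes M :: "'a::{real_normed_algebra_1,banach}"
  assumes contr: "\<And>t. 0 \<le> t \<Longrightarrow> norm (exp (t *\<^sub>R M)) \<le> 1"
    and K: "\<And>t. 0 < t \<Longrightarrow> t \<le> 1 \<Longrightarrow> norm (M * exp (t *\<^sub>R M)) \<le> K / t ^ k"
    and t: "0 < t" "t \<le> 1"
  shows "norm (M ^ n * exp (t *\<^sub>R M)) \<le> (K * exp (real k) / t ^ k) ^ n * fact n ^ k"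
proof (cases "n = 0")
  case True
  then show ?thesis using contr[of t] t by simp
next
  case False
  define s where "s = t / real n"
  have s: "0 < s" "s \<le> 1" "t = real n * s"
    using False t by (auto simp: s_def field_simps intro: order_trans[of t 1])
  have com: "M * exp (s *\<^sub>R M) = exp (s *\<^sub>R M) * M"
    by (rule exp_commute[symmetric]) simp
  have "M ^ n * exp (t *\<^sub>R M) = (M * exp (s *\<^sub>R M)) ^ n"
    by (simp add: s(3) exp_scaleR_of_nat power_mult_commuting[OF com])
  then have "norm (M ^ n * exp (t *\<^sub>R M)) \<le> (K / s ^ k) ^ n"
    using order_trans[OF norm_power_ineq power_mono[OF K[OF s(1,2)] norm_ge_zero]] by simp
  also have "\<dots> = (K / t ^ k) ^ n * (real n ^ n) ^ k"
  proof -
    have "K / s ^ k = K / t ^ k * real n ^ k"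
      using False by (simp add: s_def power_divide)
    moreover have "(real n ^ k) ^ n = (real n ^ n) ^ k"
      by (simp only: power_mult[symmetric] mult.commute)
    ultimately show ?thesis by (simp only: power_mult_distrib)
  qed
  also have "\<dots> \<le> (K / t ^ k) ^ n * (exp (real n) * fact n) ^ k"
  proof (intro mult_left_mono power_mono power_le_exp_fact)
    have "0 \<le> K / t ^ k" using K[OF t] norm_ge_zero order_trans by blast
    then show "0 \<le> (K / t ^ k) ^ n" by simp
  qed auto
  also have "\<dots> = (K * exp (real k) / t ^ k) ^ n * fact n ^ k"
  proof -
    have "exp (real n) ^ k = exp (real k) ^ n"
      by (simp only: exp_of_nat_mult[symmetric] mult.commute)
    then show ?thesis by (simp add: power_mult_distrib power_divide)
  qed
  finally show ?thesis .
qed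

section \<open>The matrix of one eigenvalue\<close>

text \<open>Along y(s) = exp(sT) x the derivative of |y|^2 is twice the real inner product of T y
  and y, hence nonpositive.\<close>

lemma norm_exp_dissipative_le_1:
  fixes T :: "'a::{euclidean_space} bop"
  assumes diss: "\<And>x. inner (bop_apply T x) x \<le> 0" and t: "0 \<le> t"
  shows "norm (exp (t *\<^sub>R T)) \<le> 1"
proof (rule norm_bop_le)
  fix x :: 'a
  define y where "y s = bop_apply (exp (s *\<^sub>R T)) x" for s
  have dy: "(y has_vector_derivative bop_apply T (y s)) (at s)" for s
    using has_vector_derivative_bop_apply[OF exp_scaleR_has_vector_derivative_left]
    unfolding y_def by simp
  have "((\<lambda>s. inner (y s) (y s)) has_real_derivative 2 * inner (bop_apply T (y s)) (y s)) (at s)" for s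
    using bounded_bilinear.has_vector_derivative[OF bounded_bilinear_inner dy dy, of s]
    by (simp add: has_real_derivative_iff_has_vector_derivative inner_commute)
  then have "inner (y t) (y t) \<le> inner (y 0) (y 0)"
    using diss t by (intro DERIV_nonpos_imp_nonincreasing[of 0 t "\<lambda>s. inner (y s) (y s)"]) (auto intro!: exI)
  then have "norm (y t) \<le> norm (y 0)" by (simp add: norm_le)
  then show "norm (bop_apply (exp (t *\<^sub>R T)) x) \<le> 1 * norm x" by (simp add: y_def)
qed simp

text \<open>In finite dimension a lower bound forces injectivity, hence bijectivity, and its
  constant bounds the inverse. Resolvents of the matrices thus require a priori estimates
  only.\<close>

lemma bop_inverse_exists:
  fixes T :: "'a::{euclidean_space} bop"
  assumes c: "\<And>x. norm x \<le> c * norm (bop_apply T x)"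
  shows "\<exists>R. R * T = 1 \<and> T * R = 1 \<and> norm R \<le> c"
proof -
  have lin: "linear (bop_apply T)"
    by (rule bounded_linear.linear[OF bounded_linear_bop_apply])
  have "inj (bop_apply T)"
  proof (rule linear_injective_0[OF lin, THEN iffD2], intro allI impI)
    fix x assume "bop_apply T x = 0" then show "x = 0" using c[of x] by simp
  qed
  then obtain f where f: "linear f" "\<And>x. f (bop_apply T x) = x" "\<And>x. bop_apply T (f x) = x"
    using linear_injective_isomorphism[OF lin] by auto
  have ap: "bop_apply (bop_of f) x = f x" for x
    using f(1) by (simp add: bop_apply_bop_of linear_conv_bounded_linear)
  \<comment> \<open>Nonnegativity of \<open>c\<close> is obtained by testing the hypothesis on a
    unit vector.\<close>
  obtain e :: 'a where "e \<in> Basis" using nonempty_Basis by blast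
  then have "norm e = 1" by simp
  then have "0 < c * norm (bop_apply T e)" using c[of e] by linarith
  then have "0 \<le> c" by (auto simp: zero_less_mult_iff)
  moreover have "norm (f x) \<le> c * norm x" for x
    using c[of "f x"] f(3) by simp
  ultimately have "norm (bop_of f) \<le> c"
    by (intro norm_bop_le) (auto simp: ap)
  moreover have "bop_of f * T = 1" "T * bop_of f = 1"
    by (rule bop_eqI, simp add: ap f)+
  ultimately show ?thesis by blast
qed

text \<open>Except for the entry - d the matrix is skew-symmetric: a couples position and velocity
  in the first equation of the system, b in the second, g couples the two velocities, and d damps
  the second velocity.\<close>

definition fibre_op :: "real \<Rightarrow> real \<Rightarrow> real \<Rightarrow> real \<Rightarrow> cvec bop" where
  "fibre_op a b g d = bop_of (\<lambda>(p, q, r, z).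
     (a *\<^sub>R r, b *\<^sub>R z, - (a *\<^sub>R p) - g *\<^sub>R z, - (b *\<^sub>R q) + g *\<^sub>R r - d *\<^sub>R z))"

lemma fibre_op_apply [simp]:
  "bop_apply (fibre_op a b g d) (p, q, r, z) =
     (a *\<^sub>R r, b *\<^sub>R z, - (a *\<^sub>R p) - g *\<^sub>R z, - (b *\<^sub>R q) + g *\<^sub>R r - d *\<^sub>R z)"
proof -
  have "linear (\<lambda>(p, q, r, z). (a *\<^sub>R r, b *\<^sub>R z, - (a *\<^sub>R p) - g *\<^sub>R z,
      - (b *\<^sub>R q) + g *\<^sub>R r - d *\<^sub>R z) :: cvec)"
    by (rule linearI) (auto simp: algebra_simps split: prod.splits)
  then show ?thesis
    unfolding fibre_op_def by (subst bop_apply_bop_of) (simp_all add: linear_conv_bounded_linear)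
qed

lemma clinear_fibre_op: "clinear_op (fibre_op a b g d)"
  unfolding clinear_op_def
proof (intro allI bop_eqI)
  fix k and x :: cvec
  obtain p q r z where x: "x = (p, q, r, z)" by (cases x)
  show "bop_apply (cop k * fibre_op a b g d) x = bop_apply (fibre_op a b g d * cop k) x"
    by (simp add: x scaleC_quad scaleC_complex_def algebra_simps)
qed

text \<open>The skew-symmetric part drops out of the real inner product, which leaves the
  damping.\<close>

lemma inner_fibre_op: "inner (bop_apply (fibre_op a b g d) (p, q, r, z)) (p, q, r, z) = - d * (cmod z)\<^sup>2"
  by (simp add: inner_diff_left inner_add_left power2_norm_eq_inner inner_commute algebra_simps)

lemma fibre_op_dissipative: "0 \<le> d \<Longrightarrow> inner (bop_apply (fibre_op a b g d) x) x \<le> 0"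
  by (cases x) (simp only: inner_fibre_op, simp)

text \<open>In the following two estimates \<open>L = |\<lambda>|\<close>; the letters \<open>P, Q, R, Z\<close> stand for the moduli of
  the components of a solution of the resolvent equation and \<open>F\<close> for the size of its right hand side.
  The strategy is to control everything by \<open>Z\<close>, the only damped component.\<close>

lemma resolvent_estimate_middle:
  fixes a b g d L K F P Q R Z :: real
  assumes pos: "0 < a" "0 < b" "0 < g" "0 < d" "0 < L" and K: "1 \<le> K"
    and gK: "g \<le> K * a" "a \<le> K * g" "b \<le> K * a"
    and L: "L \<le> 6 * K * a" "b \<le> 2 * K * L"
    and nn: "0 \<le> P" "0 \<le> Q" "0 \<le> R" "0 \<le> Z" "0 \<le> F"
    and e2: "L * Q \<le> F + b * Z" and e3: "a * P \<le> F + g * Z + L * R"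
    and e4: "g * R \<le> F + (L + d) * Z + b * Q"
  shows "P + Q + R + Z \<le> 200 * K ^ 4 * (F / L + (1 + d / a) * Z)"
proof -
  define \<phi> where "\<phi> = F / L"
  \<comment> \<open>The term d Z of \<open>e4\<close> need not be bounded by a Z, since d / a is not
    bounded uniformly; \<open>w\<close> carries this ratio along.\<close>
  define w where "w = (1 + d / a) * Z"
  have F: "F = L * \<phi>" using pos by (simp add: \<phi>_def)
  have phi: "0 \<le> \<phi>" using nn pos by (simp add: \<phi>_def)
  have dZ: "d * Z = a * (w - Z)" using pos by (simp add: w_def distrib_right)
  have Zw: "Z \<le> w" using nn pos by (simp add: w_def mult_le_cancel_right1)
  have w: "0 \<le> w" using nn Zw by linarith
  have K2: "K \<le> K\<^sup>2" "K\<^sup>2 \<le> K ^ 3" "K ^ 3 \<le> K ^ 4" "1 \<le> K\<^sup>2"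
    using power_increasing[of 1 2 K] power_increasing[of 2 3 K] power_increasing[of 3 4 K] K
    by auto
  \<comment> \<open>Order of elimination: \<open>Q\<close> from \<open>e2\<close>, where b / L is
    bounded, then \<open>R\<close> through the coupling term in \<open>e4\<close>, then
    \<open>P\<close> from \<open>e3\<close>. The comparisons in \<open>gK\<close> and
    \<open>L\<close> turn every coefficient into a multiple of a, at the price of powers of
    \<open>K\<close>.\<close>
  have Q: "Q \<le> \<phi> + 2 * K * Z"
  proof -
    have "b * Z \<le> (2 * K * L) * Z" using L nn by (intro mult_right_mono) auto
    then have "L * Q \<le> L * (\<phi> + 2 * K * Z)" using e2 F by (simp add: algebra_simps)
    then show ?thesis using pos by simp
  qed
  have bQ: "b * Q \<le> 6 * K\<^sup>2 * a * \<phi> + 2 * K\<^sup>2 * a * Z"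
  proof -
    have "b * Q \<le> (2 * K * L) * Q" using L nn by (intro mult_right_mono) auto
    also have "\<dots> = 2 * K * (L * Q)" by simp
    also have "\<dots> \<le> 2 * K * (F + b * Z)" using K by (intro mult_left_mono e2) auto
    finally have "b * Q \<le> 2 * K * F + 2 * K * (b * Z)" by (simp add: algebra_simps)
    moreover have "2 * K * (b * Z) \<le> 2 * K * ((K * a) * Z)"
      using gK nn K by (intro mult_left_mono mult_right_mono) auto
    moreover have "b * Q \<le> (K * a) * (\<phi> + 2 * K * Z)"
      using gK nn K pos Q by (intro mult_mono) auto
    moreover have "K * (a * \<phi>) \<le> 6 * K\<^sup>2 * (a * \<phi>)"
      using K K2 phi pos by (intro mult_right_mono) auto
    ultimately show ?thesis by (simp add: power2_eq_square algebra_simps)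
  qed
  have FKa: "F \<le> 6 * K * a * \<phi>" using L(1) phi by (simp add: F mult_right_mono)
  have "g * R \<le> 6 * K * a * \<phi> + (6 * K * a) * Z + d * Z + (6 * K\<^sup>2 * a * \<phi> + 2 * K\<^sup>2 * a * Z)"
    using e4 FKa bQ mult_right_mono[OF L(1) nn(4)] by (simp add: algebra_simps)
  also have "\<dots> = a * ((6 * K + 6 * K\<^sup>2) * \<phi> + (6 * K + 2 * K\<^sup>2 - 1) * Z + w)"
    using dZ by (simp add: algebra_simps)
  also have "\<dots> \<le> (K * g) * (12 * K\<^sup>2 * \<phi> + 9 * K\<^sup>2 * w)"
  proof (intro mult_mono gK)
    have "(6 * K + 6 * K\<^sup>2) * \<phi> \<le> 12 * K\<^sup>2 * \<phi>" using K2 phi by (intro mult_right_mono) auto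
    moreover have "(6 * K + 2 * K\<^sup>2 - 1) * Z \<le> (6 * K + 2 * K\<^sup>2 - 1) * w"
      using Zw K K2 by (intro mult_left_mono) auto
    moreover have "(6 * K + 2 * K\<^sup>2) * w \<le> 8 * K\<^sup>2 * w" using K2 w by (intro mult_right_mono) auto
    moreover have "w \<le> K\<^sup>2 * w" using mult_right_mono[OF K2(4) w] by simp
    ultimately show "(6 * K + 6 * K\<^sup>2) * \<phi> + (6 * K + 2 * K\<^sup>2 - 1) * Z + w \<le> 12 * K\<^sup>2 * \<phi> + 9 * K\<^sup>2 * w"
      using K2 w by (simp add: algebra_simps)
    have "0 \<le> (6 * K + 2 * K\<^sup>2 - 1) * Z" using K K2 nn by (intro mult_nonneg_nonneg) auto
    then show "0 \<le> (6 * K + 6 * K\<^sup>2) * \<phi> + (6 * K + 2 * K\<^sup>2 - 1) * Z + w"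
      using K phi w by (intro add_nonneg_nonneg[OF add_nonneg_nonneg]) auto
  qed (use K pos in auto)
  finally have "g * R \<le> g * (12 * K ^ 3 * \<phi> + 9 * K ^ 3 * w)"
    by (simp add: power3_eq_cube power2_eq_square algebra_simps)
  then have R: "R \<le> 12 * K ^ 3 * \<phi> + 9 * K ^ 3 * w" using pos by simp
  have "a * P \<le> 6 * K * a * \<phi> + (K * a) * Z + (6 * K * a) * R"
    using e3 FKa mult_right_mono[OF gK(1) nn(4)] mult_right_mono[OF L(1) nn(3)] by linarith
  also have "\<dots> = a * (6 * K * \<phi> + K * Z + 6 * K * R)" by (simp add: algebra_simps)
  finally have "P \<le> 6 * K * \<phi> + K * Z + 6 * K * R" using pos by simp
  also have "\<dots> \<le> 6 * K * \<phi> + K * w + 6 * K * (12 * K ^ 3 * \<phi> + 9 * K ^ 3 * w)"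
    using K Zw R by (intro add_mono mult_left_mono) auto
  also have "\<dots> = 6 * (K * \<phi>) + K * w + 72 * (K ^ 4 * \<phi>) + 54 * (K ^ 4 * w)"
    by (simp add: power4_eq_xxxx power3_eq_cube algebra_simps)
  finally have P: "P \<le> 6 * (K * \<phi>) + K * w + 72 * (K ^ 4 * \<phi>) + 54 * (K ^ 4 * w)" .
  have "K * \<phi> \<le> K ^ 4 * \<phi>" "K * w \<le> K ^ 4 * w" "K ^ 3 * \<phi> \<le> K ^ 4 * \<phi>" "K ^ 3 * w \<le> K ^ 4 * w"
      "1 * \<phi> \<le> K ^ 4 * \<phi>" "1 * w \<le> K ^ 4 * w" "K * Z \<le> K * w" "0 \<le> K ^ 4 * \<phi>" "0 \<le> K ^ 4 * w"
    using K K2 phi w Zw by (intro mult_right_mono mult_left_mono mult_nonneg_nonneg; simp)+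
  then have "P + Q + R + Z \<le> 200 * (K ^ 4 * \<phi>) + 200 * (K ^ 4 * w)"
    using P Q R Zw by linarith
  then show ?thesis by (simp add: \<phi>_def w_def algebra_simps)
qed

text \<open>When L is small against a and b, dividing by L as in the other regime would lose the
  factor b / L. Instead p and q are eliminated from the two pairs of equations: \<open>eR\<close>
  and \<open>eQ\<close> have the coefficients a^2 - L^2 and \<open>D\<close>, both far from 0 at
  such frequencies.\<close>

lemma resolvent_estimate_low:
  fixes a b g d L K F P Q R Z D :: real
  assumes pos: "0 < a" "0 < b" "0 < g" "0 < d" "0 < L" and K: "1 \<le> K"
    and gK: "g \<le> K * a" and L: "2 * L \<le> a" "2 * L \<le> b"
    and nn: "0 \<le> P" "0 \<le> Q" "0 \<le> R" "0 \<le> Z" "0 \<le> F"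
    and e3: "a * P \<le> F + g * Z + L * R"
    and eR: "(a\<^sup>2 - L\<^sup>2) * R \<le> L * (F + g * Z) + a * F"
    and eQ: "D * Q \<le> b * F + b * (g * R) + (L + d) * F"
    and D: "b\<^sup>2 - L\<^sup>2 \<le> D" "L * d \<le> D"
  shows "P + Q + R + Z \<le> 20 * K ^ 2 * (F / L + Z)"
proof -
  define \<phi> where "\<phi> = F / L"
  have F: "F = L * \<phi>" using pos by (simp add: \<phi>_def)
  have phi: "0 \<le> \<phi>" using nn pos by (simp add: \<phi>_def)
  have K2: "K \<le> K\<^sup>2" "1 \<le> K\<^sup>2" using power_increasing[of 1 2 K] K by auto
  \<comment> \<open>Since L is at most half of a and of b, both a^2 - L^2 >= 3/4 a^2 and D >= 3/4
    b^2.\<close>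
  have sq: "4 * L\<^sup>2 \<le> a\<^sup>2" "4 * L\<^sup>2 \<le> b\<^sup>2"
    using power_mono[OF L(1), of 2] power_mono[OF L(2), of 2] pos by (auto simp: power_mult_distrib)
  have aR: "3 * (a * R) \<le> 6 * F + 4 * K * (L * Z)"
  proof -
    have "3 * a\<^sup>2 * R \<le> 4 * (a\<^sup>2 - L\<^sup>2) * R" using sq nn by (intro mult_right_mono) auto
    also have "\<dots> \<le> 4 * (L * (F + g * Z) + a * F)" using eR by (simp add: algebra_simps)
    also have "\<dots> \<le> 4 * (L * F + L * ((K * a) * Z) + a * F)"
    proof -
      have "L * (g * Z) \<le> L * ((K * a) * Z)"
        using gK nn pos by (intro mult_left_mono mult_right_mono) auto
      then show ?thesis by (simp add: algebra_simps)
    qed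
    also have "\<dots> \<le> 6 * (a * F) + 4 * (a * (K * (L * Z)))"
      using mult_right_mono[OF L(1) nn(5)] by (simp add: algebra_simps)
    finally have "a * (3 * (a * R)) \<le> a * (6 * F + 4 * K * (L * Z))"
      by (simp add: power2_eq_square algebra_simps)
    then show ?thesis using pos by simp
  qed
  have R: "R \<le> \<phi> + K * Z"
  proof -
    have "6 * (L * R) \<le> 3 * (a * R)" using mult_right_mono[OF L(1) nn(3)] by (simp add: mult_ac)
    then have "6 * (L * R) \<le> 6 * (L * \<phi>) + 4 * (K * (L * Z))" using aR F by (simp add: algebra_simps)
    moreover have "0 \<le> K * (L * Z)" using K nn pos by simp
    ultimately have "L * R \<le> L * (\<phi> + K * Z)" by (simp add: algebra_simps)
    then show ?thesis using pos by simp
  qed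
  have P: "P \<le> 2 * \<phi> + 2 * K * Z"
  proof -
    have "a * \<phi> \<ge> 2 * L * \<phi>" using L(1) phi by (rule mult_right_mono)
    moreover have "2 * L * R \<le> a * R" using L(1) nn(3) by (rule mult_right_mono)
    moreover have "a * R \<le> a * (\<phi> + K * Z)" using R pos by simp
    moreover have "0 \<le> a * \<phi>" "0 \<le> K * (Z * a)" using K pos nn phi by auto
    moreover have "g * Z \<le> K * (Z * a)" using mult_right_mono[OF gK nn(4)] by (simp add: mult_ac)
    moreover have "a * (\<phi> + K * Z) = a * \<phi> + K * (Z * a)" "2 * L * \<phi> = 2 * F" "2 * L * R = 2 * (L * R)"
      by (simp_all add: F algebra_simps)
    ultimately have "a * P \<le> 2 * (a * \<phi>) + 2 * (K * (Z * a))"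
      using e3 by linarith
    then have "a * P \<le> a * (2 * \<phi> + 2 * K * Z)" by (simp add: algebra_simps)
    then show ?thesis using pos by simp
  qed
  have Dp: "0 < D" using D(2) pos by (meson less_le_trans mult_pos_pos)
  have Db: "3 * b\<^sup>2 \<le> 4 * D" using D(1) sq by simp
  have gR: "g * R \<le> K * (2 * F + 2 * K * (L * Z))"
  proof -
    have "g * R \<le> (K * a) * R" using gK nn by (intro mult_right_mono) auto
    also have "\<dots> = K * (a * R)" by simp
    also have "a * R \<le> 2 * F + 2 * K * (L * Z)"
    proof -
      have "0 \<le> K * (L * Z)" using K nn pos by simp
      then show ?thesis using aR by linarith
    qed
    finally show ?thesis using K by (simp add: mult_left_mono)
  qed
  have bL: "3 * (b * L) \<le> 2 * D" "3 * L\<^sup>2 \<le> D"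
  proof -
    have "2 * (b * L) \<le> b * b" using L(2) pos by simp
    then show "3 * (b * L) \<le> 2 * D" using Db by (simp add: power2_eq_square)
    show "3 * L\<^sup>2 \<le> D" using sq Db by simp
  qed
  \<comment> \<open>The damping appears here only in d F = (L d) \<phi>, and L d <= D absorbs it;
    therefore no ratio d / a arises in this regime.\<close>
  have Q: "Q \<le> 4 * K * \<phi> + 2 * K\<^sup>2 * Z"
  proof -
    have "b * (g * R) \<le> b * (K * (2 * F + 2 * K * (L * Z)))" using gR pos by simp
    then have "D * Q \<le> b * F + b * (K * (2 * F + 2 * K * (L * Z))) + (L + d) * F"
      using eQ by linarith
    also have "\<dots> = (b * L) * ((1 + 2 * K) * \<phi> + 2 * K\<^sup>2 * Z) + L\<^sup>2 * \<phi> + (L * d) * \<phi>"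
      by (simp add: F power2_eq_square algebra_simps)
    also have "\<dots> \<le> (2 / 3 * D) * ((1 + 2 * K) * \<phi> + 2 * K\<^sup>2 * Z) + (D / 3) * \<phi> + D * \<phi>"
      using bL D(2) K K2 phi nn by (intro add_mono mult_right_mono) auto
    also have "\<dots> = D * ((2 + 4 / 3 * K) * \<phi> + 4 / 3 * K\<^sup>2 * Z)"
      by (simp add: field_simps)
    finally have "Q \<le> (2 + 4 / 3 * K) * \<phi> + 4 / 3 * K\<^sup>2 * Z" using Dp by simp
    also have "\<dots> \<le> 4 * K * \<phi> + 2 * K\<^sup>2 * Z"
      using K K2 phi nn by (intro add_mono mult_right_mono) auto
    finally show ?thesis .
  qed
  have "K * \<phi> \<le> K\<^sup>2 * \<phi>" "K * Z \<le> K\<^sup>2 * Z" "1 * \<phi> \<le> K\<^sup>2 * \<phi>" "1 * Z \<le> K\<^sup>2 * Z"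
      "0 \<le> K\<^sup>2 * \<phi>" "0 \<le> K\<^sup>2 * Z"
    using K K2 phi nn by (intro mult_right_mono mult_nonneg_nonneg; simp)+
  then have "P + Q + R + Z \<le> 20 * (K\<^sup>2 * \<phi>) + 20 * (K\<^sup>2 * Z)"
    using P Q R by linarith
  then show ?thesis by (simp add: \<phi>_def algebra_simps)
qed

lemma inner_ii_scaleC_cvec: "inner ((\<i> * complex_of_real l) *\<^sub>C x) (x::cvec) = 0"
proof -
  obtain p q r z where x: "x = (p, q, r, z)" by (cases x)
  show ?thesis
    by (simp add: x scaleC_quad scaleC_complex_def inner_complex_def algebra_simps)
qed

text \<open>Z is at most sqrt(F N / d), and the inequality of arithmetic and geometric means splits
  X Z so that only half of N appears and can be absorbed on the left of an estimate for N.\<close>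

lemma square_le_imp_half_sum:
  fixes X Z N F d :: real
  assumes d: "0 < d" and Z: "d * Z\<^sup>2 \<le> F * N" and nn: "0 \<le> N" "0 \<le> F"
  shows "X * Z \<le> (N + X\<^sup>2 * F / d) / 2"
proof -
  have "(X * Z)\<^sup>2 \<le> X\<^sup>2 * (F * N / d)"
  proof -
    have "Z\<^sup>2 \<le> F * N / d" using Z d by (simp add: pos_le_divide_eq mult.commute)
    then show ?thesis by (simp only: power_mult_distrib mult_left_mono zero_le_power2)
  qed
  also have "\<dots> \<le> ((N + X\<^sup>2 * F / d) / 2)\<^sup>2"
  proof -
    have half: "N * Y \<le> ((N + Y) / 2)\<^sup>2" for Y :: real
      using sum_squares_bound[of N Y] by (simp add: power_divide power2_sum)
    have "X\<^sup>2 * (F * N / d) = N * (X\<^sup>2 * F / d)" by simp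
    then show ?thesis using half by metis
  qed
  finally have "\<bar>X * Z\<bar> \<le> \<bar>(N + X\<^sup>2 * F / d) / 2\<bar>"
    by (rule abs_le_square_iff[THEN iffD2])
  then show ?thesis using nn d by simp
qed

text \<open>At frequencies that dominate the matrix the resolvent is of order 1/|l|. Otherwise all
  components are bounded by F/L + (1 + d/a) Z, and the energy identity d Z^2 <= F N eliminates Z;
  the square of 1 + d/a over d is of the order 1/d + d/a^2. The constant \<open>K\<close> measures
  how far a and g are comparable and b is dominated by a.\<close>

lemma fibre_resolvent_estimate:
  fixes a b g d K l :: real and x :: cvec
  assumes pos: "0 < a" "0 < b" "0 < g" "0 < d" "l \<noteq> 0" and K: "1 \<le> K"
    and gK: "g \<le> K * a" "a \<le> K * g" "b \<le> K * a"
  shows "norm x \<le> 80000 * K ^ 8 * (1 / \<bar>l\<bar> + (if \<bar>l\<bar> \<le> 6 * K * a then 1 / d + d / a\<^sup>2 else 0)) *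
     norm ((\<i> * complex_of_real l) *\<^sub>C x - bop_apply (fibre_op a b g d) x)"
proof -
  obtain p q r z where x: "x = (p, q, r, z)" by (cases x)
  define f where "f = (\<i> * complex_of_real l) *\<^sub>C x - bop_apply (fibre_op a b g d) x"
  obtain f1 f2 f3 f4 where f4: "f = (f1, f2, f3, f4)" by (cases f)
  have e: "f1 = \<i> * l * p - a * r" "f2 = \<i> * l * q - b * z" "f3 = \<i> * l * r + a * p + g * z"
     "f4 = \<i> * l * z + b * q - g * r + d * z"
    using f4 by (auto simp: f_def x scaleC_quad scaleC_complex_def scaleR_conv_of_real algebra_simps)
  define L where "L = \<bar>l\<bar>"
  define N F P Q R Z where "N = norm x" and "F = norm f" and "P = cmod p" and "Q = cmod q" and "R = cmod r"
    and "Z = cmod z"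
  have L: "0 < L" using pos by (simp add: L_def)
  have nn: "0 \<le> P" "0 \<le> Q" "0 \<le> R" "0 \<le> Z" "0 \<le> F" "0 \<le> N"
    by (simp_all add: P_def Q_def R_def Z_def F_def N_def)
  have fF: "cmod f1 \<le> F" "cmod f2 \<le> F" "cmod f3 \<le> F" "cmod f4 \<le> F"
    using norm_cvec_ge[of f] by (simp_all add: F_def f4)
  have il: "cmod (\<i> * l) = L" by (simp add: norm_mult L_def)
  have NS: "N \<le> P + Q + R + Z"
    using norm_cvec_le[of x] by (simp add: x N_def P_def Q_def R_def Z_def)
  \<comment> \<open>Pairing the equation with x in the real inner product annihilates the imaginary
    multiple of x and the skew-symmetric part.\<close>
  have en: "d * Z\<^sup>2 \<le> F * N"
  proof -
    have "inner f x = - inner (bop_apply (fibre_op a b g d) x) x"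
      by (simp add: f_def inner_diff_left inner_ii_scaleC_cvec)
    also have "\<dots> = d * Z\<^sup>2" unfolding x inner_fibre_op by (simp add: Z_def)
    finally have "d * Z\<^sup>2 = inner f x" ..
    then show ?thesis using norm_cauchy_schwarz[of f x] by (simp add: F_def N_def)
  qed
  have tri2: "cmod (u + v) \<le> B + C" if "cmod u \<le> B" "cmod v \<le> C" for u v B C
    using norm_triangle_mono[OF that] .
  have e1: "L * P \<le> F + a * R"
  proof -
    have "L * P = cmod (\<i> * l * p)" unfolding norm_mult[of "\<i> * l"] il P_def ..
    also have "\<i> * l * p = f1 + a * r" by (simp add: e)
    also have "cmod \<dots> \<le> F + a * R"
      using fF pos by (intro tri2) (auto simp: R_def norm_mult)
    finally show ?thesis .
  qed
  have e2: "L * Q \<le> F + b * Z"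
  proof -
    have "L * Q = cmod (\<i> * l * q)" unfolding norm_mult[of "\<i> * l"] il Q_def ..
    also have "\<i> * l * q = f2 + b * z" by (simp add: e)
    also have "cmod \<dots> \<le> F + b * Z"
      using fF pos by (intro tri2) (auto simp: Z_def norm_mult)
    finally show ?thesis .
  qed
  have e3: "a * P \<le> F + g * Z + L * R"
  proof -
    have "a * P = cmod (a * p)" using pos by (simp add: P_def norm_mult)
    also have "a * p = (f3 + - (g * z)) + - (\<i> * l * r)" by (simp add: e)
    also have "cmod \<dots> \<le> F + g * Z + L * R"
      using fF pos il by (intro tri2) (auto simp: Z_def R_def L_def norm_mult)
    finally show ?thesis .
  qed
  have e3': "L * R \<le> F + a * P + g * Z"
  proof -
    have "L * R = cmod (\<i> * l * r)" unfolding norm_mult[of "\<i> * l"] il R_def ..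
    also have "\<i> * l * r = (f3 + - (a * p)) + - (g * z)" by (simp add: e)
    also have "cmod \<dots> \<le> F + a * P + g * Z"
      using fF pos by (intro tri2) (auto simp: P_def Z_def norm_mult)
    finally show ?thesis .
  qed
  have ild: "cmod (\<i> * l + d) \<le> L + d" "L \<le> cmod (\<i> * l + d)"
    using norm_triangle_ineq[of "\<i> * l" d] il pos abs_Im_le_cmod[of "\<i> * l + d"]
    by (auto simp: L_def)
  have e4: "g * R \<le> F + (L + d) * Z + b * Q"
  proof -
    have "g * R = cmod (g * r)" using pos by (simp add: R_def norm_mult)
    also have "g * r = (- f4 + (\<i> * l + d) * z) + b * q" by (simp add: e algebra_simps)
    also have "cmod \<dots> \<le> F + (L + d) * Z + b * Q"
      using fF pos by (intro tri2) (auto simp: Z_def Q_def norm_mult intro!: mult_right_mono ild)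
    finally show ?thesis .
  qed
  have e4': "L * Z \<le> F + b * Q + g * R"
  proof -
    have "L * Z \<le> cmod ((\<i> * l + d) * z)"
      unfolding norm_mult Z_def by (intro mult_right_mono ild) auto
    also have "(\<i> * l + d) * z = (f4 + - (b * q)) + g * r" by (simp add: e algebra_simps)
    also have "cmod \<dots> \<le> F + b * Q + g * R"
      using fF pos by (intro tri2) (auto simp: R_def Q_def norm_mult)
    finally show ?thesis .
  qed
  \<comment> \<open>Modulus of the determinant of the 2x2 block belonging to q and z.\<close>
  define D where "D = cmod ((b\<^sup>2 - l\<^sup>2) + \<i> * (l * d))"
  have D: "b\<^sup>2 - L\<^sup>2 \<le> D" "L * d \<le> D"
    using abs_Re_le_cmod[of "(b\<^sup>2 - l\<^sup>2) + \<i> * (l * d)"] abs_Im_le_cmod[of "(b\<^sup>2 - l\<^sup>2) + \<i> * (l * d)"] pos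
    by (auto simp: D_def L_def abs_mult)
  have eR: "(a\<^sup>2 - L\<^sup>2) * R \<le> L * (F + g * Z) + a * F"
  proof -
    have "(a\<^sup>2 - L\<^sup>2) * R \<le> \<bar>a\<^sup>2 - L\<^sup>2\<bar> * R" using nn by (intro mult_right_mono) auto
    also have "\<dots> = cmod (complex_of_real (a\<^sup>2 - l\<^sup>2) * r)"
      unfolding norm_mult norm_of_real by (simp add: L_def R_def)
    also have "complex_of_real (a\<^sup>2 - l\<^sup>2) * r = \<i> * l * (f3 + - (g * z)) + - (a * f1)"
      by (simp add: e algebra_simps power2_eq_square)
    also have "cmod \<dots> \<le> L * (F + g * Z) + a * F"
    proof (intro tri2)
      have "cmod (f3 + - (g * z)) \<le> F + g * Z"
        using fF pos by (intro tri2) (auto simp: Z_def norm_mult)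
      then show "cmod (\<i> * l * (f3 + - (g * z))) \<le> L * (F + g * Z)"
        unfolding norm_mult[of "\<i> * l"] il using L by simp
    qed (use fF pos in \<open>simp add: norm_mult\<close>)
    finally show ?thesis .
  qed
  have eQ: "D * Q \<le> b * F + b * (g * R) + (L + d) * F"
  proof -
    have "D * Q = cmod (((b\<^sup>2 - l\<^sup>2) + \<i> * (l * d)) * q)" by (simp only: D_def Q_def norm_mult)
    also have "((b\<^sup>2 - l\<^sup>2) + \<i> * (l * d)) * q = (b * f4 + b * (g * r)) + (\<i> * l + d) * f2"
      by (simp add: e algebra_simps power2_eq_square)
    also have "cmod \<dots> \<le> b * F + b * (g * R) + (L + d) * F"
    proof (intro tri2)
      show "cmod ((\<i> * l + d) * f2) \<le> (L + d) * F"
        unfolding norm_mult using fF pos L by (intro mult_mono ild) auto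
    qed (use fF pos in \<open>simp_all add: R_def norm_mult\<close>)
    finally show ?thesis .
  qed
  define \<Lambda> where "\<Lambda> = (if L \<le> 6 * K * a then 1 / d + d / a\<^sup>2 else 0)"
  have K8: "1 \<le> K ^ 8" "K ^ 4 \<le> K ^ 8" "K ^ 2 \<le> K ^ 4" "1 \<le> K ^ 4" "0 \<le> K ^ 4" using K by (auto intro: power_increasing)
  \<comment> \<open>If L is at least 2(a + b + g), the off-diagonal terms are absorbed directly; the
    damping does no harm because |il + d| >= L. In the opposite case L is at most 6 K a, so the
    condition in \<open>\<Lambda>\<close> holds.\<close>
  have "N \<le> 80000 * K ^ 8 * (1 / L + \<Lambda>) * F"
  proof (cases "2 * (a + b + g) \<le> L")
    case True
    define S where "S = P + Q + R + Z"
    have "L * S \<le> 4 * F + (a + b + g) * S"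
    proof -
      have "a * R + b * Z + (a * P + g * Z) + (b * Q + g * R) \<le> (a + b + g) * S"
        using pos nn by (simp add: S_def algebra_simps)
      then show ?thesis using e1 e2 e3' e4' by (simp add: S_def algebra_simps)
    qed
    moreover have "2 * ((a + b + g) * S) \<le> L * S"
      using mult_right_mono[OF True, of S] nn by (simp add: S_def algebra_simps)
    ultimately have "L * S \<le> 8 * F" by linarith
    moreover have "L * N \<le> L * S" using NS L by (simp add: S_def)
    ultimately have "L * N \<le> 8 * F" by linarith
    then have "N \<le> 8 * (1 / L * F)" using L by (simp add: pos_le_divide_eq mult.commute)
    also have "\<dots> \<le> (80000 * K ^ 8) * ((1 / L + \<Lambda>) * F)"
      using K8 L nn pos by (intro mult_mono mult_right_mono) (auto simp: \<Lambda>_def)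
    finally show ?thesis by (simp add: mult.assoc)
  next
    case False
    have "L \<le> 6 * K * a"
    proof -
      have "a \<le> K * a" using K pos by simp
      then show ?thesis using False gK by (simp add: algebra_simps)
    qed
    define w where "w = 1 + d / a"
    have w: "1 \<le> w" using pos by (simp add: w_def)
    have FL: "0 \<le> F / L" using nn L by simp
    \<comment> \<open>If b > 2 K L, then b <= K a forces 2 L <= a, and 1 <= K gives 2 L <= b; so the
      failure of the middle regime is exactly what the low regime needs.\<close>
    have main: "P + Q + R + Z \<le> 200 * K ^ 4 * (F / L + w * Z)"
    proof (cases "b \<le> 2 * K * L")
      case True
      then show ?thesis
        unfolding w_def
        using resolvent_estimate_middle[OF pos(1-4) L K gK \<open>L \<le> 6 * K * a\<close> True nn(1-5) e2 e3 e4] by simp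
    next
      case b: False
      have "2 * L \<le> a"
      proof -
        have "K * (2 * L) \<le> K * a" using b gK by simp
        then show ?thesis using K by simp
      qed
      moreover have "2 * L \<le> b"
      proof -
        have "2 * L \<le> 2 * K * L" using K L by simp
        then show ?thesis using b by simp
      qed
      ultimately have "P + Q + R + Z \<le> 20 * K ^ 2 * (F / L + Z)"
        by (intro resolvent_estimate_low[OF pos(1-4) L K gK(1) _ _ nn(1-5) e3 eR eQ D])
      also have "\<dots> \<le> 200 * K ^ 4 * (F / L + w * Z)"
        using K8 FL nn w by (intro mult_mono add_left_mono) (auto simp: mult_le_cancel_right1)
      finally show ?thesis .
    qed
    define X where "X = 200 * K ^ 4 * w"
    have i1: "N \<le> 200 * (K ^ 4 * (F / L)) + X * Z"
      using NS main by (simp add: X_def algebra_simps)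
    have i2: "X * Z \<le> (N + X\<^sup>2 * F / d) / 2"
      by (rule square_le_imp_half_sum[OF pos(4) en nn(6) nn(5)])
    have i3: "X\<^sup>2 * F / d = 40000 * (K ^ 8 * (w\<^sup>2 / d * F))"
      by (simp add: X_def power_mult_distrib power_mult[symmetric])
    have i4: "K ^ 8 * (w\<^sup>2 / d * F) \<le> 2 * (K ^ 8 * ((1 / d + d / a\<^sup>2) * F))"
    proof -
      have "w\<^sup>2 \<le> 2 * (1 + (d / a)\<^sup>2)"
        using sum_squares_bound[of 1 "d / a"] by (simp add: w_def power2_sum)
      then have "w\<^sup>2 / d \<le> 2 * (1 + (d / a)\<^sup>2) / d" using pos by (intro divide_right_mono) auto
      also have "\<dots> = 2 * (1 / d + d / a\<^sup>2)"
        using pos by (simp add: power2_eq_square add_divide_distrib)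
      finally have "K ^ 8 * (w\<^sup>2 / d * F) \<le> K ^ 8 * ((2 * (1 / d + d / a\<^sup>2)) * F)"
        using nn K8 by (intro mult_left_mono mult_right_mono) auto
      then show ?thesis by (simp only: mult.assoc mult.left_commute)
    qed
    have i5: "K ^ 4 * (F / L) \<le> K ^ 8 * (F / L)" "0 \<le> K ^ 8 * (F / L)"
      using mult_right_mono[OF K8(2) FL] mult_nonneg_nonneg[OF order_trans[OF zero_le_one K8(1)] FL] by auto
    \<comment> \<open>Absorbing N/2 leaves N <= 400 y4 + y1. Here y1 = 40000 y2 stems from 200^2,
      and the factor 2 in the bound of w^2 raises it to 80000.\<close>
    have arith: "N \<le> 80000 * y5 + 80000 * y3"
      if "N \<le> 200 * y4 + y6" "y6 \<le> (N + y1) / 2" "y1 = 40000 * y2" "y2 \<le> 2 * y3" "y4 \<le> y5" "0 \<le> y5"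
      for y1 y2 y3 y4 y5 y6 :: real
    proof -
      have "N \<le> 400 * y4 + y1" using that(1,2) by (simp add: field_simps)
      moreover have "y1 \<le> 80000 * y3" using that(3,4) by simp
      moreover have "400 * y4 \<le> 80000 * y5" using that(5,6) by simp
      ultimately show ?thesis by linarith
    qed
    have "N \<le> 80000 * (K ^ 8 * (F / L)) + 80000 * (K ^ 8 * ((1 / d + d / a\<^sup>2) * F))"
      by (rule arith[OF i1 i2 i3 i4 i5])
    then show ?thesis
      using \<open>L \<le> 6 * K * a\<close> by (simp add: \<Lambda>_def algebra_simps)
  qed
  then show ?thesis by (simp add: N_def F_def f_def \<Lambda>_def L_def)
qed


text \<open>The coefficients arise by rescaling u, v, w, z with sqrt \<alpha> \<mu>, sqrt \<alpha>
  \<mu>^(1/2), sqrt(1 + \<kappa> \<mu>^\<beta>) and 1, the square roots of their weights in the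
  energy.\<close>

definition fibre :: "real \<Rightarrow> real \<Rightarrow> real \<Rightarrow> real \<Rightarrow> real \<Rightarrow> real \<Rightarrow> real \<Rightarrow> cvec bop" where
  "fibre \<alpha> \<kappa> \<gamma> \<delta> \<theta> \<beta> \<mu> = fibre_op (sqrt \<alpha> * \<mu> / sqrt (1 + \<kappa> * \<mu> powr \<beta>)) (sqrt \<alpha> * \<mu> powr (1/2))
     (\<gamma> * \<mu> / sqrt (1 + \<kappa> * \<mu> powr \<beta>)) (\<delta> * \<mu> powr \<theta>)"

text \<open>Exchanges decay in the eigenvalue for decay in the frequency: below c \<mu>^\<sigma> the
  power \<mu>^(-e) is at most a multiple of L^(-e/\<sigma>), and 1 <= L allows the exponent to be
  lowered to \<psi>.\<close>

lemma powr_neg_le_powr_neg: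
  fixes \<mu> c e \<sigma> \<psi> L :: real
  assumes "0 < \<mu>" "0 < c" "0 < \<sigma>" "0 \<le> e" "\<psi> * \<sigma> \<le> e" "1 \<le> L" "L \<le> c * \<mu> powr \<sigma>"
  shows "\<mu> powr (- e) \<le> c powr (e / \<sigma>) * L powr (- \<psi>)"
proof -
  have "L / c \<le> \<mu> powr \<sigma>" using assms by (simp add: pos_divide_le_eq mult.commute)
  then have "(\<mu> powr \<sigma>) powr (- (e / \<sigma>)) \<le> (L / c) powr (- (e / \<sigma>))"
    using assms by (intro powr_mono2') auto
  then have "\<mu> powr (- e) \<le> (L / c) powr (- (e / \<sigma>))"
    using assms by (simp add: powr_powr)
  also have "\<dots> = c powr (e / \<sigma>) * L powr (- (e / \<sigma>))"
    using assms by (simp add: powr_divide powr_minus field_simps)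
  also have "\<dots> \<le> c powr (e / \<sigma>) * L powr (- \<psi>)"
    using assms by (intro mult_left_mono powr_mono) (auto simp: pos_le_divide_eq)
  finally show ?thesis .
qed

text \<open>With \<sigma> = 1 - \<beta>/2, a and g are comparable to \<mu>^\<sigma>, while b is of
  order \<mu>^(1/2), which is dominated by \<mu>^\<sigma> because \<beta> < 1. The extra terms 1/d
  and d/a^2 matter only for |l| up to a multiple of \<mu>^\<sigma>, and there \<psi>\<sigma> <=
  \<theta> and \<psi>\<sigma> <= 2\<sigma> - \<theta> convert them into |l|^(-\<psi>).\<close>

lemma fibre_resolvent_decay:
  fixes \<alpha> \<kappa> \<gamma> \<delta> \<theta> \<beta> \<mu>\<^sub>0 :: real
  assumes pos: "0 < \<alpha>" "0 < \<kappa>" "0 < \<gamma>" "0 < \<delta>" "0 < \<theta>" "0 < \<beta>" "\<beta> < 1" "0 < \<mu>\<^sub>0"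
    and range: "3 * \<theta> / 4 + \<beta> / 2 \<le> 1"
  defines "\<psi> \<equiv> 3 * (\<theta> / (2 * (2 + \<theta> - \<beta>)))"
  shows "\<exists>C>0. \<forall>\<mu>\<ge>\<mu>\<^sub>0. \<forall>l x. 1 \<le> \<bar>l\<bar> \<longrightarrow> norm x \<le> C * \<bar>l\<bar> powr (- \<psi>) *
     norm ((\<i> * complex_of_real l) *\<^sub>C x - bop_apply (fibre \<alpha> \<kappa> \<gamma> \<delta> \<theta> \<beta> \<mu>) x)"
proof -
  define \<sigma> where "\<sigma> = 1 - \<beta> / 2"
  have sig: "1 / 2 < \<sigma>" "3 * \<theta> \<le> 4 * \<sigma>" and psi_eq: "\<psi> = 3 * \<theta> / (4 * \<sigma> + 2 * \<theta>)"
    using pos range by (auto simp: \<sigma>_def \<psi>_def)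
  have den: "0 < 4 * \<sigma> + 2 * \<theta>" using sig pos by simp
  have psi: "\<psi> \<le> 1" "\<psi> * \<sigma> \<le> \<theta>" "\<psi> * \<sigma> \<le> 2 * \<sigma> - \<theta>"
  proof -
    show "\<psi> \<le> 1" using den sig pos by (simp add: psi_eq)
    have "3 * \<theta> * \<sigma> \<le> \<theta> * (4 * \<sigma> + 2 * \<theta>)"
      using pos sig by (simp add: algebra_simps)
    then show "\<psi> * \<sigma> \<le> \<theta>" using den by (simp add: psi_eq pos_divide_le_eq)
    \<comment> \<open>From 3\<theta> <= 4\<sigma>: 2\<theta>^2 <= 32/9 \<sigma>^2 and
      3\<theta>\<sigma> <= 4\<sigma>^2, and their sum stays below 8\<sigma>^2.\<close>
    have "9 * (\<theta> * \<theta>) \<le> 16 * (\<sigma> * \<sigma>)" "3 * \<theta> * \<sigma> \<le> 4 * (\<sigma> * \<sigma>)"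
      using mult_mono[OF sig(2) sig(2)] mult_right_mono[OF sig(2), of \<sigma>] pos sig by auto
    moreover have "0 \<le> \<sigma> * \<sigma>" by simp
    moreover have "(2 * \<sigma> - \<theta>) * (4 * \<sigma> + 2 * \<theta>) = 8 * (\<sigma> * \<sigma>) - 2 * (\<theta> * \<theta>)"
      by (simp add: algebra_simps)
    ultimately have "3 * \<theta> * \<sigma> \<le> (2 * \<sigma> - \<theta>) * (4 * \<sigma> + 2 * \<theta>)"
      by linarith
    then show "\<psi> * \<sigma> \<le> 2 * \<sigma> - \<theta>" using den by (simp add: psi_eq pos_divide_le_eq)
  qed
  define c1 where "c1 = sqrt (\<mu>\<^sub>0 powr (- \<beta>) + \<kappa>)"
  have c1: "0 < c1" using pos by (simp add: c1_def add_pos_pos)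
  \<comment> \<open>The summands bound g/a, a/g and b/a in this order. \<open>c1\<close> makes c1
    \<mu>^(\<beta>/2) an upper bound of sqrt(1 + \<kappa> \<mu>^\<beta>) above
    \<open>\<mu>\<^sub>0\<close>, and \<open>c2\<close> is chosen so that 6 K a <= c2
    \<mu>^\<sigma>.\<close>
  define K where "K = 1 + \<gamma> / sqrt \<alpha> + sqrt \<alpha> / \<gamma> + c1 * \<mu>\<^sub>0 powr (1/2 - \<sigma>)"
  define c2 where "c2 = 6 * K * (sqrt \<alpha> / sqrt \<kappa>)"
  have K: "1 \<le> K" "\<gamma> / sqrt \<alpha> \<le> K" "sqrt \<alpha> / \<gamma> \<le> K" "c1 * \<mu>\<^sub>0 powr (1/2 - \<sigma>) \<le> K"
    using pos c1 by (auto simp: K_def)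
  have c2: "0 < c2" using K pos by (simp add: c2_def)
  define C where "C = 80000 * K ^ 8 * (1 + (c2 powr (\<theta> / \<sigma>) / \<delta> + \<delta> * c1\<^sup>2 / \<alpha> * c2 powr ((2 * \<sigma> - \<theta>) / \<sigma>)))"
  have "0 < C"
    unfolding C_def using pos K by (intro mult_pos_pos add_pos_nonneg) auto
  moreover have "norm x \<le> C * \<bar>l\<bar> powr (- \<psi>) *
     norm ((\<i> * complex_of_real l) *\<^sub>C x - bop_apply (fibre \<alpha> \<kappa> \<gamma> \<delta> \<theta> \<beta> \<mu>) x)"
    if mu: "\<mu>\<^sub>0 \<le> \<mu>" and l: "1 \<le> \<bar>l\<bar>" for \<mu> l x
  proof -
    have mu0: "0 < \<mu>" using mu pos by simp
    define s where "s = sqrt (1 + \<kappa> * \<mu> powr \<beta>)"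
    define a b g d where "a = sqrt \<alpha> * \<mu> / s" and "b = sqrt \<alpha> * \<mu> powr (1/2)"
      and "g = \<gamma> * \<mu> / s" and "d = \<delta> * \<mu> powr \<theta>"
    have sqb: "sqrt (\<mu> powr \<beta>) = \<mu> powr (\<beta> / 2)"
      by (simp add: powr_half_sqrt[symmetric] powr_powr)
    have s_lower: "sqrt \<kappa> * \<mu> powr (\<beta> / 2) \<le> s"
      unfolding s_def sqb[symmetric] real_sqrt_mult[symmetric] by simp
    have s_upper: "s \<le> c1 * \<mu> powr (\<beta> / 2)"
    proof -
      have "1 = \<mu> powr (- \<beta>) * \<mu> powr \<beta>" using mu0 by (simp add: powr_add[symmetric])
      also have "\<dots> \<le> \<mu>\<^sub>0 powr (- \<beta>) * \<mu> powr \<beta>"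
        using mu pos by (intro mult_right_mono powr_mono2') auto
      finally have "1 + \<kappa> * \<mu> powr \<beta> \<le> (\<mu>\<^sub>0 powr (- \<beta>) + \<kappa>) * \<mu> powr \<beta>"
        by (simp add: distrib_right)
      then show ?thesis
        unfolding s_def c1_def sqb[symmetric] real_sqrt_mult[symmetric] by simp
    qed
    have s0: "0 < s" using pos by (simp add: s_def add_pos_nonneg)
    have mu_sig: "\<mu> = \<mu> powr \<sigma> * \<mu> powr (\<beta> / 2)"
      using mu0 by (simp add: \<sigma>_def powr_add[symmetric])
    have a_upper: "a \<le> sqrt \<alpha> / sqrt \<kappa> * \<mu> powr \<sigma>"
    proof -
      have "sqrt \<alpha> * \<mu> * sqrt \<kappa> = sqrt \<alpha> * \<mu> powr \<sigma> * (sqrt \<kappa> * \<mu> powr (\<beta> / 2))"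
        by (subst (1) mu_sig) (simp add: mult_ac)
      also have "\<dots> \<le> sqrt \<alpha> * \<mu> powr \<sigma> * s"
        using s_lower pos by (intro mult_left_mono) auto
      finally show ?thesis using s0 pos by (simp add: a_def field_simps)
    qed
    have a_lower: "\<mu> powr \<sigma> \<le> c1 / sqrt \<alpha> * a"
    proof -
      have "\<mu> powr \<sigma> * s \<le> \<mu> powr \<sigma> * (c1 * \<mu> powr (\<beta> / 2))"
        using s_upper by (intro mult_left_mono) auto
      also have "\<dots> = c1 * \<mu>" by (subst (3) mu_sig) (simp add: mult_ac)
      finally show ?thesis using s0 pos by (simp add: a_def field_simps)
    qed
    have ppos: "0 < a" "0 < b" "0 < g" "0 < d"
      using pos mu0 s0 by (auto simp: a_def b_def g_def d_def)
    have gK: "g \<le> K * a" "a \<le> K * g" "b \<le> K * a"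
    proof -
      have "g = \<gamma> / sqrt \<alpha> * a" "a = sqrt \<alpha> / \<gamma> * g"
        using pos s0 by (simp_all add: g_def a_def)
      then show "g \<le> K * a" "a \<le> K * g"
        using mult_right_mono[OF K(2), of a] mult_right_mono[OF K(3), of g] ppos by auto
      have "\<mu> powr (1/2) = \<mu> powr (1/2 - \<sigma>) * \<mu> powr \<sigma>" using mu0 by (simp add: powr_add[symmetric])
      also have "\<dots> \<le> \<mu>\<^sub>0 powr (1/2 - \<sigma>) * (c1 / sqrt \<alpha> * a)"
        using mu pos sig a_lower by (intro mult_mono powr_mono2') auto
      finally have "sqrt \<alpha> * \<mu> powr (1/2) \<le> sqrt \<alpha> * (\<mu>\<^sub>0 powr (1/2 - \<sigma>) * (c1 / sqrt \<alpha> * a))"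
        using pos by (intro mult_left_mono) auto
      also have "\<dots> = c1 * \<mu>\<^sub>0 powr (1/2 - \<sigma>) * a" using pos by simp
      also have "\<dots> \<le> K * a" using K(4) ppos by (intro mult_right_mono) auto
      finally show "b \<le> K * a" by (simp add: b_def)
    qed
    have "norm x \<le> 80000 * K ^ 8 * (1 / \<bar>l\<bar> + (if \<bar>l\<bar> \<le> 6 * K * a then 1 / d + d / a\<^sup>2 else 0)) *
       norm ((\<i> * complex_of_real l) *\<^sub>C x - bop_apply (fibre_op a b g d) x)"
      using l by (intro fibre_resolvent_estimate ppos K gK) auto
    also have "\<dots> \<le> C * \<bar>l\<bar> powr (- \<psi>) * norm ((\<i> * complex_of_real l) *\<^sub>C x - bop_apply (fibre_op a b g d) x)"
    proof (rule mult_right_mono)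
      have 1: "1 / \<bar>l\<bar> \<le> \<bar>l\<bar> powr (- \<psi>)"
        using l psi powr_mono[of "- 1" "- \<psi>" "\<bar>l\<bar>"] by (simp add: powr_minus_divide)
      have 2: "1 / d + d / a\<^sup>2 \<le>
         (c2 powr (\<theta> / \<sigma>) / \<delta> + \<delta> * c1\<^sup>2 / \<alpha> * c2 powr ((2 * \<sigma> - \<theta>) / \<sigma>)) * \<bar>l\<bar> powr (- \<psi>)"
        if "\<bar>l\<bar> \<le> 6 * K * a"
      proof -
        have lc: "\<bar>l\<bar> \<le> c2 * \<mu> powr \<sigma>"
        proof -
          have "6 * K * a \<le> 6 * K * (sqrt \<alpha> / sqrt \<kappa> * \<mu> powr \<sigma>)"
            using a_upper K by (intro mult_left_mono) auto
          then show ?thesis using that by (simp add: c2_def)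
        qed
        have "1 / d = \<mu> powr (- \<theta>) / \<delta>"
          by (simp add: d_def powr_minus field_simps)
        also have "\<dots> \<le> (c2 powr (\<theta> / \<sigma>) * \<bar>l\<bar> powr (- \<psi>)) / \<delta>"
          using pos mu0 c2 sig psi l lc by (intro divide_right_mono powr_neg_le_powr_neg) auto
        finally have d1: "1 / d \<le> c2 powr (\<theta> / \<sigma>) / \<delta> * \<bar>l\<bar> powr (- \<psi>)" by simp
        have "(\<mu> powr \<sigma>)\<^sup>2 \<le> (c1 / sqrt \<alpha> * a)\<^sup>2"
          by (intro power_mono a_lower) auto
        also have "\<dots> = c1\<^sup>2 / \<alpha> * a\<^sup>2"
          using pos by (simp add: power_mult_distrib power_divide)
        finally have a2: "(\<mu> powr \<sigma>)\<^sup>2 \<le> c1\<^sup>2 / \<alpha> * a\<^sup>2" .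
        have "d / a\<^sup>2 \<le> d * (c1\<^sup>2 / \<alpha> / (\<mu> powr \<sigma>)\<^sup>2)"
        proof -
          have "1 / a\<^sup>2 \<le> c1\<^sup>2 / \<alpha> / (\<mu> powr \<sigma>)\<^sup>2"
          proof -
            have aux: "1 / A \<le> k / M" if "0 < A" "0 < M" "M \<le> k * A" for A k M :: real
              using that by (simp add: field_simps)
            show ?thesis by (rule aux[OF _ _ a2]) (use ppos mu0 in auto)
          qed
          from mult_left_mono[OF this, of d] show ?thesis using ppos by simp
        qed
        also have "\<dots> = \<delta> * c1\<^sup>2 / \<alpha> * (\<mu> powr \<theta> / (\<mu> powr \<sigma>)\<^sup>2)"
          by (simp add: d_def)
        also have "\<mu> powr \<theta> / (\<mu> powr \<sigma>)\<^sup>2 = \<mu> powr (- (2 * \<sigma> - \<theta>))"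
          using mu0 by (simp add: powr_diff powr_power mult.commute)
        also have "\<delta> * c1\<^sup>2 / \<alpha> * \<mu> powr (- (2 * \<sigma> - \<theta>)) \<le>
            \<delta> * c1\<^sup>2 / \<alpha> * (c2 powr ((2 * \<sigma> - \<theta>) / \<sigma>) * \<bar>l\<bar> powr (- \<psi>))"
          using pos mu0 c2 sig psi l lc by (intro mult_left_mono powr_neg_le_powr_neg) auto
        finally have "d / a\<^sup>2 \<le> \<delta> * c1\<^sup>2 / \<alpha> * c2 powr ((2 * \<sigma> - \<theta>) / \<sigma>) * \<bar>l\<bar> powr (- \<psi>)"
          by (simp only: mult.assoc)
        then show ?thesis using d1 by (simp only: distrib_right)
      qed
      have cc: "0 \<le> (c2 powr (\<theta> / \<sigma>) / \<delta> + \<delta> * c1\<^sup>2 / \<alpha> * c2 powr ((2 * \<sigma> - \<theta>) / \<sigma>)) * \<bar>l\<bar> powr (- \<psi>)"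
        using pos by simp
      have "1 / \<bar>l\<bar> + (if \<bar>l\<bar> \<le> 6 * K * a then 1 / d + d / a\<^sup>2 else 0) \<le> \<bar>l\<bar> powr (- \<psi>) +
         (c2 powr (\<theta> / \<sigma>) / \<delta> + \<delta> * c1\<^sup>2 / \<alpha> * c2 powr ((2 * \<sigma> - \<theta>) / \<sigma>)) * \<bar>l\<bar> powr (- \<psi>)"
        using 1 2 cc by (intro add_mono) auto
      also have "\<dots> = (1 + (c2 powr (\<theta> / \<sigma>) / \<delta> + \<delta> * c1\<^sup>2 / \<alpha> * c2 powr ((2 * \<sigma> - \<theta>) / \<sigma>))) * \<bar>l\<bar> powr (- \<psi>)"
        by (simp only: distrib_right mult_1_left)
      finally show "80000 * K ^ 8 * (1 / \<bar>l\<bar> + (if \<bar>l\<bar> \<le> 6 * K * a then 1 / d + d / a\<^sup>2 else 0))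
          \<le> C * \<bar>l\<bar> powr (- \<psi>)"
        unfolding C_def mult.assoc[of "80000 * K ^ 8"] using K by (intro mult_left_mono) auto
    qed simp
    finally show ?thesis
      by (simp only: fibre_def a_def b_def g_def d_def s_def)
  qed
  ultimately show ?thesis by blast
qed

section \<open>Resolvents of the matrices on the lines Re = 0 and Re = 1\<close>

lemma clinear_op_inverse:
  assumes "clinear_op T" "R * T = 1" "T * R = 1"
  shows "clinear_op R"
  unfolding clinear_op_def
proof
  fix k
  have "cop k * R = R * (T * cop k) * R" using assms(2) by (simp add: mult.assoc[symmetric])
  also have "T * cop k = cop k * T" using assms(1) by (simp add: clinear_op_def)
  also have "R * (cop k * T) * R = R * cop k * (T * R)" by (simp add: mult.assoc)
  finally show "cop k * R = R * cop k" using assms(3) by simp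
qed

lemma Complex_1_scaleC: "Complex 1 l *\<^sub>C (x::cvec) = x + (\<i> * complex_of_real l) *\<^sub>C x"
proof -
  have "Complex 1 l = 1 + \<i> * complex_of_real l" by (simp add: complex_eq_iff)
  moreover have "1 *\<^sub>C x = x" using scaleC_of_real[of 1 x] by simp
  ultimately show ?thesis by (simp only: scaleC_add_left)
qed

text \<open>By dissipativity the real inner product of (1 + il - T) x and x is at least
  |x|^2.\<close>

lemma dissipative_resolvent_bound:
  fixes T :: "cvec bop"
  assumes diss: "\<And>x. inner (bop_apply T x) x \<le> 0"
  shows "norm x \<le> norm (bop_apply (cop (Complex 1 l) - T) x)"
proof (cases "x = 0")
  case False
  have "norm x * norm x = inner x x" by (simp add: power2_norm_eq_inner[symmetric] power2_eq_square)
  also have "\<dots> \<le> inner (bop_apply (cop (Complex 1 l) - T) x) x"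
    using diss[of x] by (simp add: Complex_1_scaleC inner_diff_left inner_add_left inner_ii_scaleC_cvec)
  also have "\<dots> \<le> norm (bop_apply (cop (Complex 1 l) - T) x) * norm x"
    by (rule norm_cauchy_schwarz)
  finally show ?thesis using False by simp
qed simp

text \<open>The weight exp(-t) in the Fourier inversion requires the line Re = 1. There (il - T) x
  differs from (1 + il - T) x by x, which dissipativity bounds by the latter, so the estimate on the
  imaginary axis changes by a factor 2 only. For |l| < 1 dissipativity alone suffices.\<close>

lemma shifted_resolvent_decay:
  fixes T :: "cvec bop"
  assumes diss: "\<And>x. inner (bop_apply T x) x \<le> 0"
    and decay: "\<And>l x. 1 \<le> \<bar>l\<bar> \<Longrightarrow> norm x \<le> C * \<bar>l\<bar> powr (- \<psi>) *
      norm ((\<i> * complex_of_real l) *\<^sub>C x - bop_apply T x)"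
    and C: "0 < C" and psi: "0 < \<psi>" "\<psi> \<le> 1"
  shows "\<exists>R. (cop (Complex 1 l) - T) * R = 1 \<and> norm R \<le> (4 * C + 2) * (1 + \<bar>l\<bar>) powr (- \<psi>)"
proof -
  let ?A = "cop (Complex 1 l) - T"
  have "norm x \<le> (4 * C + 2) * (1 + \<bar>l\<bar>) powr (- \<psi>) * norm (bop_apply ?A x)" for x
  proof (cases "1 \<le> \<bar>l\<bar>")
    case True
    have "(\<i> * complex_of_real l) *\<^sub>C x - bop_apply T x = bop_apply ?A x - x"
      by (simp add: Complex_1_scaleC)
    then have "norm ((\<i> * complex_of_real l) *\<^sub>C x - bop_apply T x) \<le> norm (bop_apply ?A x) + norm x"
      using norm_triangle_ineq4[of "bop_apply ?A x" x] by (simp only:)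
    also have "\<dots> \<le> 2 * norm (bop_apply ?A x)"
      using dissipative_resolvent_bound[OF diss, of x l] by linarith
    finally have "norm ((\<i> * complex_of_real l) *\<^sub>C x - bop_apply T x) \<le> 2 * norm (bop_apply ?A x)" .
    then have "norm x \<le> C * \<bar>l\<bar> powr (- \<psi>) * (2 * norm (bop_apply ?A x))"
      by (intro order_trans[OF decay[OF True, of x]] mult_left_mono) (use C in auto)
    also have "\<dots> = 2 * C * \<bar>l\<bar> powr (- \<psi>) * norm (bop_apply ?A x)" by simp
    also have "\<dots> \<le> (4 * C + 2) * (1 + \<bar>l\<bar>) powr (- \<psi>) * norm (bop_apply ?A x)"
    proof (intro mult_right_mono)
      \<comment> \<open>Replacing |l| by 1 + |l| <= 2|l| costs 2^\<psi> <= 2; this doubles 2 C to 4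
        C, and the extra 2 in the constant serves the frequencies |l| < 1.\<close>
      have "2 powr (- 1) \<le> 2 powr (- \<psi>)" using psi by (intro powr_mono) auto
      then have "\<bar>l\<bar> powr (- \<psi>) \<le> 2 * (2 powr (- \<psi>) * \<bar>l\<bar> powr (- \<psi>))"
        using mult_right_mono[of 1 "2 * 2 powr (- \<psi>)" "\<bar>l\<bar> powr (- \<psi>)"] by (simp add: powr_minus)
      also have "2 powr (- \<psi>) * \<bar>l\<bar> powr (- \<psi>) = (2 * \<bar>l\<bar>) powr (- \<psi>)"
        by (simp add: powr_mult)
      also have "(2 * \<bar>l\<bar>) powr (- \<psi>) \<le> (1 + \<bar>l\<bar>) powr (- \<psi>)"
        using True psi by (intro powr_mono2') auto
      finally have "2 * C * \<bar>l\<bar> powr (- \<psi>) \<le> 2 * C * (2 * (1 + \<bar>l\<bar>) powr (- \<psi>))"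
        using C by (intro mult_left_mono) auto
      also have "\<dots> \<le> (4 * C + 2) * (1 + \<bar>l\<bar>) powr (- \<psi>)"
        by (simp add: distrib_right)
      finally show "2 * C * \<bar>l\<bar> powr (- \<psi>) \<le> (4 * C + 2) * (1 + \<bar>l\<bar>) powr (- \<psi>)" .
    qed simp
    finally show ?thesis .
  next
    case False
    have "2 powr (- 1) \<le> (2::real) powr (- \<psi>)" using psi by (intro powr_mono) auto
    also have "2 powr (- \<psi>) \<le> (1 + \<bar>l\<bar>) powr (- \<psi>)" using False psi by (intro powr_mono2') auto
    finally have "1 \<le> 2 * (1 + \<bar>l\<bar>) powr (- \<psi>)" by (simp add: powr_minus)
    also have "\<dots> \<le> (4 * C + 2) * (1 + \<bar>l\<bar>) powr (- \<psi>)"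
      using C by (intro mult_right_mono) auto
    finally have "1 * norm (bop_apply ?A x) \<le> (4 * C + 2) * (1 + \<bar>l\<bar>) powr (- \<psi>) * norm (bop_apply ?A x)"
      by (rule mult_right_mono) simp
    then show ?thesis using dissipative_resolvent_bound[OF diss, of x l] by simp
  qed
  from bop_inverse_exists[OF this] show ?thesis by blast
qed

lemma fibre_dissipative:
  assumes "0 < \<delta>" shows "inner (bop_apply (fibre \<alpha> \<kappa> \<gamma> \<delta> \<theta> \<beta> \<mu>) x) x \<le> 0"
  unfolding fibre_def using assms by (intro fibre_op_dissipative) simp

lemma clinear_fibre: "clinear_op (fibre \<alpha> \<kappa> \<gamma> \<delta> \<theta> \<beta> \<mu>)"
  unfolding fibre_def by (rule clinear_fibre_op)

lemma norm_exp_fibre: "0 < \<delta> \<Longrightarrow> 0 \<le> t \<Longrightarrow> norm (exp (t *\<^sub>R fibre \<alpha> \<kappa> \<gamma> \<delta> \<theta> \<beta> \<mu>)) \<le> 1"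
  by (intro norm_exp_dissipative_le_1 fibre_dissipative)

lemma fibre_resolvent:
  fixes \<alpha> \<kappa> \<gamma> \<delta> \<theta> \<beta> \<mu>\<^sub>0 :: real
  assumes pos: "0 < \<alpha>" "0 < \<kappa>" "0 < \<gamma>" "0 < \<delta>" "0 < \<theta>" "0 < \<beta>" "\<beta> < 1" "0 < \<mu>\<^sub>0"
    and range: "3 * \<theta> / 4 + \<beta> / 2 \<le> 1"
  defines "\<psi> \<equiv> 3 * (\<theta> / (2 * (2 + \<theta> - \<beta>)))"
  shows "\<exists>C>0. \<forall>\<mu>\<ge>\<mu>\<^sub>0. \<forall>l. 1 \<le> \<bar>l\<bar> \<longrightarrow>
     (\<exists>R. clinear_op R \<and> R * (cop (\<i> * l) - fibre \<alpha> \<kappa> \<gamma> \<delta> \<theta> \<beta> \<mu>) = 1 \<and>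
       (cop (\<i> * l) - fibre \<alpha> \<kappa> \<gamma> \<delta> \<theta> \<beta> \<mu>) * R = 1 \<and> norm R \<le> C * \<bar>l\<bar> powr (- \<psi>))"
proof -
  obtain C where C: "0 < C" "\<And>\<mu> l x. \<mu>\<^sub>0 \<le> \<mu> \<Longrightarrow> 1 \<le> \<bar>l\<bar> \<Longrightarrow> norm x \<le> C * \<bar>l\<bar> powr (- \<psi>) *
     norm ((\<i> * complex_of_real l) *\<^sub>C x - bop_apply (fibre \<alpha> \<kappa> \<gamma> \<delta> \<theta> \<beta> \<mu>) x)"
    using fibre_resolvent_decay[OF pos range] unfolding \<psi>_def by blast
  show ?thesis
  proof (intro exI[of _ C] conjI allI impI C(1))
    fix \<mu> l :: real assume "\<mu>\<^sub>0 \<le> \<mu>" "1 \<le> \<bar>l\<bar>"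
    let ?A = "cop (\<i> * l) - fibre \<alpha> \<kappa> \<gamma> \<delta> \<theta> \<beta> \<mu>"
    have "norm x \<le> C * \<bar>l\<bar> powr (- \<psi>) * norm (bop_apply ?A x)" for x
      using C(2)[OF \<open>\<mu>\<^sub>0 \<le> \<mu>\<close> \<open>1 \<le> \<bar>l\<bar>\<close>, of x] by simp
    from bop_inverse_exists[OF this]
    obtain R where R: "R * ?A = 1" "?A * R = 1" "norm R \<le> C * \<bar>l\<bar> powr (- \<psi>)" by blast
    moreover have "clinear_op R"
      by (rule clinear_op_inverse[OF _ R(1,2)]) (intro clinear_op_diff clinear_op_cop clinear_fibre)
    ultimately show "\<exists>R. clinear_op R \<and> R * ?A = 1 \<and> ?A * R = 1 \<and> norm R \<le> C * \<bar>l\<bar> powr (- \<psi>)"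
      by blast
  qed
qed

lemma fibre_smoothing:
  fixes \<alpha> \<kappa> \<gamma> \<delta> \<theta> \<beta> \<mu>\<^sub>0 :: real
  assumes pos: "0 < \<alpha>" "0 < \<kappa>" "0 < \<gamma>" "0 < \<delta>" "0 < \<theta>" "0 < \<beta>" "\<beta> < 1" "0 < \<mu>\<^sub>0"
    and range: "3 * \<theta> / 4 + \<beta> / 2 \<le> 1"
    and k: "0 < k" "1 \<le> (\<theta> / (2 * (2 + \<theta> - \<beta>))) * real (Suc k)"
  shows "\<exists>K. \<forall>\<mu>\<ge>\<mu>\<^sub>0. \<forall>t. 0 < t \<longrightarrow> t \<le> 1 \<longrightarrow>
     norm (fibre \<alpha> \<kappa> \<gamma> \<delta> \<theta> \<beta> \<mu> * exp (t *\<^sub>R fibre \<alpha> \<kappa> \<gamma> \<delta> \<theta> \<beta> \<mu>)) \<le> K / t ^ k"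
proof -
  define \<psi> where "\<psi> = 3 * (\<theta> / (2 * (2 + \<theta> - \<beta>)))"
  have psi: "0 < \<psi>" "\<psi> \<le> 1" "3 \<le> \<psi> * real (Suc k)"
    using pos range k unfolding \<psi>_def by (auto simp: field_simps)
  obtain C where C: "0 < C" "\<And>\<mu> l x. \<mu>\<^sub>0 \<le> \<mu> \<Longrightarrow> 1 \<le> \<bar>l\<bar> \<Longrightarrow> norm x \<le> C * \<bar>l\<bar> powr (- \<psi>) *
     norm ((\<i> * complex_of_real l) *\<^sub>C x - bop_apply (fibre \<alpha> \<kappa> \<gamma> \<delta> \<theta> \<beta> \<mu>) x)"
    using fibre_resolvent_decay[OF pos range] unfolding \<psi>_def by blast
  let ?C = "4 * C + 2"
  show ?thesis
  proof (intro exI allI impI)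
    fix \<mu> t :: real assume mu: "\<mu>\<^sub>0 \<le> \<mu>" and t: "0 < t" "t \<le> 1"
    let ?M = "fibre \<alpha> \<kappa> \<gamma> \<delta> \<theta> \<beta> \<mu>"
    have "\<exists>R. \<forall>l. (cop (Complex 1 l) - ?M) * R l = 1 \<and> norm (R l) \<le> ?C * (1 + \<bar>l\<bar>) powr (- \<psi>)"
      by (intro choice allI shifted_resolvent_decay[OF fibre_dissipative[OF pos(4)] C(2)[OF mu] C(1) psi(1,2)])
    then obtain R where R: "\<And>l. (cop (Complex 1 l) - ?M) * R l = 1"
      "\<And>l. norm (R l) \<le> ?C * (1 + \<bar>l\<bar>) powr (- \<psi>)" by blast
    have "norm (?M * exp (t *\<^sub>R ?M)) \<le> 2 * fact k * (1 + ?C) * ?C ^ k * exp t / t ^ k"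
      by (rule norm_mult_exp_le[OF clinear_fibre norm_exp_fibre[OF pos(4)] R _ psi(2) k(1) psi(3) t(1)])
        (use C in auto)
    also have "\<dots> \<le> 2 * fact k * (1 + ?C) * ?C ^ k * exp 1 / t ^ k"
      using C t by (intro divide_right_mono mult_left_mono) auto
    finally show "norm (?M * exp (t *\<^sub>R ?M)) \<le> 2 * fact k * (1 + ?C) * ?C ^ k * exp 1 / t ^ k" .
  qed
qed

section \<open>Completeness and complex structure of $L^2$\<close>

lemma l2rel_refl: "square_integrable \<phi> \<Longrightarrow> l2rel \<phi> \<phi>"
  by (simp add: l2rel_def)

lemma square_integrable_rep_l2: "square_integrable (rep_l2 f)"
  using Quotient_rep_reflp[OF Quotient_l2, of f] by (simp add: l2rel_def)

lemma abs_rep_l2: "abs_l2 (rep_l2 f) = f"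
  by (rule Quotient_abs_rep[OF Quotient_l2])

lemma l2_cases:
  obtains \<phi> where "square_integrable \<phi>" "f = abs_l2 \<phi>"
  using square_integrable_rep_l2 abs_rep_l2 by metis

lemma rep_abs_l2_AE:
  assumes "square_integrable \<phi>" shows "AE x in lebesgue. rep_l2 (abs_l2 \<phi>) x = \<phi> x"
  using Quotient_rep_abs[OF Quotient_l2, OF l2rel_refl[OF assms]] by (simp add: l2rel_def)

lemma abs_l2_plus:
  "square_integrable \<phi> \<Longrightarrow> square_integrable \<psi> \<Longrightarrow> abs_l2 \<phi> + abs_l2 \<psi> = abs_l2 (\<lambda>x. \<phi> x + \<psi> x)"
  by (intro plus_l2.abs_eq l2rel_refl)

lemma abs_l2_scaleC: "square_integrable \<phi> \<Longrightarrow> k *\<^sub>C abs_l2 \<phi> = abs_l2 (\<lambda>x. k * \<phi> x)"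
  by (intro scaleC_l2.abs_eq l2rel_refl)

lemma square_integrable_diff:
  "square_integrable \<phi> \<Longrightarrow> square_integrable \<psi> \<Longrightarrow> square_integrable (\<lambda>x. \<phi> x - \<psi> x)"
  using square_integrable_add[of \<phi> "\<lambda>x. - 1 * \<psi> x"] square_integrable_cmult[of \<psi> "- 1"] by simp

lemma abs_l2_diff:
  assumes "square_integrable \<phi>" "square_integrable \<psi>"
  shows "abs_l2 \<phi> - abs_l2 \<psi> = abs_l2 (\<lambda>x. \<phi> x - \<psi> x)"
  unfolding minus_l2_def uminus_l2_def
  using abs_l2_plus[OF assms(1) square_integrable_cmult[OF assms(2), of "- 1"]] abs_l2_scaleC[OF assms(2), of "- 1"]
  by simp

lemma cinner_abs_l2:
  "square_integrable \<phi> \<Longrightarrow> square_integrable \<psi> \<Longrightarrow>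
     cinner (abs_l2 \<phi>) (abs_l2 \<psi>) = (LINT x|lebesgue. \<phi> x * cnj (\<psi> x))"
  by (intro cinner.abs_eq l2rel_refl)

lemma norm_abs_l2:
  assumes "square_integrable \<phi>"
  shows "(norm (abs_l2 \<phi>))\<^sup>2 = (LINT x|lebesgue. (cmod (\<phi> x))\<^sup>2)"
proof -
  have "cinner (abs_l2 \<phi>) (abs_l2 \<phi>) = (LINT x|lebesgue. complex_of_real ((cmod (\<phi> x))\<^sup>2))"
    using assms by (simp only: cinner_abs_l2 complex_norm_square)
  then have "Re (cinner (abs_l2 \<phi>) (abs_l2 \<phi>)) = (LINT x|lebesgue. (cmod (\<phi> x))\<^sup>2)"
    by (simp only: integral_complex_of_real Re_complex_of_real)
  moreover have "0 \<le> (LINT x|lebesgue. (cmod (\<phi> x))\<^sup>2)" by simp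
  ultimately show ?thesis by (simp add: norm_l2_def)
qed

lemma nn_integral_norm_abs_l2:
  assumes "square_integrable \<phi>"
  shows "(\<integral>\<^sup>+ x. ennreal ((cmod (\<phi> x))\<^sup>2) \<partial>lebesgue) = ennreal ((norm (abs_l2 \<phi>))\<^sup>2)"
  unfolding norm_abs_l2[OF assms]
  using assms by (intro nn_integral_eq_integral) (auto simp: square_integrable_def)

lemma fast_Cauchy_subsequence:
  fixes X :: "nat \<Rightarrow> 'a::real_normed_vector"
  assumes "Cauchy X"
  shows "\<exists>r. strict_mono r \<and> (\<forall>n. norm (X (r (Suc n)) - X (r n)) \<le> (1 / 2) ^ n)"
proof -
  have "\<exists>N. \<forall>n. \<forall>i\<ge>N n. \<forall>j\<ge>N n. norm (X i - X j) < (1 / 2) ^ n"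
    by (rule choice) (use assms in \<open>auto simp: Cauchy_iff\<close>)
  then obtain N :: "nat \<Rightarrow> nat" where N: "\<And>n i j. N n \<le> i \<Longrightarrow> N n \<le> j \<Longrightarrow> norm (X i - X j) < (1 / 2) ^ n"
    by blast
  \<comment> \<open>Adding n and all earlier thresholds makes \<open>r\<close> strictly increasing
    while keeping \<open>N n \<le> r n\<close>.\<close>
  define r where "r n = n + (\<Sum>i\<le>n. N i)" for n
  have "strict_mono r" by (rule strict_monoI_Suc) (simp add: r_def)
  moreover have "N n \<le> r n" for n
    unfolding r_def by (intro trans_le_add2 member_le_sum) auto
  moreover have "r n \<le> r (Suc n)" for n by (simp add: r_def)
  ultimately show ?thesis
    using N by (meson less_imp_le order_trans)
qed

text \<open>The weight 2^n forces the increments below a multiple of 2^(-n/2), hence into absolute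
  convergence. It is still affordable for a sequence in L^2 whose successive distances are at most
  2^(-n), as the weighted squares then sum to at most that of 2^(-n).\<close>

lemma convergent_if_weighted_squares_summable:
  fixes u :: "nat \<Rightarrow> complex"
  assumes "(\<Sum>n. ennreal (2 ^ n * (cmod (u (Suc n) - u n))\<^sup>2)) \<noteq> \<infinity>"
  shows "convergent u"
proof -
  define f where "f n = ennreal (2 ^ n * (cmod (u (Suc n) - u n))\<^sup>2)" for n
  define S where "S = enn2real (suminf f)"
  have "suminf f < top" using assms unfolding f_def[symmetric] by (simp add: less_top)
  then have S: "suminf f = ennreal S" "0 \<le> S" by (simp_all add: S_def)
  have le: "cmod (u (Suc n) - u n) \<le> sqrt S * (1 / sqrt 2) ^ n" for n
  proof -
    have "f n \<le> ennreal S"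
      unfolding S(1)[symmetric] using sum_le_suminf[of f "{n}"] by simp
    then have "ennreal (2 ^ n * (cmod (u (Suc n) - u n))\<^sup>2) \<le> ennreal S"
      by (simp only: f_def)
    then have "2 ^ n * (cmod (u (Suc n) - u n))\<^sup>2 \<le> S"
      using S(2) by (simp add: ennreal_le_iff)
    then have "(cmod (u (Suc n) - u n))\<^sup>2 \<le> S / 2 ^ n" by (simp add: field_simps)
    also have "\<dots> = (sqrt S * (1 / sqrt 2) ^ n)\<^sup>2"
      using S(2) by (simp add: power_mult_distrib power_divide real_sqrt_power[symmetric])
    finally show ?thesis
      by (rule power2_le_imp_le) (use S(2) in simp)
  qed
  have "summable (\<lambda>n. sqrt S * (1 / sqrt 2) ^ n)"
    by (intro summable_mult summable_geometric) simp
  then have "summable (\<lambda>n. u (Suc n) - u n)"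
    by (rule summable_comparison_test'[where N = 0]) (use le in simp)
  then have "convergent (\<lambda>n. \<Sum>i<n. u (Suc i) - u i)"
    by (simp add: summable_iff_convergent)
  then have "convergent (\<lambda>n. u n - u 0)"
    by (simp only: sum_lessThan_telescope)
  then have "convergent (\<lambda>n. (u n - u 0) + u 0)"
    by (intro convergent_add convergent_const)
  then show ?thesis by simp
qed

text \<open>Riesz-Fischer: a rapidly convergent subsequence has a limit almost everywhere, and
  Fatou's lemma turns it into a limit in norm.\<close>

instance l2 :: (euclidean_space) banach
proof
  fix X :: "nat \<Rightarrow> 'a l2"
  assume X: "Cauchy X"
  then obtain r where r: "strict_mono r" "\<And>n. norm (X (r (Suc n)) - X (r n)) \<le> (1 / 2) ^ n"
    using fast_Cauchy_subsequence by blast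
  define u where "u n = rep_l2 (X (r n))" for n
  have si: "square_integrable (u n)" for n
    by (simp add: u_def square_integrable_rep_l2)
  have Xu: "X (r n) = abs_l2 (u n)" for n
    by (simp add: u_def abs_rep_l2)
  have [measurable]: "u n \<in> borel_measurable lebesgue" for n
    using si by (simp add: square_integrable_def)
  have dist: "(\<integral>\<^sup>+ x. ennreal ((cmod (u m x - u n x))\<^sup>2) \<partial>lebesgue) = ennreal ((norm (X (r m) - X (r n)))\<^sup>2)" for m n
    unfolding Xu abs_l2_diff[OF si si] by (rule nn_integral_norm_abs_l2[OF square_integrable_diff[OF si si]])
  have "(\<integral>\<^sup>+ x. (\<Sum>n. ennreal (2 ^ n * (cmod (u (Suc n) x - u n x))\<^sup>2)) \<partial>lebesgue) =
      (\<Sum>n. \<integral>\<^sup>+ x. ennreal (2 ^ n * (cmod (u (Suc n) x - u n x))\<^sup>2) \<partial>lebesgue)"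
    by (rule nn_integral_suminf) measurable
  also have "\<dots> = (\<Sum>n. ennreal (2 ^ n * (norm (X (r (Suc n)) - X (r n)))\<^sup>2))"
    by (simp add: ennreal_mult nn_integral_cmult dist)
  also have "\<dots> \<le> (\<Sum>n. ennreal ((1 / 2) ^ n))"
  proof (intro suminf_le ennreal_leI summableI)
    fix n
    have "2 ^ n * (norm (X (r (Suc n)) - X (r n)))\<^sup>2 \<le> 2 ^ n * ((1 / 2) ^ n)\<^sup>2"
      by (intro mult_left_mono power_mono r) auto
    also have "\<dots> = (1 / 2) ^ n"
      by (simp add: power2_eq_square power_divide)
    finally show "2 ^ n * (norm (X (r (Suc n)) - X (r n)))\<^sup>2 \<le> (1 / 2) ^ n" .
  qed
  also have "\<dots> < \<infinity>"
    by (subst suminf_ennreal2[OF _ summable_geometric]) auto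
  finally have "(\<integral>\<^sup>+ x. (\<Sum>n. ennreal (2 ^ n * (cmod (u (Suc n) x - u n x))\<^sup>2)) \<partial>lebesgue) \<noteq> \<infinity>"
    by simp
  then have "AE x in lebesgue. (\<Sum>n. ennreal (2 ^ n * (cmod (u (Suc n) x - u n x))\<^sup>2)) \<noteq> \<infinity>"
    by (intro nn_integral_PInf_AE) measurable
  then have conv: "AE x in lebesgue. (\<lambda>n. u n x) \<longlonglongrightarrow> lim (\<lambda>n. u n x)"
    by eventually_elim
      (rule convergent_LIMSEQ_iff[THEN iffD1, OF convergent_if_weighted_squares_summable])
  define \<phi> where "\<phi> x = lim (\<lambda>n. u n x)" for x
  have [measurable]: "\<phi> \<in> borel_measurable lebesgue"
    unfolding \<phi>_def by measurable
  have fatou: "(\<integral>\<^sup>+ x. ennreal ((cmod (\<phi> x - u n x))\<^sup>2) \<partial>lebesgue) \<le> ennreal (e\<^sup>2)"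
    if e: "\<And>m. n \<le> m \<Longrightarrow> norm (X (r m) - X (r n)) \<le> e" for n e
  proof -
    have "(\<integral>\<^sup>+ x. ennreal ((cmod (\<phi> x - u n x))\<^sup>2) \<partial>lebesgue) =
        (\<integral>\<^sup>+ x. liminf (\<lambda>m. ennreal ((cmod (u m x - u n x))\<^sup>2)) \<partial>lebesgue)"
    proof (rule nn_integral_cong_AE)
      show "AE x in lebesgue. ennreal ((cmod (\<phi> x - u n x))\<^sup>2) =
          liminf (\<lambda>m. ennreal ((cmod (u m x - u n x))\<^sup>2))"
        using conv
      proof eventually_elim
        case (elim x)
        have "(\<lambda>m. ennreal ((cmod (u m x - u n x))\<^sup>2)) \<longlonglongrightarrow> ennreal ((cmod (\<phi> x - u n x))\<^sup>2)"
          unfolding \<phi>_def by (intro tendsto_ennrealI tendsto_intros elim)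
        then show ?case by (intro lim_imp_Liminf[symmetric]) auto
      qed
    qed
    also have "\<dots> \<le> liminf (\<lambda>m. \<integral>\<^sup>+ x. ennreal ((cmod (u m x - u n x))\<^sup>2) \<partial>lebesgue)"
      by (rule nn_integral_liminf) measurable
    also have "\<dots> \<le> liminf (\<lambda>m::nat. ennreal (e\<^sup>2))"
    proof (rule Liminf_mono)
      show "\<forall>\<^sub>F m in sequentially. (\<integral>\<^sup>+ x. ennreal ((cmod (u m x - u n x))\<^sup>2) \<partial>lebesgue) \<le> ennreal (e\<^sup>2)"
        unfolding dist
        by (rule eventually_mono[OF eventually_ge_at_top[of n]]) (auto intro!: ennreal_leI power_mono e)
    qed
    also have "\<dots> = ennreal (e\<^sup>2)" by (simp add: Liminf_const)
    finally show ?thesis .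
  qed
  have sid: "square_integrable (\<lambda>x. \<phi> x - u n x)" if "\<And>m. n \<le> m \<Longrightarrow> norm (X (r m) - X (r n)) \<le> e" for n e
    unfolding square_integrable_def
  proof
    show "integrable lebesgue (\<lambda>x. (cmod (\<phi> x - u n x))\<^sup>2)"
      using fatou[OF that] by (intro integrableI_nonneg) (auto simp: less_top[symmetric] top_unique)
  qed measurable
  have XrC: "\<exists>N. \<forall>n\<ge>N. \<forall>m\<ge>n. norm (X (r m) - X (r n)) \<le> e" if "0 < e" for e
  proof -
    obtain N where N: "\<forall>i\<ge>N. \<forall>j\<ge>N. norm (X i - X j) < e"
      using X[unfolded Cauchy_iff, rule_format, OF \<open>0 < e\<close>] by blast
    have "norm (X (r m) - X (r n)) \<le> e" if "N \<le> n" "n \<le> m" for n m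
      using N that seq_suble[OF r(1), of n] seq_suble[OF r(1), of m] by (simp add: less_imp_le)
    then show ?thesis by blast
  qed
  obtain n0 where n0: "\<forall>n\<ge>n0. \<forall>m\<ge>n. norm (X (r m) - X (r n)) \<le> 1"
    using XrC[of 1] by auto
  have "norm (X (r m) - X (r n0)) \<le> 1" if "n0 \<le> m" for m
    using n0 that by simp
  then have "square_integrable (\<lambda>x. (\<phi> x - u n0 x) + u n0 x)"
    by (intro square_integrable_add sid si)
  then have phi: "square_integrable \<phi>" by simp
  have "(X \<circ> r) \<longlonglongrightarrow> abs_l2 \<phi>"
  proof (rule LIMSEQ_I)
    fix e :: real assume "0 < e"
    then obtain N where N: "\<And>n m. N \<le> n \<Longrightarrow> n \<le> m \<Longrightarrow> norm (X (r m) - X (r n)) \<le> e / 2"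
      using XrC[of "e / 2"] by (metis half_gt_zero)
    have "norm ((X \<circ> r) n - abs_l2 \<phi>) < e" if "N \<le> n" for n
    proof -
      have "ennreal ((norm (abs_l2 \<phi> - abs_l2 (u n)))\<^sup>2) \<le> ennreal ((e / 2)\<^sup>2)"
        unfolding abs_l2_diff[OF phi si]
        using fatou[OF N[OF that]] nn_integral_norm_abs_l2[OF square_integrable_diff[OF phi si]] by simp
      then have "(norm (abs_l2 \<phi> - abs_l2 (u n)))\<^sup>2 \<le> (e / 2)\<^sup>2" by simp
      then have "norm (abs_l2 \<phi> - abs_l2 (u n)) \<le> e / 2"
        by (rule power2_le_imp_le) (use \<open>0 < e\<close> in simp)
      then show ?thesis using \<open>0 < e\<close> by (simp add: Xu norm_minus_commute)
    qed
    then show "\<exists>N. \<forall>n\<ge>N. norm ((X \<circ> r) n - abs_l2 \<phi>) < e" by blast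
  qed
  then have "X \<longlonglongrightarrow> abs_l2 \<phi>"
    by (rule Cauchy_converges_subseq[OF X r(1)])
  then show "convergent X" by (auto simp: convergent_def)
qed

section \<open>Complex scalars and the action of matrices on quadruples\<close>

lemma scaleC_zero_left [simp]: "0 *\<^sub>C x = (0 :: 'a::scaleC)"
  using scaleC_of_real[of 0 x] by simp

lemma scaleC_one [simp]: "1 *\<^sub>C x = (x :: 'a::scaleC)"
  using scaleC_of_real[of 1 x] by simp

lemma scaleC_zero_right [simp]: "k *\<^sub>C 0 = (0 :: 'a::scaleC)"
  using scaleC_scaleC[of k 0 0] by simp

lemma scaleC_minus_left: "(- k) *\<^sub>C x = - (k *\<^sub>C (x :: 'a::scaleC))"
  using scaleC_add_left[of k "- k" x] by (simp add: eq_neg_iff_add_eq_0 add.commute)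

lemma scaleC_minus_right: "k *\<^sub>C (- x) = - (k *\<^sub>C (x :: 'a::scaleC))"
  using scaleC_add_right[of k x "- x"] by (simp add: eq_neg_iff_add_eq_0 add.commute)

lemma scaleC_diff_left: "(j - k) *\<^sub>C x = j *\<^sub>C x - k *\<^sub>C (x :: 'a::scaleC)"
  using scaleC_add_left[of j "- k" x] by (simp add: scaleC_minus_left)

lemma scaleR_scaleC_left: "(r *\<^sub>R k) *\<^sub>C x = r *\<^sub>R (k *\<^sub>C (x :: 'a::scaleC))"
  by (simp add: scaleR_conv_of_real scaleC_scaleC[symmetric] scaleC_of_real)

lemma scaleC_scaleR: "k *\<^sub>C (r *\<^sub>R x) = r *\<^sub>R (k *\<^sub>C (x :: 'a::scaleC))"
  by (simp add: scaleC_of_real[symmetric] scaleC_scaleC mult.commute)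

text \<open>The tensor product of a vector of C^4 with \<open>x\<close>; a matrix acts on it through
  the first factor only.\<close>

definition vscale :: "cvec \<Rightarrow> 'b::scaleC \<Rightarrow> 'b \<times> 'b \<times> 'b \<times> 'b" where
  "vscale = (\<lambda>(c1, c2, c3, c4) x. (c1 *\<^sub>C x, c2 *\<^sub>C x, c3 *\<^sub>C x, c4 *\<^sub>C x))"

text \<open>The matrix of a complex linear map, applied to quadruples over any complex vector space.\<close>

definition lift_op :: "cvec bop \<Rightarrow> 'b::scaleC \<times> 'b \<times> 'b \<times> 'b \<Rightarrow> 'b \<times> 'b \<times> 'b \<times> 'b" where
  "lift_op T = (\<lambda>(x1, x2, x3, x4).
     vscale (bop_apply T (1, 0, 0, 0)) x1 + vscale (bop_apply T (0, 1, 0, 0)) x2 +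
     vscale (bop_apply T (0, 0, 1, 0)) x3 + vscale (bop_apply T (0, 0, 0, 1)) x4)"

lemma vscale_simps:
  "vscale (c + d) x = vscale c x + vscale d x"
  "vscale (c - d) x = vscale c x - vscale d x"
  "vscale (r *\<^sub>R c) x = r *\<^sub>R vscale c x"
  "vscale c (x + y) = vscale c x + vscale c y"
  "vscale c (k *\<^sub>C x) = k *\<^sub>C vscale c x"
  by (cases c; cases d; simp add: vscale_def scaleC_add_left scaleC_add_right scaleC_diff_left
      scaleR_scaleC_left scaleC_quad scaleC_scaleC mult.commute)+

lemma lift_op_add: "lift_op T (x + y) = lift_op T x + lift_op T y"
  by (cases x; cases y) (simp add: lift_op_def vscale_simps)

lemma lift_op_scaleC: "lift_op T (k *\<^sub>C x) = k *\<^sub>C lift_op T x"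
  by (cases x) (simp add: lift_op_def vscale_simps scaleC_quad scaleC_add_right)

lemma lift_op_plus: "lift_op (S + T) x = lift_op S x + lift_op T x"
  by (cases x) (simp add: lift_op_def vscale_simps)

lemma lift_op_minus: "lift_op (S - T) x = lift_op S x - lift_op T x"
  by (cases x) (simp add: lift_op_def vscale_simps)

lemma lift_op_scaleR: "lift_op (r *\<^sub>R T) x = r *\<^sub>R lift_op T x"
  by (cases x) (simp add: lift_op_def vscale_simps scaleR_add_right)

lemma lift_op_cop: "lift_op (cop k) x = k *\<^sub>C x"
  by (cases x) (simp add: lift_op_def vscale_def scaleC_quad scaleC_complex_def)

lemma lift_op_1: "lift_op 1 x = x"
  using lift_op_cop[of 1 x] by (simp add: cop_1)

lemma cvec_basis_expansion:
  "(c1, c2, c3, c4) = c1 *\<^sub>C (1, 0, 0, 0) + c2 *\<^sub>C (0, 1, 0, 0) + c3 *\<^sub>C (0, 0, 1, 0) + c4 *\<^sub>C ((0, 0, 0, 1) :: cvec)"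
  by (simp add: scaleC_quad scaleC_complex_def)

text \<open>\<open>lift_op\<close> sees only the images of the four complex basis vectors, so it
  reproduces the action of \<open>S\<close> on all of C^4 precisely through complex linearity. This
  is why products are lifted under the assumption \<open>clinear_op\<close>.\<close>

lemma lift_op_vscale:
  assumes "clinear_op S"
  shows "lift_op S (vscale c x) = vscale (bop_apply S c) x"
proof -
  have sc: "vscale (k *\<^sub>C d) x = vscale d (k *\<^sub>C x)" for k d
    by (cases d) (simp add: vscale_def scaleC_quad scaleC_complex_def scaleC_scaleC mult.commute)
  obtain c1 c2 c3 c4 where c: "c = (c1, c2, c3, c4)" by (cases c)
  have "bop_apply S c = c1 *\<^sub>C bop_apply S (1, 0, 0, 0) + c2 *\<^sub>C bop_apply S (0, 1, 0, 0) +
      c3 *\<^sub>C bop_apply S (0, 0, 1, 0) + c4 *\<^sub>C bop_apply S (0, 0, 0, 1)"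
    by (simp only: c cvec_basis_expansion[of c1] bop_apply_linear clinear_op_apply[OF assms])
  then show ?thesis
    by (simp add: vscale_simps(1) sc c lift_op_def) (simp add: vscale_def)
qed

lemma lift_op_mult:
  assumes "clinear_op S" shows "lift_op (S * T) x = lift_op S (lift_op T x)"
proof -
  obtain x1 x2 x3 x4 where x: "x = (x1, x2, x3, x4)" by (cases x)
  have "lift_op S (lift_op T x) =
     lift_op S (vscale (bop_apply T (1, 0, 0, 0)) x1) + lift_op S (vscale (bop_apply T (0, 1, 0, 0)) x2) +
     lift_op S (vscale (bop_apply T (0, 0, 1, 0)) x3) + lift_op S (vscale (bop_apply T (0, 0, 0, 1)) x4)"
    unfolding x by (subst (2) lift_op_def) (simp only: lift_op_add split_conv prod.case)
  also have "\<dots> = lift_op (S * T) x"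
    unfolding lift_op_vscale[OF assms] x by (simp add: lift_op_def)
  finally show ?thesis ..
qed

lemma lift_op_fibre_op:
  "lift_op (fibre_op a b g d) (p, q, r, z) =
     (a *\<^sub>R r, b *\<^sub>R z, - (a *\<^sub>R p) - g *\<^sub>R z, - (b *\<^sub>R q) + g *\<^sub>R r - d *\<^sub>R z)"
  by (simp add: lift_op_def vscale_def scaleC_minus_left scaleC_of_real scaleR_conv_of_real)

definition csubspace :: "'a::scaleC set \<Rightarrow> bool" where
  "csubspace V \<longleftrightarrow> 0 \<in> V \<and> (\<forall>x\<in>V. \<forall>y\<in>V. x + y \<in> V) \<and> (\<forall>k. \<forall>x\<in>V. k *\<^sub>C x \<in> V)"

lemma csubspaceD:
  assumes "csubspace V"
  shows "0 \<in> V" "x \<in> V \<Longrightarrow> y \<in> V \<Longrightarrow> x + y \<in> V" "x \<in> V \<Longrightarrow> k *\<^sub>C x \<in> V" "x \<in> V \<Longrightarrow> r *\<^sub>R x \<in> V"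
    "x \<in> V \<Longrightarrow> - x \<in> V" "x \<in> V \<Longrightarrow> y \<in> V \<Longrightarrow> x - y \<in> V"
proof -
  show 1: "0 \<in> V" "\<And>x y. x \<in> V \<Longrightarrow> y \<in> V \<Longrightarrow> x + y \<in> V" "\<And>x k. x \<in> V \<Longrightarrow> k *\<^sub>C x \<in> V"
    using assms by (auto simp: csubspace_def)
  show "r *\<^sub>R x \<in> V" if "x \<in> V" for r x
    using 1(3)[OF that, of "complex_of_real r"] by (simp add: scaleC_of_real)
  show m: "- x \<in> V" if "x \<in> V" for x
    using 1(3)[OF that, of "- 1"] by (simp add: scaleC_minus_left)
  show "x - y \<in> V" if "x \<in> V" "y \<in> V" for x y
    using 1(2)[OF that(1) m[OF that(2)]] by simp
qed

lemma csubspace_Times: "csubspace V \<Longrightarrow> csubspace W \<Longrightarrow> csubspace (V \<times> W)"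
  by (auto simp: csubspace_def scaleC_prod_def zero_prod_def)

lemma lift_op_mem:
  assumes V: "csubspace V" and x: "x \<in> V \<times> V \<times> V \<times> V"
  shows "lift_op T x \<in> V \<times> V \<times> V \<times> V"
proof -
  have vs: "vscale c y \<in> V \<times> V \<times> V \<times> V" if "y \<in> V" for c y
    using csubspaceD(3)[OF V that] by (cases c) (simp add: vscale_def)
  have "csubspace (V \<times> V \<times> V \<times> V)" by (intro csubspace_Times V)
  note add = csubspaceD(2)[OF this]
  show ?thesis using x by (auto simp only: lift_op_def split: prod.splits intro!: add vs)
qed

text \<open>The operator is applied pointwise to the vector of function values in C^4, and the
  pointwise inequality is integrated; in this way the norm does not increase, whereas estimating the
  four columns separately would lose a factor.\<close>

lemma norm_lift_op:
  fixes x :: "'a::euclidean_space state"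
  assumes T: "clinear_op T"
  shows "norm (lift_op T x) \<le> norm T * norm x"
proof -
  obtain x1 x2 x3 x4 where x: "x = (x1, x2, x3, x4)" by (cases x)
  obtain f1 f2 f3 f4 where f: "square_integrable f1" "x1 = abs_l2 f1" "square_integrable f2" "x2 = abs_l2 f2"
    "square_integrable f3" "x3 = abs_l2 f3" "square_integrable f4" "x4 = abs_l2 f4"
    by (metis l2_cases)
  define f where "f \<xi> = (f1 \<xi>, f2 \<xi>, f3 \<xi>, f4 \<xi>)" for \<xi>
  define g where "g \<xi> = bop_apply T (f \<xi>)" for \<xi>
  have g: "g \<xi> = f1 \<xi> *\<^sub>C bop_apply T (1, 0, 0, 0) + f2 \<xi> *\<^sub>C bop_apply T (0, 1, 0, 0) +
      f3 \<xi> *\<^sub>C bop_apply T (0, 0, 1, 0) + f4 \<xi> *\<^sub>C bop_apply T (0, 0, 0, 1)" for \<xi>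
    by (simp only: g_def f_def cvec_basis_expansion[of "f1 \<xi>"] bop_apply_linear clinear_op_apply[OF T])
  have comb: "c1 *\<^sub>C abs_l2 f1 + c2 *\<^sub>C abs_l2 f2 + c3 *\<^sub>C abs_l2 f3 + c4 *\<^sub>C abs_l2 f4 =
      abs_l2 (\<lambda>\<xi>. f1 \<xi> * c1 + f2 \<xi> * c2 + f3 \<xi> * c3 + f4 \<xi> * c4)"
    "square_integrable (\<lambda>\<xi>. f1 \<xi> * c1 + f2 \<xi> * c2 + f3 \<xi> * c3 + f4 \<xi> * c4)" for c1 c2 c3 c4
    using f by (simp_all add: abs_l2_scaleC abs_l2_plus square_integrable_cmult square_integrable_add mult.commute)
  define g1 g2 g3 g4 where "g1 \<xi> = fst (g \<xi>)" and "g2 \<xi> = fst (snd (g \<xi>))" and "g3 \<xi> = fst (snd (snd (g \<xi>)))"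
    and "g4 \<xi> = snd (snd (snd (g \<xi>)))" for \<xi>
  obtain a1 a2 a3 a4 b1 b2 b3 b4 c1 c2 c3 c4 d1 d2 d3 d4 where
    e: "bop_apply T (1, 0, 0, 0) = (a1, a2, a3, a4)" "bop_apply T (0, 1, 0, 0) = (b1, b2, b3, b4)"
      "bop_apply T (0, 0, 1, 0) = (c1, c2, c3, c4)" "bop_apply T (0, 0, 0, 1) = (d1, d2, d3, d4)"
    by (metis prod.collapse)
  have lift: "lift_op T x = (abs_l2 g1, abs_l2 g2, abs_l2 g3, abs_l2 g4)"
    and si: "square_integrable g1" "square_integrable g2" "square_integrable g3" "square_integrable g4"
    unfolding g1_def[abs_def] g2_def[abs_def] g3_def[abs_def] g4_def[abs_def] g e
    by (simp_all add: lift_op_def x e f(2,4,6,8) vscale_def comb scaleC_quad scaleC_complex_def)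
  have int: "integrable lebesgue (\<lambda>\<xi>. (cmod (h \<xi>))\<^sup>2)" if "square_integrable h" for h :: "'a \<Rightarrow> complex"
    using that by (simp add: square_integrable_def)
  have sum4: "(norm (abs_l2 h1, abs_l2 h2, abs_l2 h3, abs_l2 h4))\<^sup>2 =
      (LINT \<xi>|lebesgue. (norm (h1 \<xi>, h2 \<xi>, h3 \<xi>, h4 \<xi>))\<^sup>2)"
    "integrable lebesgue (\<lambda>\<xi>. (norm (h1 \<xi>, h2 \<xi>, h3 \<xi>, h4 \<xi>))\<^sup>2)"
    if "square_integrable h1" "square_integrable h2" "square_integrable h3" "square_integrable h4"
    for h1 h2 h3 h4 :: "'a \<Rightarrow> complex"
    using that int by (simp_all add: norm_quad norm_abs_l2)
  have "(norm (lift_op T x))\<^sup>2 = (LINT \<xi>|lebesgue. (norm (g \<xi>))\<^sup>2)"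
    unfolding lift using sum4(1)[OF si] by (simp add: g1_def g2_def g3_def g4_def)
  also have "\<dots> \<le> (LINT \<xi>|lebesgue. (norm T)\<^sup>2 * (norm (f \<xi>))\<^sup>2)"
  proof (rule integral_mono)
    show "integrable lebesgue (\<lambda>\<xi>. (norm (g \<xi>))\<^sup>2)"
      using sum4(2)[OF si] by (simp add: g1_def g2_def g3_def g4_def)
    show "integrable lebesgue (\<lambda>\<xi>. (norm T)\<^sup>2 * (norm (f \<xi>))\<^sup>2)"
      using sum4(2)[OF f(1,3,5,7)] by (simp add: f_def)
    show "(norm (g \<xi>))\<^sup>2 \<le> (norm T)\<^sup>2 * (norm (f \<xi>))\<^sup>2" for \<xi>
      unfolding power_mult_distrib[symmetric] g_def by (intro power_mono norm_bop_apply) simp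
  qed
  also have "\<dots> = (norm T * norm x)\<^sup>2"
    using sum4(1)[OF f(1,3,5,7)] by (simp add: f_def x f(2,4,6,8) power_mult_distrib)
  finally show ?thesis
    by (rule power2_le_imp_le) simp
qed

section \<open>Test functions\<close>

lemma integrable_lborel_continuous_compact_support:
  fixes f :: "'a::euclidean_space \<Rightarrow> 'b::{banach,second_countable_topology}"
  assumes cont: "continuous_on UNIV f" and K: "compact K" and supp: "\<And>x. x \<notin> K \<Longrightarrow> f x = 0"
  shows "integrable lborel f"
proof -
  have "integrable lborel (\<lambda>x. indicator K x *\<^sub>R f x)"
    by (rule borel_integrable_compact[OF K continuous_on_subset[OF cont]]) auto
  moreover have "(\<lambda>x. indicator K x *\<^sub>R f x) = f"
    using supp by (auto simp: fun_eq_iff indicator_def)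
  ultimately show ?thesis by simp
qed

text \<open>Translation invariance of the integral, differentiated at zero.\<close>

lemma integral_directional_derivative_eq_0:
  fixes \<psi> :: "'a::euclidean_space \<Rightarrow> real"
  assumes D: "\<And>x. (\<psi> has_derivative D x) (at x)" and cont: "continuous_on UNIV (\<lambda>x. D x i)"
    and K: "compact K" and supp: "\<And>x. x \<notin> K \<Longrightarrow> \<psi> x = 0"
  shows "(LINT x|lborel. D x i) = 0"
proof -
  have cont_psi: "continuous_on UNIV \<psi>"
    using D has_derivative_continuous continuous_at_imp_continuous_on by blast
  have [measurable]: "\<psi> \<in> borel_measurable borel" "(\<lambda>x. D x i) \<in> borel_measurable borel"
    using cont_psi cont by (auto intro: borel_measurable_continuous_onI)
  have int_psi: "integrable lborel \<psi>"
    by (rule integrable_lborel_continuous_compact_support[OF cont_psi K supp])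
  have suppD: "D x i = 0" if "x \<notin> K" for x
  proof -
    have "open (- K)" using K by (simp add: compact_imp_closed open_Compl)
    then have "(\<psi> has_derivative (\<lambda>_. 0)) (at x)"
      using that supp by (intro has_derivative_transform_within_open[OF has_derivative_const[of 0], of "- K"]) auto
    then show ?thesis using has_derivative_unique[OF D] by metis
  qed
  obtain B where B: "\<And>x. \<bar>D x i\<bar> \<le> B" "0 \<le> B"
  proof -
    have "bounded ((\<lambda>x. D x i) ` K)"
      using K cont by (intro compact_imp_bounded compact_continuous_image) (auto intro: continuous_on_subset)
    then obtain B where "\<And>x. x \<in> K \<Longrightarrow> \<bar>D x i\<bar> \<le> B" by (auto simp: bounded_iff)
    then have "\<bar>D x i\<bar> \<le> max B 0" for x
      using suppD[of x] by (cases "x \<in> K") (auto simp: le_max_iff_disj)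
    then show thesis using that[of "max B 0"] by simp
  qed
  obtain \<rho> where \<rho>: "\<And>x. x \<in> K \<Longrightarrow> norm x \<le> \<rho>"
    using compact_imp_bounded[OF K] by (auto simp: bounded_iff)
  define h where "h n = 1 / real (Suc n)" for n
  have h: "0 < h n" "h n \<le> 1" for n by (auto simp: h_def)
  have line: "((\<lambda>s. \<psi> (x + s *\<^sub>R i)) has_real_derivative D (x + s *\<^sub>R i) i) (at s)" for x s
  proof -
    have "((\<lambda>s. x + s *\<^sub>R i) has_derivative (\<lambda>s. s *\<^sub>R i)) (at s)"
      by (auto intro!: derivative_eq_intros)
    from has_derivative_compose[OF this D]
    have "((\<lambda>s. \<psi> (x + s *\<^sub>R i)) has_derivative (\<lambda>s'. D (x + s *\<^sub>R i) (s' *\<^sub>R i))) (at s)" .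
    moreover have "D (x + s *\<^sub>R i) (s' *\<^sub>R i) = D (x + s *\<^sub>R i) i * s'" for s'
      using linear_scale[OF has_derivative_linear[OF D]] by simp
    ultimately show ?thesis by (simp add: has_field_derivative_def)
  qed
  have quot_le: "\<bar>(\<psi> (x + h n *\<^sub>R i) - \<psi> x) / h n\<bar> \<le> B" for x n
  proof -
    obtain z where "\<psi> (x + h n *\<^sub>R i) - \<psi> (x + 0 *\<^sub>R i) = (h n - 0) * D (x + z *\<^sub>R i) i"
      using MVT2[of 0 "h n" "\<lambda>s. \<psi> (x + s *\<^sub>R i)" "\<lambda>s. D (x + s *\<^sub>R i) i"] line h[of n] by blast
    then show ?thesis using B(1)[of "x + z *\<^sub>R i"] h[of n] by simp
  qed
  \<comment> \<open>For steps at most 1 all difference quotients vanish outside one ball; together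
    with the bound from the mean value theorem this gives an integrable majorant.\<close>
  have quot_supp: "(\<psi> (x + h n *\<^sub>R i) - \<psi> x) / h n = 0" if "x \<notin> cball 0 (\<rho> + norm i)" for x n
  proof -
    have "x \<notin> K" using \<rho>[of x] that norm_ge_zero[of i] by (auto simp del: norm_ge_zero)
    moreover have "x + h n *\<^sub>R i \<notin> K"
    proof
      assume "x + h n *\<^sub>R i \<in> K"
      moreover have "norm x \<le> norm (x + h n *\<^sub>R i) + norm (h n *\<^sub>R i)"
        using norm_triangle_ineq4[of "x + h n *\<^sub>R i" "h n *\<^sub>R i"] by simp
      moreover have "norm (h n *\<^sub>R i) \<le> norm i"
        using h[of n] by (simp add: mult_left_le_one_le)
      ultimately show False using \<rho>[of "x + h n *\<^sub>R i"] that by simp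
    qed
    ultimately show ?thesis using supp by simp
  qed
  have "(\<lambda>n. LINT x|lborel. (\<psi> (x + h n *\<^sub>R i) - \<psi> x) / h n) \<longlonglongrightarrow> (LINT x|lborel. D x i)"
  proof (rule integral_dominated_convergence[where w = "\<lambda>x. B * indicator (cball 0 (\<rho> + norm i)) x"])
    have h0: "h \<longlonglongrightarrow> 0" unfolding h_def[abs_def] by (rule LIMSEQ_Suc[OF lim_1_over_n])
    show "AE x in lborel. (\<lambda>n. (\<psi> (x + h n *\<^sub>R i) - \<psi> x) / h n) \<longlonglongrightarrow> D x i"
    proof (rule AE_I2)
      fix x
      have "((\<lambda>s. (\<psi> (x + (0 + s) *\<^sub>R i) - \<psi> (x + 0 *\<^sub>R i)) / s) \<longlongrightarrow> D (x + 0 *\<^sub>R i) i) (at 0)"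
        using line[of x 0] unfolding DERIV_def .
      then have "((\<lambda>s. (\<psi> (x + s *\<^sub>R i) - \<psi> x) / s) \<longlongrightarrow> D x i) (at 0)" by simp
      moreover have "filterlim h (at 0) sequentially"
        using h0 h by (auto simp: filterlim_at less_imp_neq[symmetric] intro!: always_eventually)
      ultimately show "(\<lambda>n. (\<psi> (x + h n *\<^sub>R i) - \<psi> x) / h n) \<longlonglongrightarrow> D x i"
        by (rule filterlim_compose)
    qed
    show "AE x in lborel. norm ((\<psi> (x + h n *\<^sub>R i) - \<psi> x) / h n) \<le> B * indicator (cball 0 (\<rho> + norm i)) x" for n
    proof (rule AE_I2)
      fix x show "norm ((\<psi> (x + h n *\<^sub>R i) - \<psi> x) / h n) \<le> B * indicator (cball 0 (\<rho> + norm i)) x"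
        using quot_le[of x n] quot_supp[of x n] by (cases "x \<in> cball 0 (\<rho> + norm i)") auto
    qed
    show "integrable lborel (\<lambda>x. B * indicator (cball 0 (\<rho> + norm i)) x)"
      by (intro integrable_mult_right integrable_real_indicator)
        (use emeasure_compact_finite[OF compact_cball, of 0 "\<rho> + norm i"] in auto)
  qed auto
  moreover have "(LINT x|lborel. (\<psi> (x + h n *\<^sub>R i) - \<psi> x) / h n) = 0" for n
  proof -
    have "(LINT x|lborel. \<psi> (x + h n *\<^sub>R i)) = (LINT x|distr lborel borel ((+) (h n *\<^sub>R i)). \<psi> x)"
      by (subst integral_distr) (auto simp: add.commute)
    then have eq: "(LINT x|lborel. \<psi> (x + h n *\<^sub>R i)) = (LINT x|lborel. \<psi> x)"
      by (simp add: lborel_distr_plus)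
    have "integrable (distr lborel borel ((+) (h n *\<^sub>R i))) \<psi>"
      using int_psi by (simp add: lborel_distr_plus)
    then have "integrable lborel (\<lambda>x. \<psi> (x + h n *\<^sub>R i))"
      by (subst (asm) integrable_distr_eq) (auto simp: add.commute)
    then show ?thesis using int_psi eq by simp
  qed
  ultimately have "(\<lambda>n::nat. 0) \<longlonglongrightarrow> (LINT x|lborel. D x i)"
    by (simp only:)
  from LIMSEQ_unique[OF this tendsto_const] show ?thesis .
qed

section \<open>Calculus of test functions\<close>

lemma partial_eq:
  assumes "(f has_derivative f') (at x)" shows "partial i f x = f' i"
  unfolding partial_def frechet_derivative_at[OF assms, symmetric] ..

lemma partial_bounded_linear:
  assumes "bounded_linear L" "f differentiable (at x)"
  shows "partial i (\<lambda>x. L (f x)) x = L (partial i f x)" "(\<lambda>x. L (f x)) differentiable (at x)"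
proof -
  have "(f has_derivative frechet_derivative f (at x)) (at x)"
    using assms(2) frechet_derivative_works by blast
  note h = bounded_linear.has_derivative[OF assms(1) this]
  show "partial i (\<lambda>x. L (f x)) x = L (partial i f x)"
    using partial_eq[OF h, of i] by (simp add: partial_def)
  show "(\<lambda>x. L (f x)) differentiable (at x)"
    using h by (auto simp: differentiable_def)
qed

lemma partial_add:
  assumes "f differentiable (at x)" "g differentiable (at x)"
  shows "partial i (\<lambda>x. f x + g x) x = partial i f x + partial i g x"
    "(\<lambda>x. f x + g x) differentiable (at x)"
proof -
  note h = has_derivative_add[OF assms[unfolded frechet_derivative_works]]
  show "partial i (\<lambda>x. f x + g x) x = partial i f x + partial i g x"
    using partial_eq[OF h, of i] by (simp add: partial_def)
  show "(\<lambda>x. f x + g x) differentiable (at x)"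
    using h by (auto simp: differentiable_def)
qed

lemma Ck_on_bounded_linear:
  assumes L: "bounded_linear L"
  shows "Ck_on k UNIV f \<Longrightarrow> Ck_on k UNIV (\<lambda>x. L (f x))"
proof (induction k arbitrary: f)
  case 0
  then show ?case using bounded_linear.continuous_on[OF L] by auto
next
  case (Suc k)
  have "partial i (\<lambda>x. L (f x)) = (\<lambda>x. L (partial i f x))" for i
    using Suc.prems by (intro ext partial_bounded_linear[OF L]) auto
  then show ?case using Suc by (auto intro!: partial_bounded_linear(2)[OF L])
qed

lemma Ck_on_add: "Ck_on k UNIV f \<Longrightarrow> Ck_on k UNIV g \<Longrightarrow> Ck_on k UNIV (\<lambda>x. f x + g x)"
proof (induction k arbitrary: f g)
  case 0
  then show ?case by (auto intro: continuous_on_add)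
next
  case (Suc k)
  have "partial i (\<lambda>x. f x + g x) = (\<lambda>x. partial i f x + partial i g x)" for i
    using Suc.prems by (intro ext partial_add) auto
  then show ?case using Suc by (auto intro!: partial_add(2))
qed

lemma test_functionE:
  assumes "\<phi> \<in> test_functions \<Omega>"
  obtains K where "compact K" "K \<subseteq> \<Omega>" "\<And>x. x \<notin> K \<Longrightarrow> \<phi> x = 0"
  using assms unfolding test_functions_def by blast

lemma test_function_differentiable:
  assumes "\<phi> \<in> test_functions \<Omega>" shows "\<phi> differentiable (at x)"
proof -
  have "Ck_on (Suc 0) UNIV \<phi>" using assms unfolding test_functions_def smooth_on_def by blast
  then show ?thesis by simp
qed

lemma test_function_continuous:
  assumes "\<phi> \<in> test_functions \<Omega>" shows "continuous_on UNIV \<phi>"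
proof -
  have "Ck_on 0 UNIV \<phi>" using assms unfolding test_functions_def smooth_on_def by blast
  then show ?thesis by simp
qed

lemma test_function_partial:
  assumes \<phi>: "\<phi> \<in> test_functions \<Omega>" and i: "i \<in> Basis"
  shows "partial i \<phi> \<in> test_functions \<Omega>"
proof -
  obtain K where K: "compact K" "K \<subseteq> \<Omega>" "\<And>x. x \<notin> K \<Longrightarrow> \<phi> x = 0"
    using test_functionE[OF \<phi>] by blast
  have "partial i \<phi> x = 0" if "x \<notin> K" for x
  proof -
    have "open (- K)" using K by (simp add: compact_imp_closed open_Compl)
    then have "(\<phi> has_derivative (\<lambda>_. 0)) (at x)"
      using that K(3) by (intro has_derivative_transform_within_open[OF has_derivative_const[of 0], of "- K"]) auto
    then show ?thesis by (simp add: partial_eq)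
  qed
  moreover have "smooth_on UNIV (partial i \<phi>)"
    unfolding smooth_on_def
  proof
    fix k
    have "Ck_on (Suc k) UNIV \<phi>" using \<phi> unfolding test_functions_def smooth_on_def by blast
    then show "Ck_on k UNIV (partial i \<phi>)" using i by simp
  qed
  ultimately show ?thesis using K by (auto simp: test_functions_def)
qed

lemma test_function_bounded_linear:
  assumes "bounded_linear L" "\<phi> \<in> test_functions \<Omega>"
  shows "(\<lambda>x. L (\<phi> x)) \<in> test_functions \<Omega>"
proof -
  obtain K where "compact K" "K \<subseteq> \<Omega>" "\<And>x. x \<notin> K \<Longrightarrow> \<phi> x = 0"
    using test_functionE[OF assms(2)] by blast
  moreover have "L 0 = 0" by (rule linear_0[OF bounded_linear.linear[OF assms(1)]])
  moreover have "smooth_on UNIV (\<lambda>x. L (\<phi> x))"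
    using assms unfolding test_functions_def smooth_on_def by (simp add: Ck_on_bounded_linear)
  ultimately show ?thesis unfolding test_functions_def by auto
qed

lemma test_function_add:
  assumes "\<phi> \<in> test_functions \<Omega>" "\<psi> \<in> test_functions \<Omega>"
  shows "(\<lambda>x. \<phi> x + \<psi> x) \<in> test_functions \<Omega>"
proof -
  obtain K where "compact K" "K \<subseteq> \<Omega>" "\<And>x. x \<notin> K \<Longrightarrow> \<phi> x = 0"
    using test_functionE[OF assms(1)] by blast
  moreover obtain L where "compact L" "L \<subseteq> \<Omega>" "\<And>x. x \<notin> L \<Longrightarrow> \<psi> x = 0"
    using test_functionE[OF assms(2)] by blast
  ultimately have "compact (K \<union> L)" "K \<union> L \<subseteq> \<Omega>" "\<And>x. x \<notin> K \<union> L \<Longrightarrow> \<phi> x + \<psi> x = 0" by auto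
  moreover have "smooth_on UNIV (\<lambda>x. \<phi> x + \<psi> x)"
    using assms by (auto simp: test_functions_def smooth_on_def Ck_on_add)
  ultimately show ?thesis unfolding test_functions_def by blast
qed

lemma test_function_zero: "(\<lambda>x. 0) \<in> test_functions (\<Omega> :: 'a::euclidean_space set)"
proof -
  have "Ck_on k UNIV (\<lambda>x::'a. 0 :: complex)" for k
  proof (induction k)
    case (Suc k)
    have "partial i (\<lambda>x::'a. 0 :: complex) = (\<lambda>x. 0)" for i
      by (intro ext partial_eq[where f' = "\<lambda>_. 0", simplified]) auto
    then show ?case using Suc by simp
  qed simp
  then show ?thesis by (auto simp: test_functions_def smooth_on_def intro!: exI[of _ "{}"])
qed

lemma test_function_square_integrable:
  assumes "\<phi> \<in> test_functions \<Omega>" shows "square_integrable \<phi>"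
proof -
  obtain K where K: "compact K" "K \<subseteq> \<Omega>" "\<And>x. x \<notin> K \<Longrightarrow> \<phi> x = 0"
    using test_functionE[OF assms] by blast
  have c: "continuous_on UNIV \<phi>" by (rule test_function_continuous[OF assms])
  then have m: "\<phi> \<in> borel_measurable borel" by (rule borel_measurable_continuous_onI)
  have "integrable lborel (\<lambda>x. (cmod (\<phi> x))\<^sup>2)"
    using K c by (intro integrable_lborel_continuous_compact_support[of _ K]) (auto intro!: continuous_intros)
  then have "integrable lebesgue (\<lambda>x. (cmod (\<phi> x))\<^sup>2)"
    using m by (subst integrable_completion) auto
  moreover have "\<phi> \<in> borel_measurable lebesgue"
    by (rule measurable_completion) (use m in simp)
  ultimately show ?thesis by (simp add: square_integrable_def)
qed

text \<open>Integrate the derivative of $x_i |\<phi>(x)|^2$ in direction $i$.\<close>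

lemma poincare_test_function:
  fixes \<Omega> :: "'a::euclidean_space set"
  assumes \<phi>: "\<phi> \<in> test_functions \<Omega>" and i: "i \<in> Basis" and R: "\<And>x. x \<in> \<Omega> \<Longrightarrow> norm x \<le> R" "0 < R"
  shows "(norm (abs_l2 \<phi>))\<^sup>2 \<le> 4 * R\<^sup>2 * (norm (abs_l2 (partial i \<phi>)))\<^sup>2"
proof -
  obtain K where K: "compact K" "K \<subseteq> \<Omega>" "\<And>x. x \<notin> K \<Longrightarrow> \<phi> x = 0"
    using test_functionE[OF \<phi>] by blast
  have \<phi>i: "partial i \<phi> \<in> test_functions \<Omega>" by (rule test_function_partial[OF \<phi> i])
  note si = test_function_square_integrable[OF \<phi>] test_function_square_integrable[OF \<phi>i]
  have c: "continuous_on UNIV \<phi>" "continuous_on UNIV (partial i \<phi>)"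
    by (rule test_function_continuous[OF \<phi>], rule test_function_continuous[OF \<phi>i])
  define D where "D x v = (v \<bullet> i) * (\<phi> x \<bullet> \<phi> x) + (x \<bullet> i) * (2 * (\<phi> x \<bullet> frechet_derivative \<phi> (at x) v))" for x v
  have D: "((\<lambda>x. (x \<bullet> i) * (\<phi> x \<bullet> \<phi> x)) has_derivative D x) (at x)" for x
    unfolding D_def
    by (rule derivative_eq_intros refl test_function_differentiable[OF \<phi>, unfolded frechet_derivative_works] |
        simp add: inner_commute algebra_simps)+
  have Di: "D x i = (cmod (\<phi> x))\<^sup>2 + 2 * (x \<bullet> i) * (\<phi> x \<bullet> partial i \<phi> x)" for x
    using i by (simp add: D_def partial_def inner_Basis power2_norm_eq_inner)
  have Dc: "continuous_on UNIV (\<lambda>x. D x i)"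
    unfolding Di using c by (intro continuous_intros)
  have D0: "(LINT x|lborel. D x i) = 0"
    by (rule integral_directional_derivative_eq_0[OF D Dc K(1)]) (simp add: K(3))
  have I: "integrable lborel (\<lambda>x. (cmod (\<phi> x))\<^sup>2)" "integrable lborel (\<lambda>x. (cmod (partial i \<phi> x))\<^sup>2)"
    "integrable lborel (\<lambda>x. 2 * (x \<bullet> i) * (\<phi> x \<bullet> partial i \<phi> x))"
  proof -
    have z: "partial i \<phi> x = 0" if "x \<notin> K" for x
    proof -
      have "open (- K)" using K by (simp add: compact_imp_closed open_Compl)
      then have "(\<phi> has_derivative (\<lambda>_. 0)) (at x)"
        using that K(3) by (intro has_derivative_transform_within_open[OF has_derivative_const[of 0], of "- K"]) auto
      then show ?thesis by (simp add: partial_eq)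
    qed
    show "integrable lborel (\<lambda>x. (cmod (\<phi> x))\<^sup>2)" "integrable lborel (\<lambda>x. (cmod (partial i \<phi> x))\<^sup>2)"
      "integrable lborel (\<lambda>x. 2 * (x \<bullet> i) * (\<phi> x \<bullet> partial i \<phi> x))"
      using K z c by (auto intro!: integrable_lborel_continuous_compact_support[OF _ K(1)] continuous_intros)
  qed
  \<comment> \<open>On the support |x_i| <= R. Young's inequality is weighted so that one half of
    |\<phi>|^2 can be absorbed on the left; doubling the rest yields 4 R^2.\<close>
  have pw: "- (2 * (x \<bullet> i) * (\<phi> x \<bullet> partial i \<phi> x)) \<le> (1 / 2) * (cmod (\<phi> x))\<^sup>2 + 2 * R\<^sup>2 * (cmod (partial i \<phi> x))\<^sup>2" for x
  proof (cases "x \<in> K")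
    case True
    have "\<bar>x \<bullet> i\<bar> \<le> R"
      using Cauchy_Schwarz_ineq2[of x i] i R(1)[of x] True K(2) by auto
    have "\<bar>2 * (x \<bullet> i) * (\<phi> x \<bullet> partial i \<phi> x)\<bar> = 2 * \<bar>x \<bullet> i\<bar> * \<bar>\<phi> x \<bullet> partial i \<phi> x\<bar>"
      by (simp add: abs_mult)
    also have "\<dots> \<le> 2 * R * (cmod (\<phi> x) * cmod (partial i \<phi> x))"
      using \<open>\<bar>x \<bullet> i\<bar> \<le> R\<close> by (intro mult_mono Cauchy_Schwarz_ineq2) auto
    also have "\<dots> \<le> (1 / 2) * (cmod (\<phi> x))\<^sup>2 + 2 * R\<^sup>2 * (cmod (partial i \<phi> x))\<^sup>2"
      using sum_squares_bound[of "cmod (\<phi> x)" "2 * R * cmod (partial i \<phi> x)"]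
      by (simp add: power_mult_distrib field_simps)
    finally show ?thesis by linarith
  next
    case False
    then show ?thesis using K(3) by simp
  qed
  have norm_lborel: "(norm (abs_l2 g))\<^sup>2 = (LINT x|lborel. (cmod (g x))\<^sup>2)"
    if "square_integrable g" "continuous_on UNIV g" for g :: "'a \<Rightarrow> complex"
  proof -
    have "g \<in> borel_measurable borel" using that(2) by (rule borel_measurable_continuous_onI)
    then show ?thesis
      unfolding norm_abs_l2[OF that(1)] by (intro integral_completion) auto
  qed
  have "(norm (abs_l2 \<phi>))\<^sup>2 = - (LINT x|lborel. 2 * (x \<bullet> i) * (\<phi> x \<bullet> partial i \<phi> x))"
    using D0 I unfolding Di norm_lborel[OF si(1) c(1)] by simp
  also have "\<dots> \<le> (LINT x|lborel. (1 / 2) * (cmod (\<phi> x))\<^sup>2 + 2 * R\<^sup>2 * (cmod (partial i \<phi> x))\<^sup>2)"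
    unfolding Bochner_Integration.integral_minus[symmetric]
    using I pw by (intro integral_mono) auto
  also have "\<dots> = (1 / 2) * (norm (abs_l2 \<phi>))\<^sup>2 + 2 * R\<^sup>2 * (norm (abs_l2 (partial i \<phi>)))\<^sup>2"
    using I unfolding norm_lborel[OF si(1) c(1)] norm_lborel[OF si(2) c(2)] by simp
  finally show ?thesis by simp
qed

section \<open>The complex inner product, and functions vanishing outside a domain\<close>

lemma cinner_zero [simp]: "cinner 0 g = 0" "cinner f 0 = 0"
  using cinner_scaleC_left[of 0 0 g] cinner_commute[of f 0] cinner_scaleC_left[of 0 0 f] by simp_all

lemma cinner_scaleC_right: "cinner f (k *\<^sub>C g) = cnj k * cinner f g"
  by (metis cinner_scaleC_left cinner_commute complex_cnj_mult)

lemma cinner_minus_left: "cinner (- f) g = - cinner f g"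
  using cinner_add_left[of f "- f" g] by (simp add: eq_neg_iff_add_eq_0 add.commute)

lemma cinner_scaleR_left: "cinner (r *\<^sub>R f) g = r * cinner f g"
  by (simp add: scaleC_of_real[symmetric] cinner_scaleC_left)

lemma cinner_sum_left: "cinner (\<Sum>i\<in>A. f i) g = (\<Sum>i\<in>A. cinner (f i) g)"
  by (induction A rule: infinite_finite_induct) (simp_all add: cinner_add_left)

text \<open>Reduces continuity of the complex inner product to that of the real one.\<close>

lemma cinner_eq_inner: "cinner f g = Complex (inner f g) (inner ((- \<i>) *\<^sub>C f) g)"
  by (simp add: complex_eq_iff inner_l2_def cinner_scaleC_left)

lemma norm_scaleC_l2: "norm (k *\<^sub>C (f :: 'a::euclidean_space l2)) = cmod k * norm f"
  by (simp add: norm_l2_def cinner_scaleC_left cinner_scaleC_right mult.assoc[symmetric]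
      complex_norm_square[symmetric] real_sqrt_mult cmod_def power2_eq_square del: of_real_power)

lemma tendsto_cinner_right:
  assumes "X \<longlonglongrightarrow> g" shows "(\<lambda>k. cinner f (X k)) \<longlonglongrightarrow> cinner f g"
  unfolding cinner_eq_inner[of f] by (intro tendsto_Complex tendsto_inner tendsto_const assms)

lemma abs_l2_in_L2_on:
  assumes "square_integrable \<phi>"
  shows "abs_l2 \<phi> \<in> L2_on \<Omega> \<longleftrightarrow> (AE x in lebesgue. x \<notin> \<Omega> \<longrightarrow> \<phi> x = 0)"
  unfolding L2_on_def mem_Collect_eq
  using rep_abs_l2_AE[OF assms] by (intro eventually_subst) (auto elim: eventually_mono)

text \<open>Written as an intersection of kernels of continuous functionals, the space is visibly
  closed.\<close>

lemma L2_on_eq_orthogonal: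
  fixes \<Omega> :: "'a::euclidean_space set"
  assumes "open \<Omega>"
  shows "L2_on \<Omega> = (\<Inter>g\<in>{g. AE x in lebesgue. x \<in> \<Omega> \<longrightarrow> rep_l2 g x = 0}. {f. inner f g = 0})"
proof (intro equalityI subsetI)
  fix f assume f: "f \<in> L2_on \<Omega>"
  have "inner f g = 0" if "AE x in lebesgue. x \<in> \<Omega> \<longrightarrow> rep_l2 g x = 0" for g
  proof -
    have "cinner f g = (LINT x|lebesgue. rep_l2 f x * cnj (rep_l2 g x))"
      by (simp add: cinner.rep_eq)
    also have "\<dots> = (LINT x|(lebesgue :: 'a measure). 0)"
    proof (rule Bochner_Integration.integral_cong_AE)
      show "(\<lambda>x. rep_l2 f x * cnj (rep_l2 g x)) \<in> borel_measurable lebesgue"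
        using square_integrable_mult[OF square_integrable_rep_l2 square_integrable_rep_l2]
        by (rule borel_measurable_integrable)
      have "AE x in lebesgue. x \<notin> \<Omega> \<longrightarrow> rep_l2 f x = 0" using f by (simp add: L2_on_def)
      then show "AE x in lebesgue. rep_l2 f x * cnj (rep_l2 g x) = 0"
        using that by eventually_elim auto
    qed simp
    finally show ?thesis by (simp add: inner_l2_def)
  qed
  then show "f \<in> (\<Inter>g\<in>{g. AE x in lebesgue. x \<in> \<Omega> \<longrightarrow> rep_l2 g x = 0}. {f. inner f g = 0})" by blast
next
  fix f assume f: "f \<in> (\<Inter>g\<in>{g. AE x in lebesgue. x \<in> \<Omega> \<longrightarrow> rep_l2 g x = 0}. {f. inner f g = 0})"
  have om[measurable]: "\<Omega> \<in> sets lebesgue" using assms by simp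
  have sf: "square_integrable (rep_l2 f)" by (rule square_integrable_rep_l2)
  then have [measurable]: "rep_l2 f \<in> borel_measurable lebesgue" by (simp add: square_integrable_def)
  \<comment> \<open>The part of f outside the domain is itself an admissible test element, and
    pairing f with it gives the integral of |f|^2 over the complement.\<close>
  define g where "g x = (if x \<in> \<Omega> then 0 else rep_l2 f x)" for x
  have [measurable]: "g \<in> borel_measurable lebesgue" unfolding g_def by measurable
  have g: "square_integrable g"
    unfolding square_integrable_def
  proof
    show "integrable lebesgue (\<lambda>x. (cmod (g x))\<^sup>2)"
      by (rule Bochner_Integration.integrable_bound[of _ "\<lambda>x. (cmod (rep_l2 f x))\<^sup>2"])
        (use sf in \<open>auto simp: square_integrable_def g_def\<close>)
  qed measurable
  have "AE x in lebesgue. x \<in> \<Omega> \<longrightarrow> rep_l2 (abs_l2 g) x = 0"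
    using rep_abs_l2_AE[OF g] by eventually_elim (simp add: g_def)
  then have "inner f (abs_l2 g) = 0" using f by blast
  moreover have "cinner f (abs_l2 g) = (LINT x|lebesgue. complex_of_real ((cmod (g x))\<^sup>2))"
  proof -
    have "cinner f (abs_l2 g) = (LINT x|lebesgue. rep_l2 f x * cnj (g x))"
      using cinner_abs_l2[OF sf g] by (simp add: abs_rep_l2)
    also have "\<dots> = (LINT x|lebesgue. complex_of_real ((cmod (g x))\<^sup>2))"
      by (intro Bochner_Integration.integral_cong refl)
        (simp add: g_def complex_norm_square del: of_real_power)
    finally show ?thesis .
  qed
  ultimately have "(LINT x|lebesgue. (cmod (g x))\<^sup>2) = 0"
    by (simp add: inner_l2_def del: of_real_power)
  then have "AE x in lebesgue. (cmod (g x))\<^sup>2 = 0"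
    using g integral_nonneg_eq_0_iff_AE[of lebesgue "\<lambda>x. (cmod (g x))\<^sup>2"] by (simp add: square_integrable_def)
  then have "AE x in lebesgue. x \<notin> \<Omega> \<longrightarrow> rep_l2 f x = 0"
    by eventually_elim (auto simp: g_def)
  then show "f \<in> L2_on \<Omega>" by (simp add: L2_on_def)
qed

lemma closed_L2_on:
  assumes "open \<Omega>" shows "closed (L2_on \<Omega>)"
  unfolding L2_on_eq_orthogonal[OF assms]
  by (intro closed_INT ballI closed_Collect_eq continuous_intros)

lemma csubspace_L2_on: "csubspace (L2_on \<Omega>)"
proof -
  have 1: "abs_l2 (\<lambda>x. 0) \<in> L2_on \<Omega>" by (simp add: abs_l2_in_L2_on square_integrable_zero)
  have 2: "f + g \<in> L2_on \<Omega>" if "f \<in> L2_on \<Omega>" "g \<in> L2_on \<Omega>" for f g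
  proof -
    obtain \<phi> \<psi> where e: "square_integrable \<phi>" "f = abs_l2 \<phi>" "square_integrable \<psi>" "g = abs_l2 \<psi>"
      by (metis l2_cases)
    have "AE x in lebesgue. x \<notin> \<Omega> \<longrightarrow> \<phi> x = 0" "AE x in lebesgue. x \<notin> \<Omega> \<longrightarrow> \<psi> x = 0"
      using that e by (simp_all add: abs_l2_in_L2_on)
    then have "AE x in lebesgue. x \<notin> \<Omega> \<longrightarrow> \<phi> x + \<psi> x = 0" by eventually_elim simp
    then show ?thesis using e by (simp add: abs_l2_plus abs_l2_in_L2_on square_integrable_add)
  qed
  have 3: "k *\<^sub>C f \<in> L2_on \<Omega>" if "f \<in> L2_on \<Omega>" for f k
  proof -
    obtain \<phi> where e: "square_integrable \<phi>" "f = abs_l2 \<phi>" by (metis l2_cases)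
    have "AE x in lebesgue. x \<notin> \<Omega> \<longrightarrow> \<phi> x = 0" using that e by (simp add: abs_l2_in_L2_on)
    then have "AE x in lebesgue. x \<notin> \<Omega> \<longrightarrow> k * \<phi> x = 0" by eventually_elim simp
    then show ?thesis using e by (simp add: abs_l2_scaleC abs_l2_in_L2_on square_integrable_cmult)
  qed
  show ?thesis using 1 2 3 by (auto simp: csubspace_def zero_l2.abs_eq)
qed

section \<open>Eigenspaces of the Dirichlet Laplacian\<close>

lemma partial_cnj_test_function:
  assumes "\<phi> \<in> test_functions \<Omega>"
  shows "partial i (\<lambda>x. cnj (\<phi> x)) = (\<lambda>x. cnj (partial i \<phi> x))"
  by (intro ext partial_bounded_linear(1)[OF bounded_linear_cnj] test_function_differentiable[OF assms])

lemma set_integral_test_function: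
  assumes "\<phi> \<in> test_functions \<Omega>"
  shows "(LINT x:\<Omega>|lebesgue. rep_l2 f x * cnj (\<phi> x)) = cinner f (abs_l2 \<phi>)"
proof -
  have "indicator \<Omega> x *\<^sub>R (rep_l2 f x * cnj (\<phi> x)) = rep_l2 f x * cnj (\<phi> x)" for x
    using assms by (auto simp: indicator_def elim!: test_functionE)
  then have "(LINT x:\<Omega>|lebesgue. rep_l2 f x * cnj (\<phi> x)) = (LINT x|lebesgue. rep_l2 f x * cnj (\<phi> x))"
    by (simp add: set_lebesgue_integral_def)
  also have "\<dots> = cinner (abs_l2 (rep_l2 f)) (abs_l2 \<phi>)"
    by (rule cinner_abs_l2[symmetric, OF square_integrable_rep_l2 test_function_square_integrable[OF assms]])
  finally show ?thesis by (simp add: abs_rep_l2)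
qed

text \<open>The definition pairs without conjugation, the inner product conjugates its second
  argument; since test functions are closed under conjugation, both conditions range over the same
  set.\<close>

lemma has_weak_partial_iff:
  assumes i: "i \<in> Basis"
  shows "has_weak_partial \<Omega> i f g \<longleftrightarrow> f \<in> L2_on \<Omega> \<and> g \<in> L2_on \<Omega> \<and>
     (\<forall>\<phi>\<in>test_functions \<Omega>. cinner f (abs_l2 (partial i \<phi>)) = - cinner g (abs_l2 \<phi>))"
proof -
  have key: "(LINT x:\<Omega>|lebesgue. rep_l2 f x * partial i (\<lambda>x. cnj (\<phi> x)) x) = - (LINT x:\<Omega>|lebesgue. rep_l2 g x * cnj (\<phi> x))
      \<longleftrightarrow> cinner f (abs_l2 (partial i \<phi>)) = - cinner g (abs_l2 \<phi>)" if "\<phi> \<in> test_functions \<Omega>" for \<phi>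
    unfolding partial_cnj_test_function[OF that] set_integral_test_function[OF that]
      set_integral_test_function[OF test_function_partial[OF that i]] ..
  have cnj: "(\<lambda>x. cnj (\<phi> x)) \<in> test_functions \<Omega>" if "\<phi> \<in> test_functions \<Omega>" for \<phi>
    by (rule test_function_bounded_linear[OF bounded_linear_cnj that])
  have "(\<forall>\<phi>\<in>test_functions \<Omega>. (LINT x:\<Omega>|lebesgue. rep_l2 f x * partial i \<phi> x) = - (LINT x:\<Omega>|lebesgue. rep_l2 g x * \<phi> x))
    \<longleftrightarrow> (\<forall>\<phi>\<in>test_functions \<Omega>. (LINT x:\<Omega>|lebesgue. rep_l2 f x * partial i (\<lambda>x. cnj (\<phi> x)) x) = - (LINT x:\<Omega>|lebesgue. rep_l2 g x * cnj (\<phi> x)))"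
    (is "?L \<longleftrightarrow> ?R")
  proof
    assume ?L then show ?R using cnj by blast
  next
    assume R: ?R show ?L
    proof
      fix \<phi> assume "\<phi> \<in> test_functions \<Omega>"
      from R[rule_format, OF cnj[OF this]]
      show "(LINT x:\<Omega>|lebesgue. rep_l2 f x * partial i \<phi> x) = - (LINT x:\<Omega>|lebesgue. rep_l2 g x * \<phi> x)" by simp
    qed
  qed
  then show ?thesis using key by (auto simp: has_weak_partial_def)
qed

lemma has_weak_partial_zero: "i \<in> Basis \<Longrightarrow> has_weak_partial \<Omega> i 0 0"
  by (simp add: has_weak_partial_iff csubspaceD(1)[OF csubspace_L2_on])

lemma has_weak_partial_add:
  "i \<in> Basis \<Longrightarrow> has_weak_partial \<Omega> i f g \<Longrightarrow> has_weak_partial \<Omega> i f' g' \<Longrightarrow> has_weak_partial \<Omega> i (f + f') (g + g')"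
  by (simp add: has_weak_partial_iff csubspaceD(2)[OF csubspace_L2_on] cinner_add_left)

lemma has_weak_partial_scaleC:
  "i \<in> Basis \<Longrightarrow> has_weak_partial \<Omega> i f g \<Longrightarrow> has_weak_partial \<Omega> i (k *\<^sub>C f) (k *\<^sub>C g)"
  by (simp add: has_weak_partial_iff csubspaceD(3)[OF csubspace_L2_on] cinner_scaleC_left)

text \<open>Keeps the witnesses of membership in \<open>H1_0\<close> explicit, since the
  approximating functions and the limit gradient have to be named in Green's formula.\<close>

definition H1_0_approx ::
    "'a::euclidean_space set \<Rightarrow> 'a l2 \<Rightarrow> (nat \<Rightarrow> 'a \<Rightarrow> complex) \<Rightarrow> ('a \<Rightarrow> 'a l2) \<Rightarrow> bool" where
  "H1_0_approx \<Omega> f \<phi> G \<longleftrightarrow> f \<in> L2_on \<Omega> \<and> (\<forall>k. \<phi> k \<in> test_functions \<Omega>) \<and> (\<lambda>k. abs_l2 (\<phi> k)) \<longlonglongrightarrow> f \<and>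
     (\<forall>i\<in>Basis. has_weak_partial \<Omega> i f (G i) \<and> (\<lambda>k. abs_l2 (partial i (\<phi> k))) \<longlonglongrightarrow> G i)"

lemma H1_0_iff: "f \<in> H1_0 \<Omega> \<longleftrightarrow> (\<exists>\<phi> G. H1_0_approx \<Omega> f \<phi> G)"
  unfolding H1_0_def H1_0_approx_def mem_Collect_eq bchoice_iff by blast

lemma csubspace_H1_0: "csubspace (H1_0 \<Omega>)"
proof -
  note si = test_function_square_integrable
  have "0 \<in> H1_0 \<Omega>"
  proof -
    have "partial i (\<lambda>x::'a. 0 :: complex) = (\<lambda>x. 0)" for i
      by (intro ext partial_eq[where f' = "\<lambda>_. 0", simplified]) auto
    then have "H1_0_approx \<Omega> 0 (\<lambda>_ _. 0) (\<lambda>_. 0)"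
      by (simp add: H1_0_approx_def csubspaceD(1)[OF csubspace_L2_on] test_function_zero has_weak_partial_zero
          zero_l2.abs_eq[symmetric])
    then show ?thesis by (auto simp: H1_0_iff)
  qed
  moreover have "f + f' \<in> H1_0 \<Omega>" if ff: "f \<in> H1_0 \<Omega>" "f' \<in> H1_0 \<Omega>" for f f'
  proof -
    obtain \<phi> G where 1: "H1_0_approx \<Omega> f \<phi> G" using ff(1) unfolding H1_0_iff by blast
    obtain \<phi>' G' where 2: "H1_0_approx \<Omega> f' \<phi>' G'" using ff(2) unfolding H1_0_iff by blast
    note * = 1 2
    then have tf: "\<phi> k \<in> test_functions \<Omega>" "\<phi>' k \<in> test_functions \<Omega>" for k by (auto simp: H1_0_approx_def)
    have e: "abs_l2 (\<lambda>x. \<phi> k x + \<phi>' k x) = abs_l2 (\<phi> k) + abs_l2 (\<phi>' k)" for k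
      using abs_l2_plus[OF si[OF tf(1)] si[OF tf(2)]] by simp
    have p: "abs_l2 (partial i (\<lambda>x. \<phi> k x + \<phi>' k x)) = abs_l2 (partial i (\<phi> k)) + abs_l2 (partial i (\<phi>' k))"
      if "i \<in> Basis" for i k
    proof -
      have "partial i (\<lambda>x. \<phi> k x + \<phi>' k x) = (\<lambda>x. partial i (\<phi> k) x + partial i (\<phi>' k) x)"
        using tf by (intro ext partial_add test_function_differentiable)
      then show ?thesis
        using abs_l2_plus[OF si[OF test_function_partial[OF tf(1) that]] si[OF test_function_partial[OF tf(2) that]]] by simp
    qed
    have "H1_0_approx \<Omega> (f + f') (\<lambda>k x. \<phi> k x + \<phi>' k x) (\<lambda>i. G i + G' i)"
      using * by (auto simp: H1_0_approx_def csubspaceD(2)[OF csubspace_L2_on] test_function_add has_weak_partial_add e p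
          intro!: tendsto_add)
    then show ?thesis by (auto simp: H1_0_iff)
  qed
  moreover have "c *\<^sub>C f \<in> H1_0 \<Omega>" if ff: "f \<in> H1_0 \<Omega>" for f c
  proof -
    obtain \<phi> G where *: "H1_0_approx \<Omega> f \<phi> G" using ff unfolding H1_0_iff by blast
    then have tf: "\<phi> k \<in> test_functions \<Omega>" for k by (auto simp: H1_0_approx_def)
    have bl: "bounded_linear (\<lambda>x::complex. c * x)" by (rule bounded_linear_mult_right)
    have e: "abs_l2 (\<lambda>x. c * \<phi> k x) = c *\<^sub>C abs_l2 (\<phi> k)" for k
      using abs_l2_scaleC[OF si[OF tf]] by simp
    have p: "abs_l2 (partial i (\<lambda>x. c * \<phi> k x)) = c *\<^sub>C abs_l2 (partial i (\<phi> k))" if "i \<in> Basis" for i k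
    proof -
      have "partial i (\<lambda>x. c * \<phi> k x) = (\<lambda>x. c * partial i (\<phi> k) x)"
        using tf by (intro ext partial_bounded_linear[OF bl] test_function_differentiable)
      then show ?thesis using abs_l2_scaleC[OF si[OF test_function_partial[OF tf that]]] by simp
    qed
    have lim: "(\<lambda>k. c *\<^sub>C X k) \<longlonglongrightarrow> c *\<^sub>C y" if "X \<longlonglongrightarrow> y" for X and y :: "'a l2"
    proof -
      have "bounded_linear (\<lambda>z :: 'a l2. c *\<^sub>C z)"
        by (intro bounded_linear_intro[where K = "cmod c"]) (simp_all add: scaleC_add_right scaleC_scaleR norm_scaleC_l2 mult.commute)
      then show ?thesis using that by (rule bounded_linear.tendsto)
    qed
    have "H1_0_approx \<Omega> (c *\<^sub>C f) (\<lambda>k x. c * \<phi> k x) (\<lambda>i. c *\<^sub>C G i)"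
      using * by (auto simp: H1_0_approx_def csubspaceD(3)[OF csubspace_L2_on] test_function_bounded_linear[OF bl]
          has_weak_partial_scaleC e p intro!: lim)
    then show ?thesis by (auto simp: H1_0_iff)
  qed
  ultimately show ?thesis by (auto simp: csubspace_def)
qed

lemma eigenspace_iff:
  "f \<in> eigenspace \<Omega> \<mu> \<longleftrightarrow> f \<in> H2 \<Omega> \<and> f \<in> H1_0 \<Omega> \<and>
     (\<exists>g h. (\<forall>i\<in>Basis. has_weak_partial \<Omega> i f (g i) \<and> has_weak_partial \<Omega> i (g i) (h i)) \<and>
        \<mu> *\<^sub>R f = - (\<Sum>i\<in>Basis. h i))"
  unfolding eigenspace_def neg_laplacian_def by (auto simp: bchoice_iff)

lemma csubspace_eigenspace: "csubspace (eigenspace \<Omega> \<mu>)"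
proof -
  have H2: "f + f' \<in> H2 \<Omega>" if "f \<in> H2 \<Omega>" "f' \<in> H2 \<Omega>" for f f'
    using that csubspaceD(2)[OF csubspace_L2_on] has_weak_partial_add
    unfolding H2_def mem_Collect_eq by metis
  have H2': "c *\<^sub>C f \<in> H2 \<Omega>" if "f \<in> H2 \<Omega>" for f c
    using that csubspaceD(3)[OF csubspace_L2_on] has_weak_partial_scaleC
    unfolding H2_def mem_Collect_eq by metis
  have H20: "0 \<in> H2 \<Omega>"
    using csubspaceD(1)[OF csubspace_L2_on] has_weak_partial_zero unfolding H2_def mem_Collect_eq by metis
  have "0 \<in> eigenspace \<Omega> \<mu>"
    unfolding eigenspace_iff using H20 csubspaceD(1)[OF csubspace_H1_0]
    by (auto intro!: exI[of _ "\<lambda>_. 0"] has_weak_partial_zero)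
  moreover have "f + f' \<in> eigenspace \<Omega> \<mu>" if ff: "f \<in> eigenspace \<Omega> \<mu>" "f' \<in> eigenspace \<Omega> \<mu>" for f f'
  proof -
    obtain g h where
      1: "\<forall>i\<in>Basis. has_weak_partial \<Omega> i f (g i) \<and> has_weak_partial \<Omega> i (g i) (h i)" "\<mu> *\<^sub>R f = - (\<Sum>i\<in>Basis. h i)"
      using ff(1) unfolding eigenspace_iff by blast
    obtain g' h' where
      2: "\<forall>i\<in>Basis. has_weak_partial \<Omega> i f' (g' i) \<and> has_weak_partial \<Omega> i (g' i) (h' i)" "\<mu> *\<^sub>R f' = - (\<Sum>i\<in>Basis. h' i)"
      using ff(2) unfolding eigenspace_iff by blast
    show ?thesis
      unfolding eigenspace_iff
    proof (intro conjI exI)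
      show "f + f' \<in> H2 \<Omega>" "f + f' \<in> H1_0 \<Omega>"
        using that H2 csubspaceD(2)[OF csubspace_H1_0] by (auto simp: eigenspace_iff)
      show "\<forall>i\<in>Basis. has_weak_partial \<Omega> i (f + f') (g i + g' i) \<and> has_weak_partial \<Omega> i (g i + g' i) (h i + h' i)"
        using 1 2 by (auto intro!: has_weak_partial_add)
      show "\<mu> *\<^sub>R (f + f') = - (\<Sum>i\<in>Basis. h i + h' i)"
        using 1 2 by (simp add: scaleR_add_right sum.distrib)
    qed
  qed
  moreover have "c *\<^sub>C f \<in> eigenspace \<Omega> \<mu>" if ff: "f \<in> eigenspace \<Omega> \<mu>" for f c
  proof -
    obtain g h where
      1: "\<forall>i\<in>Basis. has_weak_partial \<Omega> i f (g i) \<and> has_weak_partial \<Omega> i (g i) (h i)" "\<mu> *\<^sub>R f = - (\<Sum>i\<in>Basis. h i)"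
      using ff unfolding eigenspace_iff by blast
    have sum: "c *\<^sub>C (\<Sum>i\<in>A. h i) = (\<Sum>i\<in>A. c *\<^sub>C h i)" for A
      by (induction A rule: infinite_finite_induct) (simp_all add: scaleC_add_right)
    show ?thesis
      unfolding eigenspace_iff
    proof (intro conjI exI)
      show "c *\<^sub>C f \<in> H2 \<Omega>" "c *\<^sub>C f \<in> H1_0 \<Omega>"
        using that H2' csubspaceD(3)[OF csubspace_H1_0] by (auto simp: eigenspace_iff)
      show "\<forall>i\<in>Basis. has_weak_partial \<Omega> i (c *\<^sub>C f) (c *\<^sub>C g i) \<and> has_weak_partial \<Omega> i (c *\<^sub>C g i) (c *\<^sub>C h i)"
        using 1 by (auto intro!: has_weak_partial_scaleC)
      show "\<mu> *\<^sub>R (c *\<^sub>C f) = - (\<Sum>i\<in>Basis. c *\<^sub>C h i)"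
        using 1 by (simp add: scaleC_scaleR[symmetric] scaleC_minus_right sum)
    qed
  qed
  ultimately show ?thesis by (auto simp: csubspace_def)
qed

text \<open>The gradient supplied by the definition of the Laplacian need not be known to agree with the one
  supplied by membership in $H^1_0$; both pair in the same way with test functions, hence with limits
  of test functions.\<close>

lemma eigenspace_gradient:
  assumes f: "f \<in> eigenspace \<Omega> \<mu>" "H1_0_approx \<Omega> f \<phi>f Gf" and e: "H1_0_approx \<Omega> e \<phi> Ge"
  shows "complex_of_real \<mu> * cinner f e = (\<Sum>i\<in>Basis. cinner (Gf i) (Ge i))"
proof -
  obtain g h where
    gh: "\<And>i. i \<in> Basis \<Longrightarrow> has_weak_partial \<Omega> i f (g i) \<and> has_weak_partial \<Omega> i (g i) (h i)"
      "\<mu> *\<^sub>R f = - (\<Sum>i\<in>Basis. h i)"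
    using f(1) unfolding eigenspace_iff by blast
  have tf: "\<phi> k \<in> test_functions \<Omega>" for k using e by (simp add: H1_0_approx_def)
  have same: "cinner (g i) (abs_l2 \<psi>) = cinner (Gf i) (abs_l2 \<psi>)" if "i \<in> Basis" "\<psi> \<in> test_functions \<Omega>" for i \<psi>
  proof -
    have "has_weak_partial \<Omega> i f (g i)" "has_weak_partial \<Omega> i f (Gf i)"
      using gh f(2) that(1) by (auto simp: H1_0_approx_def)
    then show ?thesis
      using that unfolding has_weak_partial_iff[OF that(1)] by (metis neg_equal_iff_equal)
  qed
  \<comment> \<open>Against a test function, Green's formula is the definition of the weak
    derivatives applied twice; the general case follows by letting k tend to infinity, which needs
    convergence of the gradients too.\<close>
  have "complex_of_real \<mu> * cinner f (abs_l2 (\<phi> k)) = (\<Sum>i\<in>Basis. cinner (Gf i) (abs_l2 (partial i (\<phi> k))))" for k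
  proof -
    have "complex_of_real \<mu> * cinner f (abs_l2 (\<phi> k)) = cinner (\<mu> *\<^sub>R f) (abs_l2 (\<phi> k))"
      by (simp add: cinner_scaleR_left)
    also have "\<dots> = - (\<Sum>i\<in>Basis. cinner (h i) (abs_l2 (\<phi> k)))"
      unfolding gh(2) cinner_minus_left cinner_sum_left ..
    also have "\<dots> = (\<Sum>i\<in>Basis. - cinner (h i) (abs_l2 (\<phi> k)))"
      by (simp add: sum_negf)
    also have "\<dots> = (\<Sum>i\<in>Basis. cinner (Gf i) (abs_l2 (partial i (\<phi> k))))"
    proof (rule sum.cong[OF refl])
      fix i :: 'a assume i: "i \<in> Basis"
      then have "has_weak_partial \<Omega> i (g i) (h i)" using gh(1) by blast
      then have "- cinner (h i) (abs_l2 (\<phi> k)) = cinner (g i) (abs_l2 (partial i (\<phi> k)))"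
        using tf by (simp add: has_weak_partial_iff[OF i])
      also have "\<dots> = cinner (Gf i) (abs_l2 (partial i (\<phi> k)))"
        by (rule same[OF i test_function_partial[OF tf i]])
      finally show "- cinner (h i) (abs_l2 (\<phi> k)) = cinner (Gf i) (abs_l2 (partial i (\<phi> k)))" .
    qed
    finally show ?thesis .
  qed
  moreover have "(\<lambda>k. complex_of_real \<mu> * cinner f (abs_l2 (\<phi> k))) \<longlonglongrightarrow> complex_of_real \<mu> * cinner f e"
    using e by (intro tendsto_mult tendsto_const tendsto_cinner_right) (simp add: H1_0_approx_def)
  moreover have "(\<lambda>k. \<Sum>i\<in>Basis. cinner (Gf i) (abs_l2 (partial i (\<phi> k)))) \<longlonglongrightarrow> (\<Sum>i\<in>Basis. cinner (Gf i) (Ge i))"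
    using e by (intro tendsto_sum tendsto_cinner_right) (simp add: H1_0_approx_def)
  ultimately show ?thesis by (simp add: LIMSEQ_unique)
qed

text \<open>The Dirichlet form is Hermitian; evaluating it from either side gives \<mu> and \<nu>
  times the same inner product.\<close>

lemma eigenspace_orthogonal:
  assumes "f \<in> eigenspace \<Omega> \<mu>" "e \<in> eigenspace \<Omega> \<nu>" "\<mu> \<noteq> \<nu>"
  shows "cinner f e = 0"
proof -
  obtain \<phi>f Gf where a1: "H1_0_approx \<Omega> f \<phi>f Gf" using assms(1) unfolding eigenspace_iff H1_0_iff by blast
  obtain \<phi>e Ge where a2: "H1_0_approx \<Omega> e \<phi>e Ge" using assms(2) unfolding eigenspace_iff H1_0_iff by blast
  note a = a1 a2
  have "complex_of_real \<mu> * cinner f e = (\<Sum>i\<in>Basis. cinner (Gf i) (Ge i))"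
    by (rule eigenspace_gradient[OF assms(1) a])
  also have "\<dots> = cnj (\<Sum>i\<in>Basis. cinner (Ge i) (Gf i))"
    unfolding cnj_sum by (intro sum.cong refl) (rule cinner_commute)
  also have "(\<Sum>i\<in>Basis. cinner (Ge i) (Gf i)) = complex_of_real \<nu> * cinner e f"
    by (rule eigenspace_gradient[OF assms(2) a(2,1), symmetric])
  also have "cnj (complex_of_real \<nu> * cinner e f) = complex_of_real \<nu> * cinner f e"
    using cinner_commute[of f e] by simp
  finally show ?thesis using assms(3) by simp
qed

text \<open>Testing the eigenvalue equation with f itself makes the squared gradient norm equal to
  \<mu> |f|^2. Poincare's inequality passes to the limit of test functions, and the derivative in a
  single coordinate direction suffices for it.\<close>

lemma eigenvalue_lower_bound:
  fixes \<Omega> :: "'a::euclidean_space set"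
  assumes "bounded \<Omega>"
  shows "\<exists>\<mu>\<^sub>0>0. \<forall>\<mu> f. f \<in> eigenspace \<Omega> \<mu> \<longrightarrow> f \<noteq> 0 \<longrightarrow> \<mu>\<^sub>0 \<le> \<mu>"
proof -
  obtain R where R: "\<And>x. x \<in> \<Omega> \<Longrightarrow> norm x \<le> R" "0 < R"
    using assms unfolding bounded_pos by blast
  obtain j :: 'a where j: "j \<in> Basis" using nonempty_Basis by blast
  have "1 / (4 * R\<^sup>2) \<le> \<mu>" if f: "f \<in> eigenspace \<Omega> \<mu>" "f \<noteq> 0" for f \<mu>
  proof -
    obtain \<phi> G where a: "H1_0_approx \<Omega> f \<phi> G"
      using f(1) unfolding eigenspace_iff H1_0_iff by blast
    have "(norm f)\<^sup>2 \<le> 4 * R\<^sup>2 * (norm (G j))\<^sup>2"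
    proof (rule LIMSEQ_le)
      show "(\<lambda>k. (norm (abs_l2 (\<phi> k)))\<^sup>2) \<longlonglongrightarrow> (norm f)\<^sup>2"
        "(\<lambda>k. 4 * R\<^sup>2 * (norm (abs_l2 (partial j (\<phi> k))))\<^sup>2) \<longlonglongrightarrow> 4 * R\<^sup>2 * (norm (G j))\<^sup>2"
        using a j by (auto intro!: tendsto_intros simp: H1_0_approx_def)
      show "\<exists>N. \<forall>k\<ge>N. (norm (abs_l2 (\<phi> k)))\<^sup>2 \<le> 4 * R\<^sup>2 * (norm (abs_l2 (partial j (\<phi> k))))\<^sup>2"
        using a by (intro exI allI impI poincare_test_function[OF _ j R]) (auto simp: H1_0_approx_def)
    qed
    also have "(norm (G j))\<^sup>2 \<le> (\<Sum>i\<in>Basis. (norm (G i))\<^sup>2)"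
      using j by (intro member_le_sum) auto
    also have "\<dots> = \<mu> * (norm f)\<^sup>2"
    proof -
      have nrm: "(norm u)\<^sup>2 = Re (cinner u u)" for u :: "'a l2"
        by (simp add: power2_norm_eq_inner inner_l2_def)
      have "Re (complex_of_real \<mu> * cinner f f) = Re (\<Sum>i\<in>Basis. cinner (G i) (G i))"
        by (simp only: eigenspace_gradient[OF f(1) a a])
      then show ?thesis by (simp add: nrm)
    qed
    finally have "(norm f)\<^sup>2 \<le> 4 * R\<^sup>2 * (\<mu> * (norm f)\<^sup>2)"
      using R by (simp add: mult_left_mono)
    then have "1 * (norm f)\<^sup>2 \<le> (4 * R\<^sup>2 * \<mu>) * (norm f)\<^sup>2" by (simp add: mult.assoc)
    then have "1 \<le> 4 * R\<^sup>2 * \<mu>" using f(2) by (simp only: mult_le_cancel_right) simp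
    then show ?thesis using R by (simp add: pos_divide_le_eq mult.commute)
  qed
  then show ?thesis using R by (intro exI[of _ "1 / (4 * R\<^sup>2)"]) auto
qed

section \<open>Square-summable families in the eigenspaces\<close>

text \<open>Dominated convergence for unordered sums: a finite set captures the sum of b up to e/2,
  the finitely many terms there tend to 0, and the rest of a is below the rest of b.\<close>

lemma tendsto_infsum_dominated:
  fixes a :: "'t \<Rightarrow> 'i \<Rightarrow> real"
  assumes b: "b summable_on UNIV" and ab: "\<forall>\<^sub>F t in G. \<forall>i. 0 \<le> a t i \<and> a t i \<le> b i"
    and lim: "\<And>i. ((\<lambda>t. a t i) \<longlongrightarrow> 0) G"
  shows "((\<lambda>t. infsum (a t) UNIV) \<longlongrightarrow> 0) G"
proof (rule tendstoI)
  fix e :: real assume e: "0 < e"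
  obtain A where A: "finite A" "dist (sum b A) (infsum b UNIV) \<le> e / 2"
    using infsum_finite_approximation[OF b, of "e / 2"] e by auto
  have "((\<lambda>t. \<Sum>i\<in>A. a t i) \<longlongrightarrow> (\<Sum>i\<in>A. 0)) G"
    by (intro tendsto_sum lim)
  then have "\<forall>\<^sub>F t in G. (\<Sum>i\<in>A. a t i) < e / 2"
    using e by (intro order_tendstoD(2)) auto
  then show "\<forall>\<^sub>F t in G. dist (infsum (a t) UNIV) 0 < e"
    using ab
  proof eventually_elim
    case (elim t)
    have at: "a t summable_on UNIV"
      by (rule summable_on_comparison_test[OF b]) (use elim in auto)
    \<comment> \<open>The comparison of the remainders: b - a is nonnegative, so its sum over
      \<open>A\<close> is at most its total sum.\<close>
    have "(\<lambda>i. b i + - a t i) summable_on UNIV"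
      using b at by (intro summable_on_add) (simp_all add: summable_on_uminus)
    then have "(\<Sum>i\<in>A. b i + - a t i) \<le> infsum (\<lambda>i. b i + - a t i) UNIV"
      using A(1) elim by (intro finite_sum_le_infsum) auto
    also have "\<dots> = infsum b UNIV + - infsum (a t) UNIV"
      using b at by (subst infsum_add) (auto simp: infsum_uminus summable_on_uminus)
    finally have "infsum (a t) UNIV \<le> infsum b UNIV - sum b A + (\<Sum>i\<in>A. a t i)"
      by (simp add: sum_subtractf)
    moreover have "0 \<le> infsum (a t) UNIV" using elim by (intro infsum_nonneg) auto
    moreover have "infsum b UNIV - sum b A \<le> e / 2"
      using A(2) abs_ge_minus_self[of "sum b A - infsum b UNIV"] unfolding dist_real_def by linarith
    ultimately have "infsum (a t) UNIV < e" using elim(1) by linarith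
    then show ?case using \<open>0 \<le> infsum (a t) UNIV\<close> by (simp add: dist_real_def)
  qed
qed

text \<open>Families are indexed by all real numbers. The gap makes components below
  \<open>\<mu>\<^sub>0\<close> vanish, so that powers of the index matter only for arguments bounded
  away from 0.\<close>

locale orthogonal_subspaces =
  fixes E :: "real \<Rightarrow> 'a::euclidean_space l2 set" and \<mu>\<^sub>0 :: real
  assumes csubspace: "csubspace (E \<mu>)"
    and orthogonal: "f \<in> E \<mu> \<Longrightarrow> g \<in> E \<nu> \<Longrightarrow> \<mu> \<noteq> \<nu> \<Longrightarrow> cinner f g = 0"
    and gap_pos: "0 < \<mu>\<^sub>0"
    and gap: "f \<in> E \<mu> \<Longrightarrow> \<mu> < \<mu>\<^sub>0 \<Longrightarrow> f = 0"
begin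

definition families :: "(real \<Rightarrow> 'a l2) set" where "families = {F. \<forall>\<mu>. F \<mu> \<in> E \<mu>}"

lemma families_iff: "F \<in> families \<longleftrightarrow> (\<forall>\<mu>. F \<mu> \<in> E \<mu>)"
  by (simp add: families_def)

lemma familiesD: "F \<in> families \<Longrightarrow> F \<mu> \<in> E \<mu>"
  by (simp add: families_def)

lemma families_scaleR: "F \<in> families \<Longrightarrow> (\<lambda>\<mu>. r \<mu> *\<^sub>R F \<mu>) \<in> families"
  using csubspaceD(4)[OF csubspace] by (auto simp: families_def)

lemma families_gap: "F \<in> families \<Longrightarrow> \<mu> < \<mu>\<^sub>0 \<Longrightarrow> F \<mu> = 0"
  using gap familiesD by blast

lemma norm_sum_families:
  assumes "F \<in> families" "finite A"
  shows "(norm (\<Sum>\<mu>\<in>A. F \<mu>))\<^sup>2 = (\<Sum>\<mu>\<in>A. (norm (F \<mu>))\<^sup>2)"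
  using assms(2)
proof (induction A rule: finite_induct)
  case (insert \<nu> A)
  have "inner (F \<nu>) (\<Sum>\<mu>\<in>A. F \<mu>) = (\<Sum>\<mu>\<in>A. inner (F \<nu>) (F \<mu>))"
    by (rule inner_sum_right)
  also have "\<dots> = 0"
  proof (rule sum.neutral, rule ballI)
    fix \<mu> assume "\<mu> \<in> A"
    then have "\<nu> \<noteq> \<mu>" using insert by auto
    then show "inner (F \<nu>) (F \<mu>) = 0"
      using orthogonal[of "F \<nu>" \<nu> "F \<mu>" \<mu>] familiesD[OF assms(1)] by (simp add: inner_l2_def)
  qed
  finally have "inner (F \<nu>) (\<Sum>\<mu>\<in>A. F \<mu>) = 0" .
  then have "(norm (F \<nu> + (\<Sum>\<mu>\<in>A. F \<mu>)))\<^sup>2 = (norm (F \<nu>))\<^sup>2 + (norm (\<Sum>\<mu>\<in>A. F \<mu>))\<^sup>2"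
    by (simp add: power2_norm_eq_inner inner_add_left inner_add_right inner_commute)
  then show ?case using insert by simp
qed simp

lemma families_has_sum_norm:
  assumes "F \<in> families" "(F has_sum f) UNIV"
  shows "((\<lambda>\<mu>. (norm (F \<mu>))\<^sup>2) has_sum (norm f)\<^sup>2) UNIV"
proof -
  have "((\<lambda>A. (norm (sum F A))\<^sup>2) \<longlongrightarrow> (norm f)\<^sup>2) (finite_subsets_at_top UNIV)"
    using assms(2) unfolding has_sum_def by (intro tendsto_intros)
  moreover have "\<forall>\<^sub>F A in finite_subsets_at_top UNIV. (norm (sum F A))\<^sup>2 = (\<Sum>\<mu>\<in>A. (norm (F \<mu>))\<^sup>2)"
    by (rule eventually_mono[OF eventually_finite_subsets_at_top_weakI]) (auto intro: norm_sum_families[OF assms(1)])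
  ultimately show ?thesis
    unfolding has_sum_def by (rule Lim_transform_eventually)
qed

text \<open>Cauchy's criterion in the complete space: by Pythagoras, the distance between partial
  sums over nested finite sets is a partial sum of the squares.\<close>

lemma families_summable:
  assumes F: "F \<in> families" and s: "(\<lambda>\<mu>. (norm (F \<mu>))\<^sup>2) summable_on UNIV"
  shows "F summable_on UNIV"
proof -
  let ?n = "\<lambda>\<mu>. (norm (F \<mu>))\<^sup>2"
  have "cauchy_filter (filtermap (sum F) (finite_subsets_at_top UNIV))"
    unfolding cauchy_filter_metric_filtermap
  proof (intro allI impI)
    fix e :: real assume e: "0 < e"
    obtain A where A: "finite A" "dist (sum ?n A) (infsum ?n UNIV) \<le> (e / 4)\<^sup>2"
      using infsum_finite_approximation[OF s, of "(e / 4)\<^sup>2"] e by auto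
    have close: "dist (sum F B) (sum F A) \<le> e / 4" if B: "finite B" "A \<subseteq> B" for B
    proof -
      have "(norm (sum F (B - A)))\<^sup>2 = sum ?n (B - A)"
        using B by (intro norm_sum_families[OF F]) auto
      also have "\<dots> = sum ?n B - sum ?n A"
        using B A(1) by (simp add: sum_diff)
      also have "\<dots> \<le> (e / 4)\<^sup>2"
        using A(2) finite_sum_le_infsum[OF s B(1)] by (simp add: dist_real_def)
      finally have "norm (sum F (B - A)) \<le> e / 4"
        by (rule power2_le_imp_le) (use e in simp)
      then show ?thesis
        using B A(1) by (simp add: dist_norm sum_diff)
    qed
    show "\<exists>P. eventually P (finite_subsets_at_top UNIV) \<and> (\<forall>x y. P x \<and> P y \<longrightarrow> dist (sum F x) (sum F y) < e)"
    proof (intro exI conjI allI impI)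
      show "\<forall>\<^sub>F B in finite_subsets_at_top UNIV. finite B \<and> A \<subseteq> B"
        using A(1) by (auto simp: eventually_finite_subsets_at_top intro!: exI[of _ A])
      fix B C assume "(finite B \<and> A \<subseteq> B) \<and> (finite C \<and> A \<subseteq> C)"
      then have "dist (sum F B) (sum F A) \<le> e / 4" "dist (sum F C) (sum F A) \<le> e / 4"
        using close by auto
      then show "dist (sum F B) (sum F C) < e"
        using dist_triangle2[of "sum F B" "sum F C" "sum F A"] e by linarith
    qed
  qed
  moreover have "complete (UNIV :: 'a l2 set)" by (rule complete_UNIV)
  ultimately obtain x where "filtermap (sum F) (finite_subsets_at_top UNIV) \<le> nhds x"
    using cauchy_filter_complete_converges[of "filtermap (sum F) (finite_subsets_at_top UNIV)" UNIV]
    by (auto simp: filtermap_bot_iff)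
  then have "(sum F \<longlongrightarrow> x) (finite_subsets_at_top UNIV)"
    by (auto simp: filterlim_def)
  then show ?thesis
    by (auto simp: summable_on_def has_sum_def)
qed

text \<open>The difference of two expansions sums to 0, and by Parseval all its members vanish. This
  legitimates the definite description in \<open>components\<close>.\<close>

lemma families_has_sum_unique:
  assumes F: "F \<in> families" "(F has_sum f) UNIV" and G: "G \<in> families" "(G has_sum f) UNIV"
  shows "F = G"
proof -
  have D: "(\<lambda>\<mu>. F \<mu> - G \<mu>) \<in> families"
    using F(1) G(1) csubspaceD(6)[OF csubspace] by (auto simp: families_def)
  have "((\<lambda>\<mu>. F \<mu> + - G \<mu>) has_sum (f + - f)) UNIV"
    using F(2) G(2) by (intro has_sum_add) (simp_all add: has_sum_uminus)
  then have "((\<lambda>\<mu>. F \<mu> - G \<mu>) has_sum 0) UNIV" by simp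
  from families_has_sum_norm[OF D this]
  have "((\<lambda>\<mu>. (norm (F \<mu> - G \<mu>))\<^sup>2) has_sum 0) UNIV" by simp
  then have "(norm (F \<mu> - G \<mu>))\<^sup>2 = 0" for \<mu>
    using nonneg_has_sum_le_0D[of "\<lambda>\<mu>. (norm (F \<mu> - G \<mu>))\<^sup>2" UNIV 0 \<mu>] by simp
  then show ?thesis by (simp add: fun_eq_iff)
qed

end

section \<open>Fractional powers in terms of components\<close>

locale dirichlet_domain =
  fixes \<Omega> :: "'a::euclidean_space set" and \<mu>\<^sub>0 :: real
  assumes open_domain: "open \<Omega>" and gap_positive: "0 < \<mu>\<^sub>0"
    and eigenvalue_gap: "f \<in> eigenspace \<Omega> \<mu> \<Longrightarrow> f \<noteq> 0 \<Longrightarrow> \<mu>\<^sub>0 \<le> \<mu>"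
begin

sublocale orthogonal_subspaces "eigenspace \<Omega>" \<mu>\<^sub>0
proof
  show "csubspace (eigenspace \<Omega> \<mu>)" for \<mu> by (rule csubspace_eigenspace)
  show "cinner f g = 0" if "f \<in> eigenspace \<Omega> \<mu>" "g \<in> eigenspace \<Omega> \<nu>" "\<mu> \<noteq> \<nu>" for f g \<mu> \<nu>
    by (rule eigenspace_orthogonal[OF that])
  show "0 < \<mu>\<^sub>0" by (rule gap_positive)
  show "f = 0" if "f \<in> eigenspace \<Omega> \<mu>" "\<mu> < \<mu>\<^sub>0" for f \<mu>
    using eigenvalue_gap[OF that(1)] that(2) by (meson not_le)
qed

lemma scale_iff: "F \<in> scale \<Omega> s \<longleftrightarrow> F \<in> families \<and> (\<lambda>\<mu>. (\<mu> powr s * norm (F \<mu>))\<^sup>2) summable_on UNIV"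
  by (simp add: scale_def families_def)

text \<open>Reduces every inclusion between spaces of the scale to an inequality for eigenvalues
  above the gap, where positive and negative powers can be compared.\<close>

lemma scale_mono:
  assumes F: "F \<in> families" and G: "G \<in> scale \<Omega> s"
    and le: "\<And>\<mu>. \<mu>\<^sub>0 \<le> \<mu> \<Longrightarrow> \<mu> powr r * norm (F \<mu>) \<le> C * (\<mu> powr s * norm (G \<mu>))"
  shows "F \<in> scale \<Omega> r"
proof -
  have "(\<lambda>\<mu>. C\<^sup>2 * (\<mu> powr s * norm (G \<mu>))\<^sup>2) summable_on UNIV"
    using G by (intro summable_on_cmult_right) (simp add: scale_iff)
  moreover have "(\<mu> powr r * norm (F \<mu>))\<^sup>2 \<le> C\<^sup>2 * (\<mu> powr s * norm (G \<mu>))\<^sup>2" for \<mu>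
  proof (cases "\<mu>\<^sub>0 \<le> \<mu>")
    case True
    have "(\<mu> powr r * norm (F \<mu>))\<^sup>2 \<le> (C * (\<mu> powr s * norm (G \<mu>)))\<^sup>2"
      by (intro power_mono le[OF True]) simp
    then show ?thesis by (simp add: power_mult_distrib)
  next
    case False
    then show ?thesis using families_gap[OF F] by simp
  qed
  ultimately have "(\<lambda>\<mu>. (\<mu> powr r * norm (F \<mu>))\<^sup>2) summable_on UNIV"
    by (rule summable_on_comparison_test) auto
  then show ?thesis using F by (simp add: scale_iff)
qed

lemma scale_norm_summable:
  assumes "F \<in> scale \<Omega> s" "0 \<le> s" shows "F \<in> families" "(\<lambda>\<mu>. (norm (F \<mu>))\<^sup>2) summable_on UNIV"
proof -
  show F: "F \<in> families" using assms by (simp add: scale_iff)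
  have "F \<in> scale \<Omega> 0"
  proof (rule scale_mono[OF F assms(1)])
    fix \<mu> assume mu: "\<mu>\<^sub>0 \<le> \<mu>"
    then have "1 \<le> \<mu>\<^sub>0 powr (- s) * \<mu> powr s"
      using gap_pos assms(2) powr_mono2[of s \<mu>\<^sub>0 \<mu>] by (simp add: powr_minus field_simps)
    then have "1 * norm (F \<mu>) \<le> (\<mu>\<^sub>0 powr (- s) * \<mu> powr s) * norm (F \<mu>)"
      by (rule mult_right_mono) simp
    then show "\<mu> powr 0 * norm (F \<mu>) \<le> \<mu>\<^sub>0 powr (- s) * (\<mu> powr s * norm (F \<mu>))"
      using mu gap_pos by (simp add: mult.assoc)
  qed
  then have s0: "(\<lambda>\<mu>. (\<mu> powr 0 * norm (F \<mu>))\<^sup>2) summable_on UNIV" by (simp add: scale_iff)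
  \<comment> \<open>\<open>\<mu> powr 0\<close> is 0 at \<mu> = 0 and 1 elsewhere; the difference is
    harmless because \<open>F\<close> vanishes below the gap.\<close>
  show "(\<lambda>\<mu>. (norm (F \<mu>))\<^sup>2) summable_on UNIV"
  proof (rule summable_on_comparison_test[OF s0])
    show "(norm (F \<mu>))\<^sup>2 \<le> (\<mu> powr 0 * norm (F \<mu>))\<^sup>2" for \<mu>
      using families_gap[OF F, of \<mu>] gap_pos by (cases "\<mu>\<^sub>0 \<le> \<mu>") auto
  qed simp
qed

lemma scale_has_sum:
  assumes "F \<in> scale \<Omega> s" "0 \<le> s"
  shows "(F has_sum synthesis F) UNIV"
  unfolding synthesis_def
  using families_summable scale_norm_summable[OF assms] by simp

lemma components_eq:
  assumes "F \<in> families" "(F has_sum f) UNIV"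
  shows "components \<Omega> f = F"
  unfolding components_def
  by (rule the_equality) (use assms families_has_sum_unique in \<open>auto simp: families_iff\<close>)

lemma eigenspace_L2_on: "eigenspace \<Omega> \<mu> \<subseteq> L2_on \<Omega>"
  by (auto simp: eigenspace_iff H2_def)

lemma has_sum_L2_on:
  assumes "F \<in> families" "(F has_sum f) UNIV" shows "f \<in> L2_on \<Omega>"
proof (rule Lim_in_closed_set[OF closed_L2_on[OF open_domain]])
  show "(sum F \<longlongrightarrow> f) (finite_subsets_at_top UNIV)" using assms(2) by (simp add: has_sum_def)
  have F: "F \<mu> \<in> L2_on \<Omega>" for \<mu>
    using assms(1) eigenspace_L2_on by (auto simp: families_iff)
  have "sum F A \<in> L2_on \<Omega>" for A
    by (induction A rule: infinite_finite_induct) (simp_all add: csubspaceD(1,2)[OF csubspace_L2_on] F)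
  then show "\<forall>\<^sub>F A in finite_subsets_at_top UNIV. sum F A \<in> L2_on \<Omega>" by simp
qed simp

lemma synthesis_dom_pow:
  assumes "F \<in> scale \<Omega> s" "0 \<le> s"
  shows "synthesis F \<in> dom_pow \<Omega> s" "components \<Omega> (synthesis F) = F"
proof -
  note hs = scale_has_sum[OF assms] and fam = scale_norm_summable(1)[OF assms]
  show "synthesis F \<in> dom_pow \<Omega> s"
    unfolding dom_pow_def using has_sum_L2_on[OF fam hs] hs assms(1) by blast
  show "components \<Omega> (synthesis F) = F" by (rule components_eq[OF fam hs])
qed

lemma dom_pow_components:
  assumes "f \<in> dom_pow \<Omega> s" "0 \<le> s"
  shows "components \<Omega> f \<in> scale \<Omega> s" "(components \<Omega> f has_sum f) UNIV" "synthesis (components \<Omega> f) = f"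
    "components \<Omega> f \<in> families"
proof -
  obtain F where F: "F \<in> scale \<Omega> s" "(F has_sum f) UNIV"
    using assms(1) unfolding dom_pow_def by blast
  have fam: "F \<in> families" using F(1) by (simp add: scale_iff)
  have c: "components \<Omega> f = F" by (rule components_eq[OF fam F(2)])
  show "components \<Omega> f \<in> scale \<Omega> s" "(components \<Omega> f has_sum f) UNIV" "components \<Omega> f \<in> families"
    using F c fam by simp_all
  show "synthesis (components \<Omega> f) = f"
    unfolding c synthesis_def using F(2) by (rule infsumI)
qed

lemma dom_pow_iff_components:
  assumes f: "f \<in> dom_pow \<Omega> r" and r: "0 \<le> r" and s: "0 \<le> s"
  shows "f \<in> dom_pow \<Omega> s \<longleftrightarrow> components \<Omega> f \<in> scale \<Omega> s"
proof
  assume "f \<in> dom_pow \<Omega> s" then show "components \<Omega> f \<in> scale \<Omega> s" by (rule dom_pow_components(1)[OF _ s])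
next
  assume "components \<Omega> f \<in> scale \<Omega> s"
  from synthesis_dom_pow(1)[OF this s] show "f \<in> dom_pow \<Omega> s"
    using dom_pow_components(3)[OF f r] by simp
qed

lemma norm_dom_pow:
  assumes "f \<in> dom_pow \<Omega> s" "0 \<le> s"
  shows "((\<lambda>\<mu>. (norm (components \<Omega> f \<mu>))\<^sup>2) has_sum (norm f)\<^sup>2) UNIV"
  using families_has_sum_norm dom_pow_components[OF assms] by blast

lemma norm_frac_pow:
  assumes "f \<in> dom_pow \<Omega> s" "0 \<le> s"
  shows "((\<lambda>\<mu>. (\<mu> powr s * norm (components \<Omega> f \<mu>))\<^sup>2) has_sum (norm (frac_pow \<Omega> s f))\<^sup>2) UNIV"
proof -
  let ?F = "scale_pow s (components \<Omega> f)"
  have n: "norm (?F \<mu>) = \<mu> powr s * norm (components \<Omega> f \<mu>)" for \<mu> by (simp add: scale_pow_def)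
  have fam: "?F \<in> families"
    unfolding scale_pow_def by (intro families_scaleR dom_pow_components[OF assms])
  have "?F summable_on UNIV"
    using dom_pow_components(1)[OF assms] by (intro families_summable fam) (simp add: n scale_iff)
  then have "(?F has_sum frac_pow \<Omega> s f) UNIV"
    unfolding frac_pow_def synthesis_def by simp
  from families_has_sum_norm[OF fam this] show ?thesis by (simp only: n)
qed

lemma components_add:
  assumes "f \<in> dom_pow \<Omega> s" "g \<in> dom_pow \<Omega> s" "0 \<le> s"
  shows "components \<Omega> (f + g) = (\<lambda>\<mu>. components \<Omega> f \<mu> + components \<Omega> g \<mu>)"
    "f + g \<in> dom_pow \<Omega> s"
proof -
  note f = dom_pow_components[OF assms(1,3)] and g = dom_pow_components[OF assms(2,3)]
  let ?F = "\<lambda>\<mu>. components \<Omega> f \<mu> + components \<Omega> g \<mu>"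
  have fam: "?F \<in> families"
    using f g csubspaceD(2)[OF csubspace] by (auto simp: families_iff)
  have hs: "(?F has_sum (f + g)) UNIV" using f g by (intro has_sum_add)
  show c: "components \<Omega> (f + g) = ?F" by (rule components_eq[OF fam hs])
  have "(\<lambda>\<mu>. 2 * (\<mu> powr s * norm (components \<Omega> f \<mu>))\<^sup>2 + 2 * (\<mu> powr s * norm (components \<Omega> g \<mu>))\<^sup>2) summable_on UNIV"
    using f(1) g(1) by (intro summable_on_add summable_on_cmult_right) (simp_all add: scale_iff)
  moreover have "(\<mu> powr s * norm (?F \<mu>))\<^sup>2 \<le>
      2 * (\<mu> powr s * norm (components \<Omega> f \<mu>))\<^sup>2 + 2 * (\<mu> powr s * norm (components \<Omega> g \<mu>))\<^sup>2" for \<mu>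
  proof -
    let ?a = "\<mu> powr s * norm (components \<Omega> f \<mu>)" and ?b = "\<mu> powr s * norm (components \<Omega> g \<mu>)"
    have "\<mu> powr s * norm (?F \<mu>) \<le> ?a + ?b"
      unfolding distrib_left[symmetric] by (intro mult_left_mono norm_triangle_ineq) simp
    then have "(\<mu> powr s * norm (?F \<mu>))\<^sup>2 \<le> (?a + ?b)\<^sup>2" by (intro power_mono) auto
    then show ?thesis using sum_squares_bound[of ?a ?b] unfolding power2_sum by linarith
  qed
  ultimately have "(\<lambda>\<mu>. (\<mu> powr s * norm (?F \<mu>))\<^sup>2) summable_on UNIV"
    by (rule summable_on_comparison_test) auto
  then have "?F \<in> scale \<Omega> s" using fam by (simp add: scale_iff)
  then show "f + g \<in> dom_pow \<Omega> s"
    unfolding dom_pow_def using has_sum_L2_on[OF fam hs] hs by blast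
qed

lemma components_scaleC:
  assumes "f \<in> dom_pow \<Omega> s" "0 \<le> s"
  shows "components \<Omega> (k *\<^sub>C f) = (\<lambda>\<mu>. k *\<^sub>C components \<Omega> f \<mu>)" "k *\<^sub>C f \<in> dom_pow \<Omega> s"
proof -
  note f = dom_pow_components[OF assms]
  let ?F = "\<lambda>\<mu>. k *\<^sub>C components \<Omega> f \<mu>"
  have bl: "bounded_linear (\<lambda>z :: 'a l2. k *\<^sub>C z)"
    by (intro bounded_linear_intro[where K = "cmod k"])
      (simp_all add: scaleC_add_right scaleC_scaleR norm_scaleC_l2 mult.commute)
  have fam: "?F \<in> families"
    using f csubspaceD(3)[OF csubspace] by (auto simp: families_iff)
  have hs: "(?F has_sum (k *\<^sub>C f)) UNIV" by (rule has_sum_bounded_linear[OF bl f(2)])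
  show c: "components \<Omega> (k *\<^sub>C f) = ?F" by (rule components_eq[OF fam hs])
  have "?F \<in> scale \<Omega> s"
    by (rule scale_mono[OF fam f(1), where C = "cmod k"]) (simp add: norm_scaleC_l2 mult.left_commute)
  then show "k *\<^sub>C f \<in> dom_pow \<Omega> s"
    unfolding dom_pow_def using has_sum_L2_on[OF fam hs] hs by blast
qed

end

section \<open>The coupled system in energy coordinates\<close>

locale coupled_system = dirichlet_domain \<Omega> \<mu>\<^sub>0
  for \<Omega> :: "'a::euclidean_space set" and \<mu>\<^sub>0 :: real +
  fixes \<alpha> \<kappa> \<gamma> \<delta> \<theta> \<beta> :: real
  assumes pos: "0 < \<alpha>" "0 < \<kappa>" "0 < \<gamma>" "0 < \<delta>" "0 < \<theta>" "0 < \<beta>" "\<beta> < 1"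
    and range: "3 * \<theta> / 4 + \<beta> / 2 \<le> 1"
begin

abbreviation "X \<equiv> phase_space \<Omega> \<beta>"
abbreviation "N \<equiv> phase_norm \<Omega> \<alpha> \<kappa> \<beta>"

text \<open>The weights are the square roots of the factors with which the components of u, v and w
  enter the squared phase norm; z has weight 1.\<close>

definition weight\<^sub>u :: "real \<Rightarrow> real" where "weight\<^sub>u \<mu> = sqrt \<alpha> * \<mu>"
definition weight\<^sub>v :: "real \<Rightarrow> real" where "weight\<^sub>v \<mu> = sqrt \<alpha> * \<mu> powr (1/2)"
definition weight\<^sub>w :: "real \<Rightarrow> real" where "weight\<^sub>w \<mu> = sqrt (1 + \<kappa> * \<mu> powr \<beta>)"

text \<open>In the following coordinates the phase space is isometric to a space of square-summable families
  and the operator acts in each component as a numerical matrix.\<close>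

definition coords :: "'a state \<Rightarrow> real \<Rightarrow> 'a state" where
  "coords = (\<lambda>(u, v, w, z) \<mu>. (weight\<^sub>u \<mu> *\<^sub>R components \<Omega> u \<mu>, weight\<^sub>v \<mu> *\<^sub>R components \<Omega> v \<mu>,
     weight\<^sub>w \<mu> *\<^sub>R components \<Omega> w \<mu>, components \<Omega> z \<mu>))"

text \<open>Inverse of \<open>coords\<close> on square-summable families. A weight can only vanish
  below the gap, where the families are 0 anyway.\<close>

definition assemble :: "(real \<Rightarrow> 'a state) \<Rightarrow> 'a state" where
  "assemble x = (synthesis (\<lambda>\<mu>. (1 / weight\<^sub>u \<mu>) *\<^sub>R fst (x \<mu>)),
     synthesis (\<lambda>\<mu>. (1 / weight\<^sub>v \<mu>) *\<^sub>R fst (snd (x \<mu>))),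
     synthesis (\<lambda>\<mu>. (1 / weight\<^sub>w \<mu>) *\<^sub>R fst (snd (snd (x \<mu>)))),
     synthesis (\<lambda>\<mu>. snd (snd (snd (x \<mu>)))))"

definition fibre_space :: "real \<Rightarrow> 'a state set" where
  "fibre_space \<mu> = eigenspace \<Omega> \<mu> \<times> eigenspace \<Omega> \<mu> \<times> eigenspace \<Omega> \<mu> \<times> eigenspace \<Omega> \<mu>"

definition square_summable :: "(real \<Rightarrow> 'a state) set" where
  "square_summable = {x. (\<forall>\<mu>. x \<mu> \<in> fibre_space \<mu>) \<and> (\<lambda>\<mu>. (norm (x \<mu>))\<^sup>2) summable_on UNIV}"

lemma csubspace_fibre_space: "csubspace (fibre_space \<mu>)"
  unfolding fibre_space_def by (intro csubspace_Times csubspace)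

lemma fibre_space_gap: "x \<in> fibre_space \<mu> \<Longrightarrow> \<mu> < \<mu>\<^sub>0 \<Longrightarrow> x = 0"
  using gap by (auto simp: fibre_space_def zero_prod_def)

lemma square_summableI_le:
  assumes "\<And>\<mu>. x \<mu> \<in> fibre_space \<mu>" "y \<in> square_summable" "\<And>\<mu>. \<mu>\<^sub>0 \<le> \<mu> \<Longrightarrow> norm (x \<mu>) \<le> C * norm (y \<mu>)"
  shows "x \<in> square_summable"
proof -
  have "(\<lambda>\<mu>. C\<^sup>2 * (norm (y \<mu>))\<^sup>2) summable_on UNIV"
    using assms(2) by (intro summable_on_cmult_right) (simp add: square_summable_def)
  moreover have "(norm (x \<mu>))\<^sup>2 \<le> C\<^sup>2 * (norm (y \<mu>))\<^sup>2" for \<mu>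
  proof (cases "\<mu>\<^sub>0 \<le> \<mu>")
    case True
    then have "(norm (x \<mu>))\<^sup>2 \<le> (C * norm (y \<mu>))\<^sup>2" by (intro power_mono assms) auto
    then show ?thesis by (simp add: power_mult_distrib)
  next
    case False
    then show ?thesis using fibre_space_gap[OF assms(1)] by simp
  qed
  ultimately have "(\<lambda>\<mu>. (norm (x \<mu>))\<^sup>2) summable_on UNIV"
    by (rule summable_on_comparison_test) auto
  then show ?thesis using assms(1) by (simp add: square_summable_def)
qed

lemma weights_pos: "0 < \<mu> \<Longrightarrow> 0 < weight\<^sub>u \<mu>" "0 < \<mu> \<Longrightarrow> 0 < weight\<^sub>v \<mu>" "0 < weight\<^sub>w \<mu>"
  using pos by (auto simp: weight\<^sub>u_def weight\<^sub>v_def weight\<^sub>w_def add_pos_nonneg)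

lemma components_gap: "0 \<le> s \<Longrightarrow> f \<in> dom_pow \<Omega> s \<Longrightarrow> \<mu> < \<mu>\<^sub>0 \<Longrightarrow> components \<Omega> f \<mu> = 0"
  using families_gap dom_pow_components(4) by blast

lemma phase_spaceD:
  assumes "(u, v, w, z) \<in> X"
  shows "u \<in> dom_pow \<Omega> 1" "v \<in> dom_pow \<Omega> (1/2)" "w \<in> dom_pow \<Omega> (\<beta>/2)" "z \<in> dom_pow \<Omega> 0"
  using assms by (simp_all add: phase_space_def)

text \<open>Parseval's identity for each term of the energy; the two terms containing w combine into
  the weight 1 + \<kappa> \<mu>^\<beta>.\<close>

lemma coords_norm:
  assumes U: "U \<in> X"
  shows "((\<lambda>\<mu>. (norm (coords U \<mu>))\<^sup>2) has_sum (N U)\<^sup>2) UNIV" "coords U \<in> square_summable"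
proof -
  obtain u v w z where U': "U = (u, v, w, z)" by (cases U)
  note d = phase_spaceD[OF U[unfolded U']]
  have b2: "0 \<le> \<beta> / 2" using pos by simp
  let ?c = "components \<Omega>"
  have hs: "((\<lambda>\<mu>. \<alpha> * (\<mu> powr 1 * norm (?c u \<mu>))\<^sup>2 + \<alpha> * (\<mu> powr (1/2) * norm (?c v \<mu>))\<^sup>2 + (norm (?c w \<mu>))\<^sup>2
      + \<kappa> * (\<mu> powr (\<beta>/2) * norm (?c w \<mu>))\<^sup>2 + (norm (?c z \<mu>))\<^sup>2) has_sum
      (\<alpha> * (norm (frac_pow \<Omega> 1 u))\<^sup>2 + \<alpha> * (norm (frac_pow \<Omega> (1/2) v))\<^sup>2
       + (norm w)\<^sup>2 + \<kappa> * (norm (frac_pow \<Omega> (\<beta>/2) w))\<^sup>2 + (norm z)\<^sup>2)) UNIV"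
    using d b2 by (intro has_sum_add has_sum_cmult_right norm_frac_pow norm_dom_pow[of w "\<beta>/2"] norm_dom_pow[of z 0]) auto
  have eq: "(norm (coords U \<mu>))\<^sup>2 = \<alpha> * (\<mu> powr 1 * norm (?c u \<mu>))\<^sup>2 + \<alpha> * (\<mu> powr (1/2) * norm (?c v \<mu>))\<^sup>2 + (norm (?c w \<mu>))\<^sup>2
      + \<kappa> * (\<mu> powr (\<beta>/2) * norm (?c w \<mu>))\<^sup>2 + (norm (?c z \<mu>))\<^sup>2" for \<mu>
  proof (cases "\<mu>\<^sub>0 \<le> \<mu>")
    case True
    then have mu: "0 < \<mu>" using gap_pos by simp
    have "(\<mu> powr (\<beta>/2))\<^sup>2 = \<mu> powr \<beta>"
      by (simp add: power2_eq_square powr_add[symmetric])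
    then have "(weight\<^sub>w \<mu>)\<^sup>2 = 1 + \<kappa> * (\<mu> powr (\<beta>/2))\<^sup>2"
      using pos by (simp add: weight\<^sub>w_def)
    then show ?thesis
      using mu pos by (simp add: U' coords_def norm_quad weight\<^sub>u_def weight\<^sub>v_def power_mult_distrib algebra_simps)
  next
    case False
    then have "\<mu> < \<mu>\<^sub>0" by simp
    then show ?thesis
      using components_gap[OF _ d(1)] components_gap[OF _ d(2)] components_gap[OF b2 d(3)] components_gap[OF _ d(4)]
      by (simp add: U' coords_def zero_prod_def[symmetric])
  qed
  have nn: "0 \<le> \<alpha> * (norm (frac_pow \<Omega> 1 u))\<^sup>2 + \<alpha> * (norm (frac_pow \<Omega> (1/2) v))\<^sup>2
       + (norm w)\<^sup>2 + \<kappa> * (norm (frac_pow \<Omega> (\<beta>/2) w))\<^sup>2 + (norm z)\<^sup>2"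
    using pos by (intro add_nonneg_nonneg) auto
  show hs': "((\<lambda>\<mu>. (norm (coords U \<mu>))\<^sup>2) has_sum (N U)\<^sup>2) UNIV"
    unfolding eq using hs nn by (simp add: U' phase_norm_def)
  have "coords U \<mu> \<in> fibre_space \<mu>" for \<mu>
    using d b2 dom_pow_components(4) csubspaceD(4)[OF csubspace]
    by (simp add: U' coords_def fibre_space_def families_iff)
  then show "coords U \<in> square_summable"
    using has_sum_imp_summable[OF hs'] by (simp add: square_summable_def)
qed

lemma N_eq: "U \<in> X \<Longrightarrow> N U = sqrt (infsum (\<lambda>\<mu>. (norm (coords U \<mu>))\<^sup>2) UNIV)"
proof -
  assume U: "U \<in> X"
  have "0 \<le> N U" by (cases U) (use pos in \<open>simp add: phase_norm_def\<close>)
  then show ?thesis using infsumI[OF coords_norm(1)[OF U]] by simp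
qed

lemma N_nonneg: "0 \<le> N U"
  by (cases U) (use pos in \<open>simp add: phase_norm_def\<close>)

lemma norm_coords_le: "U \<in> X \<Longrightarrow> norm (coords U \<mu>) \<le> N U"
proof -
  assume U: "U \<in> X"
  have "(\<Sum>\<mu>\<in>{\<mu>}. (norm (coords U \<mu>))\<^sup>2) \<le> (N U)\<^sup>2"
    by (rule finite_sum_le_has_sum[OF coords_norm(1)[OF U]]) auto
  then show ?thesis by (intro power2_le_imp_le[OF _ N_nonneg]) simp
qed

lemma square_summable_component:
  assumes x: "x \<in> square_summable" and F: "F \<in> families"
    and le: "\<And>\<mu>. \<mu>\<^sub>0 \<le> \<mu> \<Longrightarrow> \<mu> powr s * norm (F \<mu>) \<le> C * norm (x \<mu>)"
  shows "F \<in> scale \<Omega> s"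
proof -
  have "(\<lambda>\<mu>. C\<^sup>2 * (norm (x \<mu>))\<^sup>2) summable_on UNIV"
    using x by (intro summable_on_cmult_right) (simp add: square_summable_def)
  moreover have "(\<mu> powr s * norm (F \<mu>))\<^sup>2 \<le> C\<^sup>2 * (norm (x \<mu>))\<^sup>2" for \<mu>
  proof (cases "\<mu>\<^sub>0 \<le> \<mu>")
    case True
    have "(\<mu> powr s * norm (F \<mu>))\<^sup>2 \<le> (C * norm (x \<mu>))\<^sup>2"
      by (intro power_mono le[OF True]) simp
    then show ?thesis by (simp add: power_mult_distrib)
  next
    case False
    then show ?thesis using families_gap[OF F] by simp
  qed
  ultimately have "(\<lambda>\<mu>. (\<mu> powr s * norm (F \<mu>))\<^sup>2) summable_on UNIV"
    by (rule summable_on_comparison_test) auto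
  then show ?thesis using F by (simp add: scale_iff)
qed

lemma square_summable_components:
  assumes x: "x \<in> square_summable"
  shows "(\<lambda>\<mu>. (1 / weight\<^sub>u \<mu>) *\<^sub>R fst (x \<mu>)) \<in> scale \<Omega> 1"
    "(\<lambda>\<mu>. (1 / weight\<^sub>v \<mu>) *\<^sub>R fst (snd (x \<mu>))) \<in> scale \<Omega> (1/2)"
    "(\<lambda>\<mu>. (1 / weight\<^sub>w \<mu>) *\<^sub>R fst (snd (snd (x \<mu>)))) \<in> scale \<Omega> (\<beta>/2)"
    "(\<lambda>\<mu>. snd (snd (snd (x \<mu>)))) \<in> scale \<Omega> 0"
proof -
  have mem: "x \<mu> \<in> fibre_space \<mu>" for \<mu> using x by (simp add: square_summable_def)
  have comp_le: "norm (fst (x \<mu>)) \<le> norm (x \<mu>)" "norm (fst (snd (x \<mu>))) \<le> norm (x \<mu>)"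
    "norm (fst (snd (snd (x \<mu>)))) \<le> norm (x \<mu>)" "norm (snd (snd (snd (x \<mu>)))) \<le> norm (x \<mu>)" for \<mu>
    by (cases "x \<mu>", auto simp: norm_quad intro!: real_le_rsqrt)+
  have fam: "(\<lambda>\<mu>. fst (x \<mu>)) \<in> families" "(\<lambda>\<mu>. fst (snd (x \<mu>))) \<in> families"
    "(\<lambda>\<mu>. fst (snd (snd (x \<mu>)))) \<in> families" "(\<lambda>\<mu>. snd (snd (snd (x \<mu>)))) \<in> families"
    using mem by (auto simp: families_iff fibre_space_def mem_Times_iff)
  note sc = square_summable_component[OF x]
  have p: "0 < \<mu>" if "\<mu>\<^sub>0 \<le> \<mu>" for \<mu> using that gap_pos by simp
  show "(\<lambda>\<mu>. (1 / weight\<^sub>u \<mu>) *\<^sub>R fst (x \<mu>)) \<in> scale \<Omega> 1"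
  proof (rule sc[OF families_scaleR[OF fam(1)], where C = "1 / sqrt \<alpha>"])
    fix \<mu> assume "\<mu>\<^sub>0 \<le> \<mu>"
    with p[OF this] pos comp_le(1)[of \<mu>] show "\<mu> powr 1 * norm ((1 / weight\<^sub>u \<mu>) *\<^sub>R fst (x \<mu>)) \<le> 1 / sqrt \<alpha> * norm (x \<mu>)"
      by (simp add: weight\<^sub>u_def divide_right_mono)
  qed
  show "(\<lambda>\<mu>. (1 / weight\<^sub>v \<mu>) *\<^sub>R fst (snd (x \<mu>))) \<in> scale \<Omega> (1/2)"
  proof (rule sc[OF families_scaleR[OF fam(2)], where C = "1 / sqrt \<alpha>"])
    fix \<mu> assume "\<mu>\<^sub>0 \<le> \<mu>"
    with p[OF this] pos comp_le(2)[of \<mu>]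
    show "\<mu> powr (1/2) * norm ((1 / weight\<^sub>v \<mu>) *\<^sub>R fst (snd (x \<mu>))) \<le> 1 / sqrt \<alpha> * norm (x \<mu>)"
      by (simp add: weight\<^sub>v_def divide_right_mono)
  qed
  show "(\<lambda>\<mu>. (1 / weight\<^sub>w \<mu>) *\<^sub>R fst (snd (snd (x \<mu>)))) \<in> scale \<Omega> (\<beta>/2)"
  proof (rule sc[OF families_scaleR[OF fam(3)], where C = "1 / sqrt \<kappa>"])
    fix \<mu> assume "\<mu>\<^sub>0 \<le> \<mu>"
    have "sqrt (\<kappa> * \<mu> powr \<beta>) \<le> weight\<^sub>w \<mu>" by (simp add: weight\<^sub>w_def)
    moreover have "sqrt (\<kappa> * \<mu> powr \<beta>) = sqrt \<kappa> * \<mu> powr (\<beta>/2)"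
      by (simp add: real_sqrt_mult powr_half_sqrt[symmetric] powr_powr)
    ultimately have "\<mu> powr (\<beta>/2) / weight\<^sub>w \<mu> \<le> 1 / sqrt \<kappa>"
      using weights_pos(3)[of \<mu>] pos by (simp add: field_simps)
    then have "\<mu> powr (\<beta>/2) / weight\<^sub>w \<mu> * norm (fst (snd (snd (x \<mu>)))) \<le> 1 / sqrt \<kappa> * norm (x \<mu>)"
      using comp_le(3)[of \<mu>] pos by (intro mult_mono) auto
    then show "\<mu> powr (\<beta>/2) * norm ((1 / weight\<^sub>w \<mu>) *\<^sub>R fst (snd (snd (x \<mu>)))) \<le> 1 / sqrt \<kappa> * norm (x \<mu>)"
      using weights_pos(3)[of \<mu>] by simp
  qed
  show "(\<lambda>\<mu>. snd (snd (snd (x \<mu>)))) \<in> scale \<Omega> 0"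
  proof (rule sc[OF fam(4), where C = 1])
    fix \<mu> show "\<mu> powr 0 * norm (snd (snd (snd (x \<mu>)))) \<le> 1 * norm (x \<mu>)"
      using comp_le(4)[of \<mu>] by simp
  qed
qed

text \<open>Surjectivity of \<open>coords\<close>; with injectivity and the isometry it yields the
  unitary equivalence in which all further computations take place.\<close>

lemma assemble:
  assumes x: "x \<in> square_summable"
  shows "assemble x \<in> X" "coords (assemble x) = x"
proof -
  have b2: "0 \<le> \<beta> / 2" using pos by simp
  note sc = square_summable_components[OF x]
  note sy = synthesis_dom_pow[OF sc(1)] synthesis_dom_pow[OF sc(2)] synthesis_dom_pow[OF sc(3) b2] synthesis_dom_pow[OF sc(4)]
  show "assemble x \<in> X"
    using sy by (simp add: assemble_def phase_space_def)
  show "coords (assemble x) = x"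
  proof
    fix \<mu>
    obtain p q r z where xmu: "x \<mu> = (p, q, r, z)" by (cases "x \<mu>")
    show "coords (assemble x) \<mu> = x \<mu>"
    proof (cases "\<mu>\<^sub>0 \<le> \<mu>")
      case True
      then have "0 < \<mu>" using gap_pos by simp
      from weights_pos(1,2)[OF this] weights_pos(3)[of \<mu>] show ?thesis
        using sy by (simp add: assemble_def coords_def xmu)
    next
      case False
      then have "x \<mu> = 0"
        using x fibre_space_gap[of "x \<mu>" \<mu>] by (simp add: square_summable_def)
      then show ?thesis using sy by (simp add: assemble_def coords_def zero_prod_def)
    qed
  qed
qed

lemma coords_inject:
  assumes "U \<in> X" "V \<in> X" "coords U = coords V"
  shows "U = V"
proof -
  obtain u v w z where U: "U = (u, v, w, z)" by (cases U)
  obtain u' v' w' z' where V: "V = (u', v', w', z')" by (cases V)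
  note d = phase_spaceD[OF assms(1)[unfolded U]] and d' = phase_spaceD[OF assms(2)[unfolded V]]
  have b2: "0 \<le> \<beta> / 2" using pos by simp
  have eq: "components \<Omega> u \<mu> = components \<Omega> u' \<mu> \<and> components \<Omega> v \<mu> = components \<Omega> v' \<mu> \<and>
      components \<Omega> w \<mu> = components \<Omega> w' \<mu> \<and> components \<Omega> z \<mu> = components \<Omega> z' \<mu>" for \<mu>
  proof (cases "\<mu>\<^sub>0 \<le> \<mu>")
    case True
    then have "0 < \<mu>" using gap_pos by simp
    from weights_pos(1,2)[OF this] weights_pos(3)[of \<mu>] show ?thesis
      using fun_cong[OF assms(3), of \<mu>] by (simp add: U V coords_def)
  next
    case False
    then have "\<mu> < \<mu>\<^sub>0" by simp
    then show ?thesis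
      using components_gap[OF _ d(1)] components_gap[OF _ d(2)] components_gap[OF b2 d(3)] components_gap[OF _ d(4)]
        components_gap[OF _ d'(1)] components_gap[OF _ d'(2)] components_gap[OF b2 d'(3)] components_gap[OF _ d'(4)]
      by simp
  qed
  have inj: "f = g" if "f \<in> dom_pow \<Omega> s" "g \<in> dom_pow \<Omega> s" "0 \<le> s" "\<And>\<mu>. components \<Omega> f \<mu> = components \<Omega> g \<mu>" for f g s
  proof -
    have "components \<Omega> f = components \<Omega> g" by (rule ext) (rule that(4))
    then show ?thesis
      using dom_pow_components(3)[OF that(1,3)] dom_pow_components(3)[OF that(2,3)] by argo
  qed
  have "u = u'" "v = v'" "w = w'" "z = z'"
    using eq by (auto intro: inj[OF d(1) d'(1)] inj[OF d(2) d'(2)] inj[OF d(3) d'(3) b2] inj[OF d(4) d'(4)])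
  then show ?thesis by (simp add: U V)
qed

lemma assemble_coords: "U \<in> X \<Longrightarrow> assemble (coords U) = U"
  using assemble[OF coords_norm(2)] by (intro coords_inject) auto

lemma coords_add:
  assumes "U \<in> X" "V \<in> X"
  shows "coords (U + V) = (\<lambda>\<mu>. coords U \<mu> + coords V \<mu>)" "U + V \<in> X"
proof -
  obtain u v w z where U: "U = (u, v, w, z)" by (cases U)
  obtain u' v' w' z' where V: "V = (u', v', w', z')" by (cases V)
  note d = phase_spaceD[OF assms(1)[unfolded U]] and d' = phase_spaceD[OF assms(2)[unfolded V]]
  have b2: "0 \<le> \<beta> / 2" using pos by simp
  note ca = components_add[OF d(1) d'(1)] components_add[OF d(2) d'(2)] components_add[OF d(3) d'(3) b2] components_add[OF d(4) d'(4)]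
  show "coords (U + V) = (\<lambda>\<mu>. coords U \<mu> + coords V \<mu>)"
    using ca by (simp add: U V coords_def scaleR_add_right fun_eq_iff)
  show "U + V \<in> X" using ca by (simp add: U V phase_space_def)
qed

lemma coords_scaleC:
  assumes "U \<in> X"
  shows "coords (k *\<^sub>C U) = (\<lambda>\<mu>. k *\<^sub>C coords U \<mu>)" "k *\<^sub>C U \<in> X"
proof -
  obtain u v w z where U: "U = (u, v, w, z)" by (cases U)
  note d = phase_spaceD[OF assms(1)[unfolded U]]
  have b2: "0 \<le> \<beta> / 2" using pos by simp
  note ca = components_scaleC[OF d(1)] components_scaleC[OF d(2)] components_scaleC[OF d(3) b2] components_scaleC[OF d(4)]
  show "coords (k *\<^sub>C U) = (\<lambda>\<mu>. k *\<^sub>C coords U \<mu>)"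
    using ca by (simp add: U coords_def scaleC_quad scaleC_scaleR fun_eq_iff)
  show "k *\<^sub>C U \<in> X" using ca by (simp add: U phase_space_def scaleC_quad)
qed

lemma csubspace_phase_space: "csubspace X"
proof -
  have "(\<lambda>_. 0) \<in> square_summable"
    using csubspaceD(1)[OF csubspace_fibre_space] by (simp add: square_summable_def)
  then have "X \<noteq> {}" using assemble(1) by blast
  then obtain U where "U \<in> X" by blast
  then have "0 \<in> X" using coords_scaleC(2)[of U 0] by simp
  then show ?thesis using coords_add(2) coords_scaleC(2) by (auto simp: csubspace_def)
qed

lemma coords_scaleR: "U \<in> X \<Longrightarrow> coords (r *\<^sub>R U) = (\<lambda>\<mu>. r *\<^sub>R coords U \<mu>)"
  using coords_scaleC(1)[of U "complex_of_real r"] by (simp add: scaleC_of_real)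

lemma coords_diff: "U \<in> X \<Longrightarrow> V \<in> X \<Longrightarrow> coords (U - V) = (\<lambda>\<mu>. coords U \<mu> - coords V \<mu>)"
  using coords_add(1)[of U "- V"] coords_scaleC[of V "- 1"] by (simp add: scaleC_minus_left)

end

section \<open>Lifted matrices: norms, derivatives and mean values\<close>

lemma norm_vscale: "norm (vscale c (x :: 'a::euclidean_space l2)) = norm c * norm x"
proof -
  obtain c1 c2 c3 c4 where c: "c = (c1, c2, c3, c4)" by (cases c)
  have "(norm (vscale c x))\<^sup>2 = (norm c * norm x)\<^sup>2"
    by (simp add: c vscale_def norm_quad norm_scaleC_l2 power_mult_distrib distrib_right)
  then show ?thesis by (simp add: power2_eq_iff_nonneg)
qed

text \<open>Transfers derivatives of exp(tM) in the operator algebra to the trajectories. The crude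
  bound by the sum of the four norms suffices, since only boundedness matters here.\<close>

lemma bounded_linear_lift_op: "bounded_linear (\<lambda>T. lift_op T (x :: 'a::euclidean_space state))"
proof -
  obtain x1 x2 x3 x4 where x: "x = (x1, x2, x3, x4)" by (cases x)
  have v: "norm (vscale (bop_apply T (e :: cvec)) y) \<le> norm T * norm e * norm y" for T e and y :: "'a l2"
    unfolding norm_vscale by (intro mult_right_mono norm_bop_apply) simp
  have e: "norm ((1, 0, 0, 0) :: cvec) = 1" "norm ((0, 1, 0, 0) :: cvec) = 1"
    "norm ((0, 0, 1, 0) :: cvec) = 1" "norm ((0, 0, 0, 1) :: cvec) = 1"
    by (simp_all add: norm_quad)
  show ?thesis
  proof (rule bounded_linear_intro)
    show "lift_op (S + T) x = lift_op S x + lift_op T x" for S T by (rule lift_op_plus)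
    show "lift_op (r *\<^sub>R T) x = r *\<^sub>R lift_op T x" for r T by (rule lift_op_scaleR)
    fix T :: "cvec bop"
    have "norm (lift_op T x) \<le> norm T * norm x1 + norm T * norm x2 + norm T * norm x3 + norm T * norm x4"
      unfolding x lift_op_def prod.case
      using v[of T "(1, 0, 0, 0)" x1] v[of T "(0, 1, 0, 0)" x2] v[of T "(0, 0, 1, 0)" x3] v[of T "(0, 0, 0, 1)" x4]
      unfolding e mult_1_right by (intro norm_triangle_mono)
    then show "norm (lift_op T x) \<le> norm T * (norm x1 + norm x2 + norm x3 + norm x4)"
      by (simp add: distrib_left)
  qed
qed

lemma has_vector_derivative_lift_op_exp:
  "((\<lambda>t. lift_op (exp (t *\<^sub>R M)) x) has_vector_derivative lift_op (exp (t *\<^sub>R M) * M) (x :: 'a::euclidean_space state))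
    (at t within S)"
  by (intro bounded_linear.has_vector_derivative[OF bounded_linear_lift_op]
      exp_scaleR_has_vector_derivative_right)

lemma vector_mean_value:
  fixes f :: "real \<Rightarrow> 'b::real_normed_vector"
  assumes S: "convex S" "x \<in> S" "y \<in> S"
    and f: "\<And>s. s \<in> S \<Longrightarrow> (f has_vector_derivative f' s) (at s within S)" "\<And>s. s \<in> S \<Longrightarrow> norm (f' s) \<le> B"
  shows "norm (f x - f y) \<le> B * \<bar>x - y\<bar>"
proof -
  have "norm (f x - f y) \<le> B * norm (x - y)"
  proof (rule differentiable_bound[OF S(1) _ _ S(2,3)])
    show "(f has_derivative (\<lambda>h. h *\<^sub>R f' s)) (at s within S)" if "s \<in> S" for s
      using f(1)[OF that] by (simp add: has_vector_derivative_def)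
    show "onorm (\<lambda>h. h *\<^sub>R f' s) \<le> B" if "s \<in> S" for s
      using onorm_le[of "\<lambda>h. h *\<^sub>R f' s" "norm (f' s)"] f(2)[OF that] by (auto simp: mult.commute intro: order_trans)
  qed
  then show ?thesis by simp
qed

lemma op_norm_le:
  assumes "\<And>x. x \<in> X \<Longrightarrow> N (T x) \<le> c * N x" "0 \<le> c"
  shows "op_norm X N T \<le> ereal c"
  unfolding op_norm_def
proof (rule SUP_least)
  fix x assume x: "x \<in> {x\<in>X. N x \<le> 1}"
  then have "N (T x) \<le> c * N x" using assms by simp
  also have "\<dots> \<le> c * 1" using x assms(2) by (intro mult_left_mono) auto
  finally show "ereal (N (T x)) \<le> ereal c" by simp
qed

lemma op_norm_cong: "(\<And>x. x \<in> X \<Longrightarrow> S x = T x) \<Longrightarrow> op_norm X N S = op_norm X N T"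
  unfolding op_norm_def by (rule SUP_cong) auto

section \<open>Operators that act by one matrix in each component\<close>

context coupled_system
begin

lemma coords_mem: "U \<in> X \<Longrightarrow> coords U \<mu> \<in> fibre_space \<mu>"
  using coords_norm(2) by (simp add: square_summable_def)

lemma coords_gap: "U \<in> X \<Longrightarrow> \<mu> < \<mu>\<^sub>0 \<Longrightarrow> coords U \<mu> = 0"
  using coords_mem fibre_space_gap by blast

lemma lift_op_fibre_space: "x \<in> fibre_space \<mu> \<Longrightarrow> lift_op T x \<in> fibre_space \<mu>"
  unfolding fibre_space_def by (rule lift_op_mem[OF csubspace])

lemma N_le:
  assumes U: "U \<in> X" and V: "V \<in> X" and c: "0 \<le> c"
    and le: "\<And>\<mu>. \<mu>\<^sub>0 \<le> \<mu> \<Longrightarrow> norm (coords U \<mu>) \<le> c * norm (coords V \<mu>)"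
  shows "N U \<le> c * N V"
proof -
  have "(norm (coords U \<mu>))\<^sup>2 \<le> c\<^sup>2 * (norm (coords V \<mu>))\<^sup>2" for \<mu>
  proof (cases "\<mu>\<^sub>0 \<le> \<mu>")
    case True
    have "(norm (coords U \<mu>))\<^sup>2 \<le> (c * norm (coords V \<mu>))\<^sup>2" by (intro power_mono le[OF True]) simp
    then show ?thesis by (simp add: power_mult_distrib)
  next
    case False
    then show ?thesis using coords_gap[OF U] by simp
  qed
  then have "(N U)\<^sup>2 \<le> c\<^sup>2 * (N V)\<^sup>2"
    by (intro has_sum_mono[OF coords_norm(1)[OF U] has_sum_cmult_right[OF coords_norm(1)[OF V]]])
  then have "(N U)\<^sup>2 \<le> (c * N V)\<^sup>2" by (simp only: power_mult_distrib)
  then show ?thesis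
    by (rule power2_le_imp_le) (intro mult_nonneg_nonneg c N_nonneg)
qed

text \<open>Dominated convergence in the phase norm: limits in the single components suffice,
  without uniformity in \<mu>, once a fixed element of the phase space dominates.\<close>

lemma N_tendsto_0:
  assumes V: "\<forall>\<^sub>F t in G. V t \<in> X" and Y: "Y \<in> X"
    and le: "\<forall>\<^sub>F t in G. \<forall>\<mu>\<ge>\<mu>\<^sub>0. norm (coords (V t) \<mu>) \<le> c * norm (coords Y \<mu>)"
    and lim: "\<And>\<mu>. \<mu>\<^sub>0 \<le> \<mu> \<Longrightarrow> ((\<lambda>t. norm (coords (V t) \<mu>)) \<longlongrightarrow> 0) G"
  shows "((\<lambda>t. N (V t)) \<longlongrightarrow> 0) G"
proof -
  define a where "a t \<mu> = (if \<mu>\<^sub>0 \<le> \<mu> then (norm (coords (V t) \<mu>))\<^sup>2 else 0)" for t \<mu>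
  have "((\<lambda>t. infsum (a t) UNIV) \<longlongrightarrow> 0) G"
  proof (rule tendsto_infsum_dominated)
    show "(\<lambda>\<mu>. c\<^sup>2 * (norm (coords Y \<mu>))\<^sup>2) summable_on UNIV"
      using coords_norm(2)[OF Y] by (intro summable_on_cmult_right) (simp add: square_summable_def)
    show "\<forall>\<^sub>F t in G. \<forall>\<mu>. 0 \<le> a t \<mu> \<and> a t \<mu> \<le> c\<^sup>2 * (norm (coords Y \<mu>))\<^sup>2"
      using le
    proof eventually_elim
      case (elim t)
      have "(norm (coords (V t) \<mu>))\<^sup>2 \<le> (c * norm (coords Y \<mu>))\<^sup>2" if "\<mu>\<^sub>0 \<le> \<mu>" for \<mu>
        by (intro power_mono) (use elim that in auto)
      then show ?case by (auto simp: a_def power_mult_distrib)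
    qed
    show "((\<lambda>t. a t \<mu>) \<longlongrightarrow> 0) G" for \<mu>
      using tendsto_power[OF lim[of \<mu>], of 2] by (cases "\<mu>\<^sub>0 \<le> \<mu>") (simp_all add: a_def)
  qed
  then have "((\<lambda>t. sqrt (infsum (a t) UNIV)) \<longlongrightarrow> sqrt 0) G" by (rule tendsto_real_sqrt)
  then have lim0: "((\<lambda>t. sqrt (infsum (a t) UNIV)) \<longlongrightarrow> 0) G" by simp
  show ?thesis
  proof (rule Lim_transform_eventually[OF lim0])
    show "\<forall>\<^sub>F t in G. sqrt (infsum (a t) UNIV) = N (V t)"
      using V
    proof eventually_elim
      case (elim t)
      have "a t = (\<lambda>\<mu>. (norm (coords (V t) \<mu>))\<^sup>2)"
        using coords_gap[OF elim] by (auto simp: a_def fun_eq_iff)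
      then show ?case using N_eq[OF elim] by simp
    qed
  qed
qed

text \<open>A multiplier with matrix values: semigroup, resolvent and all derivatives have this
  form, so each of them is controlled by the supremum of its matrix norms.\<close>

definition family_op :: "(real \<Rightarrow> cvec bop) \<Rightarrow> 'a state \<Rightarrow> 'a state" where
  "family_op T U = assemble (\<lambda>\<mu>. lift_op (T \<mu>) (coords U \<mu>))"

definition bounded_family :: "(real \<Rightarrow> cvec bop) \<Rightarrow> real \<Rightarrow> bool" where
  "bounded_family T c \<longleftrightarrow> (\<forall>\<mu>\<ge>\<mu>\<^sub>0. clinear_op (T \<mu>) \<and> norm (T \<mu>) \<le> c)"

lemma bounded_family_nonneg: "bounded_family T c \<Longrightarrow> 0 \<le> c"
  unfolding bounded_family_def by (rule order_trans[OF norm_ge_zero[of "T \<mu>\<^sub>0"]]) simp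

lemma family_op:
  assumes T: "bounded_family T c" and U: "U \<in> X"
  shows "family_op T U \<in> X" "coords (family_op T U) = (\<lambda>\<mu>. lift_op (T \<mu>) (coords U \<mu>))"
    "N (family_op T U) \<le> c * N U"
proof -
  have le: "norm (lift_op (T \<mu>) (coords U \<mu>)) \<le> c * norm (coords U \<mu>)" if "\<mu>\<^sub>0 \<le> \<mu>" for \<mu>
    using T that by (intro order_trans[OF norm_lift_op] mult_right_mono) (auto simp: bounded_family_def)
  have ss: "(\<lambda>\<mu>. lift_op (T \<mu>) (coords U \<mu>)) \<in> square_summable"
    by (rule square_summableI_le[OF lift_op_fibre_space[OF coords_mem[OF U]] coords_norm(2)[OF U] le])
  show *: "family_op T U \<in> X" "coords (family_op T U) = (\<lambda>\<mu>. lift_op (T \<mu>) (coords U \<mu>))"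
    unfolding family_op_def using assemble[OF ss] by auto
  show "N (family_op T U) \<le> c * N U"
    by (rule N_le[OF *(1) U bounded_family_nonneg[OF T]]) (simp add: *(2) le)
qed

lemma coords_eq_family_op:
  "V \<in> X \<Longrightarrow> coords V = (\<lambda>\<mu>. lift_op (T \<mu>) (coords U \<mu>)) \<Longrightarrow> V = family_op T U"
  unfolding family_op_def using assemble_coords[of V] by simp

lemma bounded_op_family_op:
  assumes T: "bounded_family T c"
  shows "bounded_op X N (family_op T)" "op_norm X N (family_op T) \<le> ereal c"
proof -
  show n: "op_norm X N (family_op T) \<le> ereal c"
    by (intro op_norm_le family_op(3)[OF T] bounded_family_nonneg[OF T])
  have "family_op T (U + V) = family_op T U + family_op T V" if "U \<in> X" "V \<in> X" for U V
    by (rule coords_eq_family_op[symmetric])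
      (use that T in \<open>simp_all add: coords_add family_op lift_op_add\<close>)
  moreover have "family_op T (k *\<^sub>C U) = k *\<^sub>C family_op T U" if "U \<in> X" for U k
    by (rule coords_eq_family_op[symmetric])
      (use that T in \<open>simp_all add: coords_scaleC family_op lift_op_scaleC\<close>)
  moreover have "op_norm X N (family_op T) < \<infinity>"
    using n by (auto intro: le_less_trans)
  ultimately show "bounded_op X N (family_op T)"
    using family_op(1)[OF T] by (simp add: bounded_op_def)
qed

end

section \<open>The domain and the operator in energy coordinates\<close>

context dirichlet_domain
begin

lemma scale_equiv:
  assumes "F \<in> families" "G \<in> families"
    and "\<And>\<mu>. \<mu>\<^sub>0 \<le> \<mu> \<Longrightarrow> \<mu> powr r * norm (F \<mu>) \<le> C * (\<mu> powr s * norm (G \<mu>))"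
    and "\<And>\<mu>. \<mu>\<^sub>0 \<le> \<mu> \<Longrightarrow> \<mu> powr s * norm (G \<mu>) \<le> C' * (\<mu> powr r * norm (F \<mu>))"
  shows "F \<in> scale \<Omega> r \<longleftrightarrow> G \<in> scale \<Omega> s"
  using scale_mono[OF assms(1) _ assms(3)] scale_mono[OF assms(2) _ assms(4)] by blast

lemma scale_scaleR:
  assumes "F \<in> scale \<Omega> s" shows "(\<lambda>\<mu>. r *\<^sub>R F \<mu>) \<in> scale \<Omega> s"
proof -
  have F: "F \<in> families" using assms by (simp add: scale_iff)
  show ?thesis
    by (rule scale_mono[OF families_scaleR[OF F] assms, where C = "\<bar>r\<bar>"]) simp
qed

lemma scale_add:
  assumes "F \<in> scale \<Omega> s" "G \<in> scale \<Omega> s" "0 \<le> s" shows "(\<lambda>\<mu>. F \<mu> + G \<mu>) \<in> scale \<Omega> s"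
proof -
  note F = synthesis_dom_pow[OF assms(1,3)] and G = synthesis_dom_pow[OF assms(2,3)]
  from components_add[OF F(1) G(1) assms(3)] F(2) G(2) dom_pow_components(1)[OF _ assms(3)] show ?thesis
    by metis
qed

lemma families_add: "F \<in> families \<Longrightarrow> G \<in> families \<Longrightarrow> (\<lambda>\<mu>. F \<mu> + G \<mu>) \<in> families"
  using csubspaceD(2)[OF csubspace] by (auto simp: families_iff)

lemma families_diff: "F \<in> families \<Longrightarrow> G \<in> families \<Longrightarrow> (\<lambda>\<mu>. F \<mu> - G \<mu>) \<in> families"
  using csubspaceD(6)[OF csubspace] by (auto simp: families_iff)

end

context coupled_system
begin

lemma square_summable_iff:
  "x \<in> square_summable \<longleftrightarrow> (\<lambda>\<mu>. fst (x \<mu>)) \<in> scale \<Omega> 0 \<and> (\<lambda>\<mu>. fst (snd (x \<mu>))) \<in> scale \<Omega> 0 \<and>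
     (\<lambda>\<mu>. fst (snd (snd (x \<mu>)))) \<in> scale \<Omega> 0 \<and> (\<lambda>\<mu>. snd (snd (snd (x \<mu>)))) \<in> scale \<Omega> 0"
proof
  assume x: "x \<in> square_summable"
  have mem: "x \<mu> \<in> fibre_space \<mu>" for \<mu> using x by (simp add: square_summable_def)
  have comp_le: "\<mu> powr 0 * norm (fst (x \<mu>)) \<le> 1 * norm (x \<mu>)" "\<mu> powr 0 * norm (fst (snd (x \<mu>))) \<le> 1 * norm (x \<mu>)"
    "\<mu> powr 0 * norm (fst (snd (snd (x \<mu>)))) \<le> 1 * norm (x \<mu>)" "\<mu> powr 0 * norm (snd (snd (snd (x \<mu>)))) \<le> 1 * norm (x \<mu>)" for \<mu>
    by (cases "x \<mu>", auto simp: norm_quad intro!: real_le_rsqrt)+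
  have fam: "(\<lambda>\<mu>. fst (x \<mu>)) \<in> families" "(\<lambda>\<mu>. fst (snd (x \<mu>))) \<in> families"
    "(\<lambda>\<mu>. fst (snd (snd (x \<mu>)))) \<in> families" "(\<lambda>\<mu>. snd (snd (snd (x \<mu>)))) \<in> families"
    using mem by (auto simp: families_iff fibre_space_def mem_Times_iff)
  show "(\<lambda>\<mu>. fst (x \<mu>)) \<in> scale \<Omega> 0 \<and> (\<lambda>\<mu>. fst (snd (x \<mu>))) \<in> scale \<Omega> 0 \<and>
     (\<lambda>\<mu>. fst (snd (snd (x \<mu>)))) \<in> scale \<Omega> 0 \<and> (\<lambda>\<mu>. snd (snd (snd (x \<mu>)))) \<in> scale \<Omega> 0"
    by (intro conjI square_summable_component[OF x fam(1) comp_le(1)] square_summable_component[OF x fam(2) comp_le(2)]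
      square_summable_component[OF x fam(3) comp_le(3)] square_summable_component[OF x fam(4) comp_le(4)])
next
  assume a: "(\<lambda>\<mu>. fst (x \<mu>)) \<in> scale \<Omega> 0 \<and> (\<lambda>\<mu>. fst (snd (x \<mu>))) \<in> scale \<Omega> 0 \<and>
     (\<lambda>\<mu>. fst (snd (snd (x \<mu>)))) \<in> scale \<Omega> 0 \<and> (\<lambda>\<mu>. snd (snd (snd (x \<mu>)))) \<in> scale \<Omega> 0"
  have n: "(norm (x \<mu>))\<^sup>2 = (norm (fst (x \<mu>)))\<^sup>2 + (norm (fst (snd (x \<mu>))))\<^sup>2 + (norm (fst (snd (snd (x \<mu>)))))\<^sup>2
      + (norm (snd (snd (snd (x \<mu>)))))\<^sup>2" for \<mu>
    by (cases "x \<mu>") (simp add: norm_quad)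
  have "(\<lambda>\<mu>. (norm (x \<mu>))\<^sup>2) summable_on UNIV"
    unfolding n using a by (intro summable_on_add scale_norm_summable(2)[of _ 0]) auto
  moreover have "x \<mu> \<in> fibre_space \<mu>" for \<mu>
    using a by (simp add: fibre_space_def mem_Times_iff scale_iff families_iff)
  ultimately show "x \<in> square_summable" by (simp add: square_summable_def)
qed

text \<open>The candidate for the coordinates of \<open>B U\<close>, formed for every state of the
  phase space; membership in the domain then becomes its square-summability.\<close>

definition fibrewise_op :: "'a state \<Rightarrow> real \<Rightarrow> 'a state" where
  "fibrewise_op U \<mu> = lift_op (fibre \<alpha> \<kappa> \<gamma> \<delta> \<theta> \<beta> \<mu>) (coords U \<mu>)"

lemma weight\<^sub>w_square: "(weight\<^sub>w \<mu>)\<^sup>2 = 1 + \<kappa> * \<mu> powr \<beta>"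
  using pos by (simp add: weight\<^sub>w_def)

lemma fibrewise_op:
  fixes u v w z :: "'a l2" and \<mu> :: real
  defines "G \<equiv> \<alpha> *\<^sub>R scale_pow 2 (components \<Omega> u) \<mu> + \<gamma> *\<^sub>R scale_pow 1 (components \<Omega> z) \<mu>"
    and "H \<equiv> - \<alpha> *\<^sub>R scale_pow 1 (components \<Omega> v) \<mu> + \<gamma> *\<^sub>R scale_pow 1 (components \<Omega> w) \<mu>
      - \<delta> *\<^sub>R scale_pow \<theta> (components \<Omega> z) \<mu>"
  assumes mu: "0 < \<mu>"
  shows "fibrewise_op (u, v, w, z) \<mu> = (weight\<^sub>u \<mu> *\<^sub>R components \<Omega> w \<mu>, weight\<^sub>v \<mu> *\<^sub>R components \<Omega> z \<mu>,
    - ((1 / weight\<^sub>w \<mu>) *\<^sub>R G), H)"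
proof -
  have w: "sqrt (1 + \<kappa> * \<mu> powr \<beta>) = weight\<^sub>w \<mu>" by (simp add: weight\<^sub>w_def)
  have "0 < weight\<^sub>w \<mu>" by (rule weights_pos)
  moreover have "\<mu> powr (1/2) * \<mu> powr (1/2) = \<mu>" using mu by (simp add: powr_half_sqrt)
  moreover have "\<mu> powr 2 = \<mu> * \<mu>" using mu by (simp add: power2_eq_square)
  moreover have "sqrt \<alpha> * sqrt \<alpha> = \<alpha>" using pos by simp
  ultimately show ?thesis
    using mu by (simp add: fibrewise_op_def coords_def fibre_def lift_op_fibre_op w G_def H_def scale_pow_def
      weight\<^sub>u_def weight\<^sub>v_def algebra_simps)
qed

abbreviation "D \<equiv> dom_B \<Omega> \<alpha> \<gamma> \<delta> \<theta> \<beta>"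
abbreviation "B \<equiv> op_B \<Omega> \<alpha> \<kappa> \<gamma> \<delta> \<theta> \<beta>"

lemma weight\<^sub>w_bounds:
  assumes "\<mu>\<^sub>0 \<le> \<mu>"
  shows "weight\<^sub>w \<mu> \<le> sqrt (\<mu>\<^sub>0 powr (- \<beta>) + \<kappa>) * \<mu> powr (\<beta>/2)" "sqrt \<kappa> * \<mu> powr (\<beta>/2) \<le> weight\<^sub>w \<mu>"
proof -
  have mu: "0 < \<mu>" using assms gap_pos by simp
  have s: "sqrt (\<mu> powr \<beta>) = \<mu> powr (\<beta>/2)"
    using mu by (simp add: powr_half_sqrt[symmetric] powr_powr)
  have "\<mu>\<^sub>0 powr \<beta> \<le> \<mu> powr \<beta>"
    using assms gap_pos pos by (intro powr_mono2) auto
  then have "1 \<le> \<mu>\<^sub>0 powr (- \<beta>) * \<mu> powr \<beta>"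
    using gap_pos by (simp add: powr_minus field_simps)
  then have "1 + \<kappa> * \<mu> powr \<beta> \<le> (\<mu>\<^sub>0 powr (- \<beta>) + \<kappa>) * \<mu> powr \<beta>"
    by (simp add: distrib_right)
  then have "weight\<^sub>w \<mu> \<le> sqrt ((\<mu>\<^sub>0 powr (- \<beta>) + \<kappa>) * \<mu> powr \<beta>)"
    unfolding weight\<^sub>w_def by (rule real_sqrt_le_mono)
  then show "weight\<^sub>w \<mu> \<le> sqrt (\<mu>\<^sub>0 powr (- \<beta>) + \<kappa>) * \<mu> powr (\<beta>/2)"
    by (simp add: real_sqrt_mult s)
  have "sqrt (\<kappa> * \<mu> powr \<beta>) \<le> weight\<^sub>w \<mu>" unfolding weight\<^sub>w_def by (rule real_sqrt_le_mono) simp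
  then show "sqrt \<kappa> * \<mu> powr (\<beta>/2) \<le> weight\<^sub>w \<mu>" by (simp add: real_sqrt_mult s)
qed

lemma components_families:
  assumes "(u, v, w, z) \<in> X"
  shows "components \<Omega> u \<in> families" "components \<Omega> v \<in> families" "components \<Omega> w \<in> families"
    "components \<Omega> z \<in> families"
  using dom_pow_components(4)[OF phase_spaceD(1)[OF assms]] dom_pow_components(4)[OF phase_spaceD(2)[OF assms]]
    dom_pow_components(4)[OF phase_spaceD(3)[OF assms]] dom_pow_components(4)[OF phase_spaceD(4)[OF assms]] pos
  by auto

lemma fibrewise_op_phase_space:
  assumes U: "(u, v, w, z) \<in> X"
  shows "fibrewise_op (u, v, w, z) = (\<lambda>\<mu>. (weight\<^sub>u \<mu> *\<^sub>R components \<Omega> w \<mu>, weight\<^sub>v \<mu> *\<^sub>R components \<Omega> z \<mu>,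
    - ((1 / weight\<^sub>w \<mu>) *\<^sub>R (\<alpha> *\<^sub>R scale_pow 2 (components \<Omega> u) \<mu> + \<gamma> *\<^sub>R scale_pow 1 (components \<Omega> z) \<mu>)),
    - \<alpha> *\<^sub>R scale_pow 1 (components \<Omega> v) \<mu> + \<gamma> *\<^sub>R scale_pow 1 (components \<Omega> w) \<mu>
      - \<delta> *\<^sub>R scale_pow \<theta> (components \<Omega> z) \<mu>))"
proof
  fix \<mu>
  show "fibrewise_op (u, v, w, z) \<mu> = (weight\<^sub>u \<mu> *\<^sub>R components \<Omega> w \<mu>, weight\<^sub>v \<mu> *\<^sub>R components \<Omega> z \<mu>,
    - ((1 / weight\<^sub>w \<mu>) *\<^sub>R (\<alpha> *\<^sub>R scale_pow 2 (components \<Omega> u) \<mu> + \<gamma> *\<^sub>R scale_pow 1 (components \<Omega> z) \<mu>)),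
    - \<alpha> *\<^sub>R scale_pow 1 (components \<Omega> v) \<mu> + \<gamma> *\<^sub>R scale_pow 1 (components \<Omega> w) \<mu>
      - \<delta> *\<^sub>R scale_pow \<theta> (components \<Omega> z) \<mu>)"
  proof (cases "\<mu>\<^sub>0 \<le> \<mu>")
    case True
    then have "0 < \<mu>" using gap_pos by simp
    then show ?thesis by (rule fibrewise_op)
  next
    case False
    then have g: "\<mu> < \<mu>\<^sub>0" by simp
    have "fibrewise_op (u, v, w, z) \<mu> = 0"
      using fibre_space_gap[OF lift_op_fibre_space[OF coords_mem[OF U]] g] by (simp add: fibrewise_op_def)
    then show ?thesis
      using components_families[OF U, THEN families_gap, OF g] by (simp add: zero_prod_def scale_pow_def)
  qed
qed

text \<open>The four conditions of the domain correspond one by one to the four coordinates of the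
  candidate image, so the domain is the maximal one. This is the form in which the generator is
  identified.\<close>

lemma dom_B_iff: "U \<in> D \<longleftrightarrow> U \<in> X \<and> fibrewise_op U \<in> square_summable"
proof (cases "U \<in> X")
  case False
  then show ?thesis by (auto simp: dom_B_def Let_def)
next
  case True
  obtain u v w z where U: "U = (u, v, w, z)" by (cases U)
  note d = phase_spaceD[OF True[unfolded U]]
  have b2: "0 \<le> \<beta> / 2" using pos by simp
  let ?u = "components \<Omega> u" and ?v = "components \<Omega> v" and ?w = "components \<Omega> w" and ?z = "components \<Omega> z"
  note fam = components_families[OF True[unfolded U]]
  have pow: "scale_pow r F \<in> families" if "F \<in> families" for F r
    unfolding scale_pow_def by (rule families_scaleR[OF that])
  have sca: "(\<lambda>\<mu>. r *\<^sub>R F \<mu>) \<in> families" if "F \<in> families" for F r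
    by (rule families_scaleR[OF that])
  define G where "G = (\<lambda>\<mu>. \<alpha> *\<^sub>R scale_pow 2 ?u \<mu> + \<gamma> *\<^sub>R scale_pow 1 ?z \<mu>)"
  define H where "H = (\<lambda>\<mu>. - \<alpha> *\<^sub>R scale_pow 1 ?v \<mu> + \<gamma> *\<^sub>R scale_pow 1 ?w \<mu> - \<delta> *\<^sub>R scale_pow \<theta> ?z \<mu>)"
  define G' where "G' = (\<lambda>\<mu>. - \<alpha> *\<^sub>R scale_pow 2 ?u \<mu> - \<gamma> *\<^sub>R scale_pow 1 ?z \<mu>)"
  define H' where "H' = (\<lambda>\<mu>. - \<alpha> *\<^sub>R ?v \<mu> - \<delta> *\<^sub>R scale_pow (\<theta> - 1) ?z \<mu>)"
  have fam': "G \<in> families" "H \<in> families" "G' \<in> families" "H' \<in> families"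
    unfolding G_def H_def G'_def H'_def by (intro families_add families_diff sca pow fam)+
  have wfam: "(\<lambda>\<mu>. weight\<^sub>u \<mu> *\<^sub>R ?w \<mu>) \<in> families" "(\<lambda>\<mu>. weight\<^sub>v \<mu> *\<^sub>R ?z \<mu>) \<in> families"
    "(\<lambda>\<mu>. - ((1 / weight\<^sub>w \<mu>) *\<^sub>R G \<mu>)) \<in> families"
    using families_scaleR[OF fam(3)] families_scaleR[OF fam(4)] families_scaleR[OF fam'(1), of "\<lambda>\<mu>. - (1 / weight\<^sub>w \<mu>)"]
    by auto
  have F: "fibrewise_op U = (\<lambda>\<mu>. (weight\<^sub>u \<mu> *\<^sub>R ?w \<mu>, weight\<^sub>v \<mu> *\<^sub>R ?z \<mu>, - ((1 / weight\<^sub>w \<mu>) *\<^sub>R G \<mu>), H \<mu>))"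
    unfolding U G_def H_def by (rule fibrewise_op_phase_space[OF True[unfolded U]])
  have p: "0 < \<mu>" if "\<mu>\<^sub>0 \<le> \<mu>" for \<mu> using that gap_pos by simp
  have 1: "w \<in> dom_pow \<Omega> 1 \<longleftrightarrow> (\<lambda>\<mu>. weight\<^sub>u \<mu> *\<^sub>R ?w \<mu>) \<in> scale \<Omega> 0"
    unfolding dom_pow_iff_components[OF d(3) b2 zero_le_one]
    by (rule scale_equiv[OF fam(3) wfam(1), where C = "1 / sqrt \<alpha>" and C' = "sqrt \<alpha>"])
      (use p pos in \<open>auto simp: weight\<^sub>u_def abs_mult\<close>)
  have half: "0 \<le> (1/2 :: real)" by simp
  have 2: "z \<in> dom_pow \<Omega> (1/2) \<longleftrightarrow> (\<lambda>\<mu>. weight\<^sub>v \<mu> *\<^sub>R ?z \<mu>) \<in> scale \<Omega> 0"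
    unfolding dom_pow_iff_components[OF d(4) order_refl half]
    by (rule scale_equiv[OF fam(4) wfam(2), where C = "1 / sqrt \<alpha>" and C' = "sqrt \<alpha>"])
      (use p pos in \<open>auto simp: weight\<^sub>v_def abs_mult\<close>)
  have nG: "norm (G' \<mu>) = norm (G \<mu>)" for \<mu>
    using norm_minus_cancel[of "G \<mu>"] by (simp add: G_def G'_def)
  \<comment> \<open>Above the gap \<open>weight\<^sub>w\<close> is comparable to \<mu>^(\<beta>/2),
    so dividing by it amounts to measuring in the space of order - \<beta>/2.\<close>
  have 3: "G' \<in> scale \<Omega> (- \<beta>/2) \<longleftrightarrow> (\<lambda>\<mu>. - ((1 / weight\<^sub>w \<mu>) *\<^sub>R G \<mu>)) \<in> scale \<Omega> 0"
  proof (rule scale_equiv[OF fam'(3) wfam(3)])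
    fix \<mu> assume mu: "\<mu>\<^sub>0 \<le> \<mu>"
    let ?c = "sqrt (\<mu>\<^sub>0 powr (- \<beta>) + \<kappa>)" and ?p = "\<mu> powr (\<beta>/2)"
    have wp: "0 < weight\<^sub>w \<mu>" "0 < ?p" using weights_pos p[OF mu] by auto
    have m: "\<mu> powr (- \<beta>/2) = 1 / ?p" using powr_minus_divide[of \<mu> "\<beta>/2"] by simp
    have n: "\<mu> powr 0 * norm (- ((1 / weight\<^sub>w \<mu>) *\<^sub>R G \<mu>)) = 1 / weight\<^sub>w \<mu> * norm (G \<mu>)"
      using p[OF mu] wp by simp
    have "1 / ?p \<le> ?c * (1 / weight\<^sub>w \<mu>)" "1 / weight\<^sub>w \<mu> \<le> 1 / sqrt \<kappa> * (1 / ?p)"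
      using weight\<^sub>w_bounds[OF mu] wp pos by (simp_all add: field_simps)
    from mult_right_mono[OF this(1), of "norm (G \<mu>)"] mult_right_mono[OF this(2), of "norm (G \<mu>)"]
    show "\<mu> powr (- \<beta>/2) * norm (G' \<mu>) \<le> ?c * (\<mu> powr 0 * norm (- ((1 / weight\<^sub>w \<mu>) *\<^sub>R G \<mu>)))"
      "\<mu> powr 0 * norm (- ((1 / weight\<^sub>w \<mu>) *\<^sub>R G \<mu>)) \<le> 1 / sqrt \<kappa> * (\<mu> powr (- \<beta>/2) * norm (G' \<mu>))"
      unfolding n m nG by (simp_all only: mult.assoc norm_ge_zero)
  qed
  \<comment> \<open>\<mu> H' is H without the coupling term \<gamma> A w, and this term is
    square-summable as soon as w lies in the domain of A. Hence the equivalence holds only in the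
    presence of the first condition.\<close>
  have 4: "H' \<in> scale \<Omega> 1 \<longleftrightarrow> H \<in> scale \<Omega> 0" if w: "?w \<in> scale \<Omega> 1"
  proof -
    define W where "W = (\<lambda>\<mu>. \<gamma> *\<^sub>R scale_pow 1 ?w \<mu>)"
    have Wfam: "W \<in> families" unfolding W_def by (intro sca pow fam)
    have W: "W \<in> scale \<Omega> 0"
      by (rule scale_mono[OF Wfam w, where C = \<gamma>]) (use p pos in \<open>simp add: W_def scale_pow_def\<close>)
    have "(\<lambda>\<mu>. H \<mu> + (- 1) *\<^sub>R W \<mu>) \<in> scale \<Omega> 0 \<longleftrightarrow> H \<in> scale \<Omega> 0"
    proof
      assume "H \<in> scale \<Omega> 0"
      then show "(\<lambda>\<mu>. H \<mu> + (- 1) *\<^sub>R W \<mu>) \<in> scale \<Omega> 0" by (intro scale_add scale_scaleR W order_refl)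
    next
      assume "(\<lambda>\<mu>. H \<mu> + (- 1) *\<^sub>R W \<mu>) \<in> scale \<Omega> 0"
      from scale_add[OF this W order_refl] show "H \<in> scale \<Omega> 0" by simp
    qed
    moreover have "H' \<in> scale \<Omega> 1 \<longleftrightarrow> (\<lambda>\<mu>. H \<mu> + (- 1) *\<^sub>R W \<mu>) \<in> scale \<Omega> 0"
    proof (rule scale_equiv[OF fam'(4) families_add[OF fam'(2) sca[OF Wfam]], where C = 1 and C' = 1])
      fix \<mu> assume mu: "\<mu>\<^sub>0 \<le> \<mu>"
      have "\<mu> * \<mu> powr (\<theta> - 1) = \<mu> powr \<theta>" using p[OF mu] by (simp add: powr_mult_base)
      then have "H \<mu> + (- 1) *\<^sub>R W \<mu> = \<mu> *\<^sub>R H' \<mu>"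
        using p[OF mu] by (simp add: H_def W_def H'_def scale_pow_def algebra_simps)
      then have n: "norm (H \<mu> + (- 1) *\<^sub>R W \<mu>) = \<mu> * norm (H' \<mu>)" using p[OF mu] by simp
      show "\<mu> powr 1 * norm (H' \<mu>) \<le> 1 * (\<mu> powr 0 * norm (H \<mu> + (- 1) *\<^sub>R W \<mu>))"
        "\<mu> powr 0 * norm (H \<mu> + (- 1) *\<^sub>R W \<mu>) \<le> 1 * (\<mu> powr 1 * norm (H' \<mu>))"
        unfolding n using p[OF mu] by simp_all
    qed
    ultimately show ?thesis by blast
  qed
  have "U \<in> D \<longleftrightarrow> w \<in> dom_pow \<Omega> 1 \<and> z \<in> dom_pow \<Omega> (1/2) \<and> G' \<in> scale \<Omega> (- \<beta>/2) \<and> H' \<in> scale \<Omega> 1"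
    using True by (simp add: U dom_B_def G'_def H'_def Let_def)
  also have "\<dots> \<longleftrightarrow> fibrewise_op U \<in> square_summable"
    unfolding F square_summable_iff using 1 2 3 4 dom_pow_iff_components[OF d(3) b2 zero_le_one] by auto
  finally show ?thesis using True by simp
qed

lemma op_B:
  assumes U: "U \<in> D"
  shows "B U = assemble (fibrewise_op U)" "B U \<in> X" "coords (B U) = fibrewise_op U"
proof -
  obtain u v w z where U': "U = (u, v, w, z)" by (cases U)
  have X: "(u, v, w, z) \<in> X" and ss: "fibrewise_op (u, v, w, z) \<in> square_summable"
    using U unfolding dom_B_iff U' by auto
  note d = phase_spaceD[OF X] and fam = components_families[OF X] and F = fibrewise_op_phase_space[OF X]
  have b2: "0 \<le> \<beta> / 2" using pos by simp
  let ?u = "components \<Omega> u" and ?v = "components \<Omega> v" and ?w = "components \<Omega> w" and ?z = "components \<Omega> z"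
  define G where "G = (\<lambda>\<mu>. \<alpha> *\<^sub>R scale_pow 2 ?u \<mu> + \<gamma> *\<^sub>R scale_pow 1 ?z \<mu>)"
  \<comment> \<open>The preimage of \<open>G\<close> under the inertia operator. Its divisor 1 +
    \<kappa> \<mu>^\<beta> is the square of \<open>weight\<^sub>w\<close>: one factor belongs to the
    matrix, the other is removed by \<open>assemble\<close>.\<close>
  define F0 where "F0 = (\<lambda>\<mu>. (1 / (1 + \<kappa> * \<mu> powr \<beta>)) *\<^sub>R G \<mu>)"
  have m: "0 < 1 + \<kappa> * \<mu> powr \<beta>" for \<mu> using pos by (simp add: add_pos_nonneg)
  have mF0: "- F0 \<mu> = (1 / weight\<^sub>w \<mu>) *\<^sub>R - ((1 / weight\<^sub>w \<mu>) *\<^sub>R G \<mu>)" for \<mu>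
    by (simp add: F0_def weight\<^sub>w_square[symmetric] power2_eq_square)
  have mF0': "(\<lambda>\<mu>. - F0 \<mu>) \<in> scale \<Omega> (\<beta>/2)"
    using square_summable_components(3)[OF ss] unfolding mF0 by (simp add: F G_def)
  have F0: "F0 \<in> scale \<Omega> (\<beta>/2)"
    using scale_scaleR[OF mF0', of "- 1"] by simp
  have inj: "inj_on (inertia \<kappa> \<beta>) (scale \<Omega> (\<beta>/2))"
  proof (rule inj_onI, rule ext)
    fix P Q :: "real \<Rightarrow> 'a l2" and \<mu> assume "inertia \<kappa> \<beta> P = inertia \<kappa> \<beta> Q"
    from fun_cong[OF this, of \<mu>] have "(1 + \<kappa> * \<mu> powr \<beta>) *\<^sub>R P \<mu> = (1 + \<kappa> * \<mu> powr \<beta>) *\<^sub>R Q \<mu>"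
      by (simp add: inertia_def scale_pow_def scaleR_add_left)
    then show "P \<mu> = Q \<mu>" using m[of \<mu>] by simp
  qed
  have "inertia \<kappa> \<beta> F0 \<mu> = (1 + \<kappa> * \<mu> powr \<beta>) *\<^sub>R F0 \<mu>" for \<mu>
    by (simp add: inertia_def scale_pow_def scaleR_add_left)
  then have "inertia \<kappa> \<beta> F0 = G" using less_imp_neq[OF m] by (simp add: F0_def fun_eq_iff)
  then have inv: "inertia_inv \<Omega> \<kappa> \<beta> G = F0"
    unfolding inertia_inv_def by (rule the_inv_into_f_eq[OF inj _ F0])
  have p: "0 < \<mu>" if "\<mu>\<^sub>0 \<le> \<mu>" for \<mu> using that gap_pos by simp
  have w: "(\<lambda>\<mu>. (1 / weight\<^sub>u \<mu>) *\<^sub>R weight\<^sub>u \<mu> *\<^sub>R ?w \<mu>) = ?w"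
  proof
    show "(1 / weight\<^sub>u \<mu>) *\<^sub>R weight\<^sub>u \<mu> *\<^sub>R ?w \<mu> = ?w \<mu>" for \<mu>
      using weights_pos(1)[OF p, of \<mu>] families_gap[OF fam(3), of \<mu>] by (cases "\<mu>\<^sub>0 \<le> \<mu>") auto
  qed
  have z: "(\<lambda>\<mu>. (1 / weight\<^sub>v \<mu>) *\<^sub>R weight\<^sub>v \<mu> *\<^sub>R ?z \<mu>) = ?z"
  proof
    show "(1 / weight\<^sub>v \<mu>) *\<^sub>R weight\<^sub>v \<mu> *\<^sub>R ?z \<mu> = ?z \<mu>" for \<mu>
      using weights_pos(2)[OF p, of \<mu>] families_gap[OF fam(4), of \<mu>] by (cases "\<mu>\<^sub>0 \<le> \<mu>") auto
  qed
  have syn: "- synthesis F0 = synthesis (\<lambda>\<mu>. (1 / weight\<^sub>w \<mu>) *\<^sub>R - ((1 / weight\<^sub>w \<mu>) *\<^sub>R G \<mu>))"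
    unfolding synthesis_def mF0[symmetric] by (simp add: infsum_uminus)
  show eq: "B U = assemble (fibrewise_op U)"
    unfolding U' F assemble_def op_B_def Let_def prod.case fst_conv snd_conv G_def[symmetric] inv w z syn
      dom_pow_components(3)[OF d(3) b2] dom_pow_components(3)[OF d(4) order_refl] by (simp only: G_def)
  show "B U \<in> X" "coords (B U) = fibrewise_op U"
    unfolding eq using assemble[OF ss[folded U']] by auto
qed

end

section \<open>The semigroup\<close>

context coupled_system
begin

abbreviation "M \<equiv> fibre \<alpha> \<kappa> \<gamma> \<delta> \<theta> \<beta>"

definition S :: "real \<Rightarrow> 'a state \<Rightarrow> 'a state" where
  "S t = family_op (\<lambda>\<mu>. exp (t *\<^sub>R M \<mu>))"

lemma clinear_op_exp_fibre: "clinear_op (exp (t *\<^sub>R M \<mu>))"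
  by (intro clinear_op_exp clinear_op_scaleR clinear_fibre)

lemma bounded_family_exp: "0 \<le> t \<Longrightarrow> bounded_family (\<lambda>\<mu>. exp (t *\<^sub>R M \<mu>)) 1"
  using clinear_op_exp_fibre norm_exp_fibre pos by (simp add: bounded_family_def)

lemma S:
  assumes "0 \<le> t" "U \<in> X"
  shows "S t U \<in> X" "coords (S t U) = (\<lambda>\<mu>. lift_op (exp (t *\<^sub>R M \<mu>)) (coords U \<mu>))" "N (S t U) \<le> N U"
  unfolding S_def using family_op[OF bounded_family_exp[OF assms(1)] assms(2)] by auto

lemma X_minus: "U \<in> X \<Longrightarrow> V \<in> X \<Longrightarrow> U - V \<in> X"
  by (rule csubspaceD(6)[OF csubspace_phase_space])

lemma X_scaleR: "U \<in> X \<Longrightarrow> r *\<^sub>R U \<in> X"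
  by (rule csubspaceD(4)[OF csubspace_phase_space])

lemma norm_lift_op_exp: "0 \<le> t \<Longrightarrow> norm (lift_op (exp (t *\<^sub>R M \<mu>)) (x :: 'a state)) \<le> norm x"
  using order_trans[OF norm_lift_op[OF clinear_op_exp_fibre] mult_right_mono[OF norm_exp_fibre[of \<delta> t] norm_ge_zero]] pos
  by simp

lemma contraction_semigroup_S: "contraction_semigroup X N S"
  unfolding contraction_semigroup_def C0_semigroup_def
proof (intro conjI allI impI ballI)
  show "bounded_op X N (S t)" if "0 \<le> t" for t
    unfolding S_def by (rule bounded_op_family_op(1)[OF bounded_family_exp[OF that]])
  show "S 0 U = U" if "U \<in> X" for U
    by (rule coords_inject) (use S[of 0 U] that in \<open>simp_all add: lift_op_1\<close>)
  show "S (s + t) U = S s (S t U)" if "0 \<le> s" "0 \<le> t" "U \<in> X" for s t U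
  proof (rule coords_inject)
    show "S (s + t) U \<in> X" "S s (S t U) \<in> X" using S that by simp_all
    have "exp ((s + t) *\<^sub>R M \<mu>) = exp (s *\<^sub>R M \<mu>) * exp (t *\<^sub>R M \<mu>)" for \<mu>
      unfolding scaleR_add_left by (rule exp_add_commuting) simp
    then show "coords (S (s + t) U) = coords (S s (S t U))"
      using S that by (simp add: lift_op_mult[OF clinear_op_exp_fibre])
  qed
  show "N (S t U) \<le> N U" if "0 \<le> t" "U \<in> X" for t U by (rule S(3)[OF that])
  show "((\<lambda>t. N (S t U - U)) \<longlongrightarrow> 0) (at_right 0)" if U: "U \<in> X" for U
  proof (rule N_tendsto_0[OF _ U])
    have ev: "\<forall>\<^sub>F t in at_right 0. 0 < (t :: real)" by (simp add: eventually_at_right_less)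
    have c: "coords (S t U - U) = (\<lambda>\<mu>. lift_op (exp (t *\<^sub>R M \<mu>)) (coords U \<mu>) - coords U \<mu>)" if "0 < t" for t
      using S[of t U] U that by (simp add: coords_diff)
    show "\<forall>\<^sub>F t in at_right 0. S t U - U \<in> X"
      using ev by eventually_elim (use S U X_minus in simp)
    show "\<forall>\<^sub>F t in at_right 0. \<forall>\<mu>\<ge>\<mu>\<^sub>0. norm (coords (S t U - U) \<mu>) \<le> 2 * norm (coords U \<mu>)"
      using ev
    proof eventually_elim
      case (elim t)
      then have "norm (lift_op (exp (t *\<^sub>R M \<mu>)) (coords U \<mu>) - coords U \<mu>) \<le> 2 * norm (coords U \<mu>)" for \<mu>
        using norm_triangle_ineq4[of "lift_op (exp (t *\<^sub>R M \<mu>)) (coords U \<mu>)" "coords U \<mu>"]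
          norm_lift_op_exp[of t \<mu> "coords U \<mu>"] by linarith
      then show ?case using c[OF elim] by simp
    qed
    fix \<mu>
    have "((\<lambda>t. lift_op (exp (t *\<^sub>R M \<mu>)) (coords U \<mu>)) \<longlongrightarrow> lift_op (exp (0 *\<^sub>R M \<mu>)) (coords U \<mu>)) (at_right 0)"
      using has_vector_derivative_continuous[OF has_vector_derivative_lift_op_exp, of 0 "{0<..}"]
      unfolding continuous_within .
    then have "((\<lambda>t. norm (lift_op (exp (t *\<^sub>R M \<mu>)) (coords U \<mu>) - coords U \<mu>)) \<longlongrightarrow> 0) (at_right 0)"
      by (intro tendsto_norm_zero) (simp add: lift_op_1 LIM_zero)
    then show "((\<lambda>t. norm (coords (S t U - U) \<mu>)) \<longlongrightarrow> 0) (at_right 0)"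
      by (rule Lim_transform_eventually) (use ev in eventually_elim, use c in simp)
  qed
qed

lemma difference_quotient:
  assumes U: "U \<in> X" and h: "0 < h"
  shows "(S h U - U) /\<^sub>R h \<in> X"
    "coords ((S h U - U) /\<^sub>R h) = (\<lambda>\<mu>. (lift_op (exp (h *\<^sub>R M \<mu>)) (coords U \<mu>) - coords U \<mu>) /\<^sub>R h)"
proof -
  have hS: "0 \<le> h" using h by simp
  show "(S h U - U) /\<^sub>R h \<in> X" by (intro X_scaleR X_minus S U hS)
  show "coords ((S h U - U) /\<^sub>R h) = (\<lambda>\<mu>. (lift_op (exp (h *\<^sub>R M \<mu>)) (coords U \<mu>) - coords U \<mu>) /\<^sub>R h)"
    using coords_scaleR[OF X_minus[OF S(1)[OF hS U] U]] coords_diff[OF S(1)[OF hS U] U] S(2)[OF hS U] by simp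
qed

lemma fibre_difference_quotient_tendsto:
  "((\<lambda>h. (lift_op (exp (h *\<^sub>R M \<mu>)) (coords U \<mu>) - coords U \<mu>) /\<^sub>R h) \<longlongrightarrow> fibrewise_op U \<mu>) (at_right 0)"
proof (rule LIM_zero_cancel)
  let ?f = "\<lambda>h. lift_op (exp (h *\<^sub>R M \<mu>)) (coords U \<mu>)"
  have "((\<lambda>h. (1 / \<bar>h\<bar>) *\<^sub>R (?f h - (coords U \<mu> + h *\<^sub>R fibrewise_op U \<mu>))) \<longlongrightarrow> 0) (at_right 0)"
    using has_vector_derivative_lift_op_exp[of "M \<mu>" "coords U \<mu>" 0 "{0<..}"]
    by (simp add: has_vector_derivative_def has_derivative_within fibrewise_op_def lift_op_1)
  moreover have "\<forall>\<^sub>F h in at_right 0. 0 < (h :: real)" by (simp add: eventually_at_right_less)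
  then have "\<forall>\<^sub>F h in at_right 0. (1 / \<bar>h\<bar>) *\<^sub>R (?f h - (coords U \<mu> + h *\<^sub>R fibrewise_op U \<mu>)) =
      (?f h - coords U \<mu>) /\<^sub>R h - fibrewise_op U \<mu>"
    by eventually_elim (simp add: algebra_simps inverse_eq_divide)
  ultimately show "((\<lambda>h. (?f h - coords U \<mu>) /\<^sub>R h - fibrewise_op U \<mu>) \<longlongrightarrow> 0) (at_right 0)"
    by (rule Lim_transform_eventually)
qed

text \<open>The trajectory has derivative exp(sM) M x, of norm at most |M x| by contractivity; the
  mean value inequality gives a majorant that does not depend on h.\<close>

lemma norm_fibre_difference_quotient:
  assumes h: "0 < h"
  shows "norm ((lift_op (exp (h *\<^sub>R M \<mu>)) (coords U \<mu>) - coords U \<mu>) /\<^sub>R h) \<le> norm (fibrewise_op U \<mu>)"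
proof -
  let ?f = "\<lambda>t. lift_op (exp (t *\<^sub>R M \<mu>)) (coords U \<mu>)"
  have "norm (?f h - ?f 0) \<le> norm (fibrewise_op U \<mu>) * \<bar>h - 0\<bar>"
  proof (rule vector_mean_value[where S = "{0..}", OF _ _ _ has_vector_derivative_lift_op_exp])
    show "norm (lift_op (exp (s *\<^sub>R M \<mu>) * M \<mu>) (coords U \<mu>)) \<le> norm (fibrewise_op U \<mu>)" if "s \<in> {0..}" for s
      using that by (simp add: lift_op_mult[OF clinear_op_exp_fibre] fibrewise_op_def norm_lift_op_exp)
  qed (use h in auto)
  then have "norm (?f h - coords U \<mu>) \<le> norm (fibrewise_op U \<mu>) * h" using h by (simp add: lift_op_1)
  then show ?thesis
    using h unfolding norm_scaleR by (simp add: divide_inverse[symmetric] mult.commute[of "inverse h"] pos_divide_le_eq)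
qed

text \<open>On the domain the difference quotients converge in each component and are dominated by
  the coordinates of \<open>B U\<close>. Conversely, convergence in the phase norm entails
  convergence of components, which identifies the limit with the candidate image; being
  square-summable, it puts the state into the domain.\<close>

lemma is_generator_S: "is_generator X N S D B"
proof -
  have gen: "((\<lambda>h. N ((S h U - U) /\<^sub>R h - B U)) \<longlongrightarrow> 0) (at_right 0)" if U: "U \<in> D" for U
  proof -
    have UX: "U \<in> X" using U by (simp add: dom_B_iff)
    note BU = op_B(2,3)[OF U]
    have ev: "\<forall>\<^sub>F h in at_right 0. 0 < (h :: real)" by (simp add: eventually_at_right_less)
    have c: "coords ((S h U - U) /\<^sub>R h - B U) =
        (\<lambda>\<mu>. (lift_op (exp (h *\<^sub>R M \<mu>)) (coords U \<mu>) - coords U \<mu>) /\<^sub>R h - fibrewise_op U \<mu>)" if "0 < h" for h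
      using coords_diff[OF difference_quotient(1)[OF UX that] BU(1)] difference_quotient(2)[OF UX that] BU(2) by simp
    show ?thesis
    proof (rule N_tendsto_0[OF _ BU(1)])
      show "\<forall>\<^sub>F h in at_right 0. (S h U - U) /\<^sub>R h - B U \<in> X"
        using ev by eventually_elim (intro X_minus difference_quotient UX BU)
      show "\<forall>\<^sub>F h in at_right 0. \<forall>\<mu>\<ge>\<mu>\<^sub>0. norm (coords ((S h U - U) /\<^sub>R h - B U) \<mu>) \<le> 2 * norm (coords (B U) \<mu>)"
        using ev
      proof eventually_elim
        case (elim h)
        have "norm ((lift_op (exp (h *\<^sub>R M \<mu>)) (coords U \<mu>) - coords U \<mu>) /\<^sub>R h - fibrewise_op U \<mu>)
            \<le> 2 * norm (fibrewise_op U \<mu>)" for \<mu>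
          using norm_triangle_ineq4[of "(lift_op (exp (h *\<^sub>R M \<mu>)) (coords U \<mu>) - coords U \<mu>) /\<^sub>R h" "fibrewise_op U \<mu>"]
            norm_fibre_difference_quotient[OF elim, of \<mu> U] by linarith
        then show ?case using c[OF elim] BU(2) by simp
      qed
      fix \<mu>
      have "((\<lambda>h. norm ((lift_op (exp (h *\<^sub>R M \<mu>)) (coords U \<mu>) - coords U \<mu>) /\<^sub>R h - fibrewise_op U \<mu>)) \<longlongrightarrow> 0) (at_right 0)"
        by (intro tendsto_norm_zero LIM_zero fibre_difference_quotient_tendsto)
      then show "((\<lambda>h. norm (coords ((S h U - U) /\<^sub>R h - B U) \<mu>)) \<longlongrightarrow> 0) (at_right 0)"
        by (rule Lim_transform_eventually) (use ev in eventually_elim, use c in simp)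
    qed
  qed
  have conv: "U \<in> D" if U: "U \<in> X" and Y: "Y \<in> X" and lim: "((\<lambda>h. N ((S h U - U) /\<^sub>R h - Y)) \<longlongrightarrow> 0) (at_right 0)" for U Y
  proof -
    have "fibrewise_op U \<mu> = coords Y \<mu>" for \<mu>
    proof (rule tendsto_unique[OF _ fibre_difference_quotient_tendsto])
      let ?q = "\<lambda>h. (lift_op (exp (h *\<^sub>R M \<mu>)) (coords U \<mu>) - coords U \<mu>) /\<^sub>R h"
      have "((\<lambda>h. ?q h - coords Y \<mu>) \<longlongrightarrow> 0) (at_right 0)"
      proof (rule Lim_null_comparison[OF _ lim])
        have ev: "\<forall>\<^sub>F h in at_right 0. 0 < (h :: real)" by (simp add: eventually_at_right_less)
        then show "\<forall>\<^sub>F h in at_right 0. norm (?q h - coords Y \<mu>) \<le> N ((S h U - U) /\<^sub>R h - Y)"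
        proof eventually_elim
          case (elim h)
          note dq = difference_quotient[OF U elim]
          show ?case
            using norm_coords_le[OF X_minus[OF dq(1) Y], of \<mu>] coords_diff[OF dq(1) Y] dq(2) by simp
        qed
      qed
      then show "(?q \<longlongrightarrow> coords Y \<mu>) (at_right 0)" by (rule LIM_zero_cancel)
    qed simp
    then have "fibrewise_op U = coords Y" by (rule ext)
    then show ?thesis using U coords_norm(2)[OF Y] by (simp add: dom_B_iff)
  qed
  show ?thesis
    unfolding is_generator_def
  proof (intro conjI ballI set_eqI)
    show "U \<in> D \<longleftrightarrow> U \<in> {U\<in>X. \<exists>Y\<in>X. ((\<lambda>h. N ((S h U - U) /\<^sub>R h - Y)) \<longlongrightarrow> 0) (at_right 0)}" for U
    proof
      assume U: "U \<in> D"
      then have "U \<in> X" by (simp add: dom_B_iff)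
      then show "U \<in> {U\<in>X. \<exists>Y\<in>X. ((\<lambda>h. N ((S h U - U) /\<^sub>R h - Y)) \<longlongrightarrow> 0) (at_right 0)}"
        using gen[OF U] op_B(2)[OF U] by blast
    next
      assume "U \<in> {U\<in>X. \<exists>Y\<in>X. ((\<lambda>h. N ((S h U - U) /\<^sub>R h - Y)) \<longlongrightarrow> 0) (at_right 0)}"
      then show "U \<in> D" using conv by blast
    qed
  qed (rule op_B gen, assumption)+
qed

text \<open>Uniformly bounded inverses of the matrices assemble to the inverse on the phase space,
  whose norm inherits the bound.\<close>

lemma resolvent_fibrewise:
  assumes R: "bounded_family R c"
    and inv: "\<And>\<mu>. \<mu>\<^sub>0 \<le> \<mu> \<Longrightarrow> R \<mu> * (cop \<zeta> - M \<mu>) = 1" "\<And>\<mu>. \<mu>\<^sub>0 \<le> \<mu> \<Longrightarrow> (cop \<zeta> - M \<mu>) * R \<mu> = 1"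
  shows "\<zeta> \<in> resolvent_set X N D B" "op_norm X N (resolvent D B \<zeta>) \<le> ereal c"
proof -
  let ?A = "\<lambda>U. \<zeta> *\<^sub>C U - B U" and ?R = "family_op R"
  have lin: "clinear_op (cop \<zeta> - M \<mu>)" for \<mu> by (intro clinear_op_diff clinear_op_cop clinear_fibre)
  have A: "?A U \<in> X" "coords (?A U) = (\<lambda>\<mu>. lift_op (cop \<zeta> - M \<mu>) (coords U \<mu>))" if U: "U \<in> D" for U
  proof -
    have UX: "U \<in> X" using U by (simp add: dom_B_iff)
    note s = coords_scaleC[OF UX, of \<zeta>] and BU = op_B(2,3)[OF U]
    show "?A U \<in> X" by (rule X_minus[OF s(2) BU(1)])
    show "coords (?A U) = (\<lambda>\<mu>. lift_op (cop \<zeta> - M \<mu>) (coords U \<mu>))"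
      using coords_diff[OF s(2) BU(1)] s(1) BU(2) by (simp add: lift_op_minus lift_op_cop fibrewise_op_def)
  qed
  have RA: "?R (?A U) = U" if U: "U \<in> D" for U
  proof (rule coords_inject)
    note r = family_op[OF R A(1)[OF U]]
    show "?R (?A U) \<in> X" "U \<in> X" using r U by (simp_all add: dom_B_iff)
    show "coords (?R (?A U)) = coords U"
    proof
      fix \<mu>
      show "coords (?R (?A U)) \<mu> = coords U \<mu>"
      proof (cases "\<mu>\<^sub>0 \<le> \<mu>")
        case True
        then have "clinear_op (R \<mu>)" using R by (simp add: bounded_family_def)
        from lift_op_mult[OF this, of "cop \<zeta> - M \<mu>" "coords U \<mu>"] show ?thesis
          by (simp add: r(2) A(2)[OF U] inv(1)[OF True] lift_op_1)
      next
        case False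
        then show ?thesis using coords_gap[OF r(1)] coords_gap[OF \<open>U \<in> X\<close>] by simp
      qed
    qed
  qed
  have AR: "?R Y \<in> D" "?A (?R Y) = Y" if Y: "Y \<in> X" for Y
  proof -
    note r = family_op[OF R Y] and s = coords_scaleC[OF family_op(1)[OF R Y], of \<zeta>]
    \<comment> \<open>The matrix identity expresses the candidate image of \<open>?R Y\<close>
      through two elements of the phase space; so it is square-summable, and \<open>?R Y\<close>
      lies in the domain.\<close>
    have "fibrewise_op (?R Y) = coords (\<zeta> *\<^sub>C ?R Y - Y)"
    proof
      fix \<mu>
      show "fibrewise_op (?R Y) \<mu> = coords (\<zeta> *\<^sub>C ?R Y - Y) \<mu>"
      proof (cases "\<mu>\<^sub>0 \<le> \<mu>")
        case True
        have "lift_op (cop \<zeta> - M \<mu>) (coords (?R Y) \<mu>) = coords Y \<mu>"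
          using lift_op_mult[OF lin, of \<mu> "R \<mu>" "coords Y \<mu>"] by (simp add: inv(2)[OF True] lift_op_1 r(2))
        then have e: "\<zeta> *\<^sub>C coords (?R Y) \<mu> - fibrewise_op (?R Y) \<mu> = coords Y \<mu>"
          by (simp only: fibrewise_op_def lift_op_minus lift_op_cop)
        have "fibrewise_op (?R Y) \<mu> = \<zeta> *\<^sub>C coords (?R Y) \<mu> - coords Y \<mu>"
          unfolding e[symmetric] by simp
        then show ?thesis by (simp add: coords_diff[OF s(2) Y] s(1))
      next
        case False
        then show ?thesis
          using fibre_space_gap[OF lift_op_fibre_space[OF coords_mem[OF r(1)]]] coords_gap[OF X_minus[OF s(2) Y]]
          by (simp add: fibrewise_op_def)
      qed
    qed
    then have f: "fibrewise_op (?R Y) = coords (\<zeta> *\<^sub>C ?R Y - Y)" .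
    then show RD: "?R Y \<in> D" using r(1) coords_norm(2)[OF X_minus[OF s(2) Y]] by (simp add: dom_B_iff)
    have "B (?R Y) = \<zeta> *\<^sub>C ?R Y - Y"
      by (rule coords_inject[OF op_B(2)[OF RD] X_minus[OF s(2) Y]]) (simp add: op_B(3)[OF RD] f)
    then show "?A (?R Y) = Y" by simp
  qed
  have bij: "bij_betw ?A D X"
    by (rule bij_betw_byWitness[where f' = ?R]) (use RA AR A(1) in auto)
  have res: "resolvent D B \<zeta> Y = ?R Y" if "Y \<in> X" for Y
    unfolding resolvent_def by (rule the_inv_into_f_eq[OF bij_betw_imp_inj_on[OF bij] AR(2)[OF that] AR(1)[OF that]])
  have n: "op_norm X N (resolvent D B \<zeta>) = op_norm X N ?R" by (rule op_norm_cong) (rule res)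
  have "bounded_op X N (resolvent D B \<zeta>)"
    using bounded_op_family_op(1)[OF R] csubspaceD(2,3)[OF csubspace_phase_space]
    by (simp add: bounded_op_def n res)
  then show "\<zeta> \<in> resolvent_set X N D B" using bij by (simp add: resolvent_set_def)
  show "op_norm X N (resolvent D B \<zeta>) \<le> ereal c" unfolding n by (rule bounded_op_family_op(2)[OF R])
qed

lemma resolvent_estimate:
  fixes \<phi> :: real
  defines "\<phi> \<equiv> \<theta> / (2 * (2 + \<theta> - \<beta>))"
  shows "\<forall>\<^sub>F \<tau> in at_infinity. \<i> * complex_of_real \<tau> \<in> resolvent_set X N D B"
    "Limsup at_infinity (\<lambda>\<tau>::real. ereal (\<bar>\<tau>\<bar> powr \<phi>) *
       op_norm X N (resolvent D B (\<i> * complex_of_real \<tau>))) < \<infinity>"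
proof -
  have phi: "0 < \<phi>" using pos unfolding \<phi>_def by simp
  obtain C where C: "0 < C" "\<forall>\<mu>\<ge>\<mu>\<^sub>0. \<forall>l. 1 \<le> \<bar>l\<bar> \<longrightarrow>
     (\<exists>R. clinear_op R \<and> R * (cop (\<i> * l) - M \<mu>) = 1 \<and> (cop (\<i> * l) - M \<mu>) * R = 1 \<and>
        norm R \<le> C * \<bar>l\<bar> powr (- (3 * \<phi>)))"
    using fibre_resolvent[OF pos gap_pos range] unfolding \<phi>_def by blast
  have ev: "\<forall>\<^sub>F \<tau> in at_infinity. 1 \<le> \<bar>\<tau> :: real\<bar>"
    unfolding eventually_at_infinity by (intro exI[of _ 1]) simp
  have est: "\<i> * complex_of_real \<tau> \<in> resolvent_set X N D B"
    "ereal (\<bar>\<tau>\<bar> powr \<phi>) * op_norm X N (resolvent D B (\<i> * complex_of_real \<tau>)) \<le> ereal C"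
    if t: "1 \<le> \<bar>\<tau>\<bar>" for \<tau>
  proof -
    have "\<forall>\<mu>\<ge>\<mu>\<^sub>0. \<exists>R. clinear_op R \<and> R * (cop (\<i> * \<tau>) - M \<mu>) = 1 \<and> (cop (\<i> * \<tau>) - M \<mu>) * R = 1 \<and>
        norm R \<le> C * \<bar>\<tau>\<bar> powr (- (3 * \<phi>))"
      using C(2) t by blast
    then obtain R where R: "\<And>\<mu>. \<mu>\<^sub>0 \<le> \<mu> \<Longrightarrow> clinear_op (R \<mu>) \<and> R \<mu> * (cop (\<i> * \<tau>) - M \<mu>) = 1 \<and>
        (cop (\<i> * \<tau>) - M \<mu>) * R \<mu> = 1 \<and> norm (R \<mu>) \<le> C * \<bar>\<tau>\<bar> powr (- (3 * \<phi>))"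
      by metis
    have bf: "bounded_family R (C * \<bar>\<tau>\<bar> powr (- (3 * \<phi>)))" using R by (simp add: bounded_family_def)
    note res = resolvent_fibrewise[OF bf, of "\<i> * complex_of_real \<tau>"]
    show "\<i> * complex_of_real \<tau> \<in> resolvent_set X N D B" by (rule res(1)) (use R in auto)
    have "op_norm X N (resolvent D B (\<i> * complex_of_real \<tau>)) \<le> ereal (C * \<bar>\<tau>\<bar> powr (- (3 * \<phi>)))"
      by (rule res(2)) (use R in auto)
    then have "ereal (\<bar>\<tau>\<bar> powr \<phi>) * op_norm X N (resolvent D B (\<i> * complex_of_real \<tau>)) \<le>
        ereal (\<bar>\<tau>\<bar> powr \<phi>) * ereal (C * \<bar>\<tau>\<bar> powr (- (3 * \<phi>)))"
      by (rule ereal_mult_left_mono) simp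
    \<comment> \<open>The matrices decay with exponent 3 \<phi>, so the total exponent - 2 \<phi> is
      negative and may be raised to 0.\<close>
    also have "\<dots> = ereal (C * \<bar>\<tau>\<bar> powr (\<phi> + - (3 * \<phi>)))" by (simp only: powr_add) (simp add: mult.left_commute)
    also have "\<dots> \<le> ereal (C * \<bar>\<tau>\<bar> powr 0)"
      using C(1) t phi by (intro ereal_less_eq(3)[THEN iffD2] mult_left_mono powr_mono) auto
    also have "\<dots> = ereal C" using t by auto
    finally show "ereal (\<bar>\<tau>\<bar> powr \<phi>) * op_norm X N (resolvent D B (\<i> * complex_of_real \<tau>)) \<le> ereal C" .
  qed
  show "\<forall>\<^sub>F \<tau> in at_infinity. \<i> * complex_of_real \<tau> \<in> resolvent_set X N D B"
    using ev by eventually_elim (rule est(1))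
  have "Limsup at_infinity (\<lambda>\<tau>::real. ereal (\<bar>\<tau>\<bar> powr \<phi>) *
       op_norm X N (resolvent D B (\<i> * complex_of_real \<tau>))) \<le> ereal C"
    by (rule Limsup_bounded) (use ev in eventually_elim, rule est(2))
  then show "Limsup at_infinity (\<lambda>\<tau>::real. ereal (\<bar>\<tau>\<bar> powr \<phi>) *
       op_norm X N (resolvent D B (\<i> * complex_of_real \<tau>))) < \<infinity>"
    by (rule le_less_trans) simp
qed

end

text \<open>Further evolution is a contraction. This extends the smoothing bounds to t > 1 and lets
  the value at t/2 control all later times.\<close>

lemma norm_power_exp_antimono:
  fixes M :: "'a::{real_normed_algebra_1,banach}"
  assumes contr: "\<And>t. 0 \<le> t \<Longrightarrow> norm (exp (t *\<^sub>R M)) \<le> 1" and rs: "r \<le> s"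
  shows "norm (M ^ n * exp (s *\<^sub>R M)) \<le> norm (M ^ n * exp (r *\<^sub>R M))"
proof -
  have "exp (s *\<^sub>R M) = exp (r *\<^sub>R M) * exp ((s - r) *\<^sub>R M)"
    by (subst exp_add_commuting[symmetric]) (simp_all add: scaleR_add_left[symmetric])
  then have "norm (M ^ n * exp (s *\<^sub>R M)) \<le> norm (M ^ n * exp (r *\<^sub>R M)) * norm (exp ((s - r) *\<^sub>R M))"
    using norm_mult_ineq[of "M ^ n * exp (r *\<^sub>R M)" "exp ((s - r) *\<^sub>R M)"] by (simp add: mult.assoc)
  also have "\<dots> \<le> norm (M ^ n * exp (r *\<^sub>R M)) * 1"
    using rs by (intro mult_left_mono contr) auto
  finally show ?thesis by simp
qed

lemma has_vector_derivative_power_exp: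
  fixes M :: "'a::{real_normed_algebra_1,banach}"
  shows "((\<lambda>t. M ^ n * exp (t *\<^sub>R M)) has_vector_derivative M ^ Suc n * exp (t *\<^sub>R M)) (at t within A)"
proof -
  have "((\<lambda>t. M ^ n * exp (t *\<^sub>R M)) has_vector_derivative M ^ n * (M * exp (t *\<^sub>R M))) (at t within A)"
    by (intro bounded_linear.has_vector_derivative[OF bounded_linear_mult_right]
        has_vector_derivative_at_within[OF exp_scaleR_has_vector_derivative_left])
  then show ?thesis by (simp only: power_Suc2 mult.assoc)
qed

text \<open>A Taylor estimate of second order: the derivative of order n + 2 at t/2 controls the
  remainder, so the bound is uniform in the eigenvalue and gives differentiability in operator
  norm.\<close>

lemma norm_power_exp_difference_quotient:
  fixes M :: "'a::{real_normed_algebra_1,banach}"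
  defines "g \<equiv> \<lambda>n t. M ^ n * exp (t *\<^sub>R M)"
  assumes contr: "\<And>t. 0 \<le> t \<Longrightarrow> norm (exp (t *\<^sub>R M)) \<le> 1"
    and h: "\<bar>h\<bar> \<le> t / 2" "h \<noteq> 0" and B: "norm (g (Suc (Suc n)) (t / 2)) \<le> B"
  shows "norm ((g n (t + h) - g n t) /\<^sub>R h - g (Suc n) t) \<le> B * \<bar>h\<bar>"
proof -
  have der: "(g m has_vector_derivative g (Suc m) s) (at s within A)" for m s A
    unfolding g_def by (rule has_vector_derivative_power_exp)
  have t: "0 \<le> t" using h by linarith
  have g2: "norm (g (Suc (Suc n)) s) \<le> B" if "t / 2 \<le> s" for s
    using norm_power_exp_antimono[OF contr that, of "Suc (Suc n)"] B unfolding g_def by linarith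
  have g1: "norm (g (Suc n) s - g (Suc n) t) \<le> B * \<bar>h\<bar>" if s: "s \<in> closed_segment t (t + h)" for s
  proof -
    have s': "t / 2 \<le> s" "\<bar>s - t\<bar> \<le> \<bar>h\<bar>"
      using s h by (auto simp: closed_segment_eq_real_ivl split: if_splits)
    have "norm (g (Suc n) s - g (Suc n) t) \<le> B * \<bar>s - t\<bar>"
      by (rule vector_mean_value[where S = "{t / 2..}", OF _ _ _ der]) (use s' g2 t in auto)
    also have "\<dots> \<le> B * \<bar>h\<bar>"
      using s'(2) order_trans[OF norm_ge_zero B] by (rule mult_left_mono)
    finally show ?thesis .
  qed
  \<comment> \<open>Subtracting the tangent leaves a function whose derivative, by a first use of
    the mean value inequality, is at most B |h| on the segment; a second use yields B h^2, to be
    divided by |h|.\<close>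
  let ?k = "\<lambda>s. g n s - s *\<^sub>R g (Suc n) t"
  have "norm (?k (t + h) - ?k t) \<le> B * \<bar>h\<bar> * \<bar>t + h - t\<bar>"
  proof (rule vector_mean_value[where S = "closed_segment t (t + h)"])
    show "(?k has_vector_derivative g (Suc n) s - g (Suc n) t) (at s within closed_segment t (t + h))" for s
      using has_vector_derivative_diff[OF der has_vector_derivative_scaleR[OF DERIV_ident has_vector_derivative_const]]
      by simp
  qed (use g1 in auto)
  moreover have "?k (t + h) - ?k t = h *\<^sub>R ((g n (t + h) - g n t) /\<^sub>R h - g (Suc n) t)"
    using h(2) by (simp add: algebra_simps)
  ultimately have "\<bar>h\<bar> * norm ((g n (t + h) - g n t) /\<^sub>R h - g (Suc n) t) \<le> \<bar>h\<bar> * (B * \<bar>h\<bar>)"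
    by (simp add: mult.commute)
  then show ?thesis using h(2) by (simp add: mult_le_cancel_left)
qed

text \<open>b^n <= e^b n!, raised to the power e, for b^e >= a: any positive power of n! absorbs
  geometric growth. This accommodates arbitrarily small radii in the Gevrey estimate.\<close>

lemma power_le_fact_powr:
  fixes a e :: real
  assumes "0 \<le> a" "0 < e"
  shows "\<exists>C>0. \<forall>n. a ^ n \<le> C * fact n powr e"
proof -
  \<comment> \<open>Passing from a to a + 1 keeps the base positive when a = 0.\<close>
  define b where "b = (a + 1) powr (1 / e)"
  have b: "0 < b" "b powr e = a + 1" using assms by (auto simp: b_def powr_powr)
  have "a ^ n \<le> exp b powr e * fact n powr e" for n
  proof -
    have "b ^ n / fact n \<le> exp b"
      using sum_le_suminf[OF summable_exp_generic[of b], of "{n}"] b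
      by (simp add: exp_def divide_inverse mult.commute)
    then have le: "b ^ n \<le> exp b * fact n" by (simp add: divide_le_eq)
    have "a ^ n \<le> (a + 1) ^ n" using assms by (intro power_mono) auto
    also have "\<dots> = (b ^ n) powr e"
      unfolding b(2)[symmetric] using b(1) by (simp add: powr_powr powr_realpow[symmetric] mult.commute)
    also have "\<dots> \<le> (exp b * fact n) powr e" using le b assms by (intro powr_mono2) auto
    finally show ?thesis by (simp add: powr_mult)
  qed
  then show ?thesis by (intro exI[of _ "exp b powr e"]) simp
qed

context coupled_system
begin

lemma clinear_op_power_exp: "clinear_op (M \<mu> ^ n * exp (t *\<^sub>R M \<mu>))"
  by (intro clinear_op_mult clinear_op_power clinear_fibre clinear_op_exp_fibre)

lemma norm_power_exp_fibre:
  assumes "0 < k" "1 \<le> (\<theta> / (2 * (2 + \<theta> - \<beta>))) * real (Suc k)"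
  shows "\<exists>C>0. \<forall>n t. 0 < t \<longrightarrow> bounded_family (\<lambda>\<mu>. M \<mu> ^ n * exp (t *\<^sub>R M \<mu>)) ((C / min t 1 ^ k) ^ n * fact n ^ k)"
proof -
  obtain K where K: "\<forall>\<mu>\<ge>\<mu>\<^sub>0. \<forall>t. 0 < t \<longrightarrow> t \<le> 1 \<longrightarrow> norm (M \<mu> * exp (t *\<^sub>R M \<mu>)) \<le> K / t ^ k"
    using fibre_smoothing[OF pos gap_pos range assms] by blast
  \<comment> \<open>K need not be positive, hence |K| + 1. The factor exp(k) stems from the passage
    from n^n to n!, and \<open>min t 1\<close> appears because the smoothing estimate is available
    up to time 1.\<close>
  define C where "C = (\<bar>K\<bar> + 1) * exp (real k)"
  show ?thesis
  proof (intro exI[of _ C] conjI allI impI)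
    show "0 < C" unfolding C_def by (intro mult_pos_pos) auto
    fix n and t :: real assume t: "0 < t"
    show "bounded_family (\<lambda>\<mu>. M \<mu> ^ n * exp (t *\<^sub>R M \<mu>)) ((C / min t 1 ^ k) ^ n * fact n ^ k)"
      unfolding bounded_family_def
    proof (intro allI impI conjI clinear_op_power_exp)
      fix \<mu> assume mu: "\<mu>\<^sub>0 \<le> \<mu>"
      have contr: "norm (exp (s *\<^sub>R M \<mu>)) \<le> 1" if "0 \<le> s" for s
        by (rule norm_exp_fibre[OF pos(4) that])
      have K': "norm (M \<mu> * exp (s *\<^sub>R M \<mu>)) \<le> (\<bar>K\<bar> + 1) / s ^ k" if "0 < s" "s \<le> 1" for s
      proof -
        have "norm (M \<mu> * exp (s *\<^sub>R M \<mu>)) \<le> K / s ^ k" using K mu that by blast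
        also have "\<dots> \<le> (\<bar>K\<bar> + 1) / s ^ k" using that by (intro divide_right_mono) auto
        finally show ?thesis .
      qed
      have "norm (M \<mu> ^ n * exp (t *\<^sub>R M \<mu>)) \<le> norm (M \<mu> ^ n * exp (min t 1 *\<^sub>R M \<mu>))"
        by (rule norm_power_exp_antimono[OF contr]) auto
      also have "\<dots> \<le> ((\<bar>K\<bar> + 1) * exp (real k) / min t 1 ^ k) ^ n * fact n ^ k"
        by (rule norm_power_mult_exp_le[OF contr K']) (use t in auto)
      finally show "norm (M \<mu> ^ n * exp (t *\<^sub>R M \<mu>)) \<le> (C / min t 1 ^ k) ^ n * fact n ^ k"
        by (simp add: C_def)
    qed
  qed
qed

lemma op_norm_nonneg: "0 \<le> op_norm X N T"
proof -
  have "0 \<in> X" by (rule csubspaceD(1)[OF csubspace_phase_space])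
  moreover have "N 0 = 0"
    using S(3)[of 0 0] coords_scaleC(1)[OF \<open>0 \<in> X\<close>, of 0] coords_norm(1)[OF \<open>0 \<in> X\<close>] N_eq[OF \<open>0 \<in> X\<close>] by simp
  ultimately have "ereal (N (T 0)) \<le> op_norm X N T"
    unfolding op_norm_def by (intro SUP_upper) simp
  then show ?thesis using N_nonneg[of "T 0"] order_trans by (metis ereal_less_eq(5))
qed

lemma gevrey_class_S:
  fixes \<phi> s :: real
  defines "\<phi> \<equiv> \<theta> / (2 * (2 + \<theta> - \<beta>))"
  assumes phi: "\<phi> < 1" and s: "1 / \<phi> < s"
  shows "gevrey_class X N S s 0"
proof -
  have phi0: "0 < \<phi>" using pos unfolding \<phi>_def by simp
  \<comment> \<open>The smallest integer with \<phi> (k + 1) >= 1. It is strictly below 1/\<phi>,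
    also when 1/\<phi> is an integer, so s - k > 0; and it is positive because \<phi> < 1.\<close>
  define k where "k = nat (\<lceil>1 / \<phi>\<rceil> - 1)"
  have "1 < 1 / \<phi>" using phi phi0 by simp
  then have ceil: "1 < \<lceil>1 / \<phi>\<rceil>" by linarith
  then have "int k = \<lceil>1 / \<phi>\<rceil> - 1" by (simp only: k_def)
  then have k: "0 < k" "1 / \<phi> \<le> real (Suc k)" "real k < 1 / \<phi>"
    using ceil by linarith+
  have k2: "1 \<le> \<phi> * real (Suc k)" using k(2) phi0 by (simp add: divide_le_eq mult.commute)
  obtain C where C: "0 < C" "\<And>n t. 0 < t \<Longrightarrow>
      bounded_family (\<lambda>\<mu>. M \<mu> ^ n * exp (t *\<^sub>R M \<mu>)) ((C / min t 1 ^ k) ^ n * fact n ^ k)"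
    using norm_power_exp_fibre[OF k(1) k2[unfolded \<phi>_def]] by blast
  define D' where "D' n t = family_op (\<lambda>\<mu>. M \<mu> ^ n * exp (t *\<^sub>R M \<mu>))" for n t
  have der: "((\<lambda>h. op_norm X N (\<lambda>U. (D' n (t + h) U - D' n t U) /\<^sub>R h - D' (Suc n) t U)) \<longlongrightarrow> 0) (at 0)"
    if t: "0 < t" for n t
  proof -
    \<comment> \<open>Bound for the derivative of order n + 2 at t/2; the increments are kept below
      t/2, so that t + h stays above t/2.\<close>
    define b where "b = (C / min (t / 2) 1 ^ k) ^ Suc (Suc n) * fact (Suc (Suc n)) ^ k"
    define Q where "Q h \<mu> = (M \<mu> ^ n * exp ((t + h) *\<^sub>R M \<mu>) - M \<mu> ^ n * exp (t *\<^sub>R M \<mu>)) /\<^sub>R h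
      - M \<mu> ^ Suc n * exp (t *\<^sub>R M \<mu>)" for h \<mu>
    have bf: "bounded_family (Q h) (b * \<bar>h\<bar>)" if h: "\<bar>h\<bar> < t / 2" "h \<noteq> 0" for h
      unfolding bounded_family_def
    proof (intro allI impI conjI)
      fix \<mu> assume mu: "\<mu>\<^sub>0 \<le> \<mu>"
      show "clinear_op (Q h \<mu>)"
        unfolding Q_def by (intro clinear_op_diff clinear_op_scaleR clinear_op_power_exp)
      show "norm (Q h \<mu>) \<le> b * \<bar>h\<bar>"
        unfolding Q_def
      proof (rule norm_power_exp_difference_quotient)
        show "norm (exp (s *\<^sub>R M \<mu>)) \<le> 1" if "0 \<le> s" for s by (rule norm_exp_fibre[OF pos(4) that])
        show "norm (M \<mu> ^ Suc (Suc n) * exp ((t / 2) *\<^sub>R M \<mu>)) \<le> b"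
          using C(2)[of "t / 2" "Suc (Suc n)"] mu t by (simp only: b_def bounded_family_def)
      qed (use h in auto)
    qed
    have le: "op_norm X N (\<lambda>U. (D' n (t + h) U - D' n t U) /\<^sub>R h - D' (Suc n) t U) \<le> ereal (b * \<bar>h\<bar>)"
      if h: "\<bar>h\<bar> < t / 2" "h \<noteq> 0" for h
    proof -
      have th: "0 < t + h" using h t by linarith
      have "(D' n (t + h) U - D' n t U) /\<^sub>R h - D' (Suc n) t U = family_op (Q h) U" if U: "U \<in> X" for U
      proof (rule coords_eq_family_op)
        note d1 = family_op[OF C(2)[OF th, of n] U, folded D'_def]
          and d2 = family_op[OF C(2)[OF t, of n] U, folded D'_def]
          and d3 = family_op[OF C(2)[OF t, of "Suc n"] U, folded D'_def]
        note m1 = X_minus[OF d1(1) d2(1)]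
        note m2 = X_scaleR[OF m1, of "inverse h"]
        show "(D' n (t + h) U - D' n t U) /\<^sub>R h - D' (Suc n) t U \<in> X" by (rule X_minus[OF m2 d3(1)])
        show "coords ((D' n (t + h) U - D' n t U) /\<^sub>R h - D' (Suc n) t U) = (\<lambda>\<mu>. lift_op (Q h \<mu>) (coords U \<mu>))"
          unfolding coords_diff[OF m2 d3(1)] coords_scaleR[OF m1] coords_diff[OF d1(1) d2(1)] d1(2) d2(2) d3(2)
            Q_def lift_op_minus lift_op_scaleR by (rule refl)
      qed
      then have "op_norm X N (\<lambda>U. (D' n (t + h) U - D' n t U) /\<^sub>R h - D' (Suc n) t U) = op_norm X N (family_op (Q h))"
        by (rule op_norm_cong)
      then show ?thesis using bounded_op_family_op(2)[OF bf[OF h]] by simp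
    qed
    have ev: "\<forall>\<^sub>F h in at 0. \<bar>h\<bar> < t / 2 \<and> h \<noteq> 0"
      unfolding eventually_at using t by (intro exI[of _ "t / 2"]) (auto simp: dist_real_def)
    show ?thesis
    proof (rule tendsto_sandwich)
      show "\<forall>\<^sub>F h in at 0. 0 \<le> op_norm X N (\<lambda>U. (D' n (t + h) U - D' n t U) /\<^sub>R h - D' (Suc n) t U)"
        by (simp add: op_norm_nonneg)
      show "\<forall>\<^sub>F h in at 0. op_norm X N (\<lambda>U. (D' n (t + h) U - D' n t U) /\<^sub>R h - D' (Suc n) t U) \<le> ereal (b * \<bar>h\<bar>)"
        using ev by eventually_elim (use le in blast)
      have "((\<lambda>h. b * \<bar>h\<bar>) \<longlongrightarrow> b * \<bar>0\<bar>) (at 0)" by (intro tendsto_intros)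
      then show "((\<lambda>h. ereal (b * \<bar>h\<bar>)) \<longlongrightarrow> 0) (at 0)" by (simp add: zero_ereal_def)
    qed simp
  qed
  have bound: "\<exists>c>0. \<forall>t\<in>J. \<forall>n. op_norm X N (D' n t) \<le> ereal (c * \<nu> ^ n * fact n powr s)"
    if J: "compact J" "J \<subseteq> {0<..}" and nu: "0 < \<nu>" for J \<nu>
  proof -
    obtain r where r: "0 < r" "r \<le> 1" "\<And>t. t \<in> J \<Longrightarrow> r \<le> t"
    proof (cases "J = {}")
      case True
      then show ?thesis using that[of 1] by simp
    next
      case False
      from compact_attains_inf[OF J(1) False] obtain m where "m \<in> J" "\<And>t. t \<in> J \<Longrightarrow> m \<le> t" by blast
      then show ?thesis using J(2) that[of "min m 1"] by force
    qed
    \<comment> \<open>All times in the compact set are at least r, which turns the singular factor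
      into a constant. Writing a^n as \<nu>^n (a/\<nu>)^n, the second factor is absorbed by n!^(s -
      k), which together with n!^k gives n!^s.\<close>
    define a where "a = C / r ^ k"
    have a: "0 < a" using C(1) r by (simp add: a_def)
    have e: "0 < s - real k" using s k(3) by linarith
    obtain c where c: "0 < c" "\<And>n. (a / \<nu>) ^ n \<le> c * fact n powr (s - real k)"
      using power_le_fact_powr[of "a / \<nu>" "s - real k"] a nu e by auto
    have "op_norm X N (D' n t) \<le> ereal (c * \<nu> ^ n * fact n powr s)" if t: "t \<in> J" for n t
    proof -
      have t0: "0 < t" "r \<le> min t 1" using J(2) t r by auto
      have "r ^ k \<le> min t 1 ^ k" using t0 r by (intro power_mono) auto
      then have "C / min t 1 ^ k \<le> a" unfolding a_def using C(1) r t0 by (intro divide_left_mono mult_pos_pos zero_less_power) auto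
      then have "(C / min t 1 ^ k) ^ n \<le> a ^ n" using C(1) t0 by (intro power_mono) auto
      also have "a ^ n = \<nu> ^ n * (a / \<nu>) ^ n" using nu by (simp add: power_divide)
      also have "\<dots> \<le> \<nu> ^ n * (c * fact n powr (s - real k))" using c nu by (intro mult_left_mono) auto
      finally have "(C / min t 1 ^ k) ^ n * fact n ^ k \<le> \<nu> ^ n * (c * fact n powr (s - real k)) * fact n ^ k"
        by (rule mult_right_mono) simp
      also have "\<dots> = c * \<nu> ^ n * (fact n powr (s - real k) * fact n powr real k)"
        by (simp add: powr_realpow)
      also have "\<dots> = c * \<nu> ^ n * fact n powr s" by (simp add: powr_add[symmetric])
      finally have le: "(C / min t 1 ^ k) ^ n * fact n ^ k \<le> c * \<nu> ^ n * fact n powr s" .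
      have "op_norm X N (D' n t) \<le> ereal ((C / min t 1 ^ k) ^ n * fact n ^ k)"
        unfolding D'_def by (rule bounded_op_family_op(2)[OF C(2)[OF t0(1)]])
      then show ?thesis using le by (meson ereal_less_eq(3) order_trans)
    qed
    then show ?thesis using c(1) by blast
  qed
  have "1 < s" using s \<open>1 < 1 / \<phi>\<close> by linarith
  moreover have "bounded_op X N (D' n t)" if "0 < t" for n t
    unfolding D'_def by (rule bounded_op_family_op(1)[OF C(2)[OF that]])
  moreover have "D' 0 t U = S t U" for t U by (simp add: D'_def S_def)
  ultimately show ?thesis
    unfolding gevrey_class_def using der bound by (intro conjI exI[of _ D']) auto
qed

end

theorem theorem12:
  fixes \<Omega> :: "(real ^ 'n) set" and \<alpha> \<kappa> \<gamma> \<delta> \<theta> \<beta> :: real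
  assumes "bounded \<Omega>" and "open \<Omega>" and "smooth_boundary \<Omega>"
    and "\<alpha> > 0" and "\<kappa> > 0" and "\<gamma> > 0" and "\<delta> > 0"
    and "0 < \<theta>" and "\<theta> \<le> 1" and "0 < \<beta>" and "\<beta> < 1"
    and "3 * \<theta> / 4 + \<beta> / 2 \<le> 1"
  shows "let \<phi>\<^sub>2 = \<theta> / (2 * (2 + \<theta> - \<beta>));
      X = phase_space \<Omega> \<beta>; N = phase_norm \<Omega> \<alpha> \<kappa> \<beta>;
      D = dom_B \<Omega> \<alpha> \<gamma> \<delta> \<theta> \<beta>; B = op_B \<Omega> \<alpha> \<kappa> \<gamma> \<delta> \<theta> \<beta>
    in 0 < \<phi>\<^sub>2 \<and> \<phi>\<^sub>2 < 1 \<and>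
      (\<exists>S. contraction_semigroup X N S \<and> is_generator X N S D B \<and>
        (\<forall>\<^sub>F \<tau> in at_infinity. \<i> * complex_of_real \<tau> \<in> resolvent_set X N D B) \<and>
        Limsup at_infinity (\<lambda>\<tau>::real. ereal (\<bar>\<tau>\<bar> powr \<phi>\<^sub>2) *
          op_norm X N (resolvent D B (\<i> * complex_of_real \<tau>))) < \<infinity> \<and>
        (\<forall>s\<^sub>2. s\<^sub>2 > 1 / \<phi>\<^sub>2 \<longrightarrow> gevrey_class X N S s\<^sub>2 0))"
proof -
  obtain \<mu>\<^sub>0 where "0 < \<mu>\<^sub>0" "\<And>\<mu> f. f \<in> eigenspace \<Omega> \<mu> \<Longrightarrow> f \<noteq> 0 \<Longrightarrow> \<mu>\<^sub>0 \<le> \<mu>"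
    using eigenvalue_lower_bound[OF assms(1)] by blast
  then interpret coupled_system \<Omega> \<mu>\<^sub>0 \<alpha> \<kappa> \<gamma> \<delta> \<theta> \<beta>
    using assms by unfold_locales
  have phi: "0 < \<theta> / (2 * (2 + \<theta> - \<beta>))" "\<theta> / (2 * (2 + \<theta> - \<beta>)) < 1"
    using assms(8-11) by (auto simp: divide_less_eq)
  show ?thesis
    unfolding Let_def
    using phi contraction_semigroup_S is_generator_S resolvent_estimate gevrey_class_S[OF phi(2)] by blast
qed

end
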